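(* There is a universal constant $N$ such that the following holds. Let $n\ge1$, $A>0$, $B\in\mathbb R$, $\gamma>0$, and assume that $u\in L^\infty([0,1],L^2(\mathbb R^n))\cap L^2([0,1],H^1(\mathbb R^n))$ satisfies $$\partial_tu=(A+iB)\left(\triangle u+V(x,t)u+F(x,t)\right)\quad\text{in }\mathbb R^n\times[0,1],$$ where $V$ is complex-valued and $\sup_{t\in[0,1]}\|V(t)\|_\infty\le M_1$. Set $$M_2=\sup_{t\in[0,1]}\frac{\|e^{\gamma|x|^2}F(t)\|}{\|u(t)\|}$$ and assume that $\|e^{\gamma|x|^2}u(0)\|$, $\|e^{\gamma|x|^2}u(1)\|$ and $M_2$ are finite. Then $\|e^{\gamma|x|^2}u(t)\|$ is "logarithmically convex" in $[0,1]$, in the sense that $$\|e^{\gamma|x|^2}u(t)\|\le e^{N\left[(A^2+B^2)(M_1^2+M_2^2)+\sqrt{A^2+B^2}\,(M_1+M_2)\right]}\,\|e^{\gamma|x|^2}u(0)\|^{1-t}\,\|e^{\gamma|x|^2}u(1)\|^{t}$$ for all $0\le t\le1$.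
   Context: $\|\cdot\|$ is the norm of $L^2(\mathbb R^n)$ and $\|\cdot\|_\infty$ the norm of $L^\infty(\mathbb R^n)$; $u(t)=u(\cdot,t)$, etc. $F$ is complex-valued and measurable. The equation is understood in the weak sense and $u$ is identified with its representative in $C([0,1],L^2(\mathbb R^n))$. $M_2$ is understood as the least constant in $[0,+\infty]$ with $\|e^{\gamma|x|^2}F(t)\|\le M_2\|u(t)\|$ for all $t\in[0,1]$. *)

theory Defs
  imports "HOL-Analysis.Analysis" "HOL-Probability.Essential_Supremum"
begin

text \<open>
  The constant in the theorem does not depend on the dimension, so the dimension has to be
  quantified inside the statement. Hence \<open>\<real>\<^sup>d\<close> is the set \<open>extensional {..<d}\<close> of functions on
  \<open>{..<d}\<close>, with the topology of \<^typ>\<open>nat \<Rightarrow> real\<close> and with the completed product measure.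
\<close>

abbreviation euclid :: "nat \<Rightarrow> (nat \<Rightarrow> real) set" where
  "euclid d \<equiv> extensional {..<d}"

definition leb :: "nat \<Rightarrow> (nat \<Rightarrow> real) measure" where
  "leb d = completion (PiM {..<d} (\<lambda>_. lborel))"

definition leb_strip :: "nat \<Rightarrow> (real \<times> (nat \<Rightarrow> real)) measure" where
  "leb_strip n = completion (restrict_space lborel {0..1} \<Otimes>\<^sub>M PiM {..<n} (\<lambda>_. lborel))"

text \<open>The norm of \<open>L\<^sup>2(\<real>\<^sup>n)\<close>, infinite for functions outside this space.\<close>

definition L2norm :: "nat \<Rightarrow> ((nat \<Rightarrow> real) \<Rightarrow> complex) \<Rightarrow> ennreal" where
  "L2norm n f =
     (if f \<in> borel_measurable (leb n) \<and> integrable (leb n) (\<lambda>x. (cmod (f x))\<^sup>2)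
      then ennreal (sqrt (\<integral>x. (cmod (f x))\<^sup>2 \<partial>leb n)) else \<infinity>)"

definition Linf_norm :: "nat \<Rightarrow> ((nat \<Rightarrow> real) \<Rightarrow> complex) \<Rightarrow> ereal" where
  "Linf_norm n f = esssup (leb n) (\<lambda>x. ereal (cmod (f x)))"

definition gauss :: "nat \<Rightarrow> real \<Rightarrow> ((nat \<Rightarrow> real) \<Rightarrow> complex) \<Rightarrow> (nat \<Rightarrow> real) \<Rightarrow> complex" where
  "gauss n \<gamma> f = (\<lambda>x. complex_of_real (exp (\<gamma> * (\<Sum>i<n. (x i)\<^sup>2))) * f x)"

definition pd :: "nat \<Rightarrow> ((nat \<Rightarrow> real) \<Rightarrow> real) \<Rightarrow> (nat \<Rightarrow> real) \<Rightarrow> real" where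
  "pd i \<phi> x = deriv (\<lambda>s. \<phi> (x(i := s))) (x i)"

primrec C_k :: "nat \<Rightarrow> nat \<Rightarrow> ((nat \<Rightarrow> real) \<Rightarrow> real) \<Rightarrow> bool" where
  "C_k d 0 \<phi> \<longleftrightarrow> continuous_on (euclid d) \<phi>"
| "C_k d (Suc k) \<phi> \<longleftrightarrow> continuous_on (euclid d) \<phi> \<and>
     (\<forall>i<d. (\<forall>x\<in>euclid d. (\<lambda>s. \<phi> (x(i := s))) differentiable (at (x i))) \<and> C_k d k (pd i \<phi>))"

definition test_function :: "nat \<Rightarrow> ((nat \<Rightarrow> real) \<Rightarrow> real) \<Rightarrow> bool" where
  "test_function d \<phi> \<longleftrightarrow> (\<forall>k. C_k d k \<phi>) \<and>
     (\<exists>R. \<forall>x\<in>euclid d. \<phi> x \<noteq> 0 \<longrightarrow> (\<forall>i<d. \<bar>x i\<bar> \<le> R))"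

text \<open>
  Points of \<open>\<real>\<^sup>n \<times> \<real>\<close> are points of \<open>\<real>\<^sup>n\<^sup>+\<^sup>1\<close> with the time as coordinate \<open>n\<close>: the point
  \<open>(x, t)\<close> is \<open>x(n := t)\<close>, and \<open>pd n\<close> is the time derivative. The following are the elements of
  \<open>C\<^sub>c\<^sup>\<infinity>(\<real>\<^sup>n \<times> (0,1))\<close>.
\<close>

definition spacetime_test_function :: "nat \<Rightarrow> ((nat \<Rightarrow> real) \<Rightarrow> real) \<Rightarrow> bool" where
  "spacetime_test_function n \<phi> \<longleftrightarrow> test_function (Suc n) \<phi> \<and>
     (\<exists>\<epsilon>>0. \<forall>y\<in>euclid (Suc n). \<phi> y \<noteq> 0 \<longrightarrow> \<epsilon> \<le> y n \<and> y n \<le> 1 - \<epsilon>)"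

definition weak_gradient ::
  "nat \<Rightarrow> ((nat \<Rightarrow> real) \<Rightarrow> complex) \<Rightarrow> (nat \<Rightarrow> (nat \<Rightarrow> real) \<Rightarrow> complex) \<Rightarrow> bool" where
  "weak_gradient n f g \<longleftrightarrow> (\<forall>i<n. L2norm n (g i) < \<infinity> \<and>
     (\<forall>\<phi>. test_function n \<phi> \<longrightarrow>
        (\<integral>x. f x * complex_of_real (pd i \<phi> x) \<partial>leb n)
          = - (\<integral>x. g i x * complex_of_real (\<phi> x) \<partial>leb n)))"

text \<open>
  Curves \<open>u\<close> are functions of the time \<open>t\<close> with values \<open>u t\<close> in the functions on \<open>\<real>\<^sup>n\<close>. The first
  two definitions do not mention measurability in \<open>t\<close>: for curves that satisfy the third one,
  \<open>t \<mapsto> u t\<close> is strongly measurable into \<open>L\<^sup>2\<close> and, where it takes values in \<open>H\<^sup>1\<close>, into \<open>H\<^sup>1\<close>.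
\<close>

definition in_Linf_L2 :: "nat \<Rightarrow> (real \<Rightarrow> (nat \<Rightarrow> real) \<Rightarrow> complex) \<Rightarrow> bool" where
  "in_Linf_L2 n u \<longleftrightarrow> (\<exists>C::real. AE t in lebesgue_on {0..1}. L2norm n (u t) \<le> ennreal C)"

definition in_L2_H1 :: "nat \<Rightarrow> (real \<Rightarrow> (nat \<Rightarrow> real) \<Rightarrow> complex) \<Rightarrow> bool" where
  "in_L2_H1 n u \<longleftrightarrow> (\<exists>g.
     (AE t in lebesgue_on {0..1}. L2norm n (u t) < \<infinity> \<and> weak_gradient n (u t) (g t)) \<and>
     (\<integral>\<^sup>+t. (L2norm n (u t))\<^sup>2 + (\<Sum>i<n. (L2norm n (g t i))\<^sup>2) \<partial>lebesgue_on {0..1}) < \<infinity>)"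

definition in_C_L2 :: "nat \<Rightarrow> (real \<Rightarrow> (nat \<Rightarrow> real) \<Rightarrow> complex) \<Rightarrow> bool" where
  "in_C_L2 n u \<longleftrightarrow> (\<forall>s\<in>{0..1}. L2norm n (u s) < \<infinity> \<and>
     ((\<lambda>t. L2norm n (\<lambda>x. u t x - u s x)) \<longlongrightarrow> 0) (at s within {0..1}))"

text \<open>
  The weak form of \<open>\<partial>\<^sub>t u = c (\<Delta> u + V u + F)\<close> in \<open>\<real>\<^sup>n \<times> [0,1]\<close>. The outer integrals are
  over \<^const>\<open>lebesgue\<close>, as the inner ones need not be Borel functions of \<open>t\<close>.
\<close>

definition weak_solution ::
  "nat \<Rightarrow> complex \<Rightarrow> (real \<Rightarrow> (nat \<Rightarrow> real) \<Rightarrow> complex) \<Rightarrow> (real \<Rightarrow> (nat \<Rightarrow> real) \<Rightarrow> complex)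
    \<Rightarrow> (real \<Rightarrow> (nat \<Rightarrow> real) \<Rightarrow> complex) \<Rightarrow> bool" where
  "weak_solution n c V F u \<longleftrightarrow> (\<forall>\<phi>. spacetime_test_function n \<phi> \<longrightarrow>
     - (\<integral>t. (\<integral>x. u t x * complex_of_real (pd n \<phi> (x(n := t))) \<partial>leb n) \<partial>lebesgue_on {0..1})
     = c * (\<integral>t. (\<integral>x. u t x * complex_of_real (\<Sum>i<n. pd i (pd i \<phi>) (x(n := t)))
                     + (V t x * u t x + F t x) * complex_of_real (\<phi> (x(n := t))) \<partial>leb n)
              \<partial>lebesgue_on {0..1}))"

text \<open>
  The infimum is attained if it is finite. It is \<open>\<infinity>\<close> if \<open>F t\<close> is not null for some \<open>t\<close> with
  \<open>u t = 0\<close> almost everywhere, since \<open>\<infinity> * 0 = 0\<close> in \<^typ>\<open>ennreal\<close> and \<open>Inf {} = \<infinity>\<close>.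
\<close>

definition M2_const ::
  "nat \<Rightarrow> real \<Rightarrow> (real \<Rightarrow> (nat \<Rightarrow> real) \<Rightarrow> complex) \<Rightarrow> (real \<Rightarrow> (nat \<Rightarrow> real) \<Rightarrow> complex) \<Rightarrow> ennreal"
  where
  "M2_const n \<gamma> F u = Inf {M. \<forall>t\<in>{0..1}. L2norm n (gauss n \<gamma> (F t)) \<le> M * L2norm n (u t)}"

text \<open>The library has \<open>0 powr 0 = 0\<close>; the interpolation inequality uses \<open>0\<^sup>0 = 1\<close>.\<close>

definition rpow :: "real \<Rightarrow> real \<Rightarrow> real" where
  "rpow a s = (if s = 0 then 1 else a powr s)"

end

theory Submission
  imports Defs "HOL-Probability.Probability" "HOL-Real_Asymp.Real_Asymp"
begin

text \<open>
  Write \<open>\<parallel>w u(t)\<parallel>\<^sup>2\<close> for a weight \<open>w\<^sup>2 = \<Sum>\<^sub>j p\<^sub>j e\<^bsup>2\<xi>\<^sub>j\<cdot>x\<^esup>\<close> as \<open>\<Sum>\<^sub>j p\<^sub>j \<parallel>e\<^bsup>\<xi>\<^sub>j\<cdot>x\<^esup> u(t)\<parallel>\<^sup>2\<close>. After a Fourier transform the equation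
  for \<open>e\<^bsup>\<xi>\<cdot>x\<^esup> u\<close> is, at every frequency \<open>\<eta>\<close>, the scalar equation \<open>h' = m h + g\<close> with the constant
  \<open>m = (A + iB) \<Sum>\<^sub>i (\<xi>\<^sub>i - i\<eta>\<^sub>i)\<^sup>2\<close>. Solving it forwards or backwards, according to the sign of \<open>Re m - l\<close>
  for a suitable slope \<open>l\<close>, gives logarithmic convexity of the sum over all \<open>j\<close> and \<open>\<eta>\<close> at once, with an error
  that depends only on the ratio of \<open>g\<close> and \<open>h\<close>. The weights \<open>\<Prod>\<^sub>i cosh (2 (\<gamma>/k)\<^sup>1\<^sup>/\<^sup>2 x\<^sub>i)\<^sup>k\<close> are of this form, lie
  between \<open>1\<close> and \<open>e\<^bsup>2\<gamma>|x|\<^sup>2\<^esup>\<close>, and converge to the latter. That the transforms make sense at intermediate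
  times follows from an a priori estimate with the bounded weights \<open>wt\<close> and Gronwall's inequality.
\<close>

subsection \<open>Smooth functions of one variable\<close>

text \<open>Conjugation with a Gaussian produces variable coefficients and commutators, and the
  formal convexity computation needs decay at intermediate times, which is not known in advance. An
  exponential is an eigenfunction of the Laplacian, so conjugation with it merely shifts the
  multiplier \<open>m\<close>. The sign of Re m - l varies with the frequency, but both directions
  end in the same bound, a convex combination of squares, and this can be summed over j and
  integrated over \<eta>. The two-sided bound on the weights has a purpose: M2 compares the weighted
  F with the unweighted u, so the weight must be at least 1 for u and at most the Gaussian for F. In
  the a priori estimate derivatives do fall on the weight, and A > 0 pays for the first-order term.
  Its bound depends on n, A and the exponents, but it is used only as finiteness: it starts
  iterations whose outcome does not contain it. This keeps the constant universal. It is 64 since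
  the loss is 12 K + 32 K^2 with K = |A + iB| (M1 + M2), and (M1 + M2)^2 <= 2 (M1^2 + M2^2).\<close>

primrec diff_times :: "nat \<Rightarrow> (real \<Rightarrow> 'a::real_normed_vector) \<Rightarrow> bool" where
 "diff_times 0 f \<longleftrightarrow> True"
| "diff_times (Suc k) f \<longleftrightarrow> (\<exists>f'. (\<forall>x. (f has_vector_derivative f' x) (at x)) \<and> diff_times k f')"

definition smooth :: "(real \<Rightarrow> 'a::real_normed_vector) \<Rightarrow> bool" where
 "smooth f \<longleftrightarrow> (\<forall>k. diff_times k f)"

definition vd :: "(real \<Rightarrow> 'a::real_normed_vector) \<Rightarrow> real \<Rightarrow> 'a" where
 "vd f x = vector_derivative f (at x)"

lemma vdI: "(\<And>x. (f has_vector_derivative f' x) (at x)) \<Longrightarrow> vd f = f'"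
 unfolding vd_def by (rule ext) (metis vector_derivative_at)

lemma smooth_vd:
 assumes "smooth f"
 shows "(f has_vector_derivative vd f x) (at x)" "smooth (vd f)"
proof -
 have *: "(\<forall>x. (f has_vector_derivative vd f x) (at x)) \<and> diff_times k (vd f)" for k
 proof -
  have "diff_times (Suc k) f" using assms by (auto simp: smooth_def)
  then obtain f' where f': "\<forall>x. (f has_vector_derivative f' x) (at x)" "diff_times k f'" by auto
  then have "vd f = f'" by (auto intro: vdI)
  with f' show ?thesis by simp
 qed
 then show "(f has_vector_derivative vd f x) (at x)" "smooth (vd f)"
  by (auto simp: smooth_def)
qed

lemma smooth_continuous: "smooth f \<Longrightarrow> continuous_on UNIV f"
 by (meson continuous_at_imp_continuous_on has_vector_derivative_continuous smooth_vd(1))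

lemma smooth_borel: "smooth f \<Longrightarrow> f \<in> borel_measurable borel"
 by (rule borel_measurable_continuous_onI[OF smooth_continuous])

text \<open>A coinduction principle: in a class closed under differentiation the number of
  derivatives still to be taken is the only thing that decreases. No formula for the k-th derivative
  is needed.\<close>

lemma smooth_induct_family:
 assumes "P f" "\<And>g. P g \<Longrightarrow> \<exists>g'. (\<forall>x. (g has_vector_derivative g' x) (at x)) \<and> P g'"
 shows "smooth f"
proof -
 have "P g \<Longrightarrow> diff_times k g" for k g
 proof (induction k arbitrary: g)
  case (Suc k)
  from assms(2)[OF Suc.prems] obtain g' where
   g': "\<forall>x. (g has_vector_derivative g' x) (at x)" "P g'" by blast
  from g'(1) Suc.IH[OF g'(2)] show ?case by auto
 qed simp
 with assms(1) show ?thesis by (auto simp: smooth_def)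
qed

lemma diff_times_Suc: "diff_times (Suc k) f \<Longrightarrow> diff_times k f"
proof (induction k arbitrary: f)
 case (Suc k)
 then show ?case unfolding diff_times.simps(2)[of "Suc k"] diff_times.simps(2)[of k f] by blast
qed simp

lemma diff_times_add: "diff_times k f \<Longrightarrow> diff_times k g \<Longrightarrow> diff_times k (\<lambda>x. f x + g x)"
proof (induction k arbitrary: f g)
 case (Suc k)
 then obtain f' g' where "\<forall>x. (f has_vector_derivative f' x) (at x)" "diff_times k f'"
  "\<forall>x. (g has_vector_derivative g' x) (at x)" "diff_times k g'" by auto
 then show ?case using Suc.IH[of f' g'] unfolding diff_times.simps
  by (intro exI[of _ "\<lambda>x. f' x + g' x"]) (blast intro: has_vector_derivative_add)
qed simp

lemma diff_times_bounded_linear: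
 "bounded_linear h \<Longrightarrow> diff_times k f \<Longrightarrow> diff_times k (\<lambda>x. h (f x))"
proof (induction k arbitrary: f)
 case (Suc k)
 then obtain f' where "\<forall>x. (f has_vector_derivative f' x) (at x)" "diff_times k f'" by auto
 then show ?case using Suc.IH[OF Suc.prems(1)] unfolding diff_times.simps
  by (intro exI[of _ "\<lambda>x. h (f' x)"])
   (blast intro: bounded_linear.has_vector_derivative[OF Suc.prems(1)])
qed simp

text \<open>Each summand of the product rule leaves one factor undifferentiated, so the induction
  also needs k derivatives of \<open>f\<close> and \<open>g\<close> themselves, which
  \<open>diff_times_Suc\<close> extracts from k + 1.\<close>

lemma diff_times_mult:
 fixes f g :: "real \<Rightarrow> 'a::real_normed_algebra"
 shows "diff_times k f \<Longrightarrow> diff_times k g \<Longrightarrow> diff_times k (\<lambda>x. f x * g x)"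
proof (induction k arbitrary: f g)
 case (Suc k)
 from Suc(2,3) obtain f' g' where d: "\<forall>x. (f has_vector_derivative f' x) (at x)" "diff_times k f'"
  "\<forall>x. (g has_vector_derivative g' x) (at x)" "diff_times k g'" by auto
 from Suc(2,3)[THEN diff_times_Suc] have "diff_times k f" "diff_times k g" .
 then have "diff_times k (\<lambda>x. f x * g' x + f' x * g x)"
  by (intro diff_times_add Suc.IH d)
 moreover have "((\<lambda>x. f x * g x) has_vector_derivative f x * g' x + f' x * g x) (at x)" for x
  using d by (intro has_vector_derivative_mult) auto
 ultimately show ?case unfolding diff_times.simps
  by (intro exI[of _ "\<lambda>x. f x * g' x + f' x * g x"]) blast
qed simp

text \<open>The derivative -(1/f) f' (1/f) contains the reciprocal again, but only k times
  differentiable, and that is the induction hypothesis.\<close>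

lemma diff_times_inverse:
 fixes f :: "real \<Rightarrow> 'a::real_normed_field"
 assumes nz: "\<And>x. f x \<noteq> 0"
 shows "diff_times k f \<Longrightarrow> diff_times k (\<lambda>x. inverse (f x))"
proof (induction k)
 case (Suc k)
 from Suc(2) obtain f' where d: "\<forall>x. (f has_vector_derivative f' x) (at x)" "diff_times k f'"
  by auto
 have i: "diff_times k (\<lambda>x. inverse (f x))" using Suc diff_times_Suc by blast
 have "((\<lambda>x. inverse (f x)) has_vector_derivative - (inverse (f x) * f' x * inverse (f x))) (at x)" for x
  using Deriv.has_derivative_inverse[OF nz[of x] d(1)[rule_format, of x, unfolded has_vector_derivative_def]]
  unfolding has_vector_derivative_def
  by (rule back_subst[of "\<lambda>h. ((\<lambda>x. inverse (f x)) has_derivative h) (at x)"]) (auto simp: scaleR_conv_of_real)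
 moreover have "diff_times k (\<lambda>x. - (inverse (f x) * f' x * inverse (f x)))"
  by (intro diff_times_bounded_linear[OF bounded_linear_minus[OF bounded_linear_ident]]
    diff_times_mult i d(2))
 ultimately show ?case
  unfolding diff_times.simps
  by (intro exI[of _ "\<lambda>x. - (inverse (f x) * f' x * inverse (f x))"]) blast
qed simp

lemma diff_times_affine:
 "diff_times k f \<Longrightarrow> diff_times k (\<lambda>x. f (a * x + b))"
proof (induction k arbitrary: f)
 case (Suc k)
 then obtain f' where d: "\<forall>x. (f has_vector_derivative f' x) (at x)" "diff_times k f'" by auto
 have "((\<lambda>x. f (a * x + b)) has_vector_derivative a *\<^sub>R f' (a * x + b)) (at x)" for x
 proof -
  have "((\<lambda>x. a * x + b) has_vector_derivative a) (at x)"
   unfolding has_real_derivative_iff_has_vector_derivative[symmetric]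
   by (auto intro!: derivative_eq_intros)
  from vector_diff_chain_at[OF this d(1)[rule_format]] show ?thesis by (simp add: o_def)
 qed
 moreover have "diff_times k (\<lambda>x. a *\<^sub>R f' (a * x + b))"
  by (intro diff_times_bounded_linear[OF bounded_linear_scaleR_right] Suc.IH d(2))
 ultimately show ?case unfolding diff_times.simps
  by (intro exI[of _ "\<lambda>x. a *\<^sub>R f' (a * x + b)"]) blast
qed simp

lemma smooth_add: "smooth f \<Longrightarrow> smooth g \<Longrightarrow> smooth (\<lambda>x. f x + g x)"
 by (auto simp: smooth_def diff_times_add)

lemma smooth_mult:
 fixes f g :: "real \<Rightarrow> 'a::real_normed_algebra"
 shows "smooth f \<Longrightarrow> smooth g \<Longrightarrow> smooth (\<lambda>x. f x * g x)"
 by (auto simp: smooth_def diff_times_mult)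

lemma smooth_bounded_linear: "bounded_linear h \<Longrightarrow> smooth f \<Longrightarrow> smooth (\<lambda>x. h (f x))"
 by (auto simp: smooth_def diff_times_bounded_linear)

lemmas smooth_of_real = smooth_bounded_linear[OF bounded_linear_of_real]

lemma smooth_cmult:
 fixes f :: "real \<Rightarrow> 'a::real_normed_algebra"
 shows "smooth f \<Longrightarrow> smooth (\<lambda>x. c * f x)"
 by (rule smooth_bounded_linear[OF bounded_linear_mult_right])

lemma smooth_inverse:
 fixes f :: "real \<Rightarrow> 'a::real_normed_field"
 shows "(\<And>x. f x \<noteq> 0) \<Longrightarrow> smooth f \<Longrightarrow> smooth (\<lambda>x. inverse (f x))"
 by (auto simp: smooth_def diff_times_inverse)

lemma smooth_affine: "smooth f \<Longrightarrow> smooth (\<lambda>x. f (a * x + b))"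
 by (auto simp: smooth_def diff_times_affine)

lemma smooth_diff: "smooth f \<Longrightarrow> smooth g \<Longrightarrow> smooth (\<lambda>x. f x - g x)"
 using smooth_add[of f "\<lambda>x. - g x"] smooth_bounded_linear[OF bounded_linear_minus[OF bounded_linear_ident], of g]
 by simp

lemma exp_cmult_has_vector_derivative:
 fixes c :: "'a::{banach,real_normed_field}"
 shows "((\<lambda>x. exp (c * of_real x)) has_vector_derivative c * exp (c * of_real x)) (at x)"
proof -
 have 1: "((\<lambda>z. exp (c * z)) has_field_derivative c * exp (c * of_real x)) (at (of_real x))"
  by (auto intro!: derivative_eq_intros)
 have 2: "(of_real has_vector_derivative (1::'a)) (at x)"
  using bounded_linear.has_vector_derivative[OF bounded_linear_of_real has_vector_derivative_id[of "at x"]]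
  by (simp add: id_def)
 show ?thesis using field_vector_diff_chain_at[OF 2 1] by (simp add: o_def)
qed

text \<open>The multiples of a single exponential form a class closed under differentiation.\<close>

lemma smooth_exp:
 fixes c :: "'a::{banach,real_normed_field}"
 shows "smooth (\<lambda>x. exp (c * of_real x))"
proof (rule smooth_induct_family[where P = "\<lambda>f. \<exists>b. f = (\<lambda>x. b * exp (c * of_real x))"])
 show "\<exists>g'. (\<forall>x. (g has_vector_derivative g' x) (at x)) \<and> (\<exists>b. g' = (\<lambda>x. b * exp (c * of_real x)))"
  if ex: "\<exists>b. g = (\<lambda>x. b * exp (c * of_real x))" for g :: "real \<Rightarrow> 'a"
 proof -
  from ex obtain b where g: "g = (\<lambda>x. b * exp (c * of_real x))" by blast
  have "(g has_vector_derivative (b * c) * exp (c * of_real x)) (at x)" for x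
   unfolding g
   using bounded_linear.has_vector_derivative[OF bounded_linear_mult_right[of b] exp_cmult_has_vector_derivative[of c x]]
   by (simp add: mult.assoc)
  then show ?thesis
   by (intro exI[of _ "\<lambda>x. (b * c) * exp (c * of_real x)"] conjI exI[of _ "b * c"] allI refl)
 qed
 show "\<exists>b. (\<lambda>x. exp (c * of_real x)) = (\<lambda>x. b * exp (c * of_real x))"
  by (rule exI[of _ 1]) simp
qed

lemma smooth_exp_real: "smooth (\<lambda>x::real. exp (c * x))"
 using smooth_exp[of c] by simp

lemma smooth_cosh: "smooth (\<lambda>x::real. cosh (c * x))"
proof -
 have "smooth (\<lambda>x::real. (1/2) * (exp (c * x) + exp ((-c) * x)))"
  by (intro smooth_cmult smooth_add smooth_exp_real)
 then show ?thesis by (simp add: cosh_field_def)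
qed

lemma vd_mult:
 fixes f g :: "real \<Rightarrow> 'a::real_normed_algebra"
 assumes "smooth f" "smooth g"
 shows "vd (\<lambda>x. f x * g x) = (\<lambda>x. f x * vd g x + vd f x * g x)"
 by (rule vdI) (intro has_vector_derivative_mult smooth_vd assms)

lemma vd_add:
 assumes "smooth f" "smooth g"
 shows "vd (\<lambda>x. f x + g x) = (\<lambda>x. vd f x + vd g x)"
 by (rule vdI) (intro has_vector_derivative_add smooth_vd assms)

lemma vd_exp:
 fixes c :: "'a::{banach,real_normed_field}"
 shows "vd (\<lambda>x. exp (c * of_real x)) = (\<lambda>x. c * exp (c * of_real x))"
 by (rule vdI) (rule exp_cmult_has_vector_derivative)

lemma vd_of_real:
 assumes "smooth f"
 shows "vd (\<lambda>x. of_real (f x)) = (\<lambda>x. of_real (vd f x) :: 'a :: {real_normed_algebra_1})"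
 by (rule vdI) (intro bounded_linear.has_vector_derivative[OF bounded_linear_of_real] smooth_vd assms)

lemma vd_cmult:
 fixes f :: "real \<Rightarrow> 'a::real_normed_algebra"
 assumes "smooth f"
 shows "vd (\<lambda>x. c * f x) = (\<lambda>x. c * vd f x)"
 by (rule vdI) (intro bounded_linear.has_vector_derivative[OF bounded_linear_mult_right] smooth_vd assms)

lemma vd_affine:
 assumes "smooth f"
 shows "vd (\<lambda>x. f (a * x + b)) = (\<lambda>x. a *\<^sub>R vd f (a * x + b))"
proof (rule vdI)
 fix x
 have "((\<lambda>x. a * x + b) has_vector_derivative a) (at x)"
  unfolding has_real_derivative_iff_has_vector_derivative[symmetric]
  by (auto intro!: derivative_eq_intros)
 from vector_diff_chain_at[OF this smooth_vd(1)[OF assms]]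
 show "((\<lambda>x. f (a * x + b)) has_vector_derivative a *\<^sub>R vd f (a * x + b)) (at x)" by (simp add: o_def)
qed

lemma vd_eq_0:
 assumes "smooth f" "open T" "x \<in> T" "\<And>y. y \<in> T \<Longrightarrow> f y = c"
 shows "vd f x = 0"
proof -
 have "((\<lambda>_. c) has_vector_derivative vd f x) (at x)"
  by (rule has_vector_derivative_transform_within_open[OF smooth_vd(1)[OF assms(1)] assms(2,3)])
   (use assms(4) in auto)
 then show ?thesis
  by (metis has_vector_derivative_const vector_derivative_unique_at)
qed

subsection \<open>A smooth step\<close>

text \<open>The classical flat function e^(-1/x), multiplied by powers of 1/x: with these factors
  the family is closed under differentiation up to linear combinations, which gives smoothness by
  induction.\<close>

definition flat :: "nat \<Rightarrow> real \<Rightarrow> real" where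
 "flat p x = (if x > 0 then (1/x) ^ p * exp (- (1/x)) else 0)"

lemma flat_tendsto: "((\<lambda>h. (1/h) ^ p * exp (- (1/h))) \<longlongrightarrow> (0::real)) (at_right 0)"
proof -
 have "filterlim (\<lambda>h::real. 1/h) at_top (at_right 0)" by real_asymp
 from filterlim_compose[OF tendsto_power_div_exp_0 this, of p]
 show ?thesis by (simp add: exp_minus field_simps)
qed

lemma flat_has_derivative:
 "(flat p has_vector_derivative (flat (p+2) x - real p * flat (p+1) x)) (at x)"
proof -
 consider "x > 0" | "x < 0" | "x = 0" by linarith
 then have "(flat p has_real_derivative (flat (p+2) x - real p * flat (p+1) x)) (at x)"
 proof cases
  case 1
  define u where "u = 1 / x"
  have 1: "((\<lambda>u. u ^ p * exp (- u)) has_real_derivative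
    real p * u ^ (p - 1) * exp (- u) - u ^ p * exp (- u)) (at u)"
   by (auto intro!: derivative_eq_intros simp: algebra_simps)
  have 2: "((\<lambda>x. 1 / x) has_real_derivative - (u\<^sup>2)) (at x)"
   using \<open>x > 0\<close> by (auto intro!: derivative_eq_intros simp: u_def power2_eq_square)
  have "(real p * u ^ (p - 1) * exp (- u) - u ^ p * exp (- u)) * (- (u\<^sup>2)) =
    flat (p+2) x - real p * flat (p+1) x"
   using \<open>x > 0\<close> by (cases p) (auto simp: flat_def u_def[symmetric] algebra_simps power2_eq_square)
  then have "((\<lambda>x. (1/x) ^ p * exp (- (1/x))) has_real_derivative (flat (p+2) x - real p * flat (p+1) x)) (at x)"
   using DERIV_chain2[OF 1[unfolded u_def] 2] by (simp add: u_def)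
  then show ?thesis
   by (rule has_field_derivative_transform_within_open[where S = "{0<..}"]) (use \<open>x > 0\<close> in \<open>auto simp: flat_def\<close>)
 next
  case 2
  have "((\<lambda>x. 0) has_real_derivative (flat (p+2) x - real p * flat (p+1) x)) (at x)"
   using 2 by (simp add: flat_def)
  then show ?thesis
   by (rule has_field_derivative_transform_within_open[where S = "{..<0}"]) (use 2 in \<open>auto simp: flat_def\<close>)
 next
  case 3
  \<comment> \<open>From the right the difference quotient at 0 is (1/h)^(p+1) e^(-1/h), again a
    member of the family, so the limit computed for the values also serves for the
    derivatives.\<close>
  have "((\<lambda>h. (flat p (0 + h) - flat p 0) / h) \<longlongrightarrow> 0) (at 0)"
  proof (rule filterlim_split_at)
   show "((\<lambda>h. (flat p (0 + h) - flat p 0) / h) \<longlongrightarrow> 0) (at_left 0)"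
    by (rule tendsto_eventually) (auto simp: flat_def eventually_at_filter)
   show "((\<lambda>h. (flat p (0 + h) - flat p 0) / h) \<longlongrightarrow> 0) (at_right 0)"
    by (rule Lim_transform_eventually[OF flat_tendsto[of "Suc p"]])
     (auto simp: flat_def eventually_at_filter field_simps)
  qed
  then show ?thesis using 3 by (simp add: DERIV_def flat_def)
 qed
 then show ?thesis by (simp add: has_real_derivative_iff_has_vector_derivative)
qed

lemma diff_times_flat: "diff_times k (flat p)"
proof (induction k arbitrary: p)
 case (Suc k)
 have "diff_times k (\<lambda>x. flat (p+2) x + (- real p) * flat (p+1) x)"
  by (intro diff_times_add Suc diff_times_bounded_linear[OF bounded_linear_mult_right])
 then show ?case using flat_has_derivative[of p] unfolding diff_times.simps
  by (intro exI[of _ "\<lambda>x. flat (p+2) x - real p * flat (p+1) x"]) simp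
qed simp

lemma smooth_flat: "smooth (flat 0)"
 by (simp add: smooth_def diff_times_flat)

text \<open>A smooth transition from 0 to 1 on the unit interval. The argument 1 - x is written in
  the form that \<open>smooth_affine\<close> expects.\<close>

definition step :: "real \<Rightarrow> real" where
 "step x = flat 0 x * inverse (flat 0 x + flat 0 (-1 * x + 1))"

lemma flat_pos: "flat 0 x + flat 0 (-1 * x + 1) > 0"
 by (auto simp: flat_def add_pos_pos add_pos_nonneg add_nonneg_pos)

lemma smooth_step: "smooth step"
 unfolding step_def[abs_def]
 by (intro smooth_mult smooth_inverse smooth_add smooth_flat smooth_affine)
  (use flat_pos in \<open>metis less_irrefl\<close>)

lemma step_0: "x \<le> 0 \<Longrightarrow> step x = 0" and step_1: "x \<ge> 1 \<Longrightarrow> step x = 1"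
 by (auto simp: step_def flat_def)

lemma step_bounds: "0 \<le> step x" "step x \<le> 1"
proof -
 have "flat 0 x \<ge> 0" "flat 0 (-1 * x + 1) \<ge> 0" by (auto simp: flat_def)
 with flat_pos[of x] show "0 \<le> step x" "step x \<le> 1"
  by (auto simp: step_def field_simps simp del: mult_minus1)
qed

lemma vd_step_eq_0:
 assumes "x < 0 \<or> x > 1"
 shows "vd step x = 0"
proof (cases "x < 0")
 case True
 show ?thesis by (rule vd_eq_0[OF smooth_step, of "{..<0}" x 0]) (use True in \<open>auto simp: step_0\<close>)
next
 case False
 show ?thesis
  by (rule vd_eq_0[OF smooth_step, of "{1<..}" x 1]) (use False assms in \<open>auto simp: step_1\<close>)
qed

lemma vd_vd_step_eq_0:
 assumes "x < 0 \<or> x > 1"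
 shows "vd (vd step) x = 0"
 by (rule vd_eq_0[OF smooth_vd(2)[OF smooth_step], of "{..<0} \<union> {1<..}" x 0])
  (use assms in \<open>auto intro: vd_step_eq_0\<close>)

text \<open>Both derivatives are continuous and vanish off the unit interval, so compactness bounds
  them.\<close>

lemma step_derivatives_bounded: "\<exists>C\<ge>1. \<forall>x. \<bar>vd step x\<bar> \<le> C \<and> \<bar>vd (vd step) x\<bar> \<le> C"
proof -
 have *: "\<exists>C. \<forall>x. \<bar>f x\<bar> \<le> C" if f: "smooth f" "\<And>x. x < 0 \<or> x > 1 \<Longrightarrow> f x = 0" for f :: "real \<Rightarrow> real"
 proof -
  have "compact (f ` {0..1})"
   by (intro compact_continuous_image continuous_on_subset[OF smooth_continuous[OF f(1)]]) auto
  then obtain C where C: "\<And>y. y \<in> f ` {0..1} \<Longrightarrow> norm y \<le> C"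
   using compact_imp_bounded bounded_iff by metis
  have "\<bar>f x\<bar> \<le> max 0 C" for x
   using C[of "f x"] f(2)[of x] by (cases "x \<in> {0..1}") auto
  then show ?thesis by blast
 qed
 obtain C1 where C1: "\<forall>x. \<bar>vd step x\<bar> \<le> C1"
  using *[OF smooth_vd(2)[OF smooth_step]] vd_step_eq_0 by blast
 obtain C2 where C2: "\<forall>x. \<bar>vd (vd step) x\<bar> \<le> C2"
  using *[OF smooth_vd(2)[OF smooth_vd(2)[OF smooth_step]]] vd_vd_step_eq_0 by blast
 have "\<bar>vd step x\<bar> \<le> max 1 (max C1 C2) \<and> \<bar>vd (vd step) x\<bar> \<le> max 1 (max C1 C2)" for x
  using C1[rule_format, of x] C2[rule_format, of x] by linarith
 then show ?thesis by (intro exI[of _ "max 1 (max C1 C2)"]) simp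
qed

subsection \<open>Tensor products as test functions\<close>

text \<open>Tensor products are the only test functions inserted into the weak formulation. They are
  complex because the Fourier kernel is, whereas admissible test functions are real;
  \<open>Re\<close> and \<open>Im\<close> mediate.\<close>

definition tens :: "nat \<Rightarrow> (nat \<Rightarrow> real \<Rightarrow> complex) \<Rightarrow> (nat \<Rightarrow> real) \<Rightarrow> complex" where
 "tens d f x = (\<Prod>i<d. f i (x i))"

lemma continuous_on_tens:
 assumes "\<And>i. i < d \<Longrightarrow> smooth (f i)"
 shows "continuous_on S (tens d f)"
proof -
 have "continuous_on S (\<lambda>x. f i (x i))" if "i < d" for i
  by (rule continuous_on_compose2[OF smooth_continuous[OF assms[OF that]]])
   (auto intro: continuous_on_product_coordinates continuous_on_subset)
 then show ?thesis unfolding tens_def[abs_def] by (intro continuous_on_prod) auto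
qed

lemma tens_upd:
 assumes "i < d"
 shows "tens d f (x(i := s)) = f i s * (\<Prod>j\<in>{..<d}-{i}. f j (x j))"
 using assms unfolding tens_def by (subst prod.remove[of _ i]) auto

lemma tens_has_vector_derivative:
 assumes "i < d" "smooth (f i)"
 shows "((\<lambda>s. tens d f (x(i := s))) has_vector_derivative tens d (f(i := vd (f i))) (x(i:=s))) (at s)"
proof -
 have "((\<lambda>s. f i s * (\<Prod>j\<in>{..<d}-{i}. f j (x j))) has_vector_derivative
     vd (f i) s * (\<Prod>j\<in>{..<d}-{i}. f j (x j))) (at s)"
  by (intro bounded_linear.has_vector_derivative[OF bounded_linear_mult_left] smooth_vd assms)
 moreover have "tens d (f(i := vd (f i))) (x(i:=s)) = vd (f i) s * (\<Prod>j\<in>{..<d}-{i}. f j (x j))"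
  using assms by (subst tens_upd) (auto intro!: arg_cong2[where f="(*)"] prod.cong)
 ultimately show ?thesis using assms(1) by (simp add: tens_upd)
qed

text \<open>A partial derivative changes a single factor, so tensors with smooth factors are closed
  under \<open>pd\<close>. The map \<open>h\<close> will be \<open>Re\<close> or \<open>Im\<close>;
  being bounded and linear it commutes with differentiation.\<close>

lemma C_k_tens:
 assumes h: "bounded_linear (h :: complex \<Rightarrow> real)"
 shows "(\<And>i. i < d \<Longrightarrow> smooth (f i)) \<Longrightarrow> C_k d k (\<lambda>x. h (tens d f x))"
  and pd_tens: "i < d \<Longrightarrow> smooth (f i) \<Longrightarrow>
   pd i (\<lambda>x. h (tens d f x)) = (\<lambda>x. h (tens d (f(i := vd (f i))) x))"
proof -
 have hd: "((\<lambda>s. h (tens d f (x(i := s)))) has_real_derivative h (tens d (f(i := vd (f i))) (x(i:=s)))) (at s)"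
  if "i < d" "smooth (f i)" for f i x s
  using bounded_linear.has_vector_derivative[OF h tens_has_vector_derivative[where f = f and i = i and x = x and s = s, OF that]]
  by (simp add: has_real_derivative_iff_has_vector_derivative)
 have pd: "pd i (\<lambda>x. h (tens d f x)) = (\<lambda>x. h (tens d (f(i := vd (f i))) x))" if "i < d" "smooth (f i)" for f i
 proof
  fix x
  have "deriv (\<lambda>s. h (tens d f (x(i := s)))) (x i) = h (tens d (f(i := vd (f i))) (x(i := x i)))"
   by (rule DERIV_imp_deriv, rule hd[where f = f], (rule that)+)
  then show "pd i (\<lambda>x. h (tens d f x)) x = h (tens d (f(i := vd (f i))) x)" by (simp add: pd_def)
 qed
 show "i < d \<Longrightarrow> smooth (f i) \<Longrightarrow>
   pd i (\<lambda>x. h (tens d f x)) = (\<lambda>x. h (tens d (f(i := vd (f i))) x))"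
  by (rule pd)
 have co: "continuous_on (euclid d) (\<lambda>x. h (tens d f x))" if "\<And>i. i < d \<Longrightarrow> smooth (f i)" for f
  by (intro bounded_linear.continuous_on[OF h] continuous_on_tens that)
 show "(\<And>i. i < d \<Longrightarrow> smooth (f i)) \<Longrightarrow> C_k d k (\<lambda>x. h (tens d f x))"
 proof (induction k arbitrary: f)
  case (Suc k)
  show ?case
   unfolding C_k.simps
  proof (intro conjI allI impI ballI)
   show "continuous_on (euclid d) (\<lambda>x. h (tens d f x))" by (rule co) (rule Suc)
   fix i assume i: "i < d"
   show "(\<lambda>s. h (tens d f (x(i := s)))) differentiable at (x i)" for x
    unfolding real_differentiable_def by (rule exI, rule hd[where f = f], rule i, rule Suc.prems[OF i])
   show "C_k d k (pd i (\<lambda>x. h (tens d f x)))"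
    unfolding pd[where f = f and i = i, OF i Suc.prems[OF i]]
    by (rule Suc.IH) (use Suc.prems i in \<open>auto simp: smooth_vd\<close>)
  qed
 qed (auto intro!: co)
qed

subsection \<open>Plancherel's theorem\<close>

text \<open>Squared norms are extended reals, so they can be written down and compared before
  integrability is established.\<close>

abbreviation sq_int :: "'a measure \<Rightarrow> ('a \<Rightarrow> real) \<Rightarrow> ennreal" where
 "sq_int M f \<equiv> \<integral>\<^sup>+x. ennreal ((f x)\<^sup>2) \<partial>M"

abbreviation int_on :: "real \<Rightarrow> real \<Rightarrow> (real \<Rightarrow> 'b) \<Rightarrow> 'b::{banach, second_countable_topology}" where
 "int_on a b f \<equiv> \<integral>s. indicator {a..b} s *\<^sub>R f s \<partial>lborel"

text \<open>The analysis is carried out with Borel functions on uncompleted products, where the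
  Fubini theorems and the measurability prover apply directly. The completed measures of the
  statement are reached in the last subsection through representatives.\<close>

abbreviation Bor :: "nat \<Rightarrow> ((nat \<Rightarrow> real) \<Rightarrow> 'b::topological_space) set" where
 "Bor n \<equiv> borel_measurable (PiM {..<n} (\<lambda>_. lborel))"

abbreviation Bor2 :: "nat \<Rightarrow> (real \<times> (nat \<Rightarrow> real) \<Rightarrow> 'b::topological_space) set" where
 "Bor2 n \<equiv> borel_measurable (borel \<Otimes>\<^sub>M PiM {..<n} (\<lambda>_. lborel))"

abbreviation lbn :: "nat \<Rightarrow> (nat \<Rightarrow> real) measure" where
 "lbn n \<equiv> PiM {..<n} (\<lambda>_. lborel)"

interpretation lbp: product_sigma_finite "\<lambda>_::nat. lborel :: real measure" ..

interpretation lbn: sigma_finite_measure "lbn n" for n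
 by (rule lbp.sigma_finite) simp

interpretation lbn2: pair_sigma_finite "lbn n" "lbn n" for n ..

section \<open>The Gaussian kernel and the mean square difference\<close>

lemma measurable_normal_density [measurable (raw)]:
 assumes [measurable]: "f \<in> borel_measurable M" "g \<in> borel_measurable M"
 shows "(\<lambda>z. normal_density (f z) \<sigma> (g z)) \<in> borel_measurable M"
 unfolding normal_density_def by measurable

text \<open>A heat kernel, symmetric in its two points and of mass 1 in either of them.\<close>

definition gk :: "nat \<Rightarrow> real \<Rightarrow> (nat \<Rightarrow> real) \<Rightarrow> (nat \<Rightarrow> real) \<Rightarrow> real" where
 "gk n \<sigma> x y = (\<Prod>i<n. normal_density (x i) \<sigma> (y i))"

lemma gk_measurable [measurable (raw)]:
 assumes f [measurable]: "f \<in> M \<rightarrow>\<^sub>M lbn n" and g [measurable]: "g \<in> M \<rightarrow>\<^sub>M lbn n"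
 shows "(\<lambda>z. gk n \<sigma> (f z) (g z)) \<in> borel_measurable M"
proof -
 have [measurable]: "(\<lambda>z. f z i) \<in> borel_measurable M" "(\<lambda>z. g z i) \<in> borel_measurable M" if "i < n" for i
  using measurable_compose[OF f measurable_component_singleton[of i "{..<n}"]] that
   measurable_compose[OF g measurable_component_singleton[of i "{..<n}"]] by auto
 show ?thesis unfolding gk_def by measurable
qed

lemma gk_nonneg [simp]: "gk n \<sigma> x y \<ge> 0"
 by (auto simp: gk_def intro!: prod_nonneg)

lemma gk_sym: "gk n \<sigma> x y = gk n \<sigma> y x"
 by (simp add: gk_def normal_density_def power2_commute)

lemma nn_integral_gk:
 assumes "\<sigma> > 0"
 shows "(\<integral>\<^sup>+y. ennreal (gk n \<sigma> x y) \<partial>lbn n) = 1"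
proof -
 have "(\<integral>\<^sup>+y. ennreal (gk n \<sigma> x y) \<partial>lbn n) = (\<integral>\<^sup>+y. (\<Prod>i<n. ennreal (normal_density (x i) \<sigma> (y i))) \<partial>lbn n)"
  by (simp add: gk_def prod_ennreal)
 also have "\<dots> = (\<Prod>i<n. \<integral>\<^sup>+y. ennreal (normal_density (x i) \<sigma> y) \<partial>lborel)"
  by (subst lbp.product_nn_integral_prod) auto
 also have "\<dots> = 1"
  using assms by (simp add: nn_integral_eq_integral)
 finally show ?thesis .
qed

text \<open>The mean square difference of \<open>f\<close> at Gaussian distance \<sigma>. Up to a
  constant it is the exact defect in Plancherel's identity when the frequency side is damped by a
  Gaussian, see \<open>regularised_plancherel\<close>.\<close>

definition gI :: "nat \<Rightarrow> real \<Rightarrow> ((nat \<Rightarrow> real) \<Rightarrow> complex) \<Rightarrow> ennreal" where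
 "gI n \<sigma> f = (\<integral>\<^sup>+x. \<integral>\<^sup>+y. ennreal ((cmod (f x - f y))\<^sup>2 * gk n \<sigma> x y) \<partial>lbn n \<partial>lbn n)"

lemma cmod_add_sq: "(cmod (a + b))\<^sup>2 \<le> 2 * (cmod a)\<^sup>2 + 2 * (cmod b)\<^sup>2"
proof -
 have "(cmod (a + b))\<^sup>2 \<le> (cmod a + cmod b)\<^sup>2" by (intro power_mono norm_triangle_ineq) auto
 also have "\<dots> \<le> 2 * (cmod a)\<^sup>2 + 2 * (cmod b)\<^sup>2"
  using zero_le_power2[of "cmod a - cmod b"] by (simp add: power2_eq_square algebra_simps)
 finally show ?thesis .
qed

lemma gI_fst:
 assumes [measurable]: "f \<in> Bor n" and "\<sigma> > 0"
 shows "(\<integral>\<^sup>+x. \<integral>\<^sup>+y. ennreal ((cmod (f x))\<^sup>2 * gk n \<sigma> x y) \<partial>lbn n \<partial>lbn n) =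
   sq_int (lbn n) (\<lambda>x. cmod (f x))"
 by (simp add: ennreal_mult nn_integral_cmult nn_integral_gk assms cong: nn_integral_cong_simp)

lemma gI_snd:
 assumes [measurable]: "f \<in> Bor n" and "\<sigma> > 0"
 shows "(\<integral>\<^sup>+x. \<integral>\<^sup>+y. ennreal ((cmod (f y))\<^sup>2 * gk n \<sigma> x y) \<partial>lbn n \<partial>lbn n) =
   sq_int (lbn n) (\<lambda>x. cmod (f x))"
proof -
 have "(\<integral>\<^sup>+x. \<integral>\<^sup>+y. ennreal ((cmod (f y))\<^sup>2 * gk n \<sigma> x y) \<partial>lbn n \<partial>lbn n) =
   (\<integral>\<^sup>+y. \<integral>\<^sup>+x. ennreal ((cmod (f y))\<^sup>2 * gk n \<sigma> x y) \<partial>lbn n \<partial>lbn n)"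
  by (rule lbn2.Fubini'[symmetric]) measurable
 also have "\<dots> = sq_int (lbn n) (\<lambda>x. cmod (f x))"
  using gI_fst[OF assms] by (simp add: gk_sym)
 finally show ?thesis .
qed

text \<open>|f(x) - f(y)|^2 <= 2 |f(x)|^2 + 2 |f(y)|^2, and since the kernel has mass 1 in each
  variable both terms integrate to the squared norm. Uniformity in \<sigma> is what makes the class
  \<open>gD\<close> closed in L^2.\<close>

lemma gI_bound:
 assumes [measurable]: "f \<in> Bor n" and "\<sigma> > 0"
 shows "gI n \<sigma> f \<le> 4 * sq_int (lbn n) (\<lambda>x. cmod (f x))"
proof -
 have "gI n \<sigma> f \<le> (\<integral>\<^sup>+x. \<integral>\<^sup>+y. 2 * ennreal ((cmod (f x))\<^sup>2 * gk n \<sigma> x y) +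
   2 * ennreal ((cmod (f y))\<^sup>2 * gk n \<sigma> x y) \<partial>lbn n \<partial>lbn n)"
  unfolding gI_def
 proof (intro nn_integral_mono)
  fix x y
  have "(cmod (f x - f y))\<^sup>2 * gk n \<sigma> x y \<le> (2 * (cmod (f x))\<^sup>2 + 2 * (cmod (f y))\<^sup>2) * gk n \<sigma> x y"
   using cmod_add_sq[of "f x" "- f y"] by (intro mult_right_mono) auto
  then show "ennreal ((cmod (f x - f y))\<^sup>2 * gk n \<sigma> x y) \<le> 2 * ennreal ((cmod (f x))\<^sup>2 * gk n \<sigma> x y) +
   2 * ennreal ((cmod (f y))\<^sup>2 * gk n \<sigma> x y)"
   by (auto simp: ennreal_plus[symmetric] ennreal_mult[symmetric] ennreal_numeral[symmetric] algebra_simps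
     simp del: ennreal_plus ennreal_numeral intro!: ennreal_leI)
 qed
 also have "\<dots> = 2 * (\<integral>\<^sup>+x. \<integral>\<^sup>+y. ennreal ((cmod (f x))\<^sup>2 * gk n \<sigma> x y) \<partial>lbn n \<partial>lbn n)
   + 2 * (\<integral>\<^sup>+x. \<integral>\<^sup>+y. ennreal ((cmod (f y))\<^sup>2 * gk n \<sigma> x y) \<partial>lbn n \<partial>lbn n)"
  by (simp add: nn_integral_add nn_integral_cmult cong: nn_integral_cong_simp)
 also have "\<dots> = 4 * sq_int (lbn n) (\<lambda>x. cmod (f x))"
  unfolding gI_fst[OF assms] gI_snd[OF assms] by (simp add: distrib_right[symmetric])
 finally show ?thesis .
qed

lemma gI_add:
 assumes [measurable]: "f \<in> Bor n" "g \<in> Bor n"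
 shows "gI n \<sigma> (\<lambda>x. f x + g x) \<le> 2 * gI n \<sigma> f + 2 * gI n \<sigma> g"
proof -
 have "gI n \<sigma> (\<lambda>x. f x + g x) \<le> (\<integral>\<^sup>+x. \<integral>\<^sup>+y. 2 * ennreal ((cmod (f x - f y))\<^sup>2 * gk n \<sigma> x y) +
   2 * ennreal ((cmod (g x - g y))\<^sup>2 * gk n \<sigma> x y) \<partial>lbn n \<partial>lbn n)"
  unfolding gI_def
 proof (intro nn_integral_mono)
  fix x y
  have "(cmod (f x + g x - (f y + g y)))\<^sup>2 * gk n \<sigma> x y \<le>
    (2 * (cmod (f x - f y))\<^sup>2 + 2 * (cmod (g x - g y))\<^sup>2) * gk n \<sigma> x y"
   using cmod_add_sq[of "f x - f y" "g x - g y"] by (intro mult_right_mono) (auto simp: algebra_simps)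
  then show "ennreal ((cmod (f x + g x - (f y + g y)))\<^sup>2 * gk n \<sigma> x y) \<le>
   2 * ennreal ((cmod (f x - f y))\<^sup>2 * gk n \<sigma> x y) + 2 * ennreal ((cmod (g x - g y))\<^sup>2 * gk n \<sigma> x y)"
   by (auto simp: ennreal_plus[symmetric] ennreal_mult[symmetric] ennreal_numeral[symmetric] algebra_simps
     simp del: ennreal_plus ennreal_numeral intro!: ennreal_leI)
 qed
 also have "\<dots> = 2 * gI n \<sigma> f + 2 * gI n \<sigma> g"
  unfolding gI_def by (simp add: nn_integral_add nn_integral_cmult cong: nn_integral_cong_simp)
 finally show ?thesis .
qed

lemma gI_cmult:
 assumes [measurable]: "f \<in> Bor n"
 shows "gI n \<sigma> (\<lambda>x. c * f x) = ennreal ((cmod c)\<^sup>2) * gI n \<sigma> f"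
proof -
 have "ennreal ((cmod (c * f x - c * f y))\<^sup>2 * gk n \<sigma> x y) =
  ennreal ((cmod c)\<^sup>2) * ennreal ((cmod (f x - f y))\<^sup>2 * gk n \<sigma> x y)" for x y
  by (simp add: ennreal_mult[symmetric] right_diff_distrib[symmetric] norm_mult power_mult_distrib mult.assoc)
 then show ?thesis by (simp add: gI_def nn_integral_cmult cong: nn_integral_cong_simp)
qed

section \<open>Vanishing of the mean square difference on all of L^2\<close>

lemma ennreal_tendsto_0I:
 assumes "\<And>e::real. e > 0 \<Longrightarrow> eventually (\<lambda>x. f x \<le> ennreal e) F"
 shows "(f \<longlongrightarrow> 0) F"
proof (rule order_tendstoI)
 fix a :: ennreal assume "0 < a"
 then obtain b where b: "0 < b" "b < a" using dense by blast
 then have "b < top" using top.not_eq_extremum by fastforce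
 with b obtain e where "b = ennreal e" "e > 0" by (cases b) (auto simp: ennreal_less_zero_iff)
 from assms[OF this(2)] show "eventually (\<lambda>x. f x < a) F"
  by eventually_elim (use b \<open>b = ennreal e\<close> in auto)
qed auto

definition gD :: "nat \<Rightarrow> ((nat \<Rightarrow> real) \<Rightarrow> complex) \<Rightarrow> bool" where
 "gD n f \<longleftrightarrow> f \<in> Bor n \<and> (\<lambda>k. gI n (1 / real (Suc k)) f) \<longlonglongrightarrow> 0"

text \<open>A remainder e that does not depend on k may be left over, because e is arbitrary. This
  is how approximation in L^2 enters.\<close>

lemma gD_le:
 assumes [measurable]: "f \<in> Bor n"
  and "\<And>e::real. e > 0 \<Longrightarrow> \<exists>A. A \<longlonglongrightarrow> 0 \<and> (\<forall>k. gI n (1 / real (Suc k)) f \<le> A k + ennreal e)"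
 shows "gD n f"
 unfolding gD_def
proof (intro conjI assms ennreal_tendsto_0I)
 fix e :: real assume e: "e > 0"
 from assms(2)[of "e/2"] e obtain A where A: "A \<longlonglongrightarrow> 0" "\<And>k. gI n (1 / real (Suc k)) f \<le> A k + ennreal (e/2)"
  by auto
 from order_tendstoD(2)[OF A(1), of "ennreal (e/2)"] e have "eventually (\<lambda>k. A k < ennreal (e/2)) sequentially"
  by auto
 then show "eventually (\<lambda>k. gI n (1 / real (Suc k)) f \<le> ennreal e) sequentially"
 proof eventually_elim
  case (elim k)
  have "gI n (1 / real (Suc k)) f \<le> ennreal (e/2) + ennreal (e/2)"
   using A(2)[of k] elim by (meson add_right_mono less_imp_le order_trans)
  also have "\<dots> = ennreal e" using e by (simp add: ennreal_plus[symmetric] del: ennreal_plus)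
  finally show ?case .
 qed
qed

lemma gD_add:
 assumes "gD n f" "gD n g"
 shows "gD n (\<lambda>x. f x + g x)"
proof (rule gD_le)
 have [measurable]: "f \<in> Bor n" "g \<in> Bor n"
  using assms by (auto simp: gD_def)
 show "(\<lambda>x. f x + g x) \<in> Bor n" by measurable
 have "(\<lambda>k. 2 * gI n (1 / real (Suc k)) f + 2 * gI n (1 / real (Suc k)) g) \<longlonglongrightarrow> 2 * 0 + 2 * 0"
  using assms unfolding gD_def by (intro tendsto_add ennreal_tendsto_cmult) auto
 then show "\<exists>A. A \<longlonglongrightarrow> 0 \<and> (\<forall>k. gI n (1 / real (Suc k)) (\<lambda>x. f x + g x) \<le> A k + ennreal e)" for e
  using gI_add[of f n g]
  by (intro exI[of _ "\<lambda>k. 2 * gI n (1 / real (Suc k)) f + 2 * gI n (1 / real (Suc k)) g"])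
   (auto intro: add_increasing2)
qed

lemma gD_cmult:
 assumes "gD n f"
 shows "gD n (\<lambda>x. c * f x)"
proof -
 have [measurable]: "f \<in> Bor n" using assms by (auto simp: gD_def)
 have "(\<lambda>k. ennreal ((cmod c)\<^sup>2) * gI n (1 / real (Suc k)) f) \<longlonglongrightarrow> ennreal ((cmod c)\<^sup>2) * 0"
  using assms unfolding gD_def by (intro ennreal_tendsto_cmult) auto
 then show ?thesis by (simp add: gD_def gI_cmult)
qed

lemma gD_diff: "gD n f \<Longrightarrow> gD n g \<Longrightarrow> gD n (\<lambda>x. f x - g x)"
 using gD_add[of n f "\<lambda>x. (-1) * g x"] gD_cmult[of n g "-1"] by simp

lemma gD_0: "gD n (\<lambda>x. 0)"
 by (simp add: gD_def gI_def)

lemma gD_sum: "(\<And>i. i \<in> I \<Longrightarrow> gD n (f i)) \<Longrightarrow> gD n (\<lambda>x. \<Sum>i\<in>I. f i x)"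
 by (induction I rule: infinite_finite_induct) (auto intro: gD_0 gD_add)

lemma gD_cong: "(\<And>x. x \<in> space (lbn n) \<Longrightarrow> f x = g x) \<Longrightarrow> gD n f = gD n g"
 unfolding gD_def gI_def by (simp cong: nn_integral_cong measurable_cong)

text \<open>The defect of g is at most twice that of f_j plus twice that of g - f_j, and the latter
  is at most 4 times the squared distance; the threshold e/8 makes 2 * 4 * e/8 = e.\<close>

lemma gD_lim:
 assumes f: "\<And>j. gD n (f j)" and [measurable]: "g \<in> Bor n"
  and lim: "(\<lambda>j::nat. \<integral>\<^sup>+x. ennreal ((cmod (g x - f j x))\<^sup>2) \<partial>lbn n) \<longlonglongrightarrow> 0"
 shows "gD n g"
proof (rule gD_le)
 show "g \<in> Bor n" by fact
 have [measurable]: "f j \<in> Bor n" for j using f by (auto simp: gD_def)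
 fix e :: real assume e: "e > 0"
 have "eventually (\<lambda>j. (sq_int (lbn n) (\<lambda>x. cmod (g x - f j x))) < ennreal (e/8)) sequentially"
  by (rule order_tendstoD(2)[OF lim]) (use e in auto)
 then obtain j where j: "sq_int (lbn n) (\<lambda>x. cmod (g x - f j x)) < ennreal (e/8)"
  using eventually_happens' sequentially_bot by blast
 have "gI n (1 / real (Suc k)) g \<le> 2 * gI n (1 / real (Suc k)) (f j) + ennreal e" for k
 proof -
  have "gI n (1 / real (Suc k)) g \<le> 2 * gI n (1 / real (Suc k)) (f j) +
    2 * gI n (1 / real (Suc k)) (\<lambda>x. g x - f j x)"
   using gI_add[of "f j" n "\<lambda>x. g x - f j x"] by simp
  also have "gI n (1 / real (Suc k)) (\<lambda>x. g x - f j x) \<le> 4 * ennreal (e/8)"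
   by (rule order_trans[OF gI_bound mult_left_mono[OF less_imp_le[OF j]]]) auto
  also have "2 * (4 * ennreal (e/8)) = ennreal e"
   using e by (simp add: ennreal_numeral[symmetric] ennreal_mult[symmetric] del: ennreal_numeral)
  finally show ?thesis by (simp add: add_mono mult_left_mono)
 qed
 moreover have "(\<lambda>k. 2 * gI n (1 / real (Suc k)) (f j)) \<longlonglongrightarrow> 2 * 0"
  using f unfolding gD_def by (intro ennreal_tendsto_cmult) auto
 ultimately show "\<exists>A. A \<longlonglongrightarrow> 0 \<and> (\<forall>k. gI n (1 / real (Suc k)) g \<le> A k + ennreal e)" by auto
qed

text \<open>The cross term of the expanded square in \<open>gI\<close> for the indicator of a box is
  a product of such integrals, one for each coordinate.\<close>

definition gJ :: "real \<Rightarrow> real \<Rightarrow> real \<Rightarrow> ennreal" where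
 "gJ a b \<sigma> = (\<integral>\<^sup>+x. \<integral>\<^sup>+y. ennreal (indicator {a..b} x * (indicator {a..b} y * normal_density x \<sigma> y)) \<partial>lborel \<partial>lborel)"

lemma gJ_inner:
 assumes x: "a < x" "x < b" and s: "s \<longlonglongrightarrow> 0" "\<And>k. s k > 0"
 shows "(\<lambda>k. \<integral>\<^sup>+y. ennreal (indicator {a..b} y * normal_density x (s k) y) \<partial>lborel) \<longlonglongrightarrow> 1"
proof -
 \<comment> \<open>The substitution y = x + s z replaces the concentrating density by a fixed one
   and moves the parameter into the indicator, which is eventually 1 because x is an interior
   point.\<close>
 have eq: "(\<integral>\<^sup>+y. ennreal (indicator {a..b} y * normal_density x (s k) y) \<partial>lborel) =
   (\<integral>\<^sup>+z. ennreal (indicator {a..b} (x + s k * z) * std_normal_density z) \<partial>lborel)" for k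
 proof -
  have "ennreal (indicator {a..b} (x + s k * z) * std_normal_density z) =
    ennreal \<bar>s k\<bar> * ennreal (indicator {a..b} (x + s k * z) * normal_density x (s k) (x + s k * z))" for z
   using s(2)[of k]
   by (simp add: ennreal_mult[symmetric] normal_density_def power_mult_distrib real_sqrt_mult)
  then show ?thesis
   by (subst nn_integral_real_affine[where c = "s k" and t = x])
    (use s(2)[of k] in \<open>auto simp: nn_integral_cmult\<close>)
 qed
 have "(\<lambda>k. \<integral>\<^sup>+z. ennreal (indicator {a..b} (x + s k * z) * std_normal_density z) \<partial>lborel) \<longlonglongrightarrow>
   (\<integral>\<^sup>+z. ennreal (std_normal_density z) \<partial>lborel)"
 proof (rule nn_integral_dominated_convergence[where w = "\<lambda>z. ennreal (std_normal_density z)"])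
  show "(\<integral>\<^sup>+z. ennreal (std_normal_density z) \<partial>lborel) < \<infinity>" by (simp add: nn_integral_eq_integral)
  show "AE z in lborel. (\<lambda>k. ennreal (indicator {a..b} (x + s k * z) * std_normal_density z)) \<longlonglongrightarrow>
    ennreal (std_normal_density z)"
  proof (rule AE_I2)
   fix z :: real
   have l: "(\<lambda>k. x + s k * z) \<longlonglongrightarrow> x + 0 * z" by (intro tendsto_intros s)
   have "eventually (\<lambda>k. x + s k * z > a \<and> x + s k * z < b) sequentially"
    using order_tendstoD[OF l] x by (intro eventually_conj) auto
   then show "(\<lambda>k. ennreal (indicator {a..b} (x + s k * z) * std_normal_density z)) \<longlonglongrightarrow>
    ennreal (std_normal_density z)"
    by (intro tendsto_eventually, elim eventually_mono) auto
  qed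
  show "AE z in lborel. ennreal (indicator {a..b} (x + s k * z) * std_normal_density z) \<le> ennreal (std_normal_density z)" for k
   by (intro AE_I2 ennreal_leI) (auto split: split_indicator)
 qed auto
 then show ?thesis unfolding eq by (simp add: nn_integral_eq_integral)
qed

lemma gJ_tendsto:
 assumes s: "s \<longlonglongrightarrow> 0" "\<And>k. s k > 0"
 shows "(\<lambda>k. gJ a b (s k)) \<longlonglongrightarrow> emeasure lborel {a..b}"
proof -
 have eq: "gJ a b (s k) = (\<integral>\<^sup>+x. indicator {a..b} x * (\<integral>\<^sup>+y. ennreal (indicator {a..b} y * normal_density x (s k) y) \<partial>lborel) \<partial>lborel)" for k
  unfolding gJ_def by (intro nn_integral_cong) (auto split: split_indicator)
 have "(\<lambda>k. gJ a b (s k)) \<longlonglongrightarrow> (\<integral>\<^sup>+x. indicator {a..b} x \<partial>lborel)"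
  unfolding eq
 proof (rule nn_integral_dominated_convergence[where w = "indicator {a..b}"])
  show "AE x in lborel. (\<lambda>k. indicator {a..b} x * (\<integral>\<^sup>+y. ennreal (indicator {a..b} y * normal_density x (s k) y) \<partial>lborel))
   \<longlonglongrightarrow> indicator {a..b} x"
   \<comment> \<open>At an endpoint of a nondegenerate interval half of the mass falls outside and
     the inner integral tends to 1/2, so the two endpoints are discarded as a null set.\<close>
   using AE_lborel_singleton[of a] AE_lborel_singleton[of b]
  proof eventually_elim
   case (elim x)
   show ?case
   proof (cases "x \<in> {a..b}")
    case True
    then show ?thesis using gJ_inner[of a x b, OF _ _ s] elim by auto
   qed auto
  qed
  show "AE x in lborel. indicator {a..b} x * (\<integral>\<^sup>+y. ennreal (indicator {a..b} y * normal_density x (s k) y) \<partial>lborel)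
   \<le> indicator {a..b} x" for k
  proof (rule AE_I2)
   fix x :: real
   have "(\<integral>\<^sup>+y. ennreal (indicator {a..b} y * normal_density x (s k) y) \<partial>lborel) \<le>
    (\<integral>\<^sup>+y. ennreal (normal_density x (s k) y) \<partial>lborel)"
    by (intro nn_integral_mono ennreal_leI) (auto split: split_indicator)
   also have "\<dots> = 1" using s(2)[of k] by (simp add: nn_integral_eq_integral)
   finally show "indicator {a..b} x * (\<integral>\<^sup>+y. ennreal (indicator {a..b} y * normal_density x (s k) y) \<partial>lborel)
   \<le> indicator {a..b} x" by (auto split: split_indicator)
  qed
  show "(\<integral>\<^sup>+x. indicator {a..b} x \<partial>lborel) < \<infinity>" by (auto simp: emeasure_lborel_Icc_eq)
 qed auto
 then show ?thesis by simp
qed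

lemma tendsto_prod_ennreal:
 fixes f :: "'i \<Rightarrow> 'a \<Rightarrow> ennreal"
 assumes "\<And>i. i \<in> I \<Longrightarrow> (f i \<longlongrightarrow> g i) F" "\<And>i. i \<in> I \<Longrightarrow> g i < top"
 shows "((\<lambda>k. \<Prod>i\<in>I. f i k) \<longlongrightarrow> (\<Prod>i\<in>I. g i)) F \<and> (\<Prod>i\<in>I. g i) < top"
 using assms
proof (induction I rule: infinite_finite_induct)
 case (insert i I)
 then have "((\<lambda>k. \<Prod>i\<in>I. f i k) \<longlongrightarrow> (\<Prod>i\<in>I. g i)) F" "(\<Prod>i\<in>I. g i) < top"
  "(f i \<longlongrightarrow> g i) F" "g i < top" by auto
 then have "((\<lambda>k. f i k * (\<Prod>i\<in>I. f i k)) \<longlongrightarrow> g i * (\<Prod>i\<in>I. g i)) F" "g i * (\<Prod>i\<in>I. g i) < top"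
  by (intro tendsto_mult_ennreal, simp_all add: less_top ennreal_mult_less_top)
 then show ?case using insert.hyps by simp
qed auto

text \<open>For a function with values 0 and 1 the square expands to F(x) + F(y) - 2 F(x) F(y). The
  first two terms give twice the volume for every \<sigma>, and the cross term factorises over the
  coordinates and converges to twice the volume as well.\<close>

lemma gD_box: "gD n (\<lambda>x. complex_of_real (\<Prod>i<n. indicator {a i..b i} (x i)))"
proof -
 define F :: "(nat \<Rightarrow> real) \<Rightarrow> real" where "F x = (\<Prod>i<n. indicator {a i..b i} (x i))" for x
 have F01: "F x = 0 \<or> F x = 1" for x
 proof (cases "\<forall>i<n. x i \<in> {a i..b i}")
  case False
  then obtain i where "i < n" "x i \<notin> {a i..b i}" by blast
  then have "F x = 0" unfolding F_def by (intro prod_zero bexI[of _ i]) auto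
  then show ?thesis by simp
 qed (auto simp: F_def)
 have F0: "F x \<ge> 0" for x using F01[of x] by auto
 have [measurable]: "F \<in> Bor n" unfolding F_def by measurable
 define J where "J \<sigma> = (\<integral>\<^sup>+x. \<integral>\<^sup>+y. ennreal (F x * F y * gk n \<sigma> x y) \<partial>lbn n \<partial>lbn n)" for \<sigma>
 define m where "m = sq_int (lbn n) (\<lambda>x. cmod (complex_of_real (F x)))"
 have sum: "gI n \<sigma> (\<lambda>x. complex_of_real (F x)) + 2 * J \<sigma> = 2 * m" if "\<sigma> > 0" for \<sigma>
 proof -
  have pw: "ennreal ((cmod (complex_of_real (F x) - complex_of_real (F y)))\<^sup>2 * gk n \<sigma> x y) +
    2 * ennreal (F x * F y * gk n \<sigma> x y) = ennreal ((cmod (complex_of_real (F x)))\<^sup>2 * gk n \<sigma> x y)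
     + ennreal ((cmod (complex_of_real (F y)))\<^sup>2 * gk n \<sigma> x y)" for x y
   using F01[of x] F01[of y]
   by (auto simp: ennreal_plus[symmetric] ennreal_mult[symmetric] ennreal_numeral[symmetric]
     simp del: ennreal_plus ennreal_numeral)
  have "gI n \<sigma> (\<lambda>x. complex_of_real (F x)) + 2 * J \<sigma> =
    (\<integral>\<^sup>+x. \<integral>\<^sup>+y. ennreal ((cmod (complex_of_real (F x) - complex_of_real (F y)))\<^sup>2 * gk n \<sigma> x y) +
    2 * ennreal (F x * F y * gk n \<sigma> x y) \<partial>lbn n \<partial>lbn n)"
   unfolding gI_def J_def by (simp add: nn_integral_add nn_integral_cmult cong: nn_integral_cong_simp)
  also have "\<dots> = (\<integral>\<^sup>+x. \<integral>\<^sup>+y. ennreal ((cmod (complex_of_real (F x)))\<^sup>2 * gk n \<sigma> x y) \<partial>lbn n \<partial>lbn n)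
     + (\<integral>\<^sup>+x. \<integral>\<^sup>+y. ennreal ((cmod (complex_of_real (F y)))\<^sup>2 * gk n \<sigma> x y) \<partial>lbn n \<partial>lbn n)"
   unfolding pw by (simp add: nn_integral_add nn_integral_cmult cong: nn_integral_cong_simp)
  also have "\<dots> = m + m"
   unfolding m_def by (intro arg_cong2[where f = "(+)"] gI_fst gI_snd that) measurable
  finally show ?thesis by (simp add: mult_2)
 qed
 have J_eq: "J \<sigma> = (\<Prod>i<n. gJ (a i) (b i) \<sigma>)" for \<sigma>
 proof -
  have "(\<integral>\<^sup>+y. ennreal (F x * F y * gk n \<sigma> x y) \<partial>lbn n) =
   (\<Prod>i<n. \<integral>\<^sup>+y. ennreal (indicator {a i..b i} (x i) * (indicator {a i..b i} y * normal_density (x i) \<sigma> y)) \<partial>lborel)" for x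
  proof -
   have "F x * F y * gk n \<sigma> x y = (\<Prod>i<n. indicator {a i..b i} (x i) * (indicator {a i..b i} (y i) * normal_density (x i) \<sigma> (y i)))" for y
    unfolding F_def gk_def by (simp add: prod.distrib mult.assoc)
   then have "(\<integral>\<^sup>+y. ennreal (F x * F y * gk n \<sigma> x y) \<partial>lbn n) =
     (\<integral>\<^sup>+y. (\<Prod>i<n. ennreal (indicator {a i..b i} (x i) * (indicator {a i..b i} (y i) * normal_density (x i) \<sigma> (y i)))) \<partial>lbn n)"
    by (simp add: prod_ennreal)
   also have "\<dots> = (\<Prod>i<n. \<integral>\<^sup>+y. ennreal (indicator {a i..b i} (x i) * (indicator {a i..b i} y * normal_density (x i) \<sigma> y)) \<partial>lborel)"
    by (subst lbp.product_nn_integral_prod) auto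
   finally show ?thesis .
  qed
  then have "J \<sigma> = (\<integral>\<^sup>+x. (\<Prod>i<n. \<integral>\<^sup>+y. ennreal (indicator {a i..b i} (x i) * (indicator {a i..b i} y * normal_density (x i) \<sigma> y)) \<partial>lborel) \<partial>lbn n)"
   unfolding J_def by simp
  also have "\<dots> = (\<Prod>i<n. gJ (a i) (b i) \<sigma>)"
   unfolding gJ_def
   by (subst lbp.product_nn_integral_prod[where f = "\<lambda>i x. \<integral>\<^sup>+y. ennreal (indicator {a i..b i} x * (indicator {a i..b i} y * normal_density x \<sigma> y)) \<partial>lborel"]) auto
  finally show ?thesis .
 qed
 have m_eq: "m = (\<Prod>i<n. emeasure lborel {a i..b i})"
 proof -
  have "ennreal ((cmod (complex_of_real (F x)))\<^sup>2) = (\<Prod>i<n. indicator {a i..b i} (x i))" for x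
  proof -
   have "(cmod (complex_of_real (F x)))\<^sup>2 = F x" using F01[of x] by auto
   then show ?thesis unfolding F_def
    by (simp add: prod_ennreal[symmetric] ennreal_indicator)
  qed
  then have "m = (\<integral>\<^sup>+x. (\<Prod>i<n. indicator {a i..b i} (x i)) \<partial>lbn n)" by (simp add: m_def)
  also have "\<dots> = (\<Prod>i<n. emeasure lborel {a i..b i})"
   by (subst lbp.product_nn_integral_prod) auto
  finally show ?thesis .
 qed
 have s: "(\<lambda>k. 1 / real (Suc k)) \<longlonglongrightarrow> 0" by real_asymp
 have "((\<lambda>k. \<Prod>i<n. gJ (a i) (b i) (1 / real (Suc k))) \<longlonglongrightarrow> (\<Prod>i<n. emeasure lborel {a i..b i})) \<and>
  (\<Prod>i<n. emeasure lborel {a i..b i}) < top"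
 proof (rule tendsto_prod_ennreal)
  show "(\<lambda>k. gJ (a i) (b i) (1 / real (Suc k))) \<longlonglongrightarrow> emeasure lborel {a i..b i}" for i
   by (rule gJ_tendsto[OF s]) simp
 qed (simp add: emeasure_lborel_Icc_eq)
 then have lim: "(\<lambda>k. J (1 / real (Suc k))) \<longlonglongrightarrow> m" and fin: "m < top"
  unfolding J_eq m_eq by auto
 have "gI n (1 / real (Suc k)) (\<lambda>x. complex_of_real (F x)) = 2 * m - 2 * J (1 / real (Suc k))" for k
 proof -
  have S: "gI n (1 / real (Suc k)) (\<lambda>x. complex_of_real (F x)) + 2 * J (1 / real (Suc k)) = 2 * m"
   by (rule sum) simp
  have "2 * J (1 / real (Suc k)) \<le> 2 * m" unfolding S[symmetric] by (rule add_increasing) auto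
  then have "2 * J (1 / real (Suc k)) \<noteq> top" using fin by (auto simp: ennreal_mult_eq_top_iff top_unique)
  then show ?thesis unfolding S[symmetric] by (rule ennreal_add_diff_cancel_right[symmetric])
 qed
 moreover have "(\<lambda>k. 2 * m - 2 * J (1 / real (Suc k))) \<longlonglongrightarrow> 2 * m - 2 * m"
  by (intro tendsto_diff_ennreal tendsto_const ennreal_tendsto_cmult lim)
   (use fin in \<open>simp_all add: ennreal_mult_eq_top_iff less_top\<close>)
 ultimately have "(\<lambda>k. gI n (1 / real (Suc k)) (\<lambda>x. complex_of_real (F x))) \<longlonglongrightarrow> 0"
  using fin by (simp add: ennreal_mult_eq_top_iff less_top[symmetric])
 then have "gD n (\<lambda>x. complex_of_real (F x))" unfolding gD_def by (intro conjI) measurable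
 then show ?thesis unfolding F_def .
qed

definition box_sets :: "nat \<Rightarrow> (nat \<Rightarrow> real) set set" where
 "box_sets n = {Pi\<^sub>E {..<n} (\<lambda>i. {a i..b i}) | a b. True}"

lemma box_setsI: "Pi\<^sub>E {..<n} (\<lambda>i. {a i..b i}) \<in> box_sets n"
 unfolding box_sets_def by blast

text \<open>Closed boxes form an intersection-stable generator, which is what the extension from
  boxes to measurable sets requires.\<close>

lemma sets_lbn: "sets (lbn n) = sigma_sets (space (lbn n)) (box_sets n)"
proof -
 let ?E = "range (\<lambda>(a, b). {a..b::real})"
 let ?P = "{{f\<in>(\<Pi>\<^sub>E i\<in>{..<n}. UNIV). \<forall>i\<in>j. f i \<in> A i} | A j. j \<in> {{..<n}} \<and> A \<in> Pi j (\<lambda>_. ?E)}"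
 have "sets (lbn n) = sets (PiM {..<n} (\<lambda>_. sigma UNIV ?E))"
  by (rule sets_PiM_cong) (auto simp: borel_eq_atLeastAtMost[symmetric])
 also have "\<dots> = sets (sigma (\<Pi>\<^sub>E i\<in>{..<n}. UNIV) ?P)"
 proof (rule sets_PiM_sigma)
  have "(\<Union>k::nat. {- real k..real k}) = (UNIV :: real set)"
  proof -
   have "\<exists>k::nat. x \<in> {- real k..real k}" for x :: real
   proof -
    obtain k :: nat where "\<bar>x\<bar> \<le> real k" using real_arch_simple by blast
    then show ?thesis by (intro exI[of _ k]) auto
   qed
   then show ?thesis by blast
  qed
  then show "\<exists>S\<subseteq>?E. countable S \<and> UNIV = \<Union>S"
   by (intro exI[of _ "range (\<lambda>k::nat. {- real k..real k})"]) auto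
 qed auto
 also have "\<dots> = sigma_sets (\<Pi>\<^sub>E i\<in>{..<n}. UNIV) ?P"
  by (rule sets_measure_of) auto
 also have "?P = box_sets n"
 proof safe
  fix A assume "A \<in> {..<n} \<rightarrow> ?E"
  then have "\<forall>i\<in>{..<n}. \<exists>a b. A i = {a..b}" by fastforce
  then obtain a b where "\<forall>i\<in>{..<n}. A i = {a i..b i}" by metis
  then have "{f \<in> (\<Pi>\<^sub>E i\<in>{..<n}. UNIV). \<forall>i\<in>{..<n}. f i \<in> A i} = Pi\<^sub>E {..<n} (\<lambda>i. {a i..b i})"
   by (auto simp: PiE_def Pi_def)
  then show "{f \<in> (\<Pi>\<^sub>E i\<in>{..<n}. UNIV). \<forall>i\<in>{..<n}. f i \<in> A i} \<in> box_sets n"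
   unfolding box_sets_def by blast
 next
  fix X assume "X \<in> box_sets n"
  then obtain a b where "X = Pi\<^sub>E {..<n} (\<lambda>i. {a i..b i})" by (auto simp: box_sets_def)
  then show "\<exists>A j. X = {f \<in> (\<Pi>\<^sub>E i\<in>{..<n}. UNIV). \<forall>i\<in>j. f i \<in> A i} \<and> j \<in> {{..<n}} \<and> A \<in> Pi j (\<lambda>_. ?E)"
   by (intro exI[of _ "\<lambda>i. {a i..b i}"] exI[of _ "{..<n}"]) (auto simp: PiE_def Pi_def)
 qed
 finally show ?thesis by (simp add: space_PiM)
qed

lemma box_Int: "Pi\<^sub>E {..<n::nat} (\<lambda>i. {a i..b i::real}) \<inter> Pi\<^sub>E {..<n} (\<lambda>i. {c i..d i}) =
  Pi\<^sub>E {..<n} (\<lambda>i. {max (a i) (c i)..min (b i) (d i)})"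
 by (auto simp: PiE_def Pi_def)

lemma gD_box_set: "gD n (\<lambda>x. complex_of_real (indicator (Pi\<^sub>E {..<n} (\<lambda>i. {a i..b i})) x))"
proof (subst gD_cong)
 show "gD n (\<lambda>x. complex_of_real (\<Prod>i<n. indicator {a i..b i} (x i)))" by (rule gD_box)
 fix x assume x: "x \<in> space (lbn n)"
 show "complex_of_real (indicator (Pi\<^sub>E {..<n} (\<lambda>i. {a i..b i})) x) =
   complex_of_real (\<Prod>i<n. indicator {a i..b i} (x i))"
 proof (cases "\<forall>i<n. x i \<in> {a i..b i}")
  case True
  with x have "x \<in> Pi\<^sub>E {..<n} (\<lambda>i. {a i..b i})" by (auto simp: space_PiM PiE_def Pi_def)
  with True show ?thesis by simp
 next
  case False
  then obtain i where "i < n" "x i \<notin> {a i..b i}" by blast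
  moreover from this have "x \<notin> Pi\<^sub>E {..<n} (\<lambda>i. {a i..b i})" by (auto simp: PiE_def Pi_def)
  moreover have "(\<Prod>i<n. indicator {a i..b i} (x i) :: real) = 0"
   using \<open>i < n\<close> \<open>x i \<notin> _\<close> by (intro prod_zero bexI[of _ i]) auto
  ultimately show ?thesis by simp
 qed
qed

lemma emeasure_box_finite: "emeasure (lbn n) (Pi\<^sub>E {..<n} (\<lambda>i. {a i..b i})) < \<infinity>"
 by (subst lbp.emeasure_PiM) (auto simp: emeasure_lborel_Icc_eq ennreal_prod_eq_top less_top[symmetric])

text \<open>Dynkin's argument is carried out inside a fixed box \<open>Q\<close>: there a complement
  is a difference of two members of \<open>gD\<close>, and the partial unions of a disjoint family
  converge in L^2 with the indicator of \<open>Q\<close> as dominating function.\<close>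

lemma gD_set_Int_box:
 assumes A: "A \<in> sets (lbn n)"
 shows "gD n (\<lambda>x. complex_of_real (indicator (A \<inter> Pi\<^sub>E {..<n} (\<lambda>i. {c i..d i})) x))"
proof -
 define Q where "Q = Pi\<^sub>E {..<n} (\<lambda>i. {c i..d i})"
 have [measurable]: "Q \<in> sets (lbn n)" unfolding Q_def by (intro sets_PiM_I_finite) auto
 have Qfin: "emeasure (lbn n) Q < \<infinity>" unfolding Q_def by (rule emeasure_box_finite)
 have "Int_stable (box_sets n)"
 proof (rule Int_stableI)
  fix X Y assume "X \<in> box_sets n" "Y \<in> box_sets n"
  then obtain a b a' b' where "X = Pi\<^sub>E {..<n} (\<lambda>i. {a i..b i})" "Y = Pi\<^sub>E {..<n} (\<lambda>i. {a' i..b' i})"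
   unfolding box_sets_def by blast
  then have "X \<inter> Y = Pi\<^sub>E {..<n} (\<lambda>i. {(\<lambda>i. max (a i) (a' i)) i..(\<lambda>i. min (b i) (b' i)) i})"
   by (simp add: box_Int)
  then show "X \<inter> Y \<in> box_sets n"
   using box_setsI[of n "\<lambda>i. max (a i) (a' i)" "\<lambda>i. min (b i) (b' i)"] by simp
 qed
 moreover have "box_sets n \<subseteq> Pow (space (lbn n))"
  by (auto simp: box_sets_def space_PiM PiE_def)
 moreover have "A \<in> sigma_sets (space (lbn n)) (box_sets n)" using A unfolding sets_lbn .
 ultimately have "gD n (\<lambda>x. complex_of_real (indicator (A \<inter> Q) x))"
 proof (induction rule: sigma_sets_induct_disjoint)
  case (basic A)
  then obtain a b where "A = Pi\<^sub>E {..<n} (\<lambda>i. {a i..b i})" unfolding box_sets_def by blast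
  then show ?case unfolding Q_def by (simp add: box_Int gD_box_set)
 next
  case empty
  then show ?case by (simp add: gD_0)
 next
  case (compl A)
  have "gD n (\<lambda>x. complex_of_real (indicator Q x) - complex_of_real (indicator (A \<inter> Q) x))"
   using compl gD_box_set[of n c d] unfolding Q_def by (intro gD_diff) auto
  then show ?case
   by (rule gD_cong[THEN iffD1, rotated]) (auto split: split_indicator)
 next
  case (union F)
  then have [measurable]: "F i \<in> sets (lbn n)" for i unfolding sets_lbn by auto
  show ?case
  proof (rule gD_lim[where f = "\<lambda>j x. \<Sum>i<j. complex_of_real (indicator (F i \<inter> Q) x)"])
   show "gD n (\<lambda>x. \<Sum>i<j. complex_of_real (indicator (F i \<inter> Q) x))" for j
    using union by (intro gD_sum) auto
   have eq: "(\<Sum>i<j. complex_of_real (indicator (F i \<inter> Q) x)) = complex_of_real (indicator ((\<Union>i<j. F i) \<inter> Q) x)" for j x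
   proof (cases "\<exists>i<j. x \<in> F i \<inter> Q")
    case True
    then obtain i where i: "i < j" "x \<in> F i" "x \<in> Q" by auto
    then have "x \<notin> F k" if "k \<noteq> i" for k
     using \<open>disjoint_family F\<close> that by (auto simp: disjoint_family_on_def)
    then have "(\<Sum>k<j. complex_of_real (indicator (F k \<inter> Q) x)) = (\<Sum>k<j. if k = i then 1 else 0)"
     using i by (intro sum.cong) (auto split: split_indicator)
    with i show ?thesis by (auto simp: indicator_def)
   next
    case False
    then show ?thesis by (auto simp: indicator_def intro!: sum.neutral)
   qed
   have "(\<lambda>j. \<integral>\<^sup>+x. ennreal ((cmod (complex_of_real (indicator (\<Union> (range F) \<inter> Q) x) -
     complex_of_real (indicator ((\<Union>i<j. F i) \<inter> Q) x)))\<^sup>2) \<partial>lbn n) \<longlonglongrightarrow> (\<integral>\<^sup>+x. 0 \<partial>lbn n)"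
   proof (rule nn_integral_dominated_convergence[where w = "indicator Q"])
    show "AE x in lbn n. (\<lambda>j. ennreal ((cmod (complex_of_real (indicator (\<Union> (range F) \<inter> Q) x) -
     complex_of_real (indicator ((\<Union>i<j. F i) \<inter> Q) x)))\<^sup>2)) \<longlonglongrightarrow> 0"
    proof (rule AE_I2)
     fix x
     have "eventually (\<lambda>j. indicat_real ((\<Union>i<j. F i) \<inter> Q) x = indicator (\<Union> (range F) \<inter> Q) x) sequentially"
     proof (cases "\<exists>i. x \<in> F i")
      case True
      then obtain i where i: "x \<in> F i" by auto
      show ?thesis by (rule eventually_mono[OF eventually_gt_at_top[of i]]) (use i in \<open>auto simp: indicator_def\<close>)
     qed (auto simp: indicator_def)
     then show "(\<lambda>j. ennreal ((cmod (complex_of_real (indicator (\<Union> (range F) \<inter> Q) x) -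
     complex_of_real (indicator ((\<Union>i<j. F i) \<inter> Q) x)))\<^sup>2)) \<longlonglongrightarrow> 0"
      by (intro tendsto_eventually, elim eventually_mono) simp
    qed
    show "AE x in lbn n. ennreal ((cmod (complex_of_real (indicator (\<Union> (range F) \<inter> Q) x) -
     complex_of_real (indicator ((\<Union>i<j. F i) \<inter> Q) x)))\<^sup>2) \<le> indicator Q x" for j
     by (rule AE_I2) (auto simp: indicator_def)
    show "(\<integral>\<^sup>+x. indicator Q x \<partial>lbn n) < \<infinity>" using Qfin by simp
   qed auto
   then show "(\<lambda>j. \<integral>\<^sup>+x. ennreal ((cmod (complex_of_real (indicator (\<Union> (range F) \<inter> Q) x) -
     (\<Sum>i<j. complex_of_real (indicator (F i \<inter> Q) x))))\<^sup>2) \<partial>lbn n) \<longlonglongrightarrow> 0"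
    unfolding eq by simp
  qed measurable
 qed
 then show ?thesis unfolding Q_def .
qed

text \<open>The cubes [-j, j]^n exhaust the space, and the finite measure of \<open>A\<close>
  supplies the dominating function.\<close>

lemma gD_indicator:
 assumes [measurable]: "A \<in> sets (lbn n)" and fin: "emeasure (lbn n) A < \<infinity>"
 shows "gD n (\<lambda>x. complex_of_real (indicator A x))"
proof (rule gD_lim[where f = "\<lambda>j x. complex_of_real (indicator (A \<inter> Pi\<^sub>E {..<n} (\<lambda>i. {- real j..real j})) x)"])
 show "gD n (\<lambda>x. complex_of_real (indicator (A \<inter> Pi\<^sub>E {..<n} (\<lambda>i. {- real j..real j})) x))" for j
  by (rule gD_set_Int_box) fact
 have [measurable]: "Pi\<^sub>E {..<n} (\<lambda>i. {- real j..real j}) \<in> sets (lbn n)" for j by (intro sets_PiM_I_finite) auto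
 have "(\<lambda>j. \<integral>\<^sup>+x. ennreal ((cmod (complex_of_real (indicator A x) -
     complex_of_real (indicator (A \<inter> Pi\<^sub>E {..<n} (\<lambda>i. {- real j..real j})) x)))\<^sup>2) \<partial>lbn n) \<longlonglongrightarrow> (\<integral>\<^sup>+x. 0 \<partial>lbn n)"
 proof (rule nn_integral_dominated_convergence[where w = "indicator A"])
  show "AE x in lbn n. (\<lambda>j. ennreal ((cmod (complex_of_real (indicator A x) -
     complex_of_real (indicator (A \<inter> Pi\<^sub>E {..<n} (\<lambda>i. {- real j..real j})) x)))\<^sup>2)) \<longlonglongrightarrow> 0"
  proof (rule AE_I2)
   fix x assume x: "x \<in> space (lbn n)"
   obtain k :: nat where k: "(\<Sum>i<n. \<bar>x i\<bar>) \<le> real k" using real_arch_simple by blast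
   have "x \<in> Pi\<^sub>E {..<n} (\<lambda>i. {- real j..real j})" if "j \<ge> k" for j
   proof -
    have "\<bar>x i\<bar> \<le> real j" if "i < n" for i
    proof -
     have "\<bar>x i\<bar> \<le> (\<Sum>i<n. \<bar>x i\<bar>)" using that by (intro member_le_sum) auto
     with k \<open>j \<ge> k\<close> show ?thesis by (meson of_nat_mono order_trans)
    qed
    then have "\<forall>i<n. x i \<in> {- real j..real j}" by (auto simp: abs_le_iff minus_le_iff)
    with x show ?thesis by (auto simp: space_PiM PiE_def Pi_def)
   qed
   then have "eventually (\<lambda>j. indicat_real (A \<inter> Pi\<^sub>E {..<n} (\<lambda>i. {- real j..real j})) x = indicator A x) sequentially"
    by (intro eventually_mono[OF eventually_ge_at_top[of k]]) (simp add: indicator_def)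
   then show "(\<lambda>j. ennreal ((cmod (complex_of_real (indicator A x) -
     complex_of_real (indicator (A \<inter> Pi\<^sub>E {..<n} (\<lambda>i. {- real j..real j})) x)))\<^sup>2)) \<longlonglongrightarrow> 0"
    by (intro tendsto_eventually, elim eventually_mono) simp
  qed
  show "AE x in lbn n. ennreal ((cmod (complex_of_real (indicator A x) -
     complex_of_real (indicator (A \<inter> Pi\<^sub>E {..<n} (\<lambda>i. {- real j..real j})) x)))\<^sup>2) \<le> indicator A x" for j
   by (rule AE_I2) (simp add: indicator_def)
  show "(\<integral>\<^sup>+x. indicator A x \<partial>lbn n) < \<infinity>" using fin by simp
 qed measurable
 then show "(\<lambda>j. \<integral>\<^sup>+x. ennreal ((cmod (complex_of_real (indicator A x) -
     complex_of_real (indicator (A \<inter> Pi\<^sub>E {..<n} (\<lambda>i. {- real j..real j})) x)))\<^sup>2) \<partial>lbn n) \<longlonglongrightarrow> 0"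
  by simp
qed measurable

text \<open>Induction along the construction of measurable functions from simple ones; the square
  integrability of the limit is inherited by every stage and dominates the monotone limit. The
  functions take values in \<open>ennreal\<close> because the induction rule does.\<close>

lemma gD_nonneg:
 assumes "u \<in> Bor n" "(\<integral>\<^sup>+x. (u x)\<^sup>2 \<partial>lbn n) < \<infinity>"
 shows "gD n (\<lambda>x. complex_of_real (enn2real (u x)))"
 using assms
proof (induction rule: borel_measurable_induct)
 case (cong f g)
 have "(\<integral>\<^sup>+x. (f x)\<^sup>2 \<partial>lbn n) = (\<integral>\<^sup>+x. (g x)\<^sup>2 \<partial>lbn n)"
  by (intro nn_integral_cong) (simp add: cong)
 with cong have "gD n (\<lambda>x. complex_of_real (enn2real (g x)))" by simp
 then show ?case by (rule gD_cong[THEN iffD1, rotated]) (simp add: cong)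
next
 case (set A)
 have "(indicator A x :: ennreal)\<^sup>2 = indicator A x" for x by (simp split: split_indicator)
 with set have "emeasure (lbn n) A < \<infinity>" by simp
 from gD_indicator[OF set(1) this] show ?case
  by (rule gD_cong[THEN iffD1, rotated]) (simp split: split_indicator)
next
 case (mult u c)
 note [measurable] = mult(2)
 show ?case
 proof (cases "c = 0")
  case False
  have "(\<integral>\<^sup>+x. (c * u x)\<^sup>2 \<partial>lbn n) = c\<^sup>2 * (\<integral>\<^sup>+x. (u x)\<^sup>2 \<partial>lbn n)"
   by (simp add: power_mult_distrib nn_integral_cmult)
  with mult.prems False have "(\<integral>\<^sup>+x. (u x)\<^sup>2 \<partial>lbn n) < \<infinity>"
   by (auto simp: ennreal_mult_less_top)
  from gD_cmult[OF mult.IH[OF this], of "complex_of_real (enn2real c)"]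
  show ?thesis by (simp add: enn2real_mult)
 qed (simp add: gD_0)
next
 case (add u v)
 note [measurable] = add(1,4)
 have "(\<integral>\<^sup>+x. (u x)\<^sup>2 \<partial>lbn n) \<le> (\<integral>\<^sup>+x. (v x + u x)\<^sup>2 \<partial>lbn n)"
  "(\<integral>\<^sup>+x. (v x)\<^sup>2 \<partial>lbn n) \<le> (\<integral>\<^sup>+x. (v x + u x)\<^sup>2 \<partial>lbn n)"
  by (auto intro!: nn_integral_mono power_mono)
 with add.prems have "(\<integral>\<^sup>+x. (u x)\<^sup>2 \<partial>lbn n) < \<infinity>" "(\<integral>\<^sup>+x. (v x)\<^sup>2 \<partial>lbn n) < \<infinity>"
  by (auto intro: le_less_trans)
 from gD_add[OF add.IH(2)[OF this(2)] add.IH(1)[OF this(1)]] show ?case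
 proof (rule gD_cong[THEN iffD1, rotated])
  fix x assume "x \<in> space (lbn n)"
  with add show "complex_of_real (enn2real (v x)) + complex_of_real (enn2real (u x)) = complex_of_real (enn2real (v x + u x))"
   by (subst enn2real_plus) auto
 qed
next
 case (seq U)
 note [measurable] = seq(1)
 define v where "v = (SUP i. U i)"
 have v: "v x = (SUP i. U i x)" for x unfolding v_def by (simp add: image_comp)
 have [measurable]: "v \<in> Bor n" unfolding v[abs_def] by measurable
 have le: "U i x \<le> v x" for i x unfolding v by (rule SUP_upper) simp
 have vfin: "(\<integral>\<^sup>+x. (v x)\<^sup>2 \<partial>lbn n) < \<infinity>" using seq.prems unfolding v_def .
 \<comment> \<open>\<open>enn2real\<close> sends infinity to 0, so convergence and domination hold
   only where the limit is finite, which square integrability ensures almost everywhere.\<close>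
 have AEfin: "AE x in lbn n. v x < top"
 proof -
  have "AE x in lbn n. (v x)\<^sup>2 \<noteq> \<infinity>"
   by (rule nn_integral_noteq_infinite) (use vfin in auto)
  then show ?thesis by eventually_elim (auto simp: power_eq_top_ennreal less_top)
 qed
 have "gD n (\<lambda>x. complex_of_real (enn2real (v x)))"
 proof (rule gD_lim[where f = "\<lambda>j x. complex_of_real (enn2real (U j x))"])
  show "gD n (\<lambda>x. complex_of_real (enn2real (U j x)))" for j
  proof (rule seq.IH)
   have "(\<integral>\<^sup>+x. (U j x)\<^sup>2 \<partial>lbn n) \<le> (\<integral>\<^sup>+x. (v x)\<^sup>2 \<partial>lbn n)"
    by (intro nn_integral_mono power_mono le) auto
   with vfin show "(\<integral>\<^sup>+x. (U j x)\<^sup>2 \<partial>lbn n) < \<infinity>" by (rule order.strict_trans1[rotated])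
  qed
  have "(\<lambda>j. \<integral>\<^sup>+x. ennreal ((cmod (complex_of_real (enn2real (v x)) - complex_of_real (enn2real (U j x))))\<^sup>2) \<partial>lbn n)
    \<longlonglongrightarrow> (\<integral>\<^sup>+x. 0 \<partial>lbn n)"
  proof (rule nn_integral_dominated_convergence[where w = "\<lambda>x. (v x)\<^sup>2"])
   show "AE x in lbn n. (\<lambda>j. ennreal ((cmod (complex_of_real (enn2real (v x)) - complex_of_real (enn2real (U j x))))\<^sup>2)) \<longlonglongrightarrow> 0"
    using AEfin
   proof eventually_elim
    case (elim x)
    have "(\<lambda>j. U j x) \<longlonglongrightarrow> v x"
     unfolding v using \<open>incseq U\<close> by (intro LIMSEQ_SUP) (auto simp: incseq_def le_fun_def)
    then have "(\<lambda>j. enn2real (U j x)) \<longlonglongrightarrow> enn2real (v x)"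
     using elim by (intro tendsto_enn2real) (simp_all add: ennreal_enn2real)
    then have "(\<lambda>j. ennreal ((cmod (complex_of_real (enn2real (v x)) - complex_of_real (enn2real (U j x))))\<^sup>2)) \<longlonglongrightarrow>
      ennreal ((cmod (complex_of_real (enn2real (v x)) - complex_of_real (enn2real (v x))))\<^sup>2)"
     by (intro tendsto_ennrealI tendsto_power tendsto_norm tendsto_diff tendsto_const tendsto_of_real)
    then show ?case by simp
   qed
   show "AE x in lbn n. ennreal ((cmod (complex_of_real (enn2real (v x)) - complex_of_real (enn2real (U j x))))\<^sup>2) \<le> (v x)\<^sup>2" for j
    using AEfin
   proof eventually_elim
    case (elim x)
    have "enn2real (U j x) \<le> enn2real (v x)" using elim le[of j x] by (intro enn2real_mono) auto
    then have "cmod (complex_of_real (enn2real (v x)) - complex_of_real (enn2real (U j x))) \<le> enn2real (v x)"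
     by (simp flip: of_real_diff)
    then have "ennreal ((cmod (complex_of_real (enn2real (v x)) - complex_of_real (enn2real (U j x))))\<^sup>2) \<le> ennreal ((enn2real (v x))\<^sup>2)"
     by (intro ennreal_leI power_mono) auto
    also have "\<dots> = (v x)\<^sup>2" using elim by (simp add: ennreal_power[symmetric])
    finally show ?case .
   qed
  qed (use vfin in measurable)
  then show "(\<lambda>j. \<integral>\<^sup>+x. ennreal ((cmod (complex_of_real (enn2real (v x)) - complex_of_real (enn2real (U j x))))\<^sup>2) \<partial>lbn n)
    \<longlonglongrightarrow> 0" by simp
 qed measurable
 then show ?case unfolding v_def .
qed

lemma gD_L2:
 assumes [measurable]: "f \<in> Bor n" and fin: "sq_int (lbn n) (\<lambda>x. cmod (f x)) < \<infinity>"
 shows "gD n f"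
proof -
 have *: "gD n (\<lambda>x. complex_of_real (max 0 (g x)))"
  if [measurable]: "g \<in> Bor n" and g: "\<And>x. \<bar>g x\<bar> \<le> cmod (f x)" for g :: "_ \<Rightarrow> real"
 proof -
  have "(\<integral>\<^sup>+x. (ennreal (max 0 (g x)))\<^sup>2 \<partial>lbn n) \<le> sq_int (lbn n) (\<lambda>x. cmod (f x))"
  proof (intro nn_integral_mono)
   fix x
   have "(max 0 (g x))\<^sup>2 \<le> (cmod (f x))\<^sup>2" using g[of x] by (intro power_mono) auto
   then show "(ennreal (max 0 (g x)))\<^sup>2 \<le> ennreal ((cmod (f x))\<^sup>2)"
    by (subst ennreal_power) (auto intro: ennreal_leI simp del: ennreal_max_0)
  qed
  with fin have "gD n (\<lambda>x. complex_of_real (enn2real (ennreal (max 0 (g x)))))"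
   by (intro gD_nonneg) (auto simp del: ennreal_max_0)
  then show ?thesis by (simp del: ennreal_max_0)
 qed
 have "gD n (\<lambda>x. (complex_of_real (max 0 (Re (f x))) - complex_of_real (max 0 (- Re (f x)))) +
   \<i> * (complex_of_real (max 0 (Im (f x))) - complex_of_real (max 0 (- Im (f x)))))"
  by (intro gD_add gD_cmult gD_diff *) (auto simp: abs_Re_le_cmod abs_Im_le_cmod)
 also have "(\<lambda>x. (complex_of_real (max 0 (Re (f x))) - complex_of_real (max 0 (- Re (f x)))) +
   \<i> * (complex_of_real (max 0 (Im (f x))) - complex_of_real (max 0 (- Im (f x))))) = f"
  by (auto simp: fun_eq_iff complex_eq_iff max_def)
 finally show ?thesis .
qed

section \<open>The Fourier transform and Gaussian damping\<close>

interpretation lbn3: pair_sigma_finite "lbn n \<Otimes>\<^sub>M lbn n" "lbn n" for n ..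

lemma borel_measurable_cnj [measurable (raw)]:
 assumes [measurable]: "f \<in> borel_measurable M"
 shows "(\<lambda>x. cnj (f x)) \<in> borel_measurable M"
proof -
 have "cnj \<in> borel_measurable borel"
  by (intro borel_measurable_continuous_onI continuous_intros)
 then show ?thesis by measurable
qed

lemma tens_measurable [measurable]:
 assumes "\<And>i. i < n \<Longrightarrow> f i \<in> borel_measurable borel"
 shows "tens n f \<in> Bor n"
proof -
 have "(\<lambda>x. f i (x i)) \<in> Bor n" if "i < n" for i
  using that by (intro measurable_compose[OF _ assms[OF that]]) simp
 then show ?thesis unfolding tens_def[abs_def] by measurable
qed

text \<open>The character e^(-i\<eta>.x), written as a tensor so that weights and characters can be
  merged into one tensor test function.\<close>

definition ek :: "nat \<Rightarrow> (nat \<Rightarrow> real) \<Rightarrow> (nat \<Rightarrow> real) \<Rightarrow> complex" where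
 "ek n \<eta> x = tens n (\<lambda>i t. exp (- (\<i> * of_real (\<eta> i)) * of_real t)) x"

lemma norm_ek [simp]: "cmod (ek n \<eta> x) = 1"
 by (simp add: ek_def tens_def prod_norm[symmetric])

lemma ek_measurable [measurable (raw)]:
 assumes f [measurable]: "f \<in> M \<rightarrow>\<^sub>M lbn n" and g [measurable]: "g \<in> M \<rightarrow>\<^sub>M lbn n"
 shows "(\<lambda>z. ek n (f z) (g z)) \<in> borel_measurable M"
proof -
 have [measurable]: "(\<lambda>z. f z i) \<in> borel_measurable M" "(\<lambda>z. g z i) \<in> borel_measurable M" if "i < n" for i
  using measurable_compose[OF f measurable_component_singleton[of i "{..<n}"]] that
   measurable_compose[OF g measurable_component_singleton[of i "{..<n}"]] by auto
 show ?thesis unfolding ek_def tens_def by measurable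
qed

text \<open>Without a normalising factor; Plancherel's identity then carries (2 pi)^n, which cancels
  wherever the transform is applied.\<close>

definition fourier :: "nat \<Rightarrow> ((nat \<Rightarrow> real) \<Rightarrow> complex) \<Rightarrow> (nat \<Rightarrow> real) \<Rightarrow> complex" where
 "fourier n f \<eta> = (\<integral>x. f x * ek n \<eta> x \<partial>lbn n)"

lemma fourier_measurable [measurable]:
 assumes [measurable]: "f \<in> Bor n"
 shows "fourier n f \<in> Bor n"
 unfolding fourier_def by measurable

text \<open>After the substitution of z/\<sigma> for the frequency, the integral is the
  characteristic function of the standard normal distribution at -r/\<sigma>.\<close>

lemma gauss_fourier:
 fixes r :: real
 assumes "\<sigma> > 0"
 shows "integrable lborel (\<lambda>\<eta>. exp (- (\<i> * of_real \<eta>) * of_real r) * of_real (exp (- (\<sigma>\<^sup>2 * \<eta>\<^sup>2) / 2)))" (is "integrable _ ?f")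
  and "(\<integral>\<eta>. exp (- (\<i> * of_real \<eta>) * of_real r) * of_real (exp (- (\<sigma>\<^sup>2 * \<eta>\<^sup>2) / 2)) \<partial>lborel) = of_real (2 * pi * normal_density 0 \<sigma> r)"
proof -
 have eq: "?f (0 + (1/\<sigma>) * z) = of_real (sqrt (2 * pi)) * (std_normal_density z *\<^sub>R iexp ((- r / \<sigma>) * z))" for z
  using assms
  by (simp add: std_normal_density_def scaleR_conv_of_real field_simps power_divide)
 have int: "integrable lborel (\<lambda>z. std_normal_density z *\<^sub>R iexp ((- r / \<sigma>) * z))"
  by (rule Bochner_Integration.integrable_bound[OF integrable_normal_density[of 1 0]]) (auto simp: norm_mult)
 have "integrable lborel (\<lambda>z. ?f (0 + (1/\<sigma>) * z))"
  unfolding eq by (intro integrable_mult_right int)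
 then show "integrable lborel ?f"
  using assms by (subst (asm) lborel_integrable_real_affine_iff) auto
 have "integral\<^sup>L lborel ?f = \<bar>1/\<sigma>\<bar> *\<^sub>R (\<integral>z. ?f (0 + (1/\<sigma>) * z) \<partial>lborel)"
  by (rule lborel_integral_real_affine) (use assms in auto)
 also have "(\<integral>z. ?f (0 + (1/\<sigma>) * z) \<partial>lborel) =
   of_real (sqrt (2 * pi)) * (\<integral>z. std_normal_density z *\<^sub>R iexp ((- r / \<sigma>) * z) \<partial>lborel)"
  unfolding eq by (rule integral_mult_right_zero)
 also have "(\<integral>z. std_normal_density z *\<^sub>R iexp ((- r / \<sigma>) * z) \<partial>lborel) = char std_normal_distribution (- r / \<sigma>)"
  unfolding char_def by (subst integral_density) auto
 also have "\<bar>1/\<sigma>\<bar> *\<^sub>R (complex_of_real (sqrt (2 * pi)) * char std_normal_distribution (- r / \<sigma>)) = of_real (2 * pi * normal_density 0 \<sigma> r)"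
 proof -
  have "2 * pi / (sqrt 2 * (sqrt pi * \<sigma>)) = sqrt 2 * sqrt pi / \<sigma>"
   using assms by (simp add: field_simps)
  then have "\<bar>1/\<sigma>\<bar> * (sqrt (2 * pi) * exp (- ((- r / \<sigma>)\<^sup>2) / 2)) = 2 * pi * normal_density 0 \<sigma> r"
   using assms by (simp add: normal_density_def real_sqrt_mult power_divide field_simps)
  then have "complex_of_real (\<bar>1/\<sigma>\<bar> * (sqrt (2 * pi) * exp (- ((- r / \<sigma>)\<^sup>2) / 2))) =
    complex_of_real (2 * pi * normal_density 0 \<sigma> r)" by (rule arg_cong)
  then show ?thesis
   by (simp add: char_std_normal_distribution scaleR_conv_of_real)
 qed
 finally show "integral\<^sup>L lborel ?f = of_real (2 * pi * normal_density 0 \<sigma> r)" .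
qed

definition gE :: "nat \<Rightarrow> real \<Rightarrow> (nat \<Rightarrow> real) \<Rightarrow> real" where
 "gE n \<sigma> \<eta> = (\<Prod>i<n. exp (- (\<sigma>\<^sup>2 * (\<eta> i)\<^sup>2) / 2))"

lemma gE_measurable [measurable]: "gE n \<sigma> \<in> Bor n"
 unfolding gE_def by measurable

lemma gE_pos: "gE n \<sigma> \<eta> > 0" unfolding gE_def by (intro prod_pos) auto

lemma integrable_gE: "\<sigma> > 0 \<Longrightarrow> integrable (lbn n) (gE n \<sigma>)"
 unfolding gE_def
proof (rule lbp.product_integrable_prod)
 fix i assume "\<sigma> > 0"
 from integrable_norm[OF gauss_fourier(1)[OF this, of 0]]
 show "integrable lborel (\<lambda>x. exp (- (\<sigma>\<^sup>2 * x\<^sup>2) / 2))" by simp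
qed simp

lemma gE_integral:
 assumes "\<sigma> > 0"
 shows "(\<integral>\<eta>. ek n \<eta> x * cnj (ek n \<eta> y) * of_real (gE n \<sigma> \<eta>) \<partial>lbn n) = of_real ((2 * pi) ^ n * gk n \<sigma> x y)"
proof -
 have "ek n \<eta> x * cnj (ek n \<eta> y) * of_real (gE n \<sigma> \<eta>) =
  (\<Prod>i<n. exp (- (\<i> * of_real (\<eta> i)) * of_real (x i - y i)) * of_real (exp (- (\<sigma>\<^sup>2 * (\<eta> i)\<^sup>2) / 2)))" for \<eta>
  unfolding ek_def tens_def gE_def cnj_prod of_real_prod prod.distrib[symmetric]
  by (intro prod.cong refl arg_cong2[where f = "(*)"]) (simp add: exp_cnj exp_add[symmetric] algebra_simps)
 then have "(\<integral>\<eta>. ek n \<eta> x * cnj (ek n \<eta> y) * of_real (gE n \<sigma> \<eta>) \<partial>lbn n) =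
  (\<Prod>i<n. \<integral>\<eta>. exp (- (\<i> * of_real \<eta>) * of_real (x i - y i)) * of_real (exp (- (\<sigma>\<^sup>2 * \<eta>\<^sup>2) / 2)) \<partial>lborel)"
  by (subst lbp.product_integral_prod[symmetric])
   (use gauss_fourier(1)[OF assms] in \<open>simp_all del: of_real_diff\<close>)
 also have "\<dots> = (\<Prod>i<n. of_real (2 * pi * normal_density 0 \<sigma> (x i - y i)))"
  by (intro prod.cong refl gauss_fourier(2)[OF assms])
 also have "\<dots> = of_real ((2 * pi) ^ n * gk n \<sigma> x y)"
 proof -
  have "normal_density 0 \<sigma> (x i - y i) = normal_density (x i) \<sigma> (y i)" for i
   by (simp add: normal_density_def power2_commute)
  then show ?thesis
   by (simp only: of_real_prod[symmetric] prod.distrib[of "\<lambda>_. 2 * pi"] prod_constant card_lessThan gk_def)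
 qed
 finally show ?thesis .
qed

lemma integrable_pair_mult:
 fixes f g :: "_ \<Rightarrow> complex"
 assumes "integrable (lbn n) f" "integrable (lbn n) g"
 shows "integrable (lbn n \<Otimes>\<^sub>M lbn n) (\<lambda>(x, y). f x * g y)"
proof (rule lbn2.Fubini_integrable)
 have [measurable]: "f \<in> Bor n" "g \<in> Bor n" using assms by auto
 show "(\<lambda>(x, y). f x * g y) \<in> borel_measurable (lbn n \<Otimes>\<^sub>M lbn n)" by measurable
 show "integrable (lbn n) (\<lambda>x. \<integral>y. norm (case (x, y) of (x, y) \<Rightarrow> f x * g y) \<partial>lbn n)"
  using assms by (simp add: norm_mult)
 show "AE x in lbn n. integrable (lbn n) (\<lambda>y. case (x, y) of (x, y) \<Rightarrow> f x * g y)"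
  using assms by simp
qed

text \<open>|f^|^2 is a double integral over x and y; integrating the Gaussian over the frequencies
  first leaves Re (f(x) cnj f(y)) against the kernel. The polarisation 2 Re (a cnj b) = |a|^2 +
  |b|^2 - |a - b|^2 splits this into two copies of the squared norm and the defect
  \<open>gI\<close>. The result is an identity for every \<sigma> > 0, not an asymptotic
  statement.\<close>

lemma regularised_plancherel:
 assumes f: "integrable (lbn n) f" and fin: "sq_int (lbn n) (\<lambda>x. cmod (f x)) < \<infinity>" and s: "\<sigma> > 0"
 shows "2 * (\<integral>\<^sup>+\<eta>. ennreal ((cmod (fourier n f \<eta>))\<^sup>2 * gE n \<sigma> \<eta>) \<partial>lbn n) + ennreal ((2 * pi) ^ n) * gI n \<sigma> f
   = 2 * ennreal ((2 * pi) ^ n) * sq_int (lbn n) (\<lambda>x. cmod (f x))"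
proof -
 have [measurable]: "f \<in> Bor n" using f by auto
 let ?P = "lbn n \<Otimes>\<^sub>M lbn n"
 define N where "N = sq_int (lbn n) (\<lambda>x. cmod (f x))"
 have ff: "integrable ?P (\<lambda>(x, y). f x * cnj (f y))"
  using f by (intro integrable_pair_mult) auto
 have fe: "integrable (lbn n) (\<lambda>x. f x * ek n \<eta> x)" if "\<eta> \<in> space (lbn n)" for \<eta>
  by (rule Bochner_Integration.integrable_bound[OF f]) (use that in \<open>auto simp: norm_mult\<close>)
 have sq: "of_real ((cmod (fourier n f \<eta>))\<^sup>2) = (\<integral>p. (case p of (x, y) \<Rightarrow> f x * cnj (f y) * (ek n \<eta> x * cnj (ek n \<eta> y))) \<partial>?P)"
  if "\<eta> \<in> space (lbn n)" for \<eta>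
 proof -
  have i: "integrable ?P (\<lambda>(x, y). (f x * ek n \<eta> x) * cnj (f y * ek n \<eta> y))"
   using fe[OF that] by (intro integrable_pair_mult) (auto simp del: complex_cnj_mult)
  have "of_real ((cmod (fourier n f \<eta>))\<^sup>2) = fourier n f \<eta> * cnj (fourier n f \<eta>)"
   by (simp add: complex_norm_square[symmetric] flip: of_real_power)
  also have "\<dots> = (\<integral>x. \<integral>y. (f x * ek n \<eta> x) * cnj (f y * ek n \<eta> y) \<partial>lbn n \<partial>lbn n)"
   unfolding fourier_def by (simp del: complex_cnj_mult)
  also have "\<dots> = (\<integral>p. (case p of (x, y) \<Rightarrow> (f x * ek n \<eta> x) * cnj (f y * ek n \<eta> y)) \<partial>?P)"
   using lbn2.integral_fst'[OF i] by simp
  finally show ?thesis by (simp add: mult_ac)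
 qed
 define h where "h = (\<lambda>p \<eta>. (case p of (x, y) \<Rightarrow> f x * cnj (f y) * (ek n \<eta> x * cnj (ek n \<eta> y) * of_real (gE n \<sigma> \<eta>))))"
 have hm: "case_prod h \<in> borel_measurable (?P \<Otimes>\<^sub>M lbn n)" unfolding h_def by measurable
 have nh: "cmod (h p \<eta>) = cmod (f (fst p) * cnj (f (snd p))) * gE n \<sigma> \<eta>" for p \<eta>
  using less_imp_le[OF gE_pos[of n \<sigma> \<eta>]] by (simp add: h_def norm_mult split: prod.split)
 \<comment> \<open>The damping factor makes the triple integral absolutely convergent, since
   \<open>f\<close> is integrable in x and in y and the Gaussian in the frequency. This is the
   reason for damping at all.\<close>
 have hi: "integrable (?P \<Otimes>\<^sub>M lbn n) (case_prod h)"
 proof (rule lbn3.Fubini_integrable[OF hm])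
  show "integrable ?P (\<lambda>p. \<integral>\<eta>. norm (case (p, \<eta>) of (p, \<eta>) \<Rightarrow> h p \<eta>) \<partial>lbn n)"
   using integrable_norm[OF ff] by (simp add: nh split_beta)
  show "AE p in ?P. integrable (lbn n) (\<lambda>\<eta>. case (p, \<eta>) of (p, \<eta>) \<Rightarrow> h p \<eta>)"
  proof (rule AE_I2)
   fix p assume p: "p \<in> space ?P"
   have "integrable (lbn n) (\<lambda>\<eta>. cmod (f (fst p) * cnj (f (snd p))) * gE n \<sigma> \<eta>)"
    using integrable_gE[OF s] by simp
   then show "integrable (lbn n) (\<lambda>\<eta>. case (p, \<eta>) of (p, \<eta>) \<Rightarrow> h p \<eta>)"
    by (rule Bochner_Integration.integrable_bound)
     (use p hm in \<open>auto simp: nh gE_pos less_imp_le abs_mult intro: measurable_Pair2\<close>)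
  qed
 qed
 have inner: "(\<integral>\<eta>. h p \<eta> \<partial>lbn n) = (case p of (x, y) \<Rightarrow> f x * cnj (f y) * of_real ((2 * pi) ^ n * gk n \<sigma> x y))" for p
  unfolding h_def using gE_integral[OF s] by (simp split: prod.split)
 have outer: "(\<integral>p. h p \<eta> \<partial>?P) = of_real ((cmod (fourier n f \<eta>))\<^sup>2 * gE n \<sigma> \<eta>)" if "\<eta> \<in> space (lbn n)" for \<eta>
 proof -
  have "(\<integral>p. h p \<eta> \<partial>?P) = (\<integral>p. (case p of (x, y) \<Rightarrow> f x * cnj (f y) * (ek n \<eta> x * cnj (ek n \<eta> y))) * of_real (gE n \<sigma> \<eta>) \<partial>?P)"
   by (intro Bochner_Integration.integral_cong refl) (simp add: h_def mult_ac split: prod.split)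
  also have "\<dots> = (\<integral>p. (case p of (x, y) \<Rightarrow> f x * cnj (f y) * (ek n \<eta> x * cnj (ek n \<eta> y))) \<partial>?P) * of_real (gE n \<sigma> \<eta>)"
   by (rule integral_mult_left_zero)
  finally show ?thesis by (simp add: sq[OF that, symmetric])
 qed
 have fubini: "(\<integral>\<eta>. of_real ((cmod (fourier n f \<eta>))\<^sup>2 * gE n \<sigma> \<eta>) \<partial>lbn n) =
   (\<integral>p. (case p of (x, y) \<Rightarrow> f x * cnj (f y) * of_real ((2 * pi) ^ n * gk n \<sigma> x y)) \<partial>?P)"
  using lbn3.Fubini_integral[OF hi] by (simp add: inner outer cong: Bochner_Integration.integral_cong)
 have i1: "integrable (lbn n) (\<lambda>\<eta>. (cmod (fourier n f \<eta>))\<^sup>2 * gE n \<sigma> \<eta>)"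
 proof -
  have "integrable (lbn n) (\<lambda>\<eta>. \<integral>p. h p \<eta> \<partial>?P)"
   using lbn3.integrable_snd[OF hi] by simp
  then have "integrable (lbn n) (\<lambda>\<eta>. complex_of_real ((cmod (fourier n f \<eta>))\<^sup>2 * gE n \<sigma> \<eta>))"
   by (simp add: outer cong: Bochner_Integration.integrable_cong)
  then show ?thesis using integrable_Re by fastforce
 qed
 have i2: "integrable ?P (\<lambda>p. case p of (x, y) \<Rightarrow> f x * cnj (f y) * of_real ((2 * pi) ^ n * gk n \<sigma> x y))"
  using lbn3.integrable_fst'[OF hi] by (simp add: inner)
 define I1 where "I1 = (\<integral>\<eta>. (cmod (fourier n f \<eta>))\<^sup>2 * gE n \<sigma> \<eta> \<partial>lbn n)"
 have I1: "I1 = (\<integral>p. (case p of (x, y) \<Rightarrow> Re (f x * cnj (f y)) * ((2 * pi) ^ n * gk n \<sigma> x y)) \<partial>?P)"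
 proof -
  have "I1 = Re (of_real I1)" by simp
  also have "of_real I1 = (\<integral>p. (case p of (x, y) \<Rightarrow> f x * cnj (f y) * of_real ((2 * pi) ^ n * gk n \<sigma> x y)) \<partial>?P)"
   unfolding I1_def fubini[symmetric] by (rule integral_complex_of_real[symmetric])
  also have "Re \<dots> = (\<integral>p. Re (case p of (x, y) \<Rightarrow> f x * cnj (f y) * of_real ((2 * pi) ^ n * gk n \<sigma> x y)) \<partial>?P)"
   by (rule integral_Re[OF i2, symmetric])
  finally show ?thesis by (simp add: split_beta)
 qed
 have nn: "(\<integral>\<^sup>+\<eta>. ennreal ((cmod (fourier n f \<eta>))\<^sup>2 * gE n \<sigma> \<eta>) \<partial>lbn n) = ennreal I1"
  unfolding I1_def by (intro nn_integral_eq_integral i1) (auto simp: gE_pos less_imp_le)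
 let ?c = "(2 * pi) ^ n :: real"
 have a1: "(\<integral>\<^sup>+p. ennreal (case p of (x, y) \<Rightarrow> (cmod (f x))\<^sup>2 * (?c * gk n \<sigma> x y)) \<partial>?P) = ?c * N"
 proof -
  have "(\<integral>\<^sup>+p. ennreal (case p of (x, y) \<Rightarrow> (cmod (f x))\<^sup>2 * (?c * gk n \<sigma> x y)) \<partial>?P) =
   (\<integral>\<^sup>+x. \<integral>\<^sup>+y. ennreal ?c * ennreal ((cmod (f x))\<^sup>2 * gk n \<sigma> x y) \<partial>lbn n \<partial>lbn n)"
   by (subst lbn.nn_integral_fst[symmetric]) (auto simp: ennreal_mult[symmetric] mult_ac)
  also have "\<dots> = ?c * N" unfolding N_def gI_fst[OF \<open>f \<in> _\<close> s, symmetric]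
   by (simp add: nn_integral_cmult cong: nn_integral_cong_simp)
  finally show ?thesis .
 qed
 have a2: "(\<integral>\<^sup>+p. ennreal (case p of (x, y) \<Rightarrow> (cmod (f y))\<^sup>2 * (?c * gk n \<sigma> x y)) \<partial>?P) = ?c * N"
 proof -
  have "(\<integral>\<^sup>+p. ennreal (case p of (x, y) \<Rightarrow> (cmod (f y))\<^sup>2 * (?c * gk n \<sigma> x y)) \<partial>?P) =
   (\<integral>\<^sup>+x. \<integral>\<^sup>+y. ennreal ?c * ennreal ((cmod (f y))\<^sup>2 * gk n \<sigma> x y) \<partial>lbn n \<partial>lbn n)"
   by (subst lbn.nn_integral_fst[symmetric]) (auto simp: ennreal_mult[symmetric] mult_ac)
  also have "\<dots> = ?c * N" unfolding N_def gI_snd[OF \<open>f \<in> _\<close> s, symmetric]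
   by (simp add: nn_integral_cmult cong: nn_integral_cong_simp)
  finally show ?thesis .
 qed
 have a3: "(\<integral>\<^sup>+p. ennreal (case p of (x, y) \<Rightarrow> (cmod (f x - f y))\<^sup>2 * (?c * gk n \<sigma> x y)) \<partial>?P) = ?c * gI n \<sigma> f"
 proof -
  have "(\<integral>\<^sup>+p. ennreal (case p of (x, y) \<Rightarrow> (cmod (f x - f y))\<^sup>2 * (?c * gk n \<sigma> x y)) \<partial>?P) =
   (\<integral>\<^sup>+x. \<integral>\<^sup>+y. ennreal ?c * ennreal ((cmod (f x - f y))\<^sup>2 * gk n \<sigma> x y) \<partial>lbn n \<partial>lbn n)"
   by (subst lbn.nn_integral_fst[symmetric]) (auto simp: ennreal_mult[symmetric] mult_ac)
  also have "\<dots> = ?c * gI n \<sigma> f" unfolding gI_def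
   by (simp add: nn_integral_cmult cong: nn_integral_cong_simp)
  finally show ?thesis .
 qed
 have "gI n \<sigma> f \<le> 4 * N" unfolding N_def by (rule gI_bound) (use s in auto)
 with fin have gfin: "gI n \<sigma> f < \<infinity>" unfolding N_def by (auto simp: ennreal_mult_less_top intro: le_less_trans)
 obtain N' where N': "N = ennreal N'" "N' \<ge> 0" using fin unfolding N_def[symmetric] by (cases N) auto
 obtain g' where g': "gI n \<sigma> f = ennreal g'" "g' \<ge> 0" using gfin by (cases "gI n \<sigma> f") auto
 have b1: "has_bochner_integral ?P (\<lambda>p. case p of (x, y) \<Rightarrow> (cmod (f x))\<^sup>2 * (?c * gk n \<sigma> x y)) (?c * N')"
  by (rule has_bochner_integral_nn_integral) (use a1 N' in \<open>auto simp: ennreal_mult\<close>)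
 have b2: "has_bochner_integral ?P (\<lambda>p. case p of (x, y) \<Rightarrow> (cmod (f y))\<^sup>2 * (?c * gk n \<sigma> x y)) (?c * N')"
  by (rule has_bochner_integral_nn_integral) (use a2 N' in \<open>auto simp: ennreal_mult\<close>)
 have b3: "has_bochner_integral ?P (\<lambda>p. case p of (x, y) \<Rightarrow> (cmod (f x - f y))\<^sup>2 * (?c * gk n \<sigma> x y)) (?c * g')"
  by (rule has_bochner_integral_nn_integral) (use a3 g' in \<open>auto simp: ennreal_mult\<close>)
 have re: "Re (a * cnj b) = ((cmod a)\<^sup>2 + (cmod b)\<^sup>2 - (cmod (a - b))\<^sup>2) / 2" for a b
  unfolding cmod_power2 by (simp add: power2_eq_square algebra_simps)
 have pw: "Re (a * cnj b) * k = ((cmod a)\<^sup>2 * k + (cmod b)\<^sup>2 * k - (cmod (a - b))\<^sup>2 * k) / 2" for a b k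
  unfolding re by (simp add: algebra_simps)
 have "has_bochner_integral ?P (\<lambda>p. case p of (x, y) \<Rightarrow> Re (f x * cnj (f y)) * (?c * gk n \<sigma> x y))
   ((?c * N' + ?c * N' - ?c * g') / 2)"
  using has_bochner_integral_divide_zero[OF has_bochner_integral_diff[OF has_bochner_integral_add[OF b1 b2] b3], of 2]
  unfolding pw by (simp add: split_beta)
 then have "I1 = (?c * N' + ?c * N' - ?c * g') / 2"
  unfolding I1 by (rule has_bochner_integral_integral_eq)
 then have e: "2 * I1 + ?c * g' = 2 * ?c * N'" by (simp add: field_simps)
 have "I1 \<ge> 0" unfolding I1_def by (intro Bochner_Integration.integral_nonneg) (auto simp: gE_pos less_imp_le)
 then show ?thesis
  using e g'(2) N'(2)
  by (simp add: nn N_def[symmetric] N'(1) g'(1) ennreal_plus[symmetric] ennreal_mult[symmetric] ennreal_numeral[symmetric]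
    del: ennreal_plus ennreal_numeral)
qed

text \<open>As \<sigma> decreases to 0 the damping factor increases to 1, so the frequency integral
  converges monotonically, while the defect tends to 0 by \<open>gD_L2\<close>. The transform is a
  plain integral, hence integrability next to square integrability.\<close>

theorem plancherel:
 assumes f: "integrable (lbn n) f" and fin: "sq_int (lbn n) (\<lambda>x. cmod (f x)) < \<infinity>"
 shows "sq_int (lbn n) (\<lambda>\<eta>. cmod (fourier n f \<eta>)) =
   ennreal ((2 * pi) ^ n) * sq_int (lbn n) (\<lambda>x. cmod (f x))"
proof -
 have [measurable]: "f \<in> Bor n" using f by auto
 let ?A = "\<lambda>k. \<integral>\<^sup>+\<eta>. ennreal ((cmod (fourier n f \<eta>))\<^sup>2 * gE n (1 / real (Suc k)) \<eta>) \<partial>lbn n"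
 let ?L = "\<integral>\<^sup>+\<eta>. ennreal ((cmod (fourier n f \<eta>))\<^sup>2) \<partial>lbn n"
 let ?c = "ennreal ((2 * pi) ^ n)"
 have "?A \<longlonglongrightarrow> ?L"
 proof (rule nn_integral_LIMSEQ)
  have mono: "gE n (1 / real (Suc k)) \<eta> \<le> gE n (1 / real (Suc l)) \<eta>" if "k \<le> l" for k l \<eta>
  proof -
   have "(1 / real (Suc l))\<^sup>2 \<le> (1 / real (Suc k))\<^sup>2" using that by (intro power_mono) (auto simp: field_simps)
   then have "(1 / real (Suc l))\<^sup>2 * (\<eta> i)\<^sup>2 \<le> (1 / real (Suc k))\<^sup>2 * (\<eta> i)\<^sup>2" for i by (rule mult_right_mono) auto
   then show ?thesis unfolding gE_def by (intro prod_mono) auto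
  qed
  show "incseq (\<lambda>k \<eta>. ennreal ((cmod (fourier n f \<eta>))\<^sup>2 * gE n (1 / real (Suc k)) \<eta>))"
   by (intro monoI le_funI ennreal_leI mult_left_mono mono) auto
  show "(\<lambda>k. ennreal ((cmod (fourier n f \<eta>))\<^sup>2 * gE n (1 / real (Suc k)) \<eta>)) \<longlonglongrightarrow> ennreal ((cmod (fourier n f \<eta>))\<^sup>2)" for \<eta>
  proof -
   have s: "(\<lambda>k. 1 / real (Suc k)) \<longlonglongrightarrow> 0" by real_asymp
   have "(\<lambda>k. ennreal ((cmod (fourier n f \<eta>))\<^sup>2 * gE n (1 / real (Suc k)) \<eta>)) \<longlonglongrightarrow>
     ennreal ((cmod (fourier n f \<eta>))\<^sup>2 * (\<Prod>i<n. exp (- (0\<^sup>2 * (\<eta> i)\<^sup>2) / 2)))"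
    unfolding gE_def by (intro tendsto_intros s) auto
   then show ?thesis by simp
  qed
 qed measurable
 then have "(\<lambda>k. 2 * ?A k + ?c * gI n (1 / real (Suc k)) f) \<longlonglongrightarrow> 2 * ?L + ?c * 0"
  using gD_L2[OF _ fin] unfolding gD_def
  by (intro tendsto_add ennreal_tendsto_cmult) auto
 moreover have "2 * ?A k + ?c * gI n (1 / real (Suc k)) f = 2 * ?c * sq_int (lbn n) (\<lambda>x. cmod (f x))" for k
  by (rule regularised_plancherel[OF f fin]) simp
 ultimately have "2 * ?L = 2 * ?c * sq_int (lbn n) (\<lambda>x. cmod (f x))"
  by (simp add: LIMSEQ_const_iff)
 then show ?thesis by (simp add: mult.assoc ennreal_mult_cancel_left)
qed

subsection \<open>Logarithmic convexity for families of scalar equations\<close>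

text \<open>Minkowski's inequality on the disjoint union of copies of \<open>M\<close> indexed by
  \<open>J\<close>. Young's inequality with parameter e = q/p gives exactly (p + q)^2 for norms p
  and q. The bounds are first enlarged by d > 0, because the quotient makes no sense when
  \<open>a\<close> vanishes.\<close>

lemma nn_L2_triangle:
 fixes f g :: "'j \<Rightarrow> 'z \<Rightarrow> real"
 assumes [measurable]: "\<And>j. j \<in> J \<Longrightarrow> f j \<in> borel_measurable M" "\<And>j. j \<in> J \<Longrightarrow> g j \<in> borel_measurable M"
  and f: "(\<Sum>j\<in>J. \<integral>\<^sup>+z. ennreal ((f j z)\<^sup>2) \<partial>M) \<le> ennreal (a\<^sup>2)"
  and g: "(\<Sum>j\<in>J. \<integral>\<^sup>+z. ennreal ((g j z)\<^sup>2) \<partial>M) \<le> ennreal (b\<^sup>2)"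
  and ab: "a \<ge> 0" "b \<ge> 0"
 shows "(\<Sum>j\<in>J. \<integral>\<^sup>+z. ennreal ((f j z + g j z)\<^sup>2) \<partial>M) \<le> ennreal ((a + b)\<^sup>2)"
proof -
 have *: "(\<Sum>j\<in>J. \<integral>\<^sup>+z. ennreal ((f j z + g j z)\<^sup>2) \<partial>M) \<le> ennreal ((1 + e) * x\<^sup>2 + (1 + 1/e) * y\<^sup>2)"
  if e: "e > 0" and x: "a \<le> x" and y: "b \<le> y" for e x y
 proof -
  have pw: "(p + q)\<^sup>2 \<le> (1 + e) * p\<^sup>2 + (1 + 1/e) * q\<^sup>2" for p q :: real
  proof -
   have "0 \<le> (e * p - q)\<^sup>2 / e" using e by simp
   also have "\<dots> = e * p\<^sup>2 - 2 * p * q + q\<^sup>2 / e"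
    using e by (simp add: power2_eq_square field_simps)
   finally show ?thesis by (simp add: power2_eq_square algebra_simps)
  qed
  have "(\<Sum>j\<in>J. \<integral>\<^sup>+z. ennreal ((f j z + g j z)\<^sup>2) \<partial>M) \<le>
   (\<Sum>j\<in>J. \<integral>\<^sup>+z. ennreal (1 + e) * ennreal ((f j z)\<^sup>2) + ennreal (1 + 1/e) * ennreal ((g j z)\<^sup>2) \<partial>M)"
   using e pw by (intro sum_mono nn_integral_mono)
    (auto simp: ennreal_mult[symmetric] ennreal_plus[symmetric] simp del: ennreal_plus intro!: ennreal_leI)
  also have "\<dots> = (\<Sum>j\<in>J. ennreal (1 + e) * sq_int M (\<lambda>z. f j z) + ennreal (1 + 1/e) * sq_int M (\<lambda>z. g j z))"
   by (intro sum.cong refl) (subst nn_integral_add, auto simp: nn_integral_cmult)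
  also have "\<dots> = ennreal (1 + e) * (\<Sum>j\<in>J. \<integral>\<^sup>+z. ennreal ((f j z)\<^sup>2) \<partial>M) + ennreal (1 + 1/e) * (\<Sum>j\<in>J. \<integral>\<^sup>+z. ennreal ((g j z)\<^sup>2) \<partial>M)"
   by (simp add: sum.distrib sum_distrib_left)
  also have "\<dots> \<le> ennreal (1 + e) * ennreal (x\<^sup>2) + ennreal (1 + 1/e) * ennreal (y\<^sup>2)"
   using x y ab by (intro add_mono mult_left_mono order_trans[OF f] order_trans[OF g] ennreal_leI power_mono) auto
  also have "\<dots> = ennreal ((1 + e) * x\<^sup>2 + (1 + 1/e) * y\<^sup>2)"
   using e by (simp add: ennreal_mult[symmetric] ennreal_plus[symmetric] del: ennreal_plus)
  finally show ?thesis .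
 qed
 have lim: "((\<lambda>d. ennreal ((a + d + (b + d))\<^sup>2)) \<longlongrightarrow> ennreal ((a + 0 + (b + 0))\<^sup>2)) (at_right 0)"
  by (intro tendsto_intros)
 have "(\<Sum>j\<in>J. \<integral>\<^sup>+z. ennreal ((f j z + g j z)\<^sup>2) \<partial>M) \<le> ennreal ((a + d + (b + d))\<^sup>2)" if d: "d > 0" for d
 proof -
  have "a + d > 0" "b + d > 0" using ab d by auto
  moreover have "(1 + q / p) * p\<^sup>2 + (1 + 1 / (q / p)) * q\<^sup>2 = (p + q)\<^sup>2" if "p > 0" "q > 0" for p q :: real
   using that by (simp add: power2_eq_square field_simps)
  ultimately have "(1 + (b + d) / (a + d)) * (a + d)\<^sup>2 + (1 + 1 / ((b + d) / (a + d))) * (b + d)\<^sup>2 = (a + d + (b + d))\<^sup>2"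
   by blast
  moreover have "(\<Sum>j\<in>J. \<integral>\<^sup>+z. ennreal ((f j z + g j z)\<^sup>2) \<partial>M) \<le>
    ennreal ((1 + (b + d) / (a + d)) * (a + d)\<^sup>2 + (1 + 1 / ((b + d) / (a + d))) * (b + d)\<^sup>2)"
   by (rule *) (use \<open>a + d > 0\<close> \<open>b + d > 0\<close> d in auto)
  ultimately show ?thesis by (simp only:)
 qed
 then have "(\<Sum>j\<in>J. \<integral>\<^sup>+z. ennreal ((f j z + g j z)\<^sup>2) \<partial>M) \<le> ennreal ((a + 0 + (b + 0))\<^sup>2)"
  by (intro tendsto_lowerbound[OF lim]) (simp_all add: eventually_at_filter)
 then show ?thesis by simp
qed

lemma cauchy_schwarz_interval:
 fixes g :: "real \<Rightarrow> real"
 assumes [measurable]: "g \<in> borel_measurable borel" and "t0 \<le> t1"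
 shows "(\<integral>\<^sup>+s. ennreal (indicator {t0..t1} s * \<bar>g s\<bar>) \<partial>lborel)\<^sup>2 \<le>
  ennreal (t1 - t0) * (\<integral>\<^sup>+s. ennreal (indicator {t0..t1} s * (g s)\<^sup>2) \<partial>lborel)"
proof -
 have "(\<integral>\<^sup>+s. ennreal (indicator {t0..t1} s * \<bar>g s\<bar>) \<partial>lborel) =
   (\<integral>\<^sup>+s. indicator {t0..t1} s * ennreal (indicator {t0..t1} s * \<bar>g s\<bar>) \<partial>lborel)"
  by (intro nn_integral_cong) (simp split: split_indicator)
 also have "\<dots>\<^sup>2 \<le> (\<integral>\<^sup>+s. (indicator {t0..t1} s)\<^sup>2 \<partial>lborel) * (\<integral>\<^sup>+s. (ennreal (indicator {t0..t1} s * \<bar>g s\<bar>))\<^sup>2 \<partial>lborel)"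
  by (rule Cauchy_Schwarz_nn_integral) auto
 also have "(\<integral>\<^sup>+s. (indicator {t0..t1} s :: ennreal)\<^sup>2 \<partial>lborel) = (\<integral>\<^sup>+s. indicator {t0..t1} s \<partial>lborel)"
  by (intro nn_integral_cong) (simp split: split_indicator)
 also have "\<dots> = ennreal (t1 - t0)" using assms by simp
 also have "(\<integral>\<^sup>+s. (ennreal (indicator {t0..t1} s * \<bar>g s\<bar>))\<^sup>2 \<partial>lborel) = (\<integral>\<^sup>+s. ennreal (indicator {t0..t1} s * (g s)\<^sup>2) \<partial>lborel)"
  by (intro nn_integral_cong) (simp add: ennreal_power split: split_indicator)
 finally show ?thesis .
qed

lemma exp_convex_bound:
 fixes x :: real
 assumes "0 \<le> \<tau>" "\<tau> \<le> 1"
 shows "exp (\<tau> * x) \<le> (1 - \<tau>) + \<tau> * exp x"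
 using convex_onD[OF exp_convex, of \<tau> 0 x] assms by (simp add: algebra_simps)

text \<open>If \<open>Re m \<le> l\<close> the equation is solved forwards from \<open>t0\<close>, otherwise backwards from \<open>t1\<close>, so that
 the propagators are contractions in both cases.\<close>

lemma log_convex_pointwise:
 fixes h g :: "real \<Rightarrow> complex"
 assumes t: "t0 \<le> t" "t \<le> t1" "t0 < t1"
  and [measurable]: "g \<in> borel_measurable borel"
  and eq: "\<And>s0 s1. t0 \<le> s0 \<Longrightarrow> s0 \<le> s1 \<Longrightarrow> s1 \<le> t1 \<Longrightarrow>
   exp (- m * of_real s1) * h s1 - exp (- m * of_real s0) * h s0 =
   (int_on s0 s1 (\<lambda>s. exp (- m * of_real s) * g s))"
  and k: "(\<integral>\<^sup>+s. ennreal (indicator {t0..t1} s * (exp (- l * s) * cmod (g s))) \<partial>lborel) \<le> ennreal k" "k \<ge> 0"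
  and \<tau>: "\<tau> = (t - t0) / (t1 - t0)"
 defines "y \<equiv> \<lambda>s. exp (- l * s) * cmod (h s)"
 shows "y t \<le> sqrt ((1 - \<tau>) * (y t0 + k)\<^sup>2 + \<tau> * (y t1 + k)\<^sup>2) + k"
proof -
 \<comment> \<open>The growth rate that remains of the free evolution after the slope
   \<open>l\<close> has been divided out.\<close>
 define b where "b = Re m - l"
 have y0: "y s \<ge> 0" for s by (simp add: y_def)
 have E: "exp (- l * s) * cmod (exp (m * of_real s) * z) = exp (b * s) * cmod z" for s z
  by (simp add: b_def norm_mult exp_add[symmetric] algebra_simps)
 \<comment> \<open>\<open>r\<close> is the time to which the forcing is transported. The condition
   on \<open>r\<close> makes the transporting factor e^(b(r - s)) at most 1, so that only the tilted
   integral of |g| is left, whatever the size of \<open>m\<close>.\<close>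
 have ybound: "cmod (exp (- m * of_real s1) * h s1 - exp (- m * of_real s0) * h s0) * exp (b * r) \<le> k"
  if s: "t0 \<le> s0" "s0 \<le> s1" "s1 \<le> t1" and r: "\<And>s. s0 \<le> s \<Longrightarrow> s \<le> s1 \<Longrightarrow> b * r \<le> b * s" for s0 s1 r
 proof -
  let ?f = "\<lambda>s. indicator {s0..s1} s *\<^sub>R (exp (- m * of_real s) * g s)"
  have "ennreal (cmod (integral\<^sup>L lborel ?f)) \<le> (\<integral>\<^sup>+s. ennreal (cmod (?f s)) \<partial>lborel)"
  proof (cases "integrable lborel ?f")
   case True
   then show ?thesis by (rule integral_norm_bound_ennreal)
  qed (simp add: not_integrable_integral_eq)
  then have "ennreal (cmod (integral\<^sup>L lborel ?f) * exp (b * r)) \<le> (\<integral>\<^sup>+s. ennreal (cmod (?f s)) \<partial>lborel) * ennreal (exp (b * r))"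
   by (simp add: ennreal_mult mult_right_mono)
  also have "\<dots> = (\<integral>\<^sup>+s. ennreal (cmod (?f s)) * ennreal (exp (b * r)) \<partial>lborel)"
   by (rule nn_integral_multc[symmetric]) measurable
  also have "\<dots> \<le> (\<integral>\<^sup>+s. ennreal (indicator {t0..t1} s * (exp (- l * s) * cmod (g s))) \<partial>lborel)"
  proof (intro nn_integral_mono)
   fix s
   have "exp (- Re m * s) * exp (b * r) \<le> exp (- l * s)" if "s0 \<le> s" "s \<le> s1"
    using r[OF that] by (simp add: exp_add[symmetric] b_def algebra_simps)
   then have "cmod (?f s) * exp (b * r) \<le> indicator {t0..t1} s * (exp (- l * s) * cmod (g s))"
    using s by (auto simp: norm_mult mult_ac intro: mult_left_mono split: split_indicator)
   then show "ennreal (cmod (?f s)) * ennreal (exp (b * r)) \<le> ennreal (indicator {t0..t1} s * (exp (- l * s) * cmod (g s)))"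
    by (simp add: ennreal_mult[symmetric] ennreal_leI)
  qed
  also note k(1)
  finally show ?thesis using k(2) eq[OF s] by simp
 qed
 have yE: "y s = exp (b * s) * cmod (exp (- m * of_real s) * h s)" for s
  by (simp add: y_def b_def norm_mult exp_add[symmetric] algebra_simps)
 \<comment> \<open>For a decaying mode the first bound propagates forwards; the second says that the
   propagated value is not much larger than the true one. The latter brings the value at
   \<open>t1\<close> into the estimate although only \<open>t0\<close> was used to solve the
   equation. The growing case is the mirror image.\<close>
 have up: "y s1 \<le> exp (b * (s1 - s0)) * y s0 + k" "exp (b * (s1 - s0)) * y s0 \<le> y s1 + k"
  if "t0 \<le> s0" "s0 \<le> s1" "s1 \<le> t1" "b \<le> 0" for s0 s1
 proof -
  have B: "cmod (exp (- m * of_real s1) * h s1 - exp (- m * of_real s0) * h s0) * exp (b * s1) \<le> k"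
   using that by (intro ybound) (auto intro: mult_left_mono_neg)
  have e: "exp (b * (s1 - s0)) * y s0 = exp (b * s1) * cmod (exp (- m * of_real s0) * h s0)"
   by (simp add: yE exp_add[symmetric] algebra_simps flip: mult.assoc)
  have "exp (b * s1) * (cmod (exp (- m * of_real s1) * h s1) - cmod (exp (- m * of_real s0) * h s0)) \<le> k"
   "exp (b * s1) * (cmod (exp (- m * of_real s0) * h s0) - cmod (exp (- m * of_real s1) * h s1)) \<le> k"
   by (rule order_trans[OF _ B], subst mult.commute, intro mult_right_mono norm_triangle_ineq2, simp,
     rule order_trans[OF _ B], subst mult.commute, intro mult_right_mono, subst norm_minus_commute, intro norm_triangle_ineq2, simp)
  then show "y s1 \<le> exp (b * (s1 - s0)) * y s0 + k" "exp (b * (s1 - s0)) * y s0 \<le> y s1 + k"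
   unfolding e yE[of s1] by (auto simp: algebra_simps)
 qed
 have dn: "y s0 \<le> exp (- b * (s1 - s0)) * y s1 + k" "exp (- b * (s1 - s0)) * y s1 \<le> y s0 + k"
  if "t0 \<le> s0" "s0 \<le> s1" "s1 \<le> t1" "b \<ge> 0" for s0 s1
 proof -
  have B: "cmod (exp (- m * of_real s1) * h s1 - exp (- m * of_real s0) * h s0) * exp (b * s0) \<le> k"
   using that by (intro ybound) (auto intro: mult_left_mono)
  have e: "exp (- b * (s1 - s0)) * y s1 = exp (b * s0) * cmod (exp (- m * of_real s1) * h s1)"
   by (simp add: yE exp_add[symmetric] algebra_simps flip: mult.assoc)
  have "exp (b * s0) * (cmod (exp (- m * of_real s1) * h s1) - cmod (exp (- m * of_real s0) * h s0)) \<le> k"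
   "exp (b * s0) * (cmod (exp (- m * of_real s0) * h s0) - cmod (exp (- m * of_real s1) * h s1)) \<le> k"
   by (rule order_trans[OF _ B], subst mult.commute, intro mult_right_mono norm_triangle_ineq2, simp,
     rule order_trans[OF _ B], subst mult.commute, intro mult_right_mono, subst norm_minus_commute, intro norm_triangle_ineq2, simp)
  then show "y s0 \<le> exp (- b * (s1 - s0)) * y s1 + k" "exp (- b * (s1 - s0)) * y s1 \<le> y s0 + k"
   unfolding e yE[of s0] by (auto simp: algebra_simps)
 qed
 have \<tau>01: "0 \<le> \<tau>" "\<tau> \<le> 1" using t by (auto simp: \<tau>)
 \<comment> \<open>\<open>p\<close> is the free evolution at time \<open>t\<close>, and
   \<open>q0\<close>, \<open>q1\<close> are its values at the two ends. For the free evolution the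
   claim is the convexity of the exponential; the forcing costs \<open>k\<close> once at the ends
   and once at \<open>t\<close>.\<close>
 have fin: ?thesis if "y t \<le> p + k" "p\<^sup>2 \<le> (1 - \<tau>) * q0\<^sup>2 + \<tau> * q1\<^sup>2"
  "0 \<le> q0" "q0 \<le> y t0 + k" "0 \<le> q1" "q1 \<le> y t1 + k" for p q0 q1
 proof -
  have "p\<^sup>2 \<le> (1 - \<tau>) * (y t0 + k)\<^sup>2 + \<tau> * (y t1 + k)\<^sup>2"
   using \<tau>01 that by (intro order_trans[OF that(2)] add_mono mult_left_mono power_mono) auto
  then have "p \<le> sqrt ((1 - \<tau>) * (y t0 + k)\<^sup>2 + \<tau> * (y t1 + k)\<^sup>2)" by (rule real_le_rsqrt)
  with that(1) show ?thesis by simp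
 qed
 show ?thesis
 proof (cases "b \<le> 0")
  case True
  show ?thesis
  proof (rule fin)
   show "y t \<le> exp (b * (t - t0)) * y t0 + k" using up[of t0 t] t True by auto
   have "(exp (b * (t - t0)) * y t0)\<^sup>2 = exp (\<tau> * (2 * b * (t1 - t0))) * (y t0)\<^sup>2"
   proof -
    have "\<tau> * (2 * b * (t1 - t0)) = 2 * (b * (t - t0))" using t by (simp add: \<tau>)
    then show ?thesis by (simp only: power_mult_distrib exp_double[symmetric])
   qed
   also have "\<dots> \<le> ((1 - \<tau>) + \<tau> * exp (2 * b * (t1 - t0))) * (y t0)\<^sup>2"
    by (intro mult_right_mono exp_convex_bound \<tau>01) auto
   also have "\<dots> = (1 - \<tau>) * (y t0)\<^sup>2 + \<tau> * (exp (b * (t1 - t0)) * y t0)\<^sup>2"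
    by (simp add: power_mult_distrib exp_double[symmetric] algebra_simps)
   finally show "(exp (b * (t - t0)) * y t0)\<^sup>2 \<le> (1 - \<tau>) * (y t0)\<^sup>2 + \<tau> * (exp (b * (t1 - t0)) * y t0)\<^sup>2" .
   show "exp (b * (t1 - t0)) * y t0 \<le> y t1 + k" using up(2)[of t0 t1] t True by auto
  qed (use y0 k in auto)
 next
  case False
  then have b: "b \<ge> 0" by simp
  show ?thesis
  proof (rule fin)
   show "y t \<le> exp (- b * (t1 - t)) * y t1 + k" using dn[of t t1] t b by auto
   have "(exp (- b * (t1 - t)) * y t1)\<^sup>2 = exp ((1 - \<tau>) * (2 * (- b) * (t1 - t0))) * (y t1)\<^sup>2"
   proof -
    have "1 - \<tau> = (t1 - t) / (t1 - t0)" using t by (simp add: \<tau> field_simps)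
    then have "(1 - \<tau>) * (2 * (- b) * (t1 - t0)) = 2 * (- b * (t1 - t))" using t by simp
    then show ?thesis by (simp only: power_mult_distrib exp_double[symmetric])
   qed
   also have "\<dots> \<le> ((1 - (1 - \<tau>)) + (1 - \<tau>) * exp (2 * (- b) * (t1 - t0))) * (y t1)\<^sup>2"
    using \<tau>01 by (intro mult_right_mono exp_convex_bound) auto
   also have "\<dots> = (1 - \<tau>) * (exp (- b * (t1 - t0)) * y t1)\<^sup>2 + \<tau> * (y t1)\<^sup>2"
    by (simp add: power_mult_distrib exp_double[symmetric] algebra_simps)
   finally show "(exp (- b * (t1 - t)) * y t1)\<^sup>2 \<le> (1 - \<tau>) * (exp (- b * (t1 - t0)) * y t1)\<^sup>2 + \<tau> * (y t1)\<^sup>2" .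
   show "exp (- b * (t1 - t0)) * y t1 \<le> y t0 + k" using dn(2)[of t0 t1] t b by auto
  qed (use y0 k in auto)
 qed
qed

section \<open>Summation over weights and frequencies\<close>

lemma ennreal_le_of_sq_le:
 assumes "x\<^sup>2 \<le> ennreal (k\<^sup>2)" "k \<ge> 0"
 shows "x \<le> ennreal k"
proof (cases x)
 case (real r)
 with assms have "r\<^sup>2 \<le> k\<^sup>2" by (simp add: ennreal_power)
 with real assms(2) show ?thesis by (auto intro: ennreal_leI power2_le_imp_le)
next
 case top
 with assms show ?thesis by (simp add: top_unique)
qed

text \<open>The index j stands for an exponential weight and z for a frequency. The equation h' = m
  h + g is given in integrated form. The forcing is compared with \<open>h\<close> only in the total
  norm over j and z, not at a single frequency; \<open>B\<close> records that this norm is bounded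
  on the time interval.\<close>

locale scalar_family = sigma_finite_measure M for M :: "'z measure" +
 fixes J :: "'j set" and h g :: "'j \<Rightarrow> real \<Rightarrow> 'z \<Rightarrow> complex" and m :: "'j \<Rightarrow> 'z \<Rightarrow> complex" and K B :: real
 assumes h_meas: "\<And>j t. j \<in> J \<Longrightarrow> t \<in> {0..1} \<Longrightarrow> h j t \<in> borel_measurable M"
  and g_meas [measurable]: "\<And>j. j \<in> J \<Longrightarrow> case_prod (g j) \<in> borel_measurable (borel \<Otimes>\<^sub>M M)"
  and duhamel: "\<And>j z s0 s1. j \<in> J \<Longrightarrow> z \<in> space M \<Longrightarrow> 0 \<le> s0 \<Longrightarrow> s0 \<le> s1 \<Longrightarrow> s1 \<le> 1 \<Longrightarrow>
   exp (- m j z * of_real s1) * h j s1 z - exp (- m j z * of_real s0) * h j s0 z =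
   (int_on s0 s1 (\<lambda>s. exp (- m j z * of_real s) * g j s z))"
  and h_bound: "\<And>t. t \<in> {0..1} \<Longrightarrow> (\<Sum>j\<in>J. \<integral>\<^sup>+z. ennreal ((cmod (h j t z))\<^sup>2) \<partial>M) \<le> ennreal B"
  and g_bound: "\<And>t. t \<in> {0..1} \<Longrightarrow> (\<Sum>j\<in>J. \<integral>\<^sup>+z. ennreal ((cmod (g j t z))\<^sup>2) \<partial>M) \<le>
   ennreal (K\<^sup>2) * (\<Sum>j\<in>J. \<integral>\<^sup>+z. ennreal ((cmod (h j t z))\<^sup>2) \<partial>M)"
  and K_nonneg: "K \<ge> 0"
begin

definition N2 :: "real \<Rightarrow> ennreal" where
 "N2 t = (\<Sum>j\<in>J. \<integral>\<^sup>+z. ennreal ((cmod (h j t z))\<^sup>2) \<partial>M)"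

lemma pair_lborel: "pair_sigma_finite M (lborel :: real measure)"
 by (rule pair_sigma_finite.intro[OF sigma_finite_measure_axioms lborel.sigma_finite_measure_axioms])

text \<open>Tilting by e^(-lt) subtracts a linear function from the logarithm of the norm. With
  equal bounds at both ends, logarithmic convexity becomes a maximum principle.\<close>

definition wN2 :: "real \<Rightarrow> real \<Rightarrow> ennreal" where
 "wN2 l t = (\<Sum>j\<in>J. \<integral>\<^sup>+z. ennreal ((exp (- l * t) * cmod (h j t z))\<^sup>2) \<partial>M)"

lemma wN2_eq:
 assumes "t \<in> {0..1}"
 shows "wN2 l t = ennreal (exp (- 2 * l * t)) * N2 t"
proof -
 have [measurable]: "h j t \<in> borel_measurable M" if "j \<in> J" for j using h_meas that assms by auto
 have "ennreal ((exp (- l * t) * cmod (h j t z))\<^sup>2) = ennreal (exp (- 2 * l * t)) * ennreal ((cmod (h j t z))\<^sup>2)" for j z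
  by (simp add: power_mult_distrib ennreal_mult[symmetric] exp_double[symmetric])
 then show ?thesis unfolding wN2_def N2_def sum_distrib_left
  by (intro sum.cong refl) (simp add: nn_integral_cmult)
qed

lemma wN2_le_iff:
 assumes "t \<in> {0..1}"
 shows "wN2 l t \<le> ennreal ((exp x)\<^sup>2) \<longleftrightarrow> N2 t \<le> ennreal (exp (2 * (x + l * t)))"
proof -
 have "wN2 l t \<le> ennreal ((exp x)\<^sup>2) \<longleftrightarrow> ennreal (exp (- 2 * l * t)) * N2 t \<le> ennreal (exp (- 2 * l * t)) * ennreal (exp (2 * (x + l * t)))"
  unfolding wN2_eq[OF assms]
  by (simp add: ennreal_mult[symmetric] exp_add[symmetric] exp_double[symmetric] algebra_simps)
 also have "\<dots> \<longleftrightarrow> N2 t \<le> ennreal (exp (2 * (x + l * t)))"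
 proof
  assume "ennreal (exp (- 2 * l * t)) * N2 t \<le> ennreal (exp (- 2 * l * t)) * ennreal (exp (2 * (x + l * t)))"
  then have "ennreal (exp (2 * l * t)) * (ennreal (exp (- 2 * l * t)) * N2 t) \<le>
   ennreal (exp (2 * l * t)) * (ennreal (exp (- 2 * l * t)) * ennreal (exp (2 * (x + l * t))))"
   by (rule mult_left_mono) simp
  then show "N2 t \<le> ennreal (exp (2 * (x + l * t)))"
   by (simp add: mult.assoc[symmetric] ennreal_mult[symmetric] exp_add[symmetric] add.commute del: mult.assoc)
 qed (rule mult_left_mono, simp_all)
 finally show ?thesis .
qed

text \<open>If \<open>S\<close> bounds the tilted norm on the interval, the Cauchy-Schwarz
  inequality in time bounds the total of the pointwise errors by K (t1 - t0) S, and by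
  \<open>log_convex_pointwise\<close> they enter twice. An interval with 2 K (t1 - t0) < 1 therefore
  contracts the bound.\<close>

lemma local_step:
 assumes t: "0 \<le> t0" "t0 < t1" "t1 \<le> 1"
  and S: "\<And>s. s \<in> {t0..t1} \<Longrightarrow> wN2 l s \<le> ennreal (S\<^sup>2)" "S \<ge> 0"
  and a: "wN2 l t0 \<le> ennreal (a\<^sup>2)" "wN2 l t1 \<le> ennreal (a\<^sup>2)" "a \<ge> 0"
  and s: "t \<in> {t0..t1}"
 shows "wN2 l t \<le> ennreal ((a + 2 * (K * (t1 - t0)) * S)\<^sup>2)"
proof -
 define d where "d = t1 - t0"
 have d: "d > 0" using t by (simp add: d_def)
 define \<tau> where "\<tau> = (t - t0) / (t1 - t0)"
 have \<tau>01: "0 \<le> \<tau>" "\<tau> \<le> 1" using t s by (auto simp: \<tau>_def)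
 have [measurable]: "h j r \<in> borel_measurable M" if "j \<in> J" "r \<in> {t0..t1}" for j r using h_meas that t by auto
 have mt: "h j t0 \<in> borel_measurable M" "h j t1 \<in> borel_measurable M" "h j t \<in> borel_measurable M" if "j \<in> J" for j
  using that t s by auto
 define y where "y j r z = exp (- l * r) * cmod (h j r z)" for j r z
 \<comment> \<open>The L^2 norm in time is used because the hypothesis on \<open>g\<close> only
   controls squares integrated over z. By the Cauchy-Schwarz inequality \<open>k\<close> is a bound
   for the L^1 norm in time at the single frequency z.\<close>
 define q where "q j z = (\<integral>\<^sup>+r. ennreal (indicator {t0..t1} r * (exp (- l * r) * cmod (g j r z))\<^sup>2) \<partial>lborel)" for j z
 have [measurable]: "q j \<in> borel_measurable M" if [measurable]: "j \<in> J" for j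
  unfolding q_def by measurable
 define k where "k j z = sqrt (d * enn2real (q j z))" for j z
 have [measurable]: "k j \<in> borel_measurable M" if [measurable]: "j \<in> J" for j
  unfolding k_def by measurable
 have qint: "(\<integral>\<^sup>+z. q j z \<partial>M) = (\<integral>\<^sup>+r. indicator {t0..t1} r * (ennreal (exp (- 2 * l * r)) * sq_int M (\<lambda>z. cmod (g j r z))) \<partial>lborel)"
  if [measurable]: "j \<in> J" for j
 proof -
  interpret P: pair_sigma_finite M "lborel :: real measure" by (rule pair_lborel)
  have "(\<integral>\<^sup>+z. q j z \<partial>M) = (\<integral>\<^sup>+r. \<integral>\<^sup>+z. ennreal (indicator {t0..t1} r * (exp (- l * r) * cmod (g j r z))\<^sup>2) \<partial>M \<partial>lborel)"
   unfolding q_def by (rule P.Fubini'[symmetric]) measurable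
  also have "\<dots> = (\<integral>\<^sup>+r. indicator {t0..t1} r * (ennreal (exp (- 2 * l * r)) * sq_int M (\<lambda>z. cmod (g j r z))) \<partial>lborel)"
  proof (intro nn_integral_cong)
   fix r :: real
   have "ennreal (indicator {t0..t1} r * (exp (- l * r) * cmod (g j r z))\<^sup>2) =
    (indicator {t0..t1} r * ennreal (exp (- 2 * l * r))) * ennreal ((cmod (g j r z))\<^sup>2)" for z
    by (simp add: power_mult_distrib ennreal_mult[symmetric] exp_double[symmetric] split: split_indicator)
   then show "(\<integral>\<^sup>+z. ennreal (indicator {t0..t1} r * (exp (- l * r) * cmod (g j r z))\<^sup>2) \<partial>M) =
    indicator {t0..t1} r * (ennreal (exp (- 2 * l * r)) * sq_int M (\<lambda>z. cmod (g j r z)))"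
    by (simp add: nn_integral_cmult mult.assoc)
  qed
  finally show ?thesis .
 qed
 have qsum: "(\<Sum>j\<in>J. \<integral>\<^sup>+z. q j z \<partial>M) \<le> ennreal (d * (K\<^sup>2 * S\<^sup>2))"
 proof -
  have "(\<Sum>j\<in>J. \<integral>\<^sup>+z. q j z \<partial>M) =
    (\<Sum>j\<in>J. (\<integral>\<^sup>+r. indicator {t0..t1} r * (ennreal (exp (- 2 * l * r)) * sq_int M (\<lambda>z. cmod (g j r z))) \<partial>lborel))"
   by (intro sum.cong refl qint)
  also have "\<dots> = (\<integral>\<^sup>+r. (\<Sum>j\<in>J. indicator {t0..t1} r * (ennreal (exp (- 2 * l * r)) * sq_int M (\<lambda>z. cmod (g j r z)))) \<partial>lborel)"
   by (rule nn_integral_sum[symmetric]) measurable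
  also have "\<dots> = (\<integral>\<^sup>+r. indicator {t0..t1} r * (ennreal (exp (- 2 * l * r)) * (\<Sum>j\<in>J. (sq_int M (\<lambda>z. cmod (g j r z))))) \<partial>lborel)"
   by (simp add: sum_distrib_left)
  also have "\<dots> \<le> (\<integral>\<^sup>+r. ennreal (K\<^sup>2 * S\<^sup>2) * indicator {t0..t1} r \<partial>lborel)"
  proof (intro nn_integral_mono)
   fix r :: real
   show "indicator {t0..t1} r * (ennreal (exp (- 2 * l * r)) * (\<Sum>j\<in>J. (sq_int M (\<lambda>z. cmod (g j r z))))) \<le> ennreal (K\<^sup>2 * S\<^sup>2) * indicator {t0..t1} r"
   proof (cases "r \<in> {t0..t1}")
    case True
    then have r: "r \<in> {0..1}" using t by auto
    have "ennreal (exp (- 2 * l * r)) * (\<Sum>j\<in>J. (sq_int M (\<lambda>z. cmod (g j r z)))) \<le>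
      ennreal (exp (- 2 * l * r)) * (ennreal (K\<^sup>2) * N2 r)"
     unfolding N2_def by (intro mult_left_mono g_bound r) auto
    also have "\<dots> = ennreal (K\<^sup>2) * wN2 l r" by (simp add: wN2_eq[OF r] mult_ac)
    also have "\<dots> \<le> ennreal (K\<^sup>2) * ennreal (S\<^sup>2)" by (intro mult_left_mono S True) auto
    finally show ?thesis using True by (simp add: ennreal_mult)
   qed simp
  qed
  also have "\<dots> = ennreal (K\<^sup>2 * S\<^sup>2) * ennreal d" using d by (simp add: nn_integral_cmult d_def)
  finally show ?thesis using d by (simp add: ennreal_mult[symmetric] mult_ac)
 qed
 \<comment> \<open>An infinite \<open>q\<close> would be turned into 0 by \<open>enn2real\<close>;
   the pointwise lemma may be applied only where \<open>q\<close> is finite.\<close>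
 have qfin: "AE z in M. q j z < top" if [measurable]: "j \<in> J" "finite J" for j
 proof -
  have "(\<integral>\<^sup>+z. q j z \<partial>M) \<le> (\<Sum>j\<in>J. \<integral>\<^sup>+z. q j z \<partial>M)" using that by (intro member_le_sum) auto
  with qsum have "(\<integral>\<^sup>+z. q j z \<partial>M) \<noteq> \<infinity>" by (auto simp: top_unique)
  from nn_integral_noteq_infinite[OF _ this] show ?thesis by (simp add: less_top)
 qed
 have k2: "(k j z)\<^sup>2 = d * enn2real (q j z)" for j z using d by (simp add: k_def)
 have k0: "k j z \<ge> 0" for j z using d by (simp add: k_def)
 have ksum: "(\<Sum>j\<in>J. \<integral>\<^sup>+z. ennreal ((k j z)\<^sup>2) \<partial>M) \<le> ennreal ((K * d * S)\<^sup>2)"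
 proof -
  have "(\<Sum>j\<in>J. \<integral>\<^sup>+z. ennreal ((k j z)\<^sup>2) \<partial>M) \<le> (\<Sum>j\<in>J. \<integral>\<^sup>+z. ennreal d * q j z \<partial>M)"
  proof (intro sum_mono nn_integral_mono)
   fix j z
   show "ennreal ((k j z)\<^sup>2) \<le> ennreal d * q j z"
    unfolding k2 using d by (cases "q j z") (auto simp: ennreal_mult)
  qed
  also have "\<dots> = ennreal d * (\<Sum>j\<in>J. \<integral>\<^sup>+z. q j z \<partial>M)"
   unfolding sum_distrib_left by (intro sum.cong refl nn_integral_cmult) simp
  also have "\<dots> \<le> ennreal d * ennreal (d * (K\<^sup>2 * S\<^sup>2))" by (intro mult_left_mono qsum) auto
  also have "\<dots> = ennreal (d * (d * (K\<^sup>2 * S\<^sup>2)))"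
   using d by (intro ennreal_mult[symmetric]) auto
  also have "\<dots> = ennreal ((K * d * S)\<^sup>2)"
   by (simp add: power_mult_distrib power2_eq_square mult_ac)
  finally show ?thesis .
 qed
 have pw: "AE z in M. y j t z \<le> sqrt ((1 - \<tau>) * (y j t0 z + k j z)\<^sup>2 + \<tau> * (y j t1 z + k j z)\<^sup>2) + k j z"
  if j: "j \<in> J" "finite J" for j
  using qfin[OF j] AE_space
 proof eventually_elim
  case (elim z)
  have [measurable]: "(\<lambda>r. g j r z) \<in> borel_measurable borel"
   using measurable_compose[OF measurable_Pair2'[OF elim(2), of borel] g_meas[OF j(1)]] by simp
  show ?case unfolding y_def
  proof (rule log_convex_pointwise[where g = "\<lambda>r. g j r z" and m = "m j z"])
   show "(\<integral>\<^sup>+r. ennreal (indicator {t0..t1} r * (exp (- l * r) * cmod (g j r z))) \<partial>lborel) \<le> ennreal (k j z)"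
   proof (rule ennreal_le_of_sq_le)
    have "(\<integral>\<^sup>+r. ennreal (indicator {t0..t1} r * (exp (- l * r) * cmod (g j r z))) \<partial>lborel)\<^sup>2 \<le> ennreal (t1 - t0) * q j z"
     using cauchy_schwarz_interval[of "\<lambda>r. exp (- l * r) * cmod (g j r z)" t0 t1] t by (simp add: q_def abs_mult)
    also have "\<dots> = ennreal ((k j z)\<^sup>2)"
     unfolding k2 using elim d by (simp add: ennreal_mult d_def ennreal_enn2real)
    finally show "(\<integral>\<^sup>+r. ennreal (indicator {t0..t1} r * (exp (- l * r) * cmod (g j r z))) \<partial>lborel)\<^sup>2 \<le> ennreal ((k j z)\<^sup>2)" .
   qed (rule k0)
   show "exp (- m j z * of_real s1) * h j s1 z - exp (- m j z * of_real s0) * h j s0 z =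
   (int_on s0 s1 (\<lambda>r. exp (- m j z * of_real r) * g j r z))"
    if "t0 \<le> s0" "s0 \<le> s1" "s1 \<le> t1" for s0 s1
    by (rule duhamel) (use that t elim j in auto)
  qed (use t s k0 in \<open>auto simp: \<tau>_def\<close>)
 qed
 have KdS: "K * d * S \<ge> 0" using K_nonneg d S by simp
 show ?thesis
 proof (cases "finite J")
  case True
  have Y: "(\<Sum>j\<in>J. \<integral>\<^sup>+z. ennreal ((y j r z + k j z)\<^sup>2) \<partial>M) \<le> ennreal ((a + K * d * S)\<^sup>2)"
   if "r = t0 \<or> r = t1" for r
   by (rule nn_L2_triangle) (use mt that a ksum KdS in \<open>auto simp: y_def wN2_def\<close>)
  have Q: "(\<Sum>j\<in>J. \<integral>\<^sup>+z. ennreal ((sqrt ((1 - \<tau>) * (y j t0 z + k j z)\<^sup>2 + \<tau> * (y j t1 z + k j z)\<^sup>2))\<^sup>2) \<partial>M) \<le> ennreal ((a + K * d * S)\<^sup>2)"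
  proof -
   have "(\<Sum>j\<in>J. \<integral>\<^sup>+z. ennreal ((sqrt ((1 - \<tau>) * (y j t0 z + k j z)\<^sup>2 + \<tau> * (y j t1 z + k j z)\<^sup>2))\<^sup>2) \<partial>M) =
    (\<Sum>j\<in>J. \<integral>\<^sup>+z. ennreal (1 - \<tau>) * ennreal ((y j t0 z + k j z)\<^sup>2) + ennreal \<tau> * ennreal ((y j t1 z + k j z)\<^sup>2) \<partial>M)"
    using \<tau>01 by (simp add: ennreal_mult[symmetric] ennreal_plus[symmetric] del: ennreal_plus)
   also have "\<dots> = ennreal (1 - \<tau>) * (\<Sum>j\<in>J. \<integral>\<^sup>+z. ennreal ((y j t0 z + k j z)\<^sup>2) \<partial>M) +
     ennreal \<tau> * (\<Sum>j\<in>J. \<integral>\<^sup>+z. ennreal ((y j t1 z + k j z)\<^sup>2) \<partial>M)"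
    unfolding sum_distrib_left sum.distrib[symmetric]
    using mt by (intro sum.cong refl) (subst nn_integral_add, auto simp: nn_integral_cmult y_def)
   also have "\<dots> \<le> ennreal (1 - \<tau>) * ennreal ((a + K * d * S)\<^sup>2) + ennreal \<tau> * ennreal ((a + K * d * S)\<^sup>2)"
    by (intro add_mono mult_left_mono Y) auto
   also have "\<dots> = ennreal ((a + K * d * S)\<^sup>2)"
    using \<tau>01 by (simp add: ennreal_mult[symmetric] ennreal_plus[symmetric] distrib_right[symmetric] del: ennreal_plus)
   finally show ?thesis .
  qed
  have "wN2 l t = (\<Sum>j\<in>J. \<integral>\<^sup>+z. ennreal ((y j t z)\<^sup>2) \<partial>M)" by (simp add: wN2_def y_def)
  also have "\<dots> \<le> (\<Sum>j\<in>J. \<integral>\<^sup>+z. ennreal ((sqrt ((1 - \<tau>) * (y j t0 z + k j z)\<^sup>2 + \<tau> * (y j t1 z + k j z)\<^sup>2) + k j z)\<^sup>2) \<partial>M)"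
  proof (intro sum_mono nn_integral_mono_AE)
   fix j assume "j \<in> J"
   from pw[OF this True] show "AE z in M. ennreal ((y j t z)\<^sup>2) \<le> ennreal ((sqrt ((1 - \<tau>) * (y j t0 z + k j z)\<^sup>2 + \<tau> * (y j t1 z + k j z)\<^sup>2) + k j z)\<^sup>2)"
    by eventually_elim (intro ennreal_leI power_mono, auto simp: y_def)
  qed
  also have "\<dots> \<le> ennreal ((a + K * d * S + K * d * S)\<^sup>2)"
   by (rule nn_L2_triangle) (use mt Q ksum KdS a in \<open>auto simp: y_def\<close>)
  finally show ?thesis by (simp add: d_def algebra_simps)
 next
  \<comment> \<open>A sum over an infinite index set is 0 by convention.\<close>
  case False
  then show ?thesis by (simp add: wN2_def)
 qed
qed

text \<open>With \<open>l\<close> the slope of the chord from \<open>l0\<close> to \<open>l1\<close>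
  the tilted norm has the same bound e^c at both ends. Iterating \<open>local_step\<close> improves
  any bound C + S0 to C + x^i S0, where x = 2 K (t1 - t0) <= 1/2 and C = e^c + x C. In the limit C =
  e^c / (1 - x) is at most e^(c + 2x), and 2x is the loss in the exponent.\<close>

lemma local_log_convex:
 assumes t: "0 \<le> t0" "t0 < t1" "t1 \<le> 1" and Kd: "K * (t1 - t0) \<le> 1/4"
  and e: "N2 t0 \<le> ennreal (exp (2 * l0))" "N2 t1 \<le> ennreal (exp (2 * l1))"
  and s: "t \<in> {t0..t1}"
 shows "N2 t \<le> ennreal (exp (2 * (l0 + (t - t0) / (t1 - t0) * (l1 - l0) + 4 * (K * (t1 - t0)))))"
proof -
 define l where "l = (l1 - l0) / (t1 - t0)"
 define c where "c = l0 - l * t0"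
 define x where "x = 2 * (K * (t1 - t0))"
 have x: "0 \<le> x" "x \<le> 1/2" using Kd K_nonneg t by (auto simp: x_def)
 have "l * (t1 - t0) = l1 - l0" using t by (simp add: l_def)
 then have l1: "c + l * t1 = l1" by (simp add: c_def algebra_simps)
 have "(t - t0) / (t1 - t0) * (l1 - l0) = l * (t - t0)" by (simp add: l_def mult.commute)
 then have lt: "c + l * t = l0 + (t - t0) / (t1 - t0) * (l1 - l0)" by (simp add: c_def algebra_simps)
 have a: "wN2 l t0 \<le> ennreal ((exp c)\<^sup>2)" "wN2 l t1 \<le> ennreal ((exp c)\<^sup>2)"
  using e t l1 by (subst wN2_le_iff; simp add: c_def)+
 \<comment> \<open>The bound from \<open>B\<close>, enlarged by the largest possible tilt. It only
   starts the iteration and disappears in the limit.\<close>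
 define S0 where "S0 = exp \<bar>l\<bar> * sqrt \<bar>B\<bar>"
 define C where "C = exp c / (1 - x)"
 have C: "exp c + x * C = C" using x by (simp add: C_def field_simps)
 have S: "wN2 l r \<le> ennreal ((C + x ^ i * S0)\<^sup>2)" if "r \<in> {t0..t1}" for r i
  using that
 proof (induction i arbitrary: r)
  case 0
  then have r: "r \<in> {0..1}" using t by auto
  have "\<bar>l * r\<bar> \<le> \<bar>l\<bar>" using r by (simp add: abs_mult mult_left_le)
  then have "exp (- 2 * l * r) \<le> (exp \<bar>l\<bar>)\<^sup>2" by (simp add: exp_double[symmetric])
  then have "wN2 l r \<le> ennreal ((exp \<bar>l\<bar>)\<^sup>2) * ennreal B"
   unfolding wN2_eq[OF r] using h_bound[OF r] by (intro mult_mono) (auto simp: N2_def ennreal_leI)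
  also have "\<dots> \<le> ennreal ((exp \<bar>l\<bar>)\<^sup>2) * ennreal \<bar>B\<bar>" by (intro mult_left_mono ennreal_leI) auto
  also have "\<dots> = ennreal (S0\<^sup>2)" by (simp add: S0_def power_mult_distrib ennreal_mult)
  also have "\<dots> \<le> ennreal ((C + x ^ 0 * S0)\<^sup>2)"
   using x by (intro ennreal_leI power_mono) (auto simp: C_def S0_def)
  finally show ?case .
 next
  case (Suc i)
  have "wN2 l r \<le> ennreal ((exp c + 2 * (K * (t1 - t0)) * (C + x ^ i * S0))\<^sup>2)"
   by (rule local_step) (use t Suc a x in \<open>auto simp: C_def S0_def\<close>)
  also have "exp c + 2 * (K * (t1 - t0)) * (C + x ^ i * S0) = C + x ^ Suc i * S0"
   unfolding x_def[symmetric] using C by (simp add: algebra_simps)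
  finally show ?case .
 qed
 have "(\<lambda>i. ennreal ((C + x ^ i * S0)\<^sup>2)) \<longlonglongrightarrow> ennreal ((C + 0 * S0)\<^sup>2)"
  using x by (intro tendsto_intros LIMSEQ_power_zero) auto
 then have "wN2 l t \<le> ennreal ((C + 0 * S0)\<^sup>2)"
  by (rule LIMSEQ_le_const) (use S[OF s] in blast)
 also have "C + 0 * S0 = exp c / (1 - x)" by (simp add: C_def)
 also have "ennreal (\<dots>\<^sup>2) \<le> ennreal ((exp (c + 2 * x))\<^sup>2)"
 proof (intro ennreal_leI power_mono)
  have "1 \<le> (1 - x) * (1 + 2 * x)" using x by (simp add: algebra_simps) (metis mult_left_le mult_2 mult.assoc mult.commute)
  also have "\<dots> \<le> (1 - x) * exp (2 * x)" using x exp_ge_add_one_self[of "2 * x"] by (intro mult_left_mono) auto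
  finally have "1 / (1 - x) \<le> exp (2 * x)" using x by (simp add: field_simps)
  then show "exp c / (1 - x) \<le> exp (c + 2 * x)"
   using mult_left_mono[of "1 / (1 - x)" "exp (2 * x)" "exp c"] by (simp add: exp_add)
 qed (use x in auto)
 finally have "N2 t \<le> ennreal (exp (2 * (c + 2 * x + l * t)))"
  using t s by (subst (asm) wN2_le_iff) auto
 also have "c + 2 * x + l * t = l0 + (t - t0) / (t1 - t0) * (l1 - l0) + 4 * (K * (t1 - t0))"
  using lt by (simp add: x_def)
 finally show ?thesis .
qed

text \<open>For large \<open>K\<close> the local estimate is applied on intervals of length \<open>1 / (4 K)\<close>. It costs a factor
 \<open>e\<close>, which is beaten by the concavity of \<open>\<kappa> t (1 - t)\<close> with \<open>\<kappa> = 128 K\<^sup>2\<close>.\<close>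

lemma log_convex:
 assumes e: "N2 0 \<le> ennreal (exp (2 * l0))" "N2 1 \<le> ennreal (exp (2 * l1))" and t: "t \<in> {0..1}"
 shows "N2 t \<le> ennreal (exp (2 * ((1 - t) * l0 + t * l1 + 12 * K + 32 * K\<^sup>2)))"
proof (cases "K \<le> 1/4")
 case True
 have "N2 t \<le> ennreal (exp (2 * (l0 + (t - 0) / (1 - 0) * (l1 - l0) + 4 * (K * (1 - 0)))))"
  by (rule local_log_convex) (use e t True in auto)
 also have "\<dots> \<le> ennreal (exp (2 * ((1 - t) * l0 + t * l1 + 12 * K + 32 * K\<^sup>2)))"
  using K_nonneg by (intro ennreal_leI) (simp add: algebra_simps)
 finally show ?thesis .
next
 case False
 \<comment> \<open>An interval of length 2 d is the longest to which the local estimate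
   applies.\<close>
 define d where "d = 1 / (8 * K)"
 have d: "0 < d" "d < 1/2" using False by (auto simp: d_def field_simps)
 have Kd: "K * d = 1/8" using False by (simp add: d_def)
 \<comment> \<open>The average of the parabola at s - d and s + d lies \<kappa> d^2 = 2 below its
   value at s. This pays for the local loss, which is 1, and leaves a gain of 1.\<close>
 define \<kappa> where "\<kappa> = 128 * K\<^sup>2"
 have \<kappa>: "\<kappa> * d\<^sup>2 = 2" "\<kappa> \<ge> 0" using False by (auto simp: \<kappa>_def d_def power2_eq_square)
 define L where "L s = (1 - s) * l0 + s * l1 + \<kappa> * (s * (1 - s))" for s
 define X where "X \<sigma> \<longleftrightarrow> (\<forall>s\<in>{0..1}. N2 s \<le> ennreal (exp (2 * (L s + \<sigma>))))" for \<sigma>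
 \<comment> \<open>In the interior the slack drops by 1. Closer than d to an end of [0,1] the
   interval is cut off there; the bound at that end holds without slack, so the slack at s is at
   most half the old one plus the loss 1, and \<sigma>/2 + 1 <= \<sigma> - 1/2 holds exactly from
   \<sigma> = 3 on.\<close>
 have improve: "X (\<sigma> - 1/2)" if X: "X \<sigma>" and \<sigma>: "\<sigma> \<ge> 3" for \<sigma>
  unfolding X_def
 proof
  fix s :: real assume s: "s \<in> {0..1}"
  consider "s < d" | "s > 1 - d" | "d \<le> s" "s \<le> 1 - d" by linarith
  then show "N2 s \<le> ennreal (exp (2 * (L s + (\<sigma> - 1/2))))"
  proof cases
   case 1
   let ?r = "(s - 0) / (s + d - 0)"
   have r: "0 \<le> ?r" "?r \<le> 1/2" using s d 1 by (auto simp: field_simps)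
   have "K * (s + d - 0) \<le> K * (2 * d)" using 1 K_nonneg by (intro mult_left_mono) auto
   then have Kb: "K * (s + d - 0) \<le> 1/4" using Kd by (simp add: algebra_simps)
   have "N2 s \<le> ennreal (exp (2 * (l0 + ?r * ((L (s + d) + \<sigma>) - l0) + 4 * (K * (s + d - 0)))))"
    by (rule local_log_convex) (use s d 1 e X Kb in \<open>auto simp: X_def\<close>)
   also have "\<dots> \<le> ennreal (exp (2 * (L s + (\<sigma> - 1/2))))"
   proof (intro ennreal_leI)
    have rs: "?r * (s + d) = s" using s d by simp
    have "l0 + ?r * (L (s + d) - l0) = l0 + (?r * (s + d)) * (l1 - l0) + \<kappa> * ((?r * (s + d)) * (1 - (s + d)))"
     unfolding L_def by (simp only: algebra_simps)
    also have "\<dots> = L s - \<kappa> * (s * d)" unfolding rs L_def by (simp add: algebra_simps)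
    also have "\<dots> \<le> L s" using \<kappa> s d by simp
    finally have 1: "l0 + ?r * (L (s + d) - l0) \<le> L s" .
    have 2: "?r * \<sigma> \<le> 1/2 * \<sigma>" using r \<sigma> by (intro mult_right_mono) auto
    have "l0 + ?r * ((L (s + d) + \<sigma>) - l0) = l0 + ?r * (L (s + d) - l0) + ?r * \<sigma>" by (simp only: algebra_simps)
    with 1 2 Kb \<sigma> show "exp (2 * (l0 + ?r * ((L (s + d) + \<sigma>) - l0) + 4 * (K * (s + d - 0)))) \<le> exp (2 * (L s + (\<sigma> - 1/2)))"
     by (simp del: diff_0_right)
   qed
   finally show ?thesis .
  next
   case 2
   let ?r = "(s - (s - d)) / (1 - (s - d))"
   have pos: "1 - (s - d) > 0" using s d by auto
   have r: "1/2 \<le> ?r" "?r \<le> 1" using s d 2 by (auto simp: field_simps)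
   have "K * (1 - (s - d)) \<le> K * (2 * d)" using 2 K_nonneg by (intro mult_left_mono) auto
   then have Kb: "K * (1 - (s - d)) \<le> 1/4" using Kd by (simp add: algebra_simps)
   have "N2 s \<le> ennreal (exp (2 * ((L (s - d) + \<sigma>) + ?r * (l1 - (L (s - d) + \<sigma>)) + 4 * (K * (1 - (s - d))))))"
    by (rule local_log_convex) (use s d 2 e X Kb in \<open>auto simp: X_def\<close>)
   also have "\<dots> \<le> ennreal (exp (2 * (L s + (\<sigma> - 1/2))))"
   proof (intro ennreal_leI)
    \<comment> \<open>The weight of the far end s - d, which is the only one to carry slack; it is
      at most 1/2.\<close>
    define p where "p = 1 - ?r"
    have p: "p * (1 - (s - d)) = 1 - s" using pos by (simp add: p_def field_simps)
    have "L (s - d) + ?r * (l1 - L (s - d)) = l1 + p * (L (s - d) - l1)"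
    proof -
     have "a + r * (b - a) = b + (1 - r) * (a - b)" for a b r :: real by (simp add: algebra_simps)
     then show ?thesis unfolding p_def .
    qed
    also have "\<dots> = l1 + (p * (1 - (s - d))) * (l0 - l1) + \<kappa> * ((s - d) * (p * (1 - (s - d))))"
     unfolding L_def by (simp only: algebra_simps)
    also have "\<dots> = L s - \<kappa> * (d * (1 - s))" unfolding p L_def by (simp add: algebra_simps)
    also have "\<dots> \<le> L s" using \<kappa> s d by simp
    finally have 1: "L (s - d) + ?r * (l1 - L (s - d)) \<le> L s" .
    have 2: "p * \<sigma> \<le> 1/2 * \<sigma>" using r \<sigma> by (intro mult_right_mono) (auto simp: p_def)
    have "(L (s - d) + \<sigma>) + ?r * (l1 - (L (s - d) + \<sigma>)) = L (s - d) + ?r * (l1 - L (s - d)) + p * \<sigma>"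
    proof -
     have "(a + x) + r * (b - (a + x)) = a + r * (b - a) + (1 - r) * x" for a b r x :: real
      by (simp add: algebra_simps)
     then show ?thesis unfolding p_def .
    qed
    then have "(L (s - d) + \<sigma>) + ?r * (l1 - (L (s - d) + \<sigma>)) + 4 * (K * (1 - (s - d))) \<le>
      (L (s - d) + ?r * (l1 - L (s - d))) + p * \<sigma> + 4 * (K * (1 - (s - d)))" by simp
    also have "\<dots> \<le> L s + p * \<sigma> + 4 * (1/4)"
     by (rule add_mono[OF add_right_mono[OF 1] mult_left_mono[OF Kb]]) simp
    also have "\<dots> \<le> L s + (\<sigma> - 1/2)" using 2 \<sigma> by linarith
    finally show "exp (2 * ((L (s - d) + \<sigma>) + ?r * (l1 - (L (s - d) + \<sigma>)) + 4 * (K * (1 - (s - d))))) \<le> exp (2 * (L s + (\<sigma> - 1/2)))"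
     unfolding exp_le_cancel_iff by (rule mult_left_mono) simp
   qed
   finally show ?thesis .
  next
   case 3
   have Kb: "K * ((s + d) - (s - d)) = 1/4" using Kd by (simp add: algebra_simps)
   have r: "(s - (s - d)) / ((s + d) - (s - d)) = 1/2" using d by simp
   have "N2 s \<le> ennreal (exp (2 * ((L (s - d) + \<sigma>) + (s - (s - d)) / ((s + d) - (s - d)) * ((L (s + d) + \<sigma>) - (L (s - d) + \<sigma>)) + 4 * (K * ((s + d) - (s - d))))))"
    by (rule local_log_convex) (use s d 3 e X Kb in \<open>auto simp: X_def\<close>)
   also have "\<dots> \<le> ennreal (exp (2 * (L s + (\<sigma> - 1/2))))"
   proof (intro ennreal_leI)
    have "L (s - d) + 1/2 * (L (s + d) - L (s - d)) = L s - \<kappa> * d\<^sup>2"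
     unfolding L_def by (simp add: power2_eq_square field_simps)
    then have E: "(L (s - d) + \<sigma>) + 1/2 * ((L (s + d) + \<sigma>) - (L (s - d) + \<sigma>)) + 4 * (1/4) = L s + (\<sigma> - 1)"
     unfolding \<kappa> by simp
    show "exp (2 * ((L (s - d) + \<sigma>) + (s - (s - d)) / ((s + d) - (s - d)) * ((L (s + d) + \<sigma>) - (L (s - d) + \<sigma>)) + 4 * (K * ((s + d) - (s - d))))) \<le> exp (2 * (L s + (\<sigma> - 1/2)))"
     unfolding r Kb exp_le_cancel_iff E by simp
   qed
   finally show ?thesis .
  qed
 qed
 \<comment> \<open>Finitely many gains of 1/2 lead from any finite slack down to 3, so the size of
   the starting slack leaves no trace.\<close>
 have down: "X 3" if "X \<sigma>" "\<sigma> \<le> 3 + real i / 2" for i \<sigma>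
  using that
 proof (induction i arbitrary: \<sigma>)
  case 0
  then show ?case unfolding X_def by (auto elim!: ballE intro: order_trans ennreal_leI)
 next
  case (Suc i)
  show ?case
  proof (cases "\<sigma> \<ge> 3")
   case True
   from Suc.IH[OF improve[OF Suc.prems(1) True]] Suc.prems(2) show ?thesis by (simp add: field_simps)
  next
   case False
   with Suc.prems show ?thesis unfolding X_def by (auto elim!: ballE intro: order_trans ennreal_leI)
  qed
 qed
 \<comment> \<open>Large enough to compensate the linear part of \<open>L\<close> and still to
   exceed \<open>B\<close>; then B <= 2 (L + \<sigma>) <= e^(2 (L + \<sigma>)).\<close>
 define \<sigma> where "\<sigma> = \<bar>B\<bar> + \<bar>l0\<bar> + \<bar>l1\<bar>"
 have "X \<sigma>"
  unfolding X_def
 proof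
  fix s :: real assume s: "s \<in> {0..1}"
  have "\<bar>(1 - s) * l0\<bar> \<le> 1 * \<bar>l0\<bar>" unfolding abs_mult using s by (intro mult_right_mono) auto
  moreover have "\<bar>s * l1\<bar> \<le> 1 * \<bar>l1\<bar>" unfolding abs_mult using s by (intro mult_right_mono) auto
  moreover have "\<kappa> * (s * (1 - s)) \<ge> 0" using s \<kappa> by simp
  ultimately have "L s + \<sigma> \<ge> \<bar>B\<bar>" unfolding L_def \<sigma>_def by linarith
  then have "B \<le> L s + \<sigma>" "0 \<le> L s + \<sigma>" by (auto intro: order_trans[OF abs_ge_self] order_trans[OF abs_ge_zero])
  then have "B \<le> 2 * (L s + \<sigma>)" unfolding mult_2 by (metis add_increasing2)
  also have "\<dots> \<le> exp (2 * (L s + \<sigma>))" using exp_ge_add_one_self[of "2 * (L s + \<sigma>)"] by (rule order_trans[rotated]) simp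
  finally show "N2 s \<le> ennreal (exp (2 * (L s + \<sigma>)))"
   using h_bound[OF s] by (auto simp: N2_def intro: order_trans ennreal_leI)
 qed
 moreover obtain i :: nat where "2 * \<sigma> \<le> real i" using real_arch_simple by blast
 ultimately have "X 3" by (intro down[of \<sigma> i]) auto
 then have "N2 t \<le> ennreal (exp (2 * (L t + 3)))" using t by (auto simp: X_def)
 also have "\<dots> \<le> ennreal (exp (2 * ((1 - t) * l0 + t * l1 + 12 * K + 32 * K\<^sup>2)))"
 proof (intro ennreal_leI)
  have "t * (1 - t) \<le> 1/4" using zero_le_power2[of "t - 1/2"] by (simp add: power2_eq_square algebra_simps)
  then have "\<kappa> * (t * (1 - t)) \<le> \<kappa> * (1/4)" using \<kappa> by (intro mult_left_mono) auto
  also have "\<dots> = 32 * K\<^sup>2" by (simp add: \<kappa>_def)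
  finally have "\<kappa> * (t * (1 - t)) \<le> 32 * K\<^sup>2" .
  moreover have "3 \<le> 12 * K" using False by simp
  ultimately have "L t + 3 \<le> (1 - t) * l0 + t * l1 + 12 * K + 32 * K\<^sup>2" unfolding L_def by linarith
  then show "exp (2 * (L t + 3)) \<le> exp (2 * ((1 - t) * l0 + t * l1 + 12 * K + 32 * K\<^sup>2))"
   unfolding exp_le_cancel_iff by (rule mult_left_mono) simp
 qed
 finally show ?thesis .
qed

end

subsection \<open>Weak derivatives in time\<close>

text \<open>The rescaled derivative of \<open>step\<close> has mass step 1 - step 0 = 1 and sits at
  the points a + (v + b)/(j + 1) with v in [0,1]. The offset \<open>b\<close> chooses the side from
  which \<open>a\<close> is approached, so that the mass stays inside the time interval when
  \<open>a\<close> is one of its ends.\<close>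

lemma step_mollifier_tendsto:
 fixes k :: "real \<Rightarrow> complex"
 assumes k: "continuous_on {0..1} k" and a: "a \<in> {0..1}"
  and ev: "\<And>v. v \<in> {0..1} \<Longrightarrow> eventually (\<lambda>j. a + (v + b) / real (Suc j) \<in> {0..1}) sequentially"
 shows "(\<lambda>j. \<integral>s. indicator {0..1} s *\<^sub>R (k s * of_real (real (Suc j) * vd step (real (Suc j) * s + (- real (Suc j) * a - b)))) \<partial>lborel) \<longlonglongrightarrow> k a"
proof -
 obtain C where C: "\<And>x. \<bar>vd step x\<bar> \<le> C" "C \<ge> 1" using step_derivatives_bounded by blast
 have "compact (k ` {0..1})" by (intro compact_continuous_image k) auto
 then obtain D where D: "\<And>y. y \<in> k ` {0..1} \<Longrightarrow> norm y \<le> D" using compact_imp_bounded bounded_iff by metis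
 have D0: "D \<ge> 0" using D[of "k 0"] norm_ge_zero[of "k 0"] by (metis atLeastAtMost_iff image_eqI order_refl order_trans zero_le_one)
 let ?k = "\<lambda>s. indicator {0..1} s *\<^sub>R k s"
 have kD: "norm (?k s) \<le> D" for s using D[of "k s"] D0 by (auto split: split_indicator)
 have [measurable]: "?k \<in> borel_measurable borel"
  using k by (intro borel_measurable_continuous_on_indicator) auto
 have [measurable]: "vd step \<in> borel_measurable borel" by (intro smooth_borel smooth_vd smooth_step)
 have eq: "(int_on 0 1 (\<lambda>s. k s * of_real (real (Suc j) * vd step (real (Suc j) * s + (- real (Suc j) * a - b)))))
   = (\<integral>v. ?k (a + (v + b) / real (Suc j)) * of_real (vd step v) \<partial>lborel)" for j
 proof -
  let ?c = "1 / real (Suc j)"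
  have "(int_on 0 1 (\<lambda>s. k s * of_real (real (Suc j) * vd step (real (Suc j) * s + (- real (Suc j) * a - b)))))
   = \<bar>?c\<bar> *\<^sub>R (\<integral>v. ?k ((a + b * ?c) + ?c * v) * of_real (real (Suc j) * vd step (real (Suc j) * ((a + b * ?c) + ?c * v) + (- real (Suc j) * a - b))) \<partial>lborel)"
   by (subst lborel_integral_real_affine[where c = "?c" and t = "a + b * ?c"]) auto
  also have "\<dots> = (\<integral>v. \<bar>?c\<bar> *\<^sub>R (?k ((a + b * ?c) + ?c * v) * of_real (real (Suc j) * vd step (real (Suc j) * ((a + b * ?c) + ?c * v) + (- real (Suc j) * a - b)))) \<partial>lborel)"
   by (rule integral_scaleR_right[symmetric])
  also have "\<dots> = (\<integral>v. ?k (a + (v + b) / real (Suc j)) * of_real (vd step v) \<partial>lborel)"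
  proof (intro Bochner_Integration.integral_cong refl)
   fix v
   have 1: "(a + b * ?c) + ?c * v = a + (v + b) / real (Suc j)" by (simp add: add_divide_distrib)
   have 2: "real (Suc j) * (a + (v + b) / real (Suc j)) + (- real (Suc j) * a - b) = v"
    by (simp add: field_simps)
   show "\<bar>?c\<bar> *\<^sub>R (?k ((a + b * ?c) + ?c * v) * of_real (real (Suc j) * vd step (real (Suc j) * ((a + b * ?c) + ?c * v) + (- real (Suc j) * a - b))))
    = ?k (a + (v + b) / real (Suc j)) * of_real (vd step v)"
    unfolding 1 2 by (simp add: scaleR_conv_of_real field_simps del: of_nat_Suc)
  qed
  finally show ?thesis .
 qed
 have "(\<lambda>j. \<integral>v. ?k (a + (v + b) / real (Suc j)) * of_real (vd step v) \<partial>lborel) \<longlonglongrightarrow> (\<integral>v. k a * of_real (vd step v) \<partial>lborel)"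
 proof (rule integral_dominated_convergence[where w = "\<lambda>v::real. D * C * indicator {0..1} v"])
  show "integrable lborel (\<lambda>v::real. D * C * indicator {0..1} v)" by (intro integrable_mult_right integrable_real_indicator) simp_all
  show "AE v in lborel. norm (?k (a + (v + b) / real (Suc j)) * of_real (vd step v)) \<le> D * C * indicator {0..1} v" for j
  proof (rule AE_I2)
   fix v :: real
   show "norm (?k (a + (v + b) / real (Suc j)) * of_real (vd step v)) \<le> D * C * indicator {0..1} v"
   proof (cases "v \<in> {0..1}")
    case True
    then show ?thesis unfolding norm_mult using kD C D0 by (simp add: mult_mono)
   qed (auto simp: vd_step_eq_0)
  qed
  show "AE v in lborel. (\<lambda>j. ?k (a + (v + b) / real (Suc j)) * of_real (vd step v)) \<longlonglongrightarrow> k a * of_real (vd step v)"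
  proof (rule AE_I2)
   fix v :: real
   show "(\<lambda>j. ?k (a + (v + b) / real (Suc j)) * of_real (vd step v)) \<longlonglongrightarrow> k a * of_real (vd step v)"
   proof (cases "v \<in> {0..1}")
    case True
    have l: "(\<lambda>j. a + (v + b) / real (Suc j)) \<longlonglongrightarrow> a" by real_asymp
    have "(\<lambda>j. k (a + (v + b) / real (Suc j))) \<longlonglongrightarrow> k a"
     by (rule continuous_on_tendsto_compose[OF k l a ev[OF True]])
    then have "(\<lambda>j. ?k (a + (v + b) / real (Suc j))) \<longlonglongrightarrow> k a"
     by (rule Lim_transform_eventually) (use ev[OF True] in \<open>eventually_elim, simp\<close>)
    then show ?thesis by (intro tendsto_mult tendsto_const)
   qed (auto simp: vd_step_eq_0)
  qed
 qed measurable
 moreover have "(\<integral>v. k a * complex_of_real (vd step v) \<partial>lborel) = k a"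
 proof -
  have "(int_on 0 1 (\<lambda>v. vd step v)) = step 1 - step 0"
   by (rule integral_FTC_Icc)
    (auto intro: has_vector_derivative_at_within smooth_vd smooth_step
     continuous_on_subset[OF smooth_continuous[OF smooth_vd(2)[OF smooth_step]]])
  moreover have "indicator {0..1} v *\<^sub>R vd step v = vd step v" for v
   by (auto simp: vd_step_eq_0 split: split_indicator)
  ultimately have "(\<integral>v. vd step v \<partial>lborel) = 1" by (simp only: step_0 step_1 order_refl diff_zero)
  then show ?thesis by simp
 qed
 ultimately show ?thesis unfolding eq by (simp only:)
qed

text \<open>The test function is a smooth trapezoid that rises just after \<open>t0\<close> and
  falls just before \<open>t1\<close>. Its derivative is a difference of two approximate identities,
  and the continuity of \<open>k\<close> yields the values at the given times themselves.\<close>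

lemma weak_derivative_ftc:
 fixes k r :: "real \<Rightarrow> complex"
 assumes k: "continuous_on {0..1} k" and [measurable]: "r \<in> borel_measurable borel"
  and r: "integrable lborel (\<lambda>s. indicator {0..1} s *\<^sub>R r s)"
  and weak: "\<And>\<theta>. smooth \<theta> \<Longrightarrow> (\<exists>\<epsilon>>0. \<forall>s. \<theta> s \<noteq> 0 \<longrightarrow> \<epsilon> \<le> s \<and> s \<le> 1 - \<epsilon>) \<Longrightarrow>
   - (int_on 0 1 (\<lambda>s. k s * vd \<theta> s)) = (int_on 0 1 (\<lambda>s. r s * \<theta> s))"
  and t: "0 \<le> t0" "t0 < t1" "t1 \<le> 1"
 shows "k t1 - k t0 = (int_on t0 t1 (\<lambda>s. r s))"
proof -
 \<comment> \<open>With J = j + 1, \<open>p\<close> rises on [t0 + 1/J, t0 + 2/J] and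
   \<open>q\<close> on [t1 - 2/J, t1 - 1/J]; the offsets 1 and -2 keep both transitions inside the
   interval even for t0 = 0 and t1 = 1.\<close>
 define p where "p j s = step (real (Suc j) * s + (- real (Suc j) * t0 - 1))" for j s
 define q where "q j s = step (real (Suc j) * s + (- real (Suc j) * t1 - (-2)))" for j s
 define \<theta> where "\<theta> j s = complex_of_real (p j s - q j s)" for j s
 have sp: "smooth (p j)" "smooth (q j)" for j unfolding p_def q_def by (intro smooth_affine smooth_step)+
 have s\<theta>: "smooth (\<theta> j)" for j unfolding \<theta>_def by (intro smooth_of_real smooth_diff sp)
 have [measurable]: "\<theta> j \<in> borel_measurable borel" for j by (rule smooth_borel[OF s\<theta>])
 have v\<theta>: "vd (\<theta> j) s = of_real (real (Suc j) * vd step (real (Suc j) * s + (- real (Suc j) * t0 - 1))) -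
   of_real (real (Suc j) * vd step (real (Suc j) * s + (- real (Suc j) * t1 - (-2))))" for j s
 proof -
  have "((\<lambda>s. p j s - q j s) has_vector_derivative vd (p j) s - vd (q j) s) (at s)" for s
   by (intro derivative_intros smooth_vd sp)
  then have "vd (\<lambda>s. p j s - q j s) = (\<lambda>s. vd (p j) s - vd (q j) s)" by (rule vdI)
  moreover have "vd (\<theta> j) = (\<lambda>s. of_real (vd (\<lambda>s. p j s - q j s) s))"
   unfolding \<theta>_def by (intro vd_of_real smooth_diff sp)
  moreover have "vd (p j) s = real (Suc j) * vd step (real (Suc j) * s + (- real (Suc j) * t0 - 1))"
   "vd (q j) s = real (Suc j) * vd step (real (Suc j) * s + (- real (Suc j) * t1 - (-2)))"
   unfolding p_def q_def by (simp_all only: vd_affine[OF smooth_step] real_scaleR_def)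
  ultimately show ?thesis by (simp only: of_real_diff)
 qed
 have pq01: "p j s \<in> {0..1}" "q j s \<in> {0..1}" for j s unfolding p_def q_def using step_bounds by auto
 have n\<theta>: "norm (\<theta> j s) \<le> 1" for j s using pq01[of j s] unfolding \<theta>_def norm_of_real by auto
 have large: "eventually (\<lambda>j. real (Suc j) * d \<ge> x) sequentially" if "d > 0" for d x :: real
  using that by real_asymp
 \<comment> \<open>Once J (t1 - t0) >= 3, the functions \<open>p\<close> and \<open>q\<close> are
   both 0 for s < 1/J and both 1 for s > 1 - 1/J, so their difference is admissible with margin
   1/J.\<close>
 have w: "eventually (\<lambda>j. - (int_on 0 1 (\<lambda>s. k s * vd (\<theta> j) s)) = (int_on 0 1 (\<lambda>s. r s * \<theta> j s))) sequentially"
  using large[of "t1 - t0" 3, OF t(2)[THEN diff_gt_0_iff_gt[THEN iffD2]]]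
 proof eventually_elim
  case (elim j)
  show ?case
  proof (rule weak[OF s\<theta>], intro exI[of _ "1 / real (Suc j)"] conjI allI impI)
   fix s assume nz: "\<theta> j s \<noteq> 0"
   have le: "real (Suc j) * t0 \<ge> 0" "real (Suc j) * t1 \<le> real (Suc j)" using t by (auto intro: mult_left_le simp del: of_nat_Suc)
   have e: "real (Suc j) * t1 - real (Suc j) * t0 \<ge> 3"
    using elim by (simp only: right_diff_distrib)
   have "1 \<le> real (Suc j) * s"
   proof (rule ccontr)
    assume "\<not> 1 \<le> real (Suc j) * s"
    with le e have "real (Suc j) * s + (- real (Suc j) * t0 - 1) \<le> 0" "real (Suc j) * s + (- real (Suc j) * t1 - (-2)) \<le> 0"
     by linarith+
    then have "\<theta> j s = 0" unfolding \<theta>_def p_def q_def by (simp add: step_0 del: of_nat_Suc)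
    with nz show False by simp
   qed
   then show "1 / real (Suc j) \<le> s" by (simp add: field_simps del: of_nat_Suc)
   have "real (Suc j) * s \<le> real (Suc j) - 1"
   proof (rule ccontr)
    assume "\<not> real (Suc j) * s \<le> real (Suc j) - 1"
    with le e have "real (Suc j) * s + (- real (Suc j) * t0 - 1) \<ge> 1" "real (Suc j) * s + (- real (Suc j) * t1 - (-2)) \<ge> 1"
     by linarith+
    then have "\<theta> j s = 0" unfolding \<theta>_def p_def q_def by (simp add: step_1 del: of_nat_Suc)
    with nz show False by simp
   qed
   then show "s \<le> 1 - 1 / real (Suc j)" by (simp add: field_simps del: of_nat_Suc)
  qed simp
 qed
 define A where "A j = (int_on 0 1 (\<lambda>s. k s * of_real (real (Suc j) * vd step (real (Suc j) * s + (- real (Suc j) * t0 - 1)))))" for j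
 define B where "B j = (int_on 0 1 (\<lambda>s. k s * of_real (real (Suc j) * vd step (real (Suc j) * s + (- real (Suc j) * t1 - (-2))))))" for j
 have A: "A \<longlonglongrightarrow> k t0" unfolding A_def
 proof (rule step_mollifier_tendsto[OF k])
  fix v :: real assume v: "v \<in> {0..1}"
  have "(\<lambda>j. t0 + (v + 1) / real (Suc j)) \<longlonglongrightarrow> t0" by real_asymp
  from order_tendstoD(2)[OF this, of 1] t have "eventually (\<lambda>j. t0 + (v + 1) / real (Suc j) < 1) sequentially" by auto
  then show "eventually (\<lambda>j. t0 + (v + 1) / real (Suc j) \<in> {0..1}) sequentially"
   by eventually_elim (use v t in auto)
 qed (use t in auto)
 have B: "B \<longlonglongrightarrow> k t1" unfolding B_def
 proof (rule step_mollifier_tendsto[OF k])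
  fix v :: real assume v: "v \<in> {0..1}"
  have "(\<lambda>j. t1 + (v + (-2)) / real (Suc j)) \<longlonglongrightarrow> t1" by real_asymp
  from order_tendstoD(1)[OF this, of 0] t have "eventually (\<lambda>j. t1 + (v + (-2)) / real (Suc j) > 0) sequentially" by auto
  then show "eventually (\<lambda>j. t1 + (v + (-2)) / real (Suc j) \<in> {0..1}) sequentially"
  proof eventually_elim
   case (elim j)
   have "(v + (-2)) / real (Suc j) \<le> 0" using v by (intro divide_nonpos_pos) auto
   then have "t1 + (v + (-2)) / real (Suc j) \<le> 1" using t by linarith
   with elim show ?case by simp
  qed
 qed (use t in auto)
 have int: "integrable lborel (\<lambda>s. indicator {0..1} s *\<^sub>R (k s * of_real (f s)))" if "continuous_on {0..1} f" for f :: "real \<Rightarrow> real"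
  using borel_integrable_atLeastAtMost'[of 0 1 "\<lambda>s. k s * of_real (f s)"] that k
  by (simp add: set_integrable_def continuous_intros)
 have cv: "continuous_on {0..1} (\<lambda>s. real (Suc j) * vd step (real (Suc j) * s + b))" for j b
  by (intro continuous_intros continuous_on_compose2[OF smooth_continuous[OF smooth_vd(2)[OF smooth_step]]]) auto
 have "(int_on 0 1 (\<lambda>s. k s * vd (\<theta> j) s)) = A j - B j" for j
  unfolding v\<theta> A_def B_def right_diff_distrib scaleR_right_diff_distrib
  by (rule Bochner_Integration.integral_diff) (intro int cv)+
 with w have w': "eventually (\<lambda>j. B j - A j = (int_on 0 1 (\<lambda>s. r s * \<theta> j s))) sequentially"
  by simp
 have "(\<lambda>j. \<integral>s. indicator {0..1} s *\<^sub>R (r s * \<theta> j s) \<partial>lborel) \<longlonglongrightarrow> (int_on t0 t1 (\<lambda>s. r s))"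
 proof (rule integral_dominated_convergence[where w = "\<lambda>s. norm (indicator {0..1} s *\<^sub>R r s)"])
  show "integrable lborel (\<lambda>s. norm (indicator {0..1} s *\<^sub>R r s))" by (rule integrable_norm[OF r])
  show "AE s in lborel. norm (indicator {0..1} s *\<^sub>R (r s * \<theta> j s)) \<le> norm (indicator {0..1} s *\<^sub>R r s)" for j
   by (rule AE_I2) (use n\<theta>[of j] in \<open>auto simp: norm_mult mult_left_le split: split_indicator\<close>)
  show "AE s in lborel. (\<lambda>j. indicator {0..1} s *\<^sub>R (r s * \<theta> j s)) \<longlonglongrightarrow> indicator {t0..t1} s *\<^sub>R r s"
   using AE_lborel_singleton[of t0] AE_lborel_singleton[of t1]
  proof eventually_elim
   case (elim s)
   have pl: "eventually (\<lambda>j. p j s = (if s > t0 then 1 else 0)) sequentially"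
   proof (cases "s > t0")
    case True
    from large[of "s - t0" 2] True show ?thesis
     by (auto elim!: eventually_mono simp: p_def step_1 algebra_simps simp del: of_nat_Suc)
   next
    case False
    have "p j s = 0" for j
    proof -
     have "real (Suc j) * s \<le> real (Suc j) * t0" using False by (intro mult_left_mono) auto
     then show ?thesis unfolding p_def by (intro step_0) linarith
    qed
    with False show ?thesis by simp
   qed
   have ql: "eventually (\<lambda>j. q j s = (if s \<ge> t1 then 1 else 0)) sequentially"
   proof (cases "s \<ge> t1")
    case True
    have "q j s = 1" for j
    proof -
     have "real (Suc j) * t1 \<le> real (Suc j) * s" using True by (intro mult_left_mono) auto
     then show ?thesis unfolding q_def by (intro step_1) linarith
    qed
    with True show ?thesis by simp
   next
    case False
    with large[of "t1 - s" 2] show ?thesis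
     by (auto elim!: eventually_mono simp: q_def step_0 algebra_simps simp del: of_nat_Suc)
   qed
   from pl ql have "eventually (\<lambda>j. indicator {0..1} s *\<^sub>R (r s * \<theta> j s) = indicator {t0..t1} s *\<^sub>R r s) sequentially"
    by eventually_elim (use t elim in \<open>auto simp: \<theta>_def indicator_def\<close>)
   then show ?case by (rule tendsto_eventually)
  qed
 qed measurable
 then have "(\<lambda>j. B j - A j) \<longlonglongrightarrow> (int_on t0 t1 (\<lambda>s. r s))"
  by (rule Lim_transform_eventually) (use w' in \<open>eventually_elim, simp\<close>)
 moreover have "(\<lambda>j. B j - A j) \<longlonglongrightarrow> k t1 - k t0" by (intro tendsto_diff A B)
 ultimately show ?thesis by (metis LIMSEQ_unique)
qed

subsection \<open>Testing the equation with tensor products\<close>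

lemma L2_product:
 fixes f g :: "'a \<Rightarrow> complex"
 assumes [measurable]: "f \<in> borel_measurable M" "g \<in> borel_measurable M"
  and f: "sq_int M (\<lambda>x. cmod (f x)) \<le> ennreal (a\<^sup>2)"
  and g: "sq_int M (\<lambda>x. cmod (g x)) \<le> ennreal (b\<^sup>2)" and ab: "a \<ge> 0" "b \<ge> 0"
 shows "(\<integral>\<^sup>+x. ennreal (cmod (f x * g x)) \<partial>M) \<le> ennreal (a * b)"
  and "integrable M (\<lambda>x. f x * g x)" and "cmod (\<integral>x. f x * g x \<partial>M) \<le> a * b"
proof -
 have "(\<integral>\<^sup>+x. ennreal (cmod (f x * g x)) \<partial>M)\<^sup>2 = (\<integral>\<^sup>+x. ennreal (cmod (f x)) * ennreal (cmod (g x)) \<partial>M)\<^sup>2"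
  by (simp add: norm_mult ennreal_mult)
 also have "\<dots> \<le> (\<integral>\<^sup>+x. (ennreal (cmod (f x)))\<^sup>2 \<partial>M) * (\<integral>\<^sup>+x. (ennreal (cmod (g x)))\<^sup>2 \<partial>M)"
  by (rule Cauchy_Schwarz_nn_integral) auto
 also have "\<dots> \<le> ennreal (a\<^sup>2) * ennreal (b\<^sup>2)"
  using f g by (intro mult_mono) (auto simp: ennreal_power)
 also have "\<dots> = ennreal ((a * b)\<^sup>2)" by (simp add: ennreal_mult power_mult_distrib)
 finally show 1: "(\<integral>\<^sup>+x. ennreal (cmod (f x * g x)) \<partial>M) \<le> ennreal (a * b)"
  by (rule ennreal_le_of_sq_le) (use ab in auto)
 then show i: "integrable M (\<lambda>x. f x * g x)"
  by (intro integrableI_bounded) (auto intro: le_less_trans)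
 have "ennreal (cmod (\<integral>x. f x * g x \<partial>M)) \<le> ennreal (a * b)"
  using integral_norm_bound_ennreal[OF i] 1 by (rule order_trans)
 then show "cmod (\<integral>x. f x * g x \<partial>M) \<le> a * b" using ab by simp
qed

lemma smooth_tens_measurable: "(\<And>i. i < n \<Longrightarrow> smooth (f i)) \<Longrightarrow> tens n f \<in> Bor n"
 by (intro tens_measurable smooth_borel)

lemma tens_L2:
 assumes f: "\<And>i. i < n \<Longrightarrow> smooth (f i)" and R: "\<And>i s. i < n \<Longrightarrow> f i s \<noteq> 0 \<Longrightarrow> \<bar>s\<bar> \<le> R"
 shows "\<exists>a\<ge>0. (sq_int (lbn n) (\<lambda>x. cmod (tens n f x))) \<le> ennreal (a\<^sup>2)"
proof -
 have fin: "sq_int lborel (\<lambda>s. cmod (f i s)) < \<infinity>" if i: "i < n" for i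
 proof -
  have "compact (f i ` {-R..R})"
   by (intro compact_continuous_image continuous_on_subset[OF smooth_continuous[OF f[OF i]]]) auto
  then obtain D where D: "\<And>y. y \<in> f i ` {-R..R} \<Longrightarrow> norm y \<le> D" using compact_imp_bounded bounded_iff by metis
  have "sq_int lborel (\<lambda>s. cmod (f i s)) \<le> (\<integral>\<^sup>+s. ennreal (D\<^sup>2) * indicator {-R..R} s \<partial>lborel)"
  proof (intro nn_integral_mono)
   fix s
   show "ennreal ((cmod (f i s))\<^sup>2) \<le> ennreal (D\<^sup>2) * indicator {-R..R} s"
   proof (cases "s \<in> {-R..R}")
    case True
    then show ?thesis using D[of "f i s"] by (auto intro!: ennreal_leI power_mono)
   next
    case False
    then have "f i s = 0" using R[OF i, of s] by (auto simp: abs_le_iff minus_le_iff)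
    then show ?thesis by simp
   qed
  qed
  also have "\<dots> < \<infinity>" by (simp add: nn_integral_cmult ennreal_mult_less_top emeasure_lborel_Icc_eq)
  finally show ?thesis .
 qed
 have "sq_int (lbn n) (\<lambda>x. cmod (tens n f x)) = (\<integral>\<^sup>+x. (\<Prod>i<n. ennreal ((cmod (f i (x i)))\<^sup>2)) \<partial>lbn n)"
  by (simp add: tens_def prod_norm[symmetric] prod_power_distrib prod_ennreal)
 also have "\<dots> = (\<Prod>i<n. \<integral>\<^sup>+s. ennreal ((cmod (f i s))\<^sup>2) \<partial>lborel)"
 proof (rule lbp.product_nn_integral_prod)
  fix i assume "i \<in> {..<n}"
  then have [measurable]: "f i \<in> borel_measurable borel" using f by (auto intro: smooth_borel)
  show "(\<lambda>s. ennreal ((cmod (f i s))\<^sup>2)) \<in> borel_measurable lborel" by measurable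
 qed simp
 also have "\<dots> < \<infinity>" using fin by (simp add: less_top[symmetric] ennreal_prod_eq_top)
 finally obtain r where "sq_int (lbn n) (\<lambda>x. cmod (tens n f x)) = ennreal r" "r \<ge> 0"
  by (cases "\<integral>\<^sup>+x. ennreal ((cmod (tens n f x))\<^sup>2) \<partial>lbn n") auto
 then show ?thesis by (intro exI[of _ "sqrt r"]) auto
qed

definition lap :: "nat \<Rightarrow> (nat \<Rightarrow> real \<Rightarrow> complex) \<Rightarrow> (nat \<Rightarrow> real) \<Rightarrow> complex" where
 "lap n f x = (\<Sum>i<n. tens n (f(i := vd (vd (f i)))) x)"

text \<open>The equation after the choice of Borel representatives, with G in the role of V u + F.
  The constant \<open>CU\<close> bounds U and G at every time, so that pairings with test functions
  are defined for each t.\<close>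

locale heat_solution =
 fixes n :: nat and c :: complex and U G :: "real \<Rightarrow> (nat \<Rightarrow> real) \<Rightarrow> complex" and CU :: real
 assumes U_meas: "case_prod U \<in> Bor2 n"
  and G_meas: "case_prod G \<in> Bor2 n"
  and CU: "CU \<ge> 0"
  and U_L2: "\<And>t. t \<in> {0..1} \<Longrightarrow> (sq_int (lbn n) (\<lambda>x. cmod (U t x))) \<le> ennreal (CU\<^sup>2)"
  and G_L2: "\<And>t. t \<in> {0..1} \<Longrightarrow> (sq_int (lbn n) (\<lambda>x. cmod (G t x))) \<le> ennreal (CU\<^sup>2)"
  and U_cont: "\<And>s. s \<in> {0..1} \<Longrightarrow>
   ((\<lambda>t. \<integral>\<^sup>+x. ennreal ((cmod (U t x - U s x))\<^sup>2) \<partial>lbn n) \<longlongrightarrow> 0) (at s within {0..1})"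
  and weak: "\<And>\<phi>. spacetime_test_function n \<phi> \<Longrightarrow>
   - (int_on 0 1 (\<lambda>t. \<integral>x. U t x * of_real (pd n \<phi> (x(n := t))) \<partial>lbn n)) =
   c * (int_on 0 1 (\<lambda>t. \<integral>x. U t x * of_real (\<Sum>i<n. pd i (pd i \<phi>) (x(n := t))) +
      G t x * of_real (\<phi> (x(n := t))) \<partial>lbn n))"
begin

lemma U_measurable [measurable]: "t \<in> {0..1} \<Longrightarrow> U t \<in> Bor n"
 "case_prod U \<in> Bor2 n"
 "case_prod U \<in> borel_measurable (lborel \<Otimes>\<^sub>M lbn n)"
proof -
 show "U t \<in> Bor n" using measurable_compose[OF measurable_Pair1'[of t borel "lbn n"] U_meas] by simp
 show "case_prod U \<in> Bor2 n" by (rule U_meas)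
 show "case_prod U \<in> borel_measurable (lborel \<Otimes>\<^sub>M lbn n)" using U_meas by simp
qed

lemma G_measurable [measurable]: "t \<in> {0..1} \<Longrightarrow> G t \<in> Bor n"
 "case_prod G \<in> Bor2 n"
 "case_prod G \<in> borel_measurable (lborel \<Otimes>\<^sub>M lbn n)"
proof -
 show "G t \<in> Bor n" using measurable_compose[OF measurable_Pair1'[of t borel "lbn n"] G_meas] by simp
 show "case_prod G \<in> Bor2 n" by (rule G_meas)
 show "case_prod G \<in> borel_measurable (lborel \<Otimes>\<^sub>M lbn n)" using G_meas by simp
qed

definition pair :: "(real \<Rightarrow> (nat \<Rightarrow> real) \<Rightarrow> complex) \<Rightarrow> (nat \<Rightarrow> real \<Rightarrow> complex) \<Rightarrow> real \<Rightarrow> complex" where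
 "pair W f t = (\<integral>x. W t x * tens n f x \<partial>lbn n)"

text \<open>The spatial factor of a test function; the time factor is kept apart so that it can
  absorb an integrating factor.\<close>

definition tests :: "(nat \<Rightarrow> real \<Rightarrow> complex) \<Rightarrow> bool" where
 "tests f \<longleftrightarrow> (\<forall>i<n. smooth (f i)) \<and> (\<exists>R. \<forall>i<n. \<forall>s. f i s \<noteq> 0 \<longrightarrow> \<bar>s\<bar> \<le> R)"

lemma vd_support:
 assumes "smooth f" "\<And>s. f s \<noteq> 0 \<Longrightarrow> \<bar>s\<bar> \<le> R" "vd f s \<noteq> 0"
 shows "\<bar>s\<bar> \<le> R"
proof (rule ccontr)
 assume "\<not> \<bar>s\<bar> \<le> R"
 then have "vd f s = 0"
  by (intro vd_eq_0[OF assms(1), of "{..<-R} \<union> {R<..}" s 0]) (use assms(2) in \<open>auto simp: abs_le_iff, fastforce+\<close>)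
 with assms(3) show False by simp
qed

lemma tests_vd: "tests f \<Longrightarrow> i < n \<Longrightarrow> tests (f(i := vd (vd (f i))))"
 unfolding tests_def by (auto simp: smooth_vd) (metis smooth_vd(2) vd_support)

lemma tests_L2:
 assumes "tests f"
 shows "\<exists>a\<ge>0. (sq_int (lbn n) (\<lambda>x. cmod (tens n f x))) \<le> ennreal (a\<^sup>2)"
proof -
 from assms obtain R where "\<And>i. i < n \<Longrightarrow> smooth (f i)" "\<And>i s. i < n \<Longrightarrow> f i s \<noteq> 0 \<Longrightarrow> \<bar>s\<bar> \<le> R"
  unfolding tests_def by blast
 then show ?thesis by (intro tens_L2) auto
qed

lemma tests_measurable [measurable (raw)]: "tests f \<Longrightarrow> tens n f \<in> Bor n"
 by (intro smooth_tens_measurable) (auto simp: tests_def)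

lemma pair_U:
 assumes f: "tests f"
 shows "\<And>t. t \<in> {0..1} \<Longrightarrow> integrable (lbn n) (\<lambda>x. U t x * tens n f x)"
  and "\<exists>b. \<forall>t\<in>{0..1}. cmod (pair U f t) \<le> b"
  and "pair U f \<in> borel_measurable borel"
  and "continuous_on {0..1} (pair U f)"
proof -
 have [measurable]: "tens n f \<in> Bor n" using f by measurable
 obtain a where a: "a \<ge> 0" "sq_int (lbn n) (\<lambda>x. cmod (tens n f x)) \<le> ennreal (a\<^sup>2)"
  using tests_L2[OF f] by blast
 show int: "integrable (lbn n) (\<lambda>x. U t x * tens n f x)" if "t \<in> {0..1}" for t
  by (rule L2_product(2)[OF _ _ U_L2 a(2)]) (use that CU a in auto)
 have "cmod (pair U f t) \<le> CU * a" if "t \<in> {0..1}" for t unfolding pair_def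
  by (rule L2_product(3)[OF _ _ U_L2 a(2)]) (use that CU a in auto)
 then show "\<exists>b. \<forall>t\<in>{0..1}. cmod (pair U f t) \<le> b" by blast
 show "pair U f \<in> borel_measurable borel" unfolding pair_def[abs_def] by measurable
 show "continuous_on {0..1} (pair U f)"
  unfolding continuous_on
 proof
  fix s :: real assume s: "s \<in> {0..1}"
  show "(pair U f \<longlongrightarrow> pair U f s) (at s within {0..1})"
  proof (rule tendstoI)
   fix e :: real assume e: "e > 0"
   have a1: "a + 1 > 0" using a by simp
   define d where "d = e / 2 / (a + 1)"
   have d: "d > 0" using e a1 by (simp add: d_def)
   have "d * a \<le> d * (a + 1)" using d by simp
   also have "d * (a + 1) = e / 2" using a1 unfolding d_def by (metis less_irrefl nonzero_mult_div_cancel_right times_divide_eq_left)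
   finally have da: "d * a < e" using e by simp
   have "eventually (\<lambda>t. (sq_int (lbn n) (\<lambda>x. cmod (U t x - U s x))) < ennreal (d\<^sup>2)) (at s within {0..1})"
    by (rule order_tendstoD(2)[OF U_cont[OF s]]) (use d in auto)
   moreover have "eventually (\<lambda>t. t \<in> {0..1}) (at s within {0..1})" by (simp add: eventually_at_filter)
   ultimately show "eventually (\<lambda>t. dist (pair U f t) (pair U f s) < e) (at s within {0..1})"
   proof eventually_elim
    case (elim t)
    have "cmod (\<integral>x. (U t x - U s x) * tens n f x \<partial>lbn n) \<le> d * a"
     by (rule L2_product(3)[OF _ _ less_imp_le[OF elim(1)] a(2)]) (use elim s d a in auto)
    moreover have "pair U f t - pair U f s = (\<integral>x. (U t x - U s x) * tens n f x \<partial>lbn n)"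
     unfolding pair_def left_diff_distrib
     by (rule Bochner_Integration.integral_diff[symmetric]) (use int elim s in auto)
    ultimately show ?case using da by (simp add: dist_norm)
   qed
  qed
 qed
qed

lemma pair_G:
 assumes f: "tests f"
 shows "\<And>t. t \<in> {0..1} \<Longrightarrow> integrable (lbn n) (\<lambda>x. G t x * tens n f x)"
  and "\<exists>b. \<forall>t\<in>{0..1}. cmod (pair G f t) \<le> b"
  and "pair G f \<in> borel_measurable borel"
proof -
 have [measurable]: "tens n f \<in> Bor n" using f by measurable
 obtain a where a: "a \<ge> 0" "sq_int (lbn n) (\<lambda>x. cmod (tens n f x)) \<le> ennreal (a\<^sup>2)"
  using tests_L2[OF f] by blast
 show int: "integrable (lbn n) (\<lambda>x. G t x * tens n f x)" if "t \<in> {0..1}" for t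
  by (rule L2_product(2)[OF _ _ G_L2 a(2)]) (use that CU a in auto)
 have "cmod (pair G f t) \<le> CU * a" if "t \<in> {0..1}" for t unfolding pair_def
  by (rule L2_product(3)[OF _ _ G_L2 a(2)]) (use that CU a in auto)
 then show "\<exists>b. \<forall>t\<in>{0..1}. cmod (pair G f t) \<le> b" by blast
 show "pair G f \<in> borel_measurable borel" unfolding pair_def[abs_def] by measurable
qed

text \<open>The right-hand side of the equation without the factor \<open>c\<close>, paired with a
  tensor, the Laplacian having been moved onto the tensor.\<close>

definition rhs :: "(nat \<Rightarrow> real \<Rightarrow> complex) \<Rightarrow> real \<Rightarrow> complex" where
 "rhs f t = (\<Sum>i<n. pair U (f(i := vd (vd (f i)))) t) + pair G f t"

lemma rhs_bounded:
 assumes "tests f"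
 shows "\<exists>b. \<forall>t\<in>{0..1}. cmod (rhs f t) \<le> b" and "rhs f \<in> borel_measurable borel"
proof -
 have "\<forall>i\<in>{..<n}. \<exists>b. \<forall>t\<in>{0..1}. cmod (pair U (f(i := vd (vd (f i)))) t) \<le> b"
  using pair_U(2)[OF tests_vd[OF assms]] by blast
 then obtain b where b: "\<And>i t. i < n \<Longrightarrow> t \<in> {0..1} \<Longrightarrow> cmod (pair U (f(i := vd (vd (f i)))) t) \<le> b i"
  by (metis lessThan_iff)
 obtain b' where b': "\<forall>t\<in>{0..1}. cmod (pair G f t) \<le> b'" using pair_G(2)[OF assms] by blast
 have "cmod (rhs f t) \<le> (\<Sum>i<n. b i) + b'" if t: "t \<in> {0..1}" for t
 proof -
  have "cmod (rhs f t) \<le> (\<Sum>i<n. cmod (pair U (f(i := vd (vd (f i)))) t)) + cmod (pair G f t)"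
   unfolding rhs_def by (intro order_trans[OF norm_triangle_ineq] add_mono norm_sum) auto
  also have "\<dots> \<le> (\<Sum>i<n. b i) + b'" using b b' t by (intro add_mono sum_mono) auto
  finally show ?thesis .
 qed
 then show "\<exists>b. \<forall>t\<in>{0..1}. cmod (rhs f t) \<le> b" by blast
 have [measurable]: "pair G f \<in> borel_measurable borel" by (rule pair_G(3)[OF assms])
 have "(\<lambda>t. \<Sum>i<n. pair U (f(i := vd (vd (f i)))) t) \<in> borel_measurable borel"
  by (intro borel_measurable_sum pair_U(3) tests_vd assms) simp
 then show "rhs f \<in> borel_measurable borel" unfolding rhs_def[abs_def] by measurable
qed

lemma integrable_bounded_on:
 fixes p :: "real \<Rightarrow> complex"
 assumes [measurable]: "p \<in> borel_measurable borel" and "\<forall>t\<in>{0..1}. cmod (p t) \<le> b"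
 shows "integrable lborel (\<lambda>t. indicator {0..1} t *\<^sub>R p t)"
proof (rule Bochner_Integration.integrable_bound[where f = "\<lambda>t::real. b * indicator {0..1} t"])
 show "integrable lborel (\<lambda>t::real. b * indicator {0..1} t)"
  by (intro integrable_mult_right integrable_real_indicator) simp_all
 show "AE t in lborel. norm (indicator {0..1} t *\<^sub>R p t) \<le> norm (b * indicator {0..1} t)"
  using assms(2) by (intro AE_I2) (auto split: split_indicator intro: order_trans[OF _ abs_ge_self])
qed measurable

lemma tests_bound:
 assumes f: "tests f"
 shows "\<exists>b. \<forall>t\<in>{0..1}. (\<integral>\<^sup>+x. ennreal (cmod (U t x * tens n f x)) \<partial>lbn n) \<le> ennreal b"
  and "\<exists>b. \<forall>t\<in>{0..1}. (\<integral>\<^sup>+x. ennreal (cmod (G t x * tens n f x)) \<partial>lbn n) \<le> ennreal b"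
proof -
 have [measurable]: "tens n f \<in> Bor n" using f by measurable
 obtain a where a: "a \<ge> 0" "sq_int (lbn n) (\<lambda>x. cmod (tens n f x)) \<le> ennreal (a\<^sup>2)"
  using tests_L2[OF f] by blast
 have "(\<integral>\<^sup>+x. ennreal (cmod (U t x * tens n f x)) \<partial>lbn n) \<le> ennreal (CU * a)" if "t \<in> {0..1}" for t
  by (rule L2_product(1)[OF _ _ U_L2 a(2)]) (use that CU a in auto)
 then show "\<exists>b. \<forall>t\<in>{0..1}. (\<integral>\<^sup>+x. ennreal (cmod (U t x * tens n f x)) \<partial>lbn n) \<le> ennreal b" by blast
 have "(\<integral>\<^sup>+x. ennreal (cmod (G t x * tens n f x)) \<partial>lbn n) \<le> ennreal (CU * a)" if "t \<in> {0..1}" for t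
  by (rule L2_product(1)[OF _ _ G_L2 a(2)]) (use that CU a in auto)
 then show "\<exists>b. \<forall>t\<in>{0..1}. (\<integral>\<^sup>+x. ennreal (cmod (G t x * tens n f x)) \<partial>lbn n) \<le> ennreal b" by blast
qed

lemma cintegral:
 fixes A B :: "'x \<Rightarrow> complex"
 assumes "integrable N A" "integrable N B"
 shows "(\<integral>t. A t \<partial>N) + \<i> * (\<integral>t. B t \<partial>N) = (\<integral>t. A t + \<i> * B t \<partial>N)"
 using assms by simp

lemma integral_diff_cmult:
 fixes A B :: "'x \<Rightarrow> complex"
 assumes "integrable N A" "integrable N B"
 shows "(\<integral>t. A t - m * B t \<partial>N) = (\<integral>t. A t \<partial>N) - m * (\<integral>t. B t \<partial>N)"
 using assms by simp

text \<open>Since admissible test functions are real, a complex product w(x) \<theta>(t) has to be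
  tested through its real and its imaginary part. Here the two integrals are recombined; the
  integrability of each of them is what permits this.\<close>

lemma split_test:
 assumes \<theta>: "smooth \<theta>"
  and z: "case_prod z \<in> Bor2 n" and [measurable]: "w \<in> Bor n"
  and b: "\<forall>t\<in>{0..1}. (\<integral>\<^sup>+x. ennreal (cmod (z t x * w x)) \<partial>lbn n) \<le> ennreal b"
 shows "h = Re \<or> h = Im \<Longrightarrow> t \<in> {0..1} \<Longrightarrow> integrable (lbn n) (\<lambda>x. z t x * of_real (h (w x * \<theta> t)))"
  and "h = Re \<or> h = Im \<Longrightarrow> integrable lborel (\<lambda>t. indicator {0..1} t *\<^sub>R (\<integral>x. z t x * of_real (h (w x * \<theta> t)) \<partial>lbn n))"
  and "(int_on 0 1 (\<lambda>t. \<integral>x. z t x * of_real (Re (w x * \<theta> t)) \<partial>lbn n)) +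
   \<i> * (int_on 0 1 (\<lambda>t. \<integral>x. z t x * of_real (Im (w x * \<theta> t)) \<partial>lbn n)) =
   (int_on 0 1 (\<lambda>t. (\<integral>x. z t x * w x \<partial>lbn n) * \<theta> t))"
  and "integrable lborel (\<lambda>t. indicator {0..1} t *\<^sub>R ((\<integral>x. z t x * w x \<partial>lbn n) * \<theta> t))"
proof -
 have [measurable]: "\<theta> \<in> borel_measurable borel" by (rule smooth_borel[OF \<theta>])
 have [measurable]: "case_prod z \<in> Bor2 n" by (rule z)
 have zt [measurable]: "z t \<in> Bor n" for t
  using measurable_compose[OF measurable_Pair1'[of t borel "lbn n"] z] by simp
 have "compact (\<theta> ` {0..1})" by (intro compact_continuous_image continuous_on_subset[OF smooth_continuous[OF \<theta>]]) auto
 then obtain D where D: "\<forall>t\<in>{0..1}. cmod (\<theta> t) \<le> D" using compact_imp_bounded bounded_iff by (metis imageI)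
 have i: "integrable (lbn n) (\<lambda>x. z t x * (w x * \<theta> t))" and ib: "(\<integral>\<^sup>+x. ennreal (cmod (z t x * (w x * \<theta> t))) \<partial>lbn n) \<le> ennreal (max 0 b * D)"
  if t: "t \<in> {0..1}" for t
 proof -
  have "integrable (lbn n) (\<lambda>x. z t x * w x)"
   by (intro integrableI_bounded) (use b[rule_format, OF t] in \<open>auto intro: le_less_trans\<close>)
  then have "integrable (lbn n) (\<lambda>x. (z t x * w x) * \<theta> t)" by simp
  then show "integrable (lbn n) (\<lambda>x. z t x * (w x * \<theta> t))" by (simp add: mult.assoc)
  have "(\<integral>\<^sup>+x. ennreal (cmod (z t x * (w x * \<theta> t))) \<partial>lbn n) = (\<integral>\<^sup>+x. ennreal (cmod (z t x * w x)) * ennreal (cmod (\<theta> t)) \<partial>lbn n)"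
   by (simp add: norm_mult ennreal_mult mult_ac)
  also have "\<dots> = (\<integral>\<^sup>+x. ennreal (cmod (z t x * w x)) \<partial>lbn n) * ennreal (cmod (\<theta> t))" by (rule nn_integral_multc) measurable
  also have "\<dots> \<le> ennreal (max 0 b) * ennreal D"
   using b[rule_format, OF t] D t by (intro mult_mono) (auto intro: ennreal_leI)
  also have "\<dots> = ennreal (max 0 b * D)" using D t by (intro ennreal_mult[symmetric]) (auto intro: order_trans[OF norm_ge_zero])
  finally show "(\<integral>\<^sup>+x. ennreal (cmod (z t x * (w x * \<theta> t))) \<partial>lbn n) \<le> ennreal (max 0 b * D)" .
 qed
 have D0: "D \<ge> 0" using D by (metis atLeastAtMost_iff norm_ge_zero order_refl order_trans zero_le_one)
 have cbn: "cmod (a * of_real (h v)) \<le> cmod (a * v)" if "h = Re \<or> h = Im" for h and a v :: complex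
  unfolding norm_mult using that abs_Re_le_cmod[of v] abs_Im_le_cmod[of v] by (auto intro!: mult_left_mono)
 have hm [measurable]: "h \<in> borel_measurable borel" if "h = Re \<or> h = Im" for h :: "complex \<Rightarrow> real"
  using that by auto
 show ih: "integrable (lbn n) (\<lambda>x. z t x * of_real (h (w x * \<theta> t)))" if h: "h = Re \<or> h = Im" and t: "t \<in> {0..1}" for h t
  by (rule Bochner_Integration.integrable_bound[OF i[OF t]]) (use hm[OF h] cbn[OF h] in \<open>measurable, auto\<close>)
 show oh: "integrable lborel (\<lambda>t. indicator {0..1} t *\<^sub>R (\<integral>x. z t x * of_real (h (w x * \<theta> t)) \<partial>lbn n))"
  if h: "h = Re \<or> h = Im" for h
 proof (rule integrable_bounded_on)
  have [measurable]: "h \<in> borel_measurable borel" by (rule hm[OF h])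
  show "(\<lambda>t. \<integral>x. z t x * of_real (h (w x * \<theta> t)) \<partial>lbn n) \<in> borel_measurable borel" by measurable
  show "\<forall>t\<in>{0..1}. cmod (\<integral>x. z t x * of_real (h (w x * \<theta> t)) \<partial>lbn n) \<le> max 0 b * D"
  proof
   fix t :: real assume t: "t \<in> {0..1}"
   have "ennreal (cmod (\<integral>x. z t x * of_real (h (w x * \<theta> t)) \<partial>lbn n)) \<le> (\<integral>\<^sup>+x. ennreal (cmod (z t x * of_real (h (w x * \<theta> t)))) \<partial>lbn n)"
    by (rule integral_norm_bound_ennreal[OF ih[OF h t]])
   also have "\<dots> \<le> (\<integral>\<^sup>+x. ennreal (cmod (z t x * (w x * \<theta> t))) \<partial>lbn n)"
    by (intro nn_integral_mono ennreal_leI cbn h)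
   also note ib[rule_format, OF t]
   finally show "cmod (\<integral>x. z t x * of_real (h (w x * \<theta> t)) \<partial>lbn n) \<le> max 0 b * D"
    using D0 by (subst (asm) ennreal_le_iff) auto
  qed
 qed
 have sp: "(\<integral>x. z t x * of_real (Re (w x * \<theta> t)) \<partial>lbn n) + \<i> * (\<integral>x. z t x * of_real (Im (w x * \<theta> t)) \<partial>lbn n) = (\<integral>x. z t x * w x \<partial>lbn n) * \<theta> t"
  if t: "t \<in> {0..1}" for t
 proof -
  have eq: "z t x * of_real (Re (w x * \<theta> t)) + \<i> * (z t x * of_real (Im (w x * \<theta> t))) = (z t x * w x) * \<theta> t" for x
  proof -
   have "z t x * of_real (Re v) + \<i> * (z t x * of_real (Im v)) = z t x * v" for v
    by (simp add: complex_eq_iff algebra_simps)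
   from this[of "w x * \<theta> t"] show ?thesis by (simp only: mult.assoc)
  qed
  have "(\<integral>x. z t x * of_real (Re (w x * \<theta> t)) \<partial>lbn n) + \<i> * (\<integral>x. z t x * of_real (Im (w x * \<theta> t)) \<partial>lbn n) =
    (\<integral>x. z t x * of_real (Re (w x * \<theta> t)) \<partial>lbn n) + (\<integral>x. \<i> * (z t x * of_real (Im (w x * \<theta> t))) \<partial>lbn n)"
   by simp
  also have "\<dots> = (\<integral>x. z t x * of_real (Re (w x * \<theta> t)) + \<i> * (z t x * of_real (Im (w x * \<theta> t))) \<partial>lbn n)"
   by (intro Bochner_Integration.integral_add[symmetric] integrable_mult_right ih t) auto
  also have "\<dots> = (\<integral>x. z t x * w x \<partial>lbn n) * \<theta> t" unfolding eq by simp
  finally show ?thesis .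
 qed
 have "(int_on 0 1 (\<lambda>t. \<integral>x. z t x * of_real (Re (w x * \<theta> t)) \<partial>lbn n)) +
   \<i> * (int_on 0 1 (\<lambda>t. \<integral>x. z t x * of_real (Im (w x * \<theta> t)) \<partial>lbn n)) =
   (\<integral>t. indicator {0..1} t *\<^sub>R (\<integral>x. z t x * of_real (Re (w x * \<theta> t)) \<partial>lbn n) +
   \<i> * (indicator {0..1} t *\<^sub>R (\<integral>x. z t x * of_real (Im (w x * \<theta> t)) \<partial>lbn n)) \<partial>lborel)"
  by (intro cintegral oh) auto
 moreover have comb: "indicator {0..1} t *\<^sub>R (\<integral>x. z t x * of_real (Re (w x * \<theta> t)) \<partial>lbn n) +
   \<i> * (indicator {0..1} t *\<^sub>R (\<integral>x. z t x * of_real (Im (w x * \<theta> t)) \<partial>lbn n)) = indicator {0..1} t *\<^sub>R ((\<integral>x. z t x * w x \<partial>lbn n) * \<theta> t)" for t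
  using sp[of t] by (simp split: split_indicator)
 ultimately show "(int_on 0 1 (\<lambda>t. \<integral>x. z t x * of_real (Re (w x * \<theta> t)) \<partial>lbn n)) +
   \<i> * (int_on 0 1 (\<lambda>t. \<integral>x. z t x * of_real (Im (w x * \<theta> t)) \<partial>lbn n)) =
   (int_on 0 1 (\<lambda>t. (\<integral>x. z t x * w x \<partial>lbn n) * \<theta> t))" by simp
 have "integrable lborel (\<lambda>t. indicator {0..1} t *\<^sub>R (\<integral>x. z t x * of_real (Re (w x * \<theta> t)) \<partial>lbn n) +
   \<i> * (indicator {0..1} t *\<^sub>R (\<integral>x. z t x * of_real (Im (w x * \<theta> t)) \<partial>lbn n)))"
  by (intro Bochner_Integration.integrable_add integrable_mult_right oh) auto
 then show "integrable lborel (\<lambda>t. indicator {0..1} t *\<^sub>R ((\<integral>x. z t x * w x \<partial>lbn n) * \<theta> t))"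
  unfolding comb .
qed

text \<open>With time as coordinate n, the product of a spatial tensor and \<theta> is a tensor with
  n + 1 factors, so \<open>pd_tens\<close> computes the time derivative and the Laplacian
  alike.\<close>

lemma weak_tensor:
 assumes f: "tests f" and \<theta>: "smooth \<theta>" and supp: "\<exists>\<epsilon>>0. \<forall>s. \<theta> s \<noteq> 0 \<longrightarrow> \<epsilon> \<le> s \<and> s \<le> 1 - \<epsilon>"
 shows "- (int_on 0 1 (\<lambda>t. pair U f t * vd \<theta> t)) = c * (int_on 0 1 (\<lambda>t. rhs f t * \<theta> t))"
proof -
 define F where "F = f(n := \<theta>)"
 have Fs: "smooth (F i)" if "i < Suc n" for i using f \<theta> that by (auto simp: F_def tests_def less_Suc_eq)
 have tensF: "tens (Suc n) F (x(n := t)) = tens n f x * \<theta> t" for x t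
  by (simp add: tens_def F_def mult.commute)
 have tens_time: "tens (Suc n) (F(n := vd (F n))) (x(n := t)) = tens n f x * vd \<theta> t" for x t
  by (simp add: tens_def F_def mult.commute)
 have tens_space: "tens (Suc n) (F(i := vd (vd (F i)))) (x(n := t)) = tens n (f(i := vd (vd (f i)))) x * \<theta> t"
  if "i < n" for x t i
  using that by (auto simp: tens_def F_def mult.commute intro!: arg_cong2[where f = "(*)"] prod.cong)
 from f obtain R where R: "\<And>i s. i < n \<Longrightarrow> f i s \<noteq> 0 \<Longrightarrow> \<bar>s\<bar> \<le> R" by (auto simp: tests_def)
 from supp obtain e where e: "e > 0" "\<And>s. \<theta> s \<noteq> 0 \<Longrightarrow> e \<le> s \<and> s \<le> 1 - e" by blast
 have test: "spacetime_test_function n (\<lambda>y. h (tens (Suc n) F y))" if h: "bounded_linear h" for h :: "complex \<Rightarrow> real"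
 proof -
  have h0: "h 0 = 0" by (rule linear_0[OF bounded_linear.linear[OF h]])
  have nz: "F i (y i) \<noteq> 0" if "h (tens (Suc n) F y) \<noteq> 0" "i < Suc n" for y i
  proof -
   have "tens (Suc n) F y \<noteq> 0" using that h0 by auto
   then show ?thesis using that by (simp add: tens_def del: prod.lessThan_Suc)
  qed
  have time: "e \<le> y n \<and> y n \<le> 1 - e" if "h (tens (Suc n) F y) \<noteq> 0" for y
   using nz[OF that, of n] e(2) by (auto simp: F_def)
  \<comment> \<open>The spatial coordinates are bounded by R, the time coordinate by 1.\<close>
  have "\<bar>y i\<bar> \<le> max R 1" if y: "h (tens (Suc n) F y) \<noteq> 0" "i < Suc n" for y i
  proof (cases "i = n")
   case True
   with time[OF y(1)] e(1) show ?thesis by auto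
  next
   case False
   with y nz[OF y] R[of i "y i"] show ?thesis by (auto simp: F_def)
  qed
  moreover have "C_k (Suc n) k (\<lambda>y. h (tens (Suc n) F y))" for k
   by (rule C_k_tens(1)[OF h]) (rule Fs)
  ultimately have "test_function (Suc n) (\<lambda>y. h (tens (Suc n) F y))"
   unfolding test_function_def by blast
  with time e(1) show ?thesis unfolding spacetime_test_function_def by blast
 qed
 have eqh: "- (int_on 0 1 (\<lambda>t. \<integral>x. U t x * of_real (h (tens n f x * vd \<theta> t)) \<partial>lbn n)) =
   c * (int_on 0 1 (\<lambda>t. \<integral>x. U t x * of_real (\<Sum>i<n. h (tens n (f(i := vd (vd (f i)))) x * \<theta> t)) +
      G t x * of_real (h (tens n f x * \<theta> t)) \<partial>lbn n))" if h: "bounded_linear h" for h :: "complex \<Rightarrow> real"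
 proof -
  have p1: "pd n (\<lambda>y. h (tens (Suc n) F y)) = (\<lambda>y. h (tens (Suc n) (F(n := vd (F n))) y))"
   by (rule pd_tens[OF h]) (use Fs in auto)
  have p2: "pd i (pd i (\<lambda>y. h (tens (Suc n) F y))) = (\<lambda>y. h (tens (Suc n) (F(i := vd (vd (F i)))) y))"
   if "i < n" for i
  proof -
   have "pd i (\<lambda>y. h (tens (Suc n) F y)) = (\<lambda>y. h (tens (Suc n) (F(i := vd (F i))) y))"
    by (rule pd_tens[OF h]) (use Fs that in auto)
   then show ?thesis using pd_tens[OF h, of i "Suc n" "F(i := vd (F i))"] Fs that by (simp add: smooth_vd)
  qed
  show ?thesis using weak[OF test[OF h]] unfolding p1 tens_time by (simp add: p2 tens_space tensF)
 qed
 from tests_bound[OF f] obtain bU bG where b: "\<forall>t\<in>{0..1}. (\<integral>\<^sup>+x. ennreal (cmod (U t x * tens n f x)) \<partial>lbn n) \<le> ennreal bU"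
  "\<forall>t\<in>{0..1}. (\<integral>\<^sup>+x. ennreal (cmod (G t x * tens n f x)) \<partial>lbn n) \<le> ennreal bG" by blast
 have "\<forall>i\<in>{..<n}. \<exists>b. \<forall>t\<in>{0..1}. (\<integral>\<^sup>+x. ennreal (cmod (U t x * tens n (f(i := vd (vd (f i)))) x)) \<partial>lbn n) \<le> ennreal b"
  using tests_bound(1)[OF tests_vd[OF f]] by blast
 then obtain bi where bi: "\<And>i t. i < n \<Longrightarrow> t \<in> {0..1} \<Longrightarrow> (\<integral>\<^sup>+x. ennreal (cmod (U t x * tens n (f(i := vd (vd (f i)))) x)) \<partial>lbn n) \<le> ennreal (bi i)"
  by (metis lessThan_iff)
 have fm [measurable]: "tens n f \<in> Bor n" using f by measurable
 have fim [measurable]: "tens n (f(i := vd (vd (f i)))) \<in> Bor n" if "i < n" for i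
  using tests_measurable[OF tests_vd[OF f that]] .
 have lapm [measurable]: "lap n f \<in> Bor n" unfolding lap_def[abs_def] by measurable
 have blap: "(\<integral>\<^sup>+x. ennreal (cmod (U t x * lap n f x)) \<partial>lbn n) \<le> ennreal (\<Sum>i<n. max 0 (bi i))" if t: "t \<in> {0..1}" for t
 proof -
  have [measurable]: "U t \<in> Bor n" using t by measurable
  have "(\<integral>\<^sup>+x. ennreal (cmod (U t x * lap n f x)) \<partial>lbn n) \<le> (\<integral>\<^sup>+x. (\<Sum>i<n. ennreal (cmod (U t x * tens n (f(i := vd (vd (f i)))) x))) \<partial>lbn n)"
   unfolding lap_def sum_distrib_left
   by (intro nn_integral_mono) (simp add: sum_ennreal ennreal_leI norm_sum)
  also have "\<dots> = (\<Sum>i<n. \<integral>\<^sup>+x. ennreal (cmod (U t x * tens n (f(i := vd (vd (f i)))) x)) \<partial>lbn n)"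
   by (rule nn_integral_sum) measurable
  also have "\<dots> \<le> (\<Sum>i<n. ennreal (max 0 (bi i)))"
   by (intro sum_mono order_trans[OF bi[OF _ t]] ennreal_leI) auto
  also have "\<dots> = ennreal (\<Sum>i<n. max 0 (bi i))" by (rule sum_ennreal) simp
  finally show ?thesis .
 qed
 then have blap': "\<forall>t\<in>{0..1}. (\<integral>\<^sup>+x. ennreal (cmod (U t x * lap n f x)) \<partial>lbn n) \<le> ennreal (\<Sum>i<n. max 0 (bi i))"
  by blast
 note S1 = split_test[OF smooth_vd(2)[OF \<theta>] U_meas fm b(1)]
 note S2 = split_test[OF \<theta> U_meas lapm blap']
 note S3 = split_test[OF \<theta> G_meas fm b(2)]
 define X where "X h = (int_on 0 1 (\<lambda>t. \<integral>x. U t x * of_real (h (tens n f x * vd \<theta> t)) \<partial>lbn n))" for h :: "complex \<Rightarrow> real"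
 define Y where "Y h = (int_on 0 1 (\<lambda>t. \<integral>x. U t x * of_real (h (lap n f x * \<theta> t)) \<partial>lbn n))" for h :: "complex \<Rightarrow> real"
 define Z where "Z h = (int_on 0 1 (\<lambda>t. \<integral>x. G t x * of_real (h (tens n f x * \<theta> t)) \<partial>lbn n))" for h :: "complex \<Rightarrow> real"
 have XYZ: "- X h = c * (Y h + Z h)" if h: "h = Re \<or> h = Im" for h
 proof -
  have bl: "bounded_linear h" using h bounded_linear_Re bounded_linear_Im by auto
  have hs: "(\<Sum>i<n. h (tens n (f(i := vd (vd (f i)))) x * \<theta> t)) = h (lap n f x * \<theta> t)" for x t
   unfolding lap_def sum_distrib_right by (rule linear_sum[OF bounded_linear.linear[OF bl], symmetric])
  have "(int_on 0 1 (\<lambda>t. \<integral>x. U t x * of_real (h (lap n f x * \<theta> t)) + G t x * of_real (h (tens n f x * \<theta> t)) \<partial>lbn n))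
    = (\<integral>t. indicator {0..1} t *\<^sub>R (\<integral>x. U t x * of_real (h (lap n f x * \<theta> t)) \<partial>lbn n) +
     indicator {0..1} t *\<^sub>R (\<integral>x. G t x * of_real (h (tens n f x * \<theta> t)) \<partial>lbn n) \<partial>lborel)"
   using S2(1)[OF h] S3(1)[OF h]
   by (intro Bochner_Integration.integral_cong refl) (simp split: split_indicator)
  also have "\<dots> = Y h + Z h"
   unfolding Y_def Z_def by (rule Bochner_Integration.integral_add[OF S2(2)[OF h] S3(2)[OF h]])
  finally show ?thesis using eqh[OF bl] unfolding hs X_def by simp
 qed
 have "- (int_on 0 1 (\<lambda>t. pair U f t * vd \<theta> t)) = - (X Re + \<i> * X Im)"
  using S1(3) unfolding X_def pair_def by simp
 also have "\<dots> = c * ((Y Re + \<i> * Y Im) + (Z Re + \<i> * Z Im))"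
 proof -
  have lin: "- x = c * (y + z) \<Longrightarrow> - x' = c * (y' + z') \<Longrightarrow> - (x + \<i> * x') = c * ((y + \<i> * y') + (z + \<i> * z'))"
   for x x' y y' z z' :: complex
  proof -
   assume 1: "- x = c * (y + z)" and 2: "- x' = c * (y' + z')"
   have "- (x + \<i> * x') = - x + \<i> * (- x')" by simp
   also have "\<dots> = c * ((y + \<i> * y') + (z + \<i> * z'))" unfolding 1 2 by (simp add: algebra_simps)
   finally show ?thesis .
  qed
  show ?thesis by (rule lin[OF XYZ XYZ]) simp_all
 qed
 also have "(Y Re + \<i> * Y Im) = (int_on 0 1 (\<lambda>t. (\<integral>x. U t x * lap n f x \<partial>lbn n) * \<theta> t))"
  using S2(3) unfolding Y_def by simp
 also have "(Z Re + \<i> * Z Im) = (int_on 0 1 (\<lambda>t. pair G f t * \<theta> t))"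
  using S3(3) unfolding Z_def pair_def by simp
 also have "(int_on 0 1 (\<lambda>t. (\<integral>x. U t x * lap n f x \<partial>lbn n) * \<theta> t)) + (int_on 0 1 (\<lambda>t. pair G f t * \<theta> t))
   = (int_on 0 1 (\<lambda>t. rhs f t * \<theta> t))"
 proof -
  have "rhs f t = (\<integral>x. U t x * lap n f x \<partial>lbn n) + pair G f t" if t: "t \<in> {0..1}" for t
   unfolding rhs_def lap_def sum_distrib_left pair_def
   by (subst Bochner_Integration.integral_sum) (auto intro!: pair_U(1) tests_vd f simp: t[simplified])
  then have "indicator {0..1} t *\<^sub>R (rhs f t * \<theta> t) = indicator {0..1} t *\<^sub>R ((\<integral>x. U t x * lap n f x \<partial>lbn n) * \<theta> t) +
    indicator {0..1} t *\<^sub>R (pair G f t * \<theta> t)" for t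
   by (simp add: algebra_simps split: split_indicator)
  then show ?thesis
   using S2(4) S3(4) unfolding pair_def by (simp add: Bochner_Integration.integral_add)
 qed
 finally show ?thesis .
qed

text \<open>The integrating factor is absorbed into the time factor of the test function, where it
  is an admissible smooth factor; its derivative produces the term with \<open>m\<close>.\<close>

lemma duhamel_compact:
 assumes f: "tests f" and t: "0 \<le> t0" "t0 \<le> t1" "t1 \<le> 1"
 shows "exp (- m * of_real t1) * pair U f t1 - exp (- m * of_real t0) * pair U f t0 =
  (int_on t0 t1 (\<lambda>s. exp (- m * of_real s) * (c * rhs f s - m * pair U f s)))"
proof (cases "t0 = t1")
 case True
 have "(int_on t1 t1 (\<lambda>s. exp (- m * of_real s) * (c * rhs f s - m * pair U f s))) = 0"
  by (rule integral_eq_zero_AE) (use AE_lborel_singleton[of t1] in \<open>eventually_elim, simp\<close>)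
 with True show ?thesis by simp
next
 case False
 let ?e = "\<lambda>s. exp (- m * of_real s)"
 let ?r = "\<lambda>s. ?e s * (c * rhs f s - m * pair U f s)"
 have [measurable]: "rhs f \<in> borel_measurable borel" "pair U f \<in> borel_measurable borel"
  by (rule rhs_bounded(2)[OF f], rule pair_U(3)[OF f])
 have es: "smooth ?e" by (rule smooth_exp)
 have [measurable]: "?e \<in> borel_measurable borel" by (rule smooth_borel[OF es])
 have "\<exists>b. \<forall>s\<in>{0..1}. cmod (?e s) \<le> b"
 proof -
  have "compact (?e ` {0..1})" by (intro compact_continuous_image continuous_on_subset[OF smooth_continuous[OF es]]) auto
  then show ?thesis using compact_imp_bounded bounded_iff by (metis imageI)
 qed
 then obtain be where be: "\<forall>s\<in>{0..1}. cmod (?e s) \<le> be" by blast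
 obtain br where br: "\<forall>s\<in>{0..1}. cmod (rhs f s) \<le> br" using rhs_bounded(1)[OF f] by blast
 obtain bp where bp: "\<forall>s\<in>{0..1}. cmod (pair U f s) \<le> bp" using pair_U(2)[OF f] by blast
 have rb: "\<forall>s\<in>{0..1}. cmod (?r s) \<le> be * (cmod c * br + cmod m * bp)"
 proof
  fix s :: real assume s: "s \<in> {0..1}"
  have "cmod (c * rhs f s - m * pair U f s) \<le> cmod c * br + cmod m * bp"
   using br bp s by (intro order_trans[OF norm_triangle_ineq4] add_mono) (auto simp: norm_mult intro: mult_left_mono)
  moreover have "cmod (?e s) \<le> be" using be s by blast
  moreover from this have "0 \<le> be" by (rule order_trans[OF norm_ge_zero])
  ultimately show "cmod (?r s) \<le> be * (cmod c * br + cmod m * bp)"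
   unfolding norm_mult[of "?e s"] by (intro mult_mono) auto
 qed
 show ?thesis
 proof (rule weak_derivative_ftc[where k = "\<lambda>s. ?e s * pair U f s" and r = ?r])
  show "continuous_on {0..1} (\<lambda>s. ?e s * pair U f s)"
   by (intro continuous_on_mult pair_U(4)[OF f] continuous_on_subset[OF smooth_continuous[OF es]]) auto
  show "?r \<in> borel_measurable borel" by measurable
  show "integrable lborel (\<lambda>s. indicator {0..1} s *\<^sub>R ?r s)" by (rule integrable_bounded_on[OF _ rb]) measurable
  show "0 \<le> t0" "t0 < t1" "t1 \<le> 1" using t False by auto
  fix \<theta> :: "real \<Rightarrow> complex" assume \<theta>: "smooth \<theta>" and supp: "\<exists>\<epsilon>>0. \<forall>s. \<theta> s \<noteq> 0 \<longrightarrow> \<epsilon> \<le> s \<and> s \<le> 1 - \<epsilon>"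
  have e\<theta>: "smooth (\<lambda>s. ?e s * \<theta> s)" by (intro smooth_mult es \<theta>)
  have [measurable]: "\<theta> \<in> borel_measurable borel" "vd \<theta> \<in> borel_measurable borel"
   by (rule smooth_borel[OF \<theta>], rule smooth_borel[OF smooth_vd(2)[OF \<theta>]])
  have vde: "vd (\<lambda>s. ?e s * \<theta> s) s = ?e s * vd \<theta> s - m * ?e s * \<theta> s" for s
   unfolding vd_mult[OF es \<theta>] vd_exp by simp
  have bd: "\<exists>b. \<forall>s\<in>{0..1}. cmod (g s) \<le> b" if "smooth g" for g :: "real \<Rightarrow> complex"
  proof -
   have "compact (g ` {0..1})" by (intro compact_continuous_image continuous_on_subset[OF smooth_continuous[OF that]]) auto
   then show ?thesis using compact_imp_bounded bounded_iff by (metis imageI)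
  qed
  have int: "integrable lborel (\<lambda>s. indicator {0..1} s *\<^sub>R (pair U f s * g s))" if g: "smooth g" for g
  proof -
   obtain b where b: "\<forall>s\<in>{0..1}. cmod (g s) \<le> b" using bd[OF g] by blast
   have [measurable]: "g \<in> borel_measurable borel" by (rule smooth_borel[OF g])
   show ?thesis
   proof (rule integrable_bounded_on)
    show "\<forall>s\<in>{0..1}. cmod (pair U f s * g s) \<le> bp * b"
     unfolding norm_mult using bp b by (intro ballI mult_mono) (auto intro: order_trans[OF norm_ge_zero])
   qed measurable
  qed
  have int': "integrable lborel (\<lambda>s. indicator {0..1} s *\<^sub>R (rhs f s * g s))" if g: "smooth g" for g
  proof -
   obtain b where b: "\<forall>s\<in>{0..1}. cmod (g s) \<le> b" using bd[OF g] by blast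
   have [measurable]: "g \<in> borel_measurable borel" by (rule smooth_borel[OF g])
   show ?thesis
   proof (rule integrable_bounded_on)
    show "\<forall>s\<in>{0..1}. cmod (rhs f s * g s) \<le> br * b"
     unfolding norm_mult using br b by (intro ballI mult_mono) (auto intro: order_trans[OF norm_ge_zero])
   qed measurable
  qed
  have "- (int_on 0 1 (\<lambda>s. pair U f s * vd (\<lambda>s. ?e s * \<theta> s) s)) = c * (int_on 0 1 (\<lambda>s. rhs f s * (?e s * \<theta> s)))"
   by (rule weak_tensor[OF f e\<theta>]) (use supp in auto)
  moreover have "(int_on 0 1 (\<lambda>s. pair U f s * vd (\<lambda>s. ?e s * \<theta> s) s)) =
    (int_on 0 1 (\<lambda>s. ?e s * pair U f s * vd \<theta> s)) - m * (int_on 0 1 (\<lambda>s. pair U f s * (?e s * \<theta> s)))"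
  proof -
   have "indicator {0..1} s *\<^sub>R (pair U f s * vd (\<lambda>s. ?e s * \<theta> s) s) =
     indicator {0..1} s *\<^sub>R (pair U f s * (?e s * vd \<theta> s)) - m * (indicator {0..1} s *\<^sub>R (pair U f s * (?e s * \<theta> s)))" for s
    unfolding vde by (simp add: algebra_simps split: split_indicator)
   then have "(int_on 0 1 (\<lambda>s. pair U f s * vd (\<lambda>s. ?e s * \<theta> s) s)) =
     (\<integral>s. indicator {0..1} s *\<^sub>R (pair U f s * (?e s * vd \<theta> s)) - m * (indicator {0..1} s *\<^sub>R (pair U f s * (?e s * \<theta> s))) \<partial>lborel)"
    by (simp only:)
   also have "\<dots> = (int_on 0 1 (\<lambda>s. pair U f s * (?e s * vd \<theta> s))) - m * (int_on 0 1 (\<lambda>s. pair U f s * (?e s * \<theta> s)))"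
    by (rule integral_diff_cmult[OF int[OF smooth_mult[OF es smooth_vd(2)[OF \<theta>]]] int[OF e\<theta>]])
   finally show ?thesis by (simp only: mult_ac)
  qed
  moreover have "(int_on 0 1 (\<lambda>s. ?r s * \<theta> s)) = c * (int_on 0 1 (\<lambda>s. rhs f s * (?e s * \<theta> s)))
    - m * (int_on 0 1 (\<lambda>s. pair U f s * (?e s * \<theta> s)))"
  proof -
   have "indicator {0..1} s *\<^sub>R (?r s * \<theta> s) =
     c * (indicator {0..1} s *\<^sub>R (rhs f s * (?e s * \<theta> s))) - m * (indicator {0..1} s *\<^sub>R (pair U f s * (?e s * \<theta> s)))" for s
    by (simp add: algebra_simps split: split_indicator)
   then have "(int_on 0 1 (\<lambda>s. ?r s * \<theta> s)) =
     (\<integral>s. c * (indicator {0..1} s *\<^sub>R (rhs f s * (?e s * \<theta> s))) - m * (indicator {0..1} s *\<^sub>R (pair U f s * (?e s * \<theta> s))) \<partial>lborel)"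
    by (simp only:)
   also have "\<dots> = (\<integral>s. c * (indicator {0..1} s *\<^sub>R (rhs f s * (?e s * \<theta> s))) \<partial>lborel) - m * (int_on 0 1 (\<lambda>s. pair U f s * (?e s * \<theta> s)))"
    by (rule integral_diff_cmult[OF integrable_mult_right[OF int'[OF e\<theta>]] int[OF e\<theta>]])
   finally show ?thesis by (simp only: integral_mult_right_zero)
  qed
  moreover have "- X = c * R \<Longrightarrow> X = P - m * Q \<Longrightarrow> Z = c * R - m * Q \<Longrightarrow> - P = Z" for X R P Q Z :: complex
   by (auto simp: algebra_simps)
  ultimately show "- (int_on 0 1 (\<lambda>s. ?e s * pair U f s * vd \<theta> s)) = (int_on 0 1 (\<lambda>s. ?r s * \<theta> s))"
   by blast
 qed
qed

end

section \<open>From compactly supported test functions to integrable ones\<close>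

lemma vd_cong_open:
 assumes "smooth f" "smooth g" "open T" "x \<in> T" "\<And>y. y \<in> T \<Longrightarrow> f y = g y"
 shows "vd f x = vd g x"
proof -
 have "(g has_vector_derivative vd f x) (at x)"
  by (rule has_vector_derivative_transform_within_open[OF smooth_vd(1)[OF assms(1)] assms(3,4)]) (rule assms(5))
 then show ?thesis using smooth_vd(1)[OF assms(2)] vector_derivative_unique_at by blast
qed

text \<open>A smooth cutoff of the interval [-k, k] whose transition has width 1 for every k.
  Therefore its derivatives are bounded uniformly in k.\<close>

definition cut :: "nat \<Rightarrow> real \<Rightarrow> real" where
 "cut k s = step (1 * s + (real k + 1)) * step ((-1) * s + (real k + 1))"

lemma smooth_cut: "smooth (cut k)"
 unfolding cut_def[abs_def] by (intro smooth_mult smooth_affine smooth_step)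

lemma cut_1: "\<bar>s\<bar> \<le> real k \<Longrightarrow> cut k s = 1"
 by (simp add: cut_def step_1)

lemma cut_0: "\<bar>s\<bar> > real k + 1 \<Longrightarrow> cut k s = 0"
 by (cases "s \<ge> 0") (auto simp: cut_def step_0)

lemma cut_bounds: "\<exists>C\<ge>1. \<forall>k s. \<bar>cut k s\<bar> \<le> C \<and> \<bar>vd (cut k) s\<bar> \<le> C \<and> \<bar>vd (vd (cut k)) s\<bar> \<le> C"
proof -
 obtain C where C: "C \<ge> 1" "\<And>x. \<bar>vd step x\<bar> \<le> C" "\<And>x. \<bar>vd (vd step) x\<bar> \<le> C" using step_derivatives_bounded by blast
 have s1: "\<bar>step x\<bar> \<le> 1" for x using step_bounds[of x] by simp
 define D where "D = 1 + 2 * C + (2 * C + 2 * (C * C))"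
 have D: "D \<ge> 1" "1 \<le> D" "2 * C \<le> D" "2 * C + 2 * (C * C) \<le> D" using C(1) by (auto simp: D_def)
 have "\<bar>cut k s\<bar> \<le> D \<and> \<bar>vd (cut k) s\<bar> \<le> D \<and> \<bar>vd (vd (cut k)) s\<bar> \<le> D" for k s
 proof -
  define a where "a = (\<lambda>s. step (1 * s + (real k + 1)))"
  define b where "b = (\<lambda>s. step ((-1) * s + (real k + 1)))"
  have sa: "smooth a" "smooth b" unfolding a_def b_def by (intro smooth_affine smooth_step)+
  have va: "vd a = (\<lambda>s. vd step (1 * s + (real k + 1)))"
   unfolding a_def by (subst vd_affine[OF smooth_step]) simp
  have vb: "vd b = (\<lambda>s. (-1) * vd step ((-1) * s + (real k + 1)))"
   unfolding b_def by (subst vd_affine[OF smooth_step]) simp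
  have vva: "vd (vd a) s = vd (vd step) (1 * s + (real k + 1))" for s
   unfolding va by (subst vd_affine[OF smooth_vd(2)[OF smooth_step]]) simp
  have vvb: "vd (vd b) s = vd (vd step) ((-1) * s + (real k + 1))" for s
   unfolding vb by (subst vd_cmult, intro smooth_affine smooth_vd smooth_step, subst vd_affine[OF smooth_vd(2)[OF smooth_step]]) simp
  have ab: "\<bar>a s\<bar> \<le> 1" "\<bar>b s\<bar> \<le> 1" "\<bar>vd a s\<bar> \<le> C" "\<bar>vd b s\<bar> \<le> C" "\<bar>vd (vd a) s\<bar> \<le> C" "\<bar>vd (vd b) s\<bar> \<le> C"
   unfolding vva vvb unfolding va vb unfolding a_def b_def using s1 C by (auto simp: abs_mult)
  have c: "cut k = (\<lambda>s. a s * b s)" by (simp add: cut_def[abs_def] a_def b_def)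
  have v1: "vd (cut k) = (\<lambda>s. a s * vd b s + vd a s * b s)" unfolding c by (rule vd_mult[OF sa])
  have v2: "vd (vd (cut k)) s = (a s * vd (vd b) s + vd a s * vd b s) + (vd a s * vd b s + vd (vd a) s * b s)"
   unfolding v1 by (subst vd_add) (auto intro!: smooth_mult smooth_vd sa simp: vd_mult sa smooth_vd)
  have m: "\<bar>x * y\<bar> \<le> p * q" if "\<bar>x\<bar> \<le> p" "\<bar>y\<bar> \<le> q" for x y p q :: real
   unfolding abs_mult using that by (intro mult_mono) auto
  have 0: "\<bar>cut k s\<bar> \<le> 1 * 1" unfolding c by (rule m) (rule ab)+
  have 1: "\<bar>vd (cut k) s\<bar> \<le> 1 * C + C * 1" unfolding v1
   by (rule order_trans[OF abs_triangle_ineq]) (intro add_mono m ab)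
  have 2: "\<bar>vd (vd (cut k)) s\<bar> \<le> (1 * C + C * C) + (C * C + C * 1)" unfolding v2
   by (rule order_trans[OF abs_triangle_ineq], rule add_mono; rule order_trans[OF abs_triangle_ineq]; intro add_mono m ab)
  from 0 1 2 D show ?thesis by auto
 qed
 with D(1) show ?thesis by blast
qed

definition cutf :: "nat \<Rightarrow> (real \<Rightarrow> complex) \<Rightarrow> real \<Rightarrow> complex" where
 "cutf k f s = of_real (cut k s) * f s"

lemma cutf:
 assumes f: "smooth f"
 shows "smooth (cutf k f)" and "\<bar>s\<bar> < real k \<Longrightarrow> cutf k f s = f s"
  "\<bar>s\<bar> < real k \<Longrightarrow> vd (vd (cutf k f)) s = vd (vd f) s"
  "cutf k f s \<noteq> 0 \<Longrightarrow> \<bar>s\<bar> \<le> real k + 1"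
proof -
 show sc: "smooth (cutf k f)" unfolding cutf_def[abs_def] by (intro smooth_mult smooth_of_real smooth_cut f)
 have op: "open {-real k<..<real k}" by simp
 have eq: "cutf k f s = f s" if "s \<in> {-real k<..<real k}" for s
  using that cut_1[of s k] by (simp add: cutf_def abs_le_iff)
 then have eq1: "vd (cutf k f) s = vd f s" if "s \<in> {-real k<..<real k}" for s
  by (rule vd_cong_open[OF sc f op that])
 have eq2: "vd (vd (cutf k f)) s = vd (vd f) s" if "s \<in> {-real k<..<real k}" for s
  by (rule vd_cong_open[OF smooth_vd(2)[OF sc] smooth_vd(2)[OF f] op that eq1])
 show "\<bar>s\<bar> < real k \<Longrightarrow> cutf k f s = f s" by (rule eq) (auto simp: abs_less_iff)
 show "\<bar>s\<bar> < real k \<Longrightarrow> vd (vd (cutf k f)) s = vd (vd f) s" by (rule eq2) (auto simp: abs_less_iff)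
 show "cutf k f s \<noteq> 0 \<Longrightarrow> \<bar>s\<bar> \<le> real k + 1" using cut_0[of k s] by (force simp: cutf_def)
qed

text \<open>The factor 4 counts the terms of the product rule for the second derivative.
  \<open>E\<close> depends neither on k nor on f, so one envelope dominates all truncations.\<close>

lemma cutf_bounds:
 "\<exists>E\<ge>1. \<forall>k f b. smooth f \<longrightarrow> (\<forall>s. cmod (f s) \<le> b s \<and> cmod (vd f s) \<le> b s \<and> cmod (vd (vd f) s) \<le> b s) \<longrightarrow>
  (\<forall>s. cmod (cutf k f s) \<le> E * b s \<and> cmod (vd (vd (cutf k f)) s) \<le> E * b s)"
proof -
 obtain C where C: "C \<ge> 1" "\<And>k s. \<bar>cut k s\<bar> \<le> C" "\<And>k s. \<bar>vd (cut k) s\<bar> \<le> C" "\<And>k s. \<bar>vd (vd (cut k)) s\<bar> \<le> C"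
  using cut_bounds by blast
 have "cmod (cutf k f s) \<le> (4 * C) * b s \<and> cmod (vd (vd (cutf k f)) s) \<le> (4 * C) * b s"
  if f: "smooth f" and b: "\<forall>s. cmod (f s) \<le> b s \<and> cmod (vd f s) \<le> b s \<and> cmod (vd (vd f) s) \<le> b s" for k f b s
 proof -
  let ?c = "\<lambda>s. complex_of_real (cut k s)"
  have sc: "smooth ?c" by (intro smooth_of_real smooth_cut)
  have vc: "vd ?c = (\<lambda>s. of_real (vd (cut k) s))" by (rule vd_of_real[OF smooth_cut])
  have vvc: "vd (vd ?c) = (\<lambda>s. of_real (vd (vd (cut k)) s))" unfolding vc by (rule vd_of_real[OF smooth_vd(2)[OF smooth_cut]])
  have v1: "vd (cutf k f) = (\<lambda>s. ?c s * vd f s + vd ?c s * f s)" unfolding cutf_def[abs_def] by (rule vd_mult[OF sc f])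
  have v2: "vd (vd (cutf k f)) s = (?c s * vd (vd f) s + vd ?c s * vd f s) + (vd ?c s * vd f s + vd (vd ?c) s * f s)"
   unfolding v1 by (subst vd_add) (auto intro!: smooth_mult smooth_vd sc f simp: vd_mult sc f smooth_vd)
  have b0: "b s \<ge> 0" using b norm_ge_zero order_trans by blast
  have m: "cmod (of_real x * z) \<le> C * b s" if "\<bar>x\<bar> \<le> C" "cmod z \<le> b s" for x z
   using that by (auto simp: norm_mult intro!: mult_mono)
  have "cmod (cutf k f s) \<le> C * b s" unfolding cutf_def by (rule m) (use C b in auto)
  moreover have "cmod (vd (vd (cutf k f)) s) \<le> (C * b s + C * b s) + (C * b s + C * b s)"
   unfolding v2 unfolding vvc unfolding vc
   by (rule order_trans[OF norm_triangle_ineq], rule add_mono; rule order_trans[OF norm_triangle_ineq]; intro add_mono m) (use C b in auto)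
  moreover have "C * b s \<ge> 0" using C(1) b0 by simp
  ultimately show ?thesis by (auto simp: algebra_simps)
 qed
 moreover have "4 * C \<ge> 1" using C by simp
 ultimately show ?thesis by blast
qed

context heat_solution
begin

text \<open>At a given point a truncation and its second derivatives agree with the original for all
  large k, and E^n times the product of the envelopes dominates them. Dominated convergence is used
  in x for the pairings and then in time, where the pairings are bounded uniformly in k.\<close>

lemma duhamel_dominated:
 assumes f: "\<And>i. i < n \<Longrightarrow> smooth (f i)"
  and fb: "\<And>i s. i < n \<Longrightarrow> cmod (f i s) \<le> b i s \<and> cmod (vd (f i) s) \<le> b i s \<and> cmod (vd (vd (f i)) s) \<le> b i s"
  and bm [measurable]: "\<And>i. i < n \<Longrightarrow> b i \<in> borel_measurable borel"
  and dom: "\<And>t. t \<in> {0..1} \<Longrightarrow> (\<integral>\<^sup>+x. ennreal ((\<Prod>i<n. b i (x i)) * (cmod (U t x) + cmod (G t x))) \<partial>lbn n) \<le> ennreal C"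
  and t: "0 \<le> t0" "t0 \<le> t1" "t1 \<le> 1"
 shows "exp (- m * of_real t1) * pair U f t1 - exp (- m * of_real t0) * pair U f t0 =
  (int_on t0 t1 (\<lambda>s. exp (- m * of_real s) * (c * rhs f s - m * pair U f s)))"
proof -
 obtain E where E: "E \<ge> 1" and Eb: "\<And>k f b. smooth f \<Longrightarrow> (\<forall>s. cmod (f s) \<le> b s \<and> cmod (vd f s) \<le> b s \<and> cmod (vd (vd f) s) \<le> b s) \<Longrightarrow>
  (\<forall>s. cmod (cutf k f s) \<le> E * b s \<and> cmod (vd (vd (cutf k f)) s) \<le> E * b s)"
  using cutf_bounds by metis
 define F where "F k i = cutf k (f i)" for k i
 define T where "T g = (\<lambda>k. tens n (g k))" for g :: "nat \<Rightarrow> nat \<Rightarrow> real \<Rightarrow> complex"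
 have tF: "tests (F k)" for k
  unfolding tests_def F_def using cutf(1,4)[OF f] by blast
 have Fb: "cmod (F k i s) \<le> E * b i s" "cmod (vd (vd (F k i)) s) \<le> E * b i s" if "i < n" for k i s
  using Eb[OF f[OF that], of "b i" k] fb[OF that] unfolding F_def by blast+
 have b0: "b i s \<ge> 0" if "i < n" for i s using fb[OF that, of s] norm_ge_zero order_trans by blast
 define Bx where "Bx x = (\<Prod>i<n. b i (x i))" for x :: "nat \<Rightarrow> real"
 have Bx0: "Bx x \<ge> 0" for x unfolding Bx_def by (intro prod_nonneg) (auto intro: b0)
 have [measurable]: "(\<lambda>x. b i (x i)) \<in> Bor n" if "i < n" for i
  using that by (intro measurable_compose[OF _ bm[OF that]]) simp
 have [measurable]: "Bx \<in> Bor n" unfolding Bx_def[abs_def] by measurable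
 have tens_le: "cmod (tens n g x) \<le> E ^ n * Bx x" if "\<And>i s. i < n \<Longrightarrow> cmod (g i s) \<le> E * b i s" for g x
 proof -
  have "cmod (tens n g x) = (\<Prod>i<n. cmod (g i (x i)))" by (simp add: tens_def prod_norm)
  also have "\<dots> \<le> (\<Prod>i<n. E * b i (x i))" by (intro prod_mono) (auto intro: that)
  finally show ?thesis by (simp add: prod.distrib Bx_def)
 qed
 have general: "(\<forall>t\<in>{0..1}. (\<lambda>k. pair W (g k) t) \<longlonglongrightarrow> pair W h t) \<and> (\<forall>k. \<forall>t\<in>{0..1}. cmod (pair W (g k) t) \<le> E ^ n * max 0 C)"
  if W: "W = U \<or> W = G" and gm: "\<And>k. tens n (g k) \<in> Bor n" "tens n h \<in> Bor n"
   and gb: "\<And>k i s. i < n \<Longrightarrow> cmod (g k i s) \<le> E * b i s"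
   and lim: "\<And>i s. i < n \<Longrightarrow> eventually (\<lambda>k. g k i s = h i s) sequentially" for W g h
 proof -
  note [measurable] = gm
  have [measurable]: "W t \<in> Bor n" if "t \<in> {0..1}" for t using W that by auto
  have Wd: "(\<integral>\<^sup>+x. ennreal (E ^ n * Bx x * cmod (W t x)) \<partial>lbn n) \<le> ennreal (E ^ n * max 0 C)" if t: "t \<in> {0..1}" for t
  proof -
   have [measurable]: "U t \<in> Bor n" "G t \<in> Bor n" using t by auto
   have "(\<integral>\<^sup>+x. ennreal (E ^ n * Bx x * cmod (W t x)) \<partial>lbn n) \<le> (\<integral>\<^sup>+x. ennreal (E ^ n) * ennreal (Bx x * (cmod (U t x) + cmod (G t x))) \<partial>lbn n)"
   proof (intro nn_integral_mono)
    fix x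
    have "Bx x * cmod (W t x) \<le> Bx x * (cmod (U t x) + cmod (G t x))" using W Bx0 by (intro mult_left_mono) auto
    then have "E ^ n * Bx x * cmod (W t x) \<le> E ^ n * (Bx x * (cmod (U t x) + cmod (G t x)))"
     using E unfolding mult.assoc by (intro mult_left_mono[where c = "E ^ n"]) auto
    then show "ennreal (E ^ n * Bx x * cmod (W t x)) \<le> ennreal (E ^ n) * ennreal (Bx x * (cmod (U t x) + cmod (G t x)))"
     using E Bx0 by (subst ennreal_mult[symmetric]) (auto intro: ennreal_leI)
   qed
   also have "\<dots> = ennreal (E ^ n) * (\<integral>\<^sup>+x. ennreal (Bx x * (cmod (U t x) + cmod (G t x))) \<partial>lbn n)"
    by (rule nn_integral_cmult) measurable
   also have "\<dots> \<le> ennreal (E ^ n) * ennreal (max 0 C)"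
    using dom[OF t] unfolding Bx_def[symmetric] by (intro mult_left_mono order_trans[OF dom[OF t, folded Bx_def]] ennreal_leI) auto
   also have "\<dots> = ennreal (E ^ n * max 0 C)" using E by (intro ennreal_mult[symmetric]) auto
   finally show ?thesis .
  qed
  have wi: "integrable (lbn n) (\<lambda>x. E ^ n * Bx x * cmod (W t x))" if t: "t \<in> {0..1}" for t
  proof (rule integrableI_bounded)
   have [measurable]: "W t \<in> Bor n" using W t by auto
   show "(\<lambda>x. E ^ n * Bx x * cmod (W t x)) \<in> Bor n" by measurable
   have "norm (E ^ n * Bx x * cmod (W t x)) = E ^ n * Bx x * cmod (W t x)" for x using E Bx0 by (simp add: abs_mult)
   then show "(\<integral>\<^sup>+x. ennreal (norm (E ^ n * Bx x * cmod (W t x))) \<partial>lbn n) < \<infinity>"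
    using Wd[OF t] by (simp add: le_less_trans[OF _ ennreal_less_top])
  qed
  have nb: "cmod (W t x * tens n (g k) x) \<le> E ^ n * Bx x * cmod (W t x)" for k t x
   unfolding norm_mult using tens_le[of "g k" x] gb by (simp add: mult.commute mult_left_mono)
  have "(\<lambda>k. pair W (g k) t) \<longlonglongrightarrow> pair W h t" if t: "t \<in> {0..1}" for t
   unfolding pair_def
  proof (rule integral_dominated_convergence[OF _ _ wi[OF t]])
   have [measurable]: "W t \<in> Bor n" using W t by auto
   show "(\<lambda>x. W t x * tens n h x) \<in> Bor n" "(\<lambda>x. W t x * tens n (g k) x) \<in> Bor n" for k
    by measurable
   show "AE x in lbn n. (\<lambda>k. W t x * tens n (g k) x) \<longlonglongrightarrow> W t x * tens n h x"
   proof (rule AE_I2)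
    fix x
    have "eventually (\<lambda>k. \<forall>i\<in>{..<n}. g k i (x i) = h i (x i)) sequentially"
     by (intro eventually_ball_finite) (auto intro: lim)
    then have "eventually (\<lambda>k. W t x * tens n (g k) x = W t x * tens n h x) sequentially"
     by eventually_elim (simp add: tens_def)
    then show "(\<lambda>k. W t x * tens n (g k) x) \<longlonglongrightarrow> W t x * tens n h x" by (rule tendsto_eventually)
   qed
   show "AE x in lbn n. norm (W t x * tens n (g k) x) \<le> E ^ n * Bx x * cmod (W t x)" for k
    using nb by auto
  qed
  moreover have "cmod (pair W (g k) t) \<le> E ^ n * max 0 C" if t: "t \<in> {0..1}" for t k
  proof -
   have [measurable]: "W t \<in> Bor n" using W t by auto
   have "integrable (lbn n) (\<lambda>x. W t x * tens n (g k) x)"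
   proof (rule Bochner_Integration.integrable_bound[OF wi[OF t]])
    show "(\<lambda>x. W t x * tens n (g k) x) \<in> Bor n" by measurable
    have "norm (W t x * tens n (g k) x) \<le> norm (E ^ n * Bx x * cmod (W t x))" for x
     unfolding real_norm_def by (rule order_trans[OF nb abs_ge_self])
    then show "AE x in lbn n. norm (W t x * tens n (g k) x) \<le> norm (E ^ n * Bx x * cmod (W t x))" by simp
   qed
   then have "ennreal (cmod (pair W (g k) t)) \<le> (\<integral>\<^sup>+x. ennreal (cmod (W t x * tens n (g k) x)) \<partial>lbn n)"
    unfolding pair_def by (rule integral_norm_bound_ennreal)
   also have "\<dots> \<le> (\<integral>\<^sup>+x. ennreal (E ^ n * Bx x * cmod (W t x)) \<partial>lbn n)" by (intro nn_integral_mono ennreal_leI nb)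
   also note Wd[OF t]
   finally show ?thesis using E by (subst (asm) ennreal_le_iff) auto
  qed
  ultimately show ?thesis by blast
 qed
 have evk: "eventually (\<lambda>k. \<bar>s\<bar> < real k) sequentially" for s :: real
  using eventually_gt_at_top[of "nat \<lceil>\<bar>s\<bar>\<rceil>"] by eventually_elim linarith
 have fup: "smooth ((f(i := vd (vd (f i)))) j)" if "i < n" "j < n" for i j using f that by (auto simp: smooth_vd)
 have PU: "\<forall>t\<in>{0..1}. (\<lambda>k. pair U (F k) t) \<longlonglongrightarrow> pair U f t" "\<forall>k. \<forall>t\<in>{0..1}. cmod (pair U (F k) t) \<le> E ^ n * max 0 C"
  "\<forall>t\<in>{0..1}. (\<lambda>k. pair G (F k) t) \<longlonglongrightarrow> pair G f t" "\<forall>k. \<forall>t\<in>{0..1}. cmod (pair G (F k) t) \<le> E ^ n * max 0 C"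
 proof -
  have 1: "tens n (F k) \<in> Bor n" for k by (rule tests_measurable[OF tF])
  have 2: "tens n f \<in> Bor n" by (rule smooth_tens_measurable[OF f])
  have 3: "eventually (\<lambda>k. F k i s = f i s) sequentially" if "i < n" for i s
   using evk[of s] unfolding F_def by eventually_elim (rule cutf(2)[OF f[OF that]])
  show "\<forall>t\<in>{0..1}. (\<lambda>k. pair U (F k) t) \<longlonglongrightarrow> pair U f t" "\<forall>k. \<forall>t\<in>{0..1}. cmod (pair U (F k) t) \<le> E ^ n * max 0 C"
   using general[of U F f, OF _ 1 2 Fb(1) 3] by blast+
  show "\<forall>t\<in>{0..1}. (\<lambda>k. pair G (F k) t) \<longlonglongrightarrow> pair G f t" "\<forall>k. \<forall>t\<in>{0..1}. cmod (pair G (F k) t) \<le> E ^ n * max 0 C"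
   using general[of G F f, OF _ 1 2 Fb(1) 3] by blast+
 qed
 have PL: "(\<forall>t\<in>{0..1}. (\<lambda>k. pair U ((F k)(i := vd (vd (F k i)))) t) \<longlonglongrightarrow> pair U (f(i := vd (vd (f i)))) t) \<and>
  (\<forall>k. \<forall>t\<in>{0..1}. cmod (pair U ((F k)(i := vd (vd (F k i)))) t) \<le> E ^ n * max 0 C)" if i: "i < n" for i
 proof (rule general)
  show "tens n ((F k)(i := vd (vd (F k i)))) \<in> Bor n" for k
   by (rule tests_measurable[OF tests_vd[OF tF i]])
  show "tens n (f(i := vd (vd (f i)))) \<in> Bor n" by (rule smooth_tens_measurable[OF fup[OF i]])
  show "cmod (((F k)(i := vd (vd (F k i)))) j s) \<le> E * b j s" if "j < n" for k j s using Fb[OF that] Fb[OF i] by auto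
  show "eventually (\<lambda>k. ((F k)(i := vd (vd (F k i)))) j s = (f(i := vd (vd (f i)))) j s) sequentially" if "j < n" for j s
   using evk[of s] unfolding F_def by eventually_elim (use cutf(2,3)[OF f[OF that]] in auto)
 qed simp
 define Q where "Q = real n * (E ^ n * max 0 C) + E ^ n * max 0 C"
 have R: "(\<lambda>k. rhs (F k) t) \<longlonglongrightarrow> rhs f t" "cmod (rhs (F k) t) \<le> Q" if t: "t \<in> {0..1}" for t k
 proof -
  show "(\<lambda>k. rhs (F k) t) \<longlonglongrightarrow> rhs f t"
   unfolding rhs_def using PL PU(3) t by (intro tendsto_add tendsto_sum) auto
  have "cmod (rhs (F k) t) \<le> (\<Sum>i<n. cmod (pair U ((F k)(i := vd (vd (F k i)))) t)) + cmod (pair G (F k) t)"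
   unfolding rhs_def by (intro order_trans[OF norm_triangle_ineq] add_mono norm_sum) auto
  also have "\<dots> \<le> (\<Sum>i<n. E ^ n * max 0 C) + E ^ n * max 0 C"
   using PL PU(4) t by (intro add_mono sum_mono) auto
  finally show "cmod (rhs (F k) t) \<le> Q" by (simp add: Q_def)
 qed
 let ?e = "\<lambda>s. exp (- m * complex_of_real s)"
 have eq: "?e t1 * pair U (F k) t1 - ?e t0 * pair U (F k) t0 =
  (int_on t0 t1 (\<lambda>s. ?e s * (c * rhs (F k) s - m * pair U (F k) s)))" for k
  by (rule duhamel_compact[OF tF t])
 have l1: "(\<lambda>k. ?e t1 * pair U (F k) t1 - ?e t0 * pair U (F k) t0) \<longlonglongrightarrow> ?e t1 * pair U f t1 - ?e t0 * pair U f t0"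
  using PU(1) t by (intro tendsto_intros) auto
 have em: "?e \<in> borel_measurable borel" by (rule smooth_borel[OF smooth_exp])
 have be: "cmod (?e s) \<le> exp \<bar>Re m\<bar>" if "s \<in> {0..1}" for s
 proof -
  have "- Re m * s \<le> \<bar>Re m * s\<bar>" by simp
  also have "\<dots> \<le> \<bar>Re m\<bar>" using that by (simp add: abs_mult mult_left_le)
  finally show ?thesis by simp
 qed
 have [measurable]: "pair U f \<in> borel_measurable borel" "rhs f \<in> borel_measurable borel"
 proof -
  have [measurable]: "tens n f \<in> Bor n" by (rule smooth_tens_measurable[OF f])
  have u [measurable]: "tens n (f(i := vd (vd (f i)))) \<in> Bor n" if "i < n" for i
   by (rule smooth_tens_measurable[OF fup[OF that]])
  show "pair U f \<in> borel_measurable borel" unfolding pair_def[abs_def] by measurable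
  show "rhs f \<in> borel_measurable borel" unfolding rhs_def[abs_def] pair_def by measurable
 qed
 have "(\<lambda>k. \<integral>s. indicator {t0..t1} s *\<^sub>R (?e s * (c * rhs (F k) s - m * pair U (F k) s)) \<partial>lborel) \<longlonglongrightarrow>
   (int_on t0 t1 (\<lambda>s. ?e s * (c * rhs f s - m * pair U f s)))"
 proof (rule integral_dominated_convergence[where w = "\<lambda>s::real. (exp \<bar>Re m\<bar> * (cmod c * Q + cmod m * (E ^ n * max 0 C))) * indicator {0..1} s"])
  note [measurable] = em rhs_bounded(2)[OF tF] pair_U(3)[OF tF]
  show "(\<lambda>s. indicator {t0..t1} s *\<^sub>R (?e s * (c * rhs f s - m * pair U f s))) \<in> borel_measurable lborel" by measurable
  show "(\<lambda>s. indicator {t0..t1} s *\<^sub>R (?e s * (c * rhs (F k) s - m * pair U (F k) s))) \<in> borel_measurable lborel" for k by measurable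
  show "integrable lborel (\<lambda>s::real. (exp \<bar>Re m\<bar> * (cmod c * Q + cmod m * (E ^ n * max 0 C))) * indicator {0..1} s)"
   by (intro integrable_mult_right integrable_real_indicator) simp_all
  show "AE s in lborel. (\<lambda>k. indicator {t0..t1} s *\<^sub>R (?e s * (c * rhs (F k) s - m * pair U (F k) s))) \<longlonglongrightarrow>
    indicator {t0..t1} s *\<^sub>R (?e s * (c * rhs f s - m * pair U f s))"
  proof (rule AE_I2)
   fix s :: real
   show "(\<lambda>k. indicator {t0..t1} s *\<^sub>R (?e s * (c * rhs (F k) s - m * pair U (F k) s))) \<longlonglongrightarrow>
    indicator {t0..t1} s *\<^sub>R (?e s * (c * rhs f s - m * pair U f s))"
   proof (cases "s \<in> {t0..t1}")
    case True
    then have "s \<in> {0..1}" using t by auto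
    then show ?thesis using PU(1) R(1) by (intro tendsto_intros) auto
   qed simp
  qed
  show "AE s in lborel. norm (indicator {t0..t1} s *\<^sub>R (?e s * (c * rhs (F k) s - m * pair U (F k) s))) \<le>
    (exp \<bar>Re m\<bar> * (cmod c * Q + cmod m * (E ^ n * max 0 C))) * indicator {0..1} s" for k
  proof (rule AE_I2)
   fix s :: real
   show "norm (indicator {t0..t1} s *\<^sub>R (?e s * (c * rhs (F k) s - m * pair U (F k) s))) \<le>
    (exp \<bar>Re m\<bar> * (cmod c * Q + cmod m * (E ^ n * max 0 C))) * indicator {0..1} s"
   proof (cases "s \<in> {t0..t1}")
    case True
    then have s: "s \<in> {0..1}" using t by auto
    have "cmod (c * rhs (F k) s - m * pair U (F k) s) \<le> cmod c * Q + cmod m * (E ^ n * max 0 C)"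
     using R(2)[OF s] PU(2) s by (intro order_trans[OF norm_triangle_ineq4] add_mono) (auto simp: norm_mult intro!: mult_left_mono)
    then have "cmod (?e s * (c * rhs (F k) s - m * pair U (F k) s)) \<le> exp \<bar>Re m\<bar> * (cmod c * Q + cmod m * (E ^ n * max 0 C))"
     unfolding norm_mult[of "?e s"] using be[OF s] by (intro mult_mono) auto
    with True s show ?thesis by simp
   next
    case False
    have "Q \<ge> 0" using E by (simp add: Q_def)
    then have "(exp \<bar>Re m\<bar> * (cmod c * Q + cmod m * (E ^ n * max 0 C))) * indicator {0..1} s \<ge> 0" using E by simp
    moreover have "indicator {t0..t1} s = (0 :: real)" using False by simp
    ultimately show ?thesis by (simp only: scaleR_zero_left norm_zero)
   qed
  qed
 qed
 with l1 show ?thesis unfolding eq by (rule LIMSEQ_unique)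
qed

end

subsection \<open>The one-dimensional weights\<close>

lemma cosh_even_sums: "(\<lambda>k. x ^ (2 * k) / fact (2 * k)) sums cosh (x::real)"
proof -
 have "(\<lambda>n. if even n then x ^ n /\<^sub>R fact n else 0) sums cosh x" by (rule cosh_converges)
 then have "(\<lambda>n. (\<lambda>n. if even n then x ^ n /\<^sub>R fact n else 0) (2 * n)) sums cosh x"
  by (subst sums_mono_reindex[where g = "\<lambda>n. 2 * n"]) (auto simp: strict_mono_def elim!: evenE)
 then show ?thesis by (simp add: field_simps)
qed

lemma cosh_lower: "1 + x\<^sup>2 / 2 \<le> cosh (x::real)"
proof -
 have "(\<Sum>k<2. x ^ (2 * k) / fact (2 * k)) \<le> cosh x"
  using sum_le_suminf[of "\<lambda>k. x ^ (2 * k) / fact (2 * k)" "{..<2}"] cosh_even_sums[of x]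
  by (simp add: sums_iff)
 then show ?thesis by (simp add: numeral_2_eq_2)
qed

text \<open>The power series are compared term by term through 2^k k! <= (2k)!. The exponent x^2/2
  agrees with cosh to second order, so rescaled powers of cosh converge to the Gaussian from
  below.\<close>

lemma cosh_le_exp_sq: "cosh x \<le> exp (x\<^sup>2 / 2 :: real)"
proof -
 have f: "2 ^ k * fact k \<le> (fact (2 * k) :: real)" for k
 proof (induction k)
  case (Suc k)
  have "2 ^ Suc k * fact (Suc k) = (2 * real (Suc k)) * (2 ^ k * fact k)" by simp
  also have "\<dots> \<le> (2 * real (Suc k)) * fact (2 * k)" using Suc by (intro mult_left_mono) auto
  also have "\<dots> \<le> (2 * real (Suc k)) * (real (Suc (2 * k)) * fact (2 * k))"
   by (intro mult_left_mono) (auto simp: algebra_simps intro: add_increasing)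
  also have "\<dots> = fact (2 * Suc k)" by (simp add: algebra_simps)
  finally show ?case .
 qed simp
 have "(\<lambda>k. (x\<^sup>2 / 2) ^ k /\<^sub>R fact k) sums exp (x\<^sup>2 / 2)" by (rule exp_converges)
 moreover have "x ^ (2 * k) / fact (2 * k) \<le> (x\<^sup>2 / 2) ^ k /\<^sub>R fact k" for k
 proof -
  have "(x\<^sup>2) ^ k / fact (2 * k) \<le> (x\<^sup>2) ^ k / (2 ^ k * fact k)"
   using f[of k] by (intro divide_left_mono) auto
  also have "\<dots> = (x\<^sup>2 / 2) ^ k /\<^sub>R fact k" by (simp add: power_divide field_simps)
  finally show ?thesis by (simp only: power_mult)
 qed
 ultimately show ?thesis by (intro sums_le[OF _ cosh_even_sums[of x]])
qed

text \<open>The square of 1 + s^2/2 exceeds 1 + s^2, so 1/(1 + s^2) is an integrable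
  majorant.\<close>

lemma sech_L2: "sq_int lborel (\<lambda>s. 1 / cosh (s::real)) < \<infinity>"
proof -
 have "sq_int lborel (\<lambda>s. 1 / cosh (s::real)) \<le> (\<integral>\<^sup>+s. ennreal (norm (inverse (1 + (s::real)\<^sup>2))) \<partial>lborel)"
 proof (intro nn_integral_mono ennreal_leI)
  fix s :: real
  have "(1 + s\<^sup>2 / 2)\<^sup>2 = 1 + s\<^sup>2 + (s\<^sup>2)\<^sup>2 / 4" by (simp add: power2_eq_square field_simps)
  then have "1 + s\<^sup>2 \<le> (1 + s\<^sup>2 / 2)\<^sup>2" by simp
  also have "\<dots> \<le> (cosh s)\<^sup>2" by (intro power_mono cosh_lower) (auto intro: add_nonneg_nonneg)
  finally have "1 + s\<^sup>2 \<le> (cosh s)\<^sup>2" .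
  then have "inverse ((cosh s)\<^sup>2) \<le> inverse (1 + s\<^sup>2)" by (intro le_imp_inverse_le) (auto intro: add_pos_nonneg)
  then have "inverse ((cosh s)\<^sup>2) \<le> norm (inverse (1 + s\<^sup>2))"
   unfolding real_norm_def by (rule order_trans[OF _ abs_ge_self])
  then show "(1 / cosh s)\<^sup>2 \<le> norm (inverse (1 + s\<^sup>2))"
   by (simp only: power_one_over inverse_eq_divide)
 qed
 also have "\<dots> < \<infinity>"
  using integrable_inverse_1_plus_square by (simp add: set_integrable_def integrable_iff_bounded)
 finally show ?thesis .
qed

text \<open>A bounded replacement for cosh(l s), equal to it for d = 0 and decaying like sech/d
  otherwise. Compared with a cutoff, the reciprocal of a sum has the advantage that its logarithmic
  derivatives are bounded independently of \<open>d\<close>.\<close>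

definition wt :: "real \<Rightarrow> real \<Rightarrow> real \<Rightarrow> real" where
 "wt l d s = inverse (inverse (cosh (l * s)) + d * cosh (l * s))"

lemma cosh_ne_0 [simp]: "cosh (x::real) \<noteq> 0" using cosh_real_pos[of x] by linarith

lemma smooth_wt: "d \<ge> 0 \<Longrightarrow> smooth (wt l d)"
 unfolding wt_def[abs_def]
proof (intro smooth_inverse smooth_add smooth_cmult smooth_cosh)
 fix x assume "d \<ge> 0"
 then have "inverse (cosh (l * x)) + d * cosh (l * x) > 0" by (intro add_pos_nonneg) auto
 then show "inverse (cosh (l * x)) + d * cosh (l * x) \<noteq> 0" by simp
qed simp

lemma wt_pos: "d \<ge> 0 \<Longrightarrow> wt l d s > 0"
 unfolding wt_def by (intro positive_imp_inverse_positive add_pos_nonneg) auto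

lemma wt_le_cosh: "d \<ge> 0 \<Longrightarrow> wt l d s \<le> cosh (l * s)"
proof -
 assume "d \<ge> 0"
 then have "inverse (inverse (cosh (l * s)) + d * cosh (l * s)) \<le> inverse (inverse (cosh (l * s)))"
  by (intro le_imp_inverse_le) auto
 then show ?thesis by (simp add: wt_def)
qed

lemma wt_le_sech: "d > 0 \<Longrightarrow> wt l d s \<le> (1 / d) * (1 / cosh (l * s))"
proof -
 assume d: "d > 0"
 then have "inverse (inverse (cosh (l * s)) + d * cosh (l * s)) \<le> inverse (d * cosh (l * s))"
  by (intro le_imp_inverse_le) auto
 then show ?thesis using d by (simp add: wt_def field_simps)
qed

lemma wt_tendsto: "(\<lambda>k. wt l (1 / real (Suc k)) s) \<longlonglongrightarrow> cosh (l * s)"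
proof -
 have "(\<lambda>k. 1 / real (Suc k)) \<longlonglongrightarrow> 0" by real_asymp
 then have "(\<lambda>k. wt l (1 / real (Suc k)) s) \<longlonglongrightarrow> inverse (inverse (cosh (l * s)) + 0 * cosh (l * s))"
  unfolding wt_def by (intro tendsto_intros) auto
 then show ?thesis by simp
qed

text \<open>The reciprocal D of the weight is a sum of sech and cosh, for which |D'| <= l D and
  |D''| <= l^2 D. For w = 1/D this gives |w'| <= l w and |w''| <= |D''|/D^2 + 2 D'^2/D^3 <= 3 l^2 w.
  That \<open>d\<close> does not occur in the constants is what allows the limit d -> 0.\<close>

lemma wt_derivatives:
 assumes l: "l \<ge> 0" and d: "d \<ge> 0"
 shows "\<bar>vd (wt l d) s\<bar> \<le> l * wt l d s" "\<bar>vd (vd (wt l d)) s\<bar> \<le> 3 * l\<^sup>2 * wt l d s"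
proof -
 define C where "C s = cosh (l * s)" for s
 define S where "S s = sinh (l * s)" for s
 have C0: "C s > 0" for s by (simp add: C_def)
 have SC: "\<bar>S s\<bar> \<le> C s" "(S s)\<^sup>2 = (C s)\<^sup>2 - 1" for s
  using cosh_square_eq[of "l * s"] abs_le_square_iff[of "S s" "C s"] C0[of s] by (auto simp: C_def S_def)
 define D where "D s = inverse (C s) + d * C s" for s
 define D1 where "D1 s = l * (S s * (d - inverse ((C s)\<^sup>2)))" for s
 define D2 where "D2 s = l\<^sup>2 * (d * C s + inverse (C s) - 2 * inverse ((C s)^3))" for s
 have D0: "D s > 0" for s unfolding D_def using C0[of s] d by (intro add_pos_nonneg) auto
 have dC: "(C has_real_derivative l * S s) (at s)" "(S has_real_derivative l * C s) (at s)" for s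
  unfolding C_def S_def by (auto intro!: derivative_eq_intros)
 have dD: "(D has_real_derivative D1 s) (at s)" for s
  unfolding D_def D1_def using C0[of s]
  by (auto intro!: derivative_eq_intros dC simp: power2_eq_square algebra_simps)
 have dD1: "(D1 has_real_derivative D2 s) (at s)" for s
 proof -
  have "(D1 has_real_derivative l * (l * C s * (d - inverse ((C s)\<^sup>2)) + S s * (2 * (l * S s) * inverse ((C s)^3)))) (at s)"
   unfolding D1_def using C0[of s]
   by (auto intro!: derivative_eq_intros dC simp: power2_eq_square power3_eq_cube field_simps)
  moreover have "l * (l * C s * (d - inverse ((C s)\<^sup>2)) + S s * (2 * (l * S s) * inverse ((C s)^3))) = D2 s"
  proof -
   have "S s * (2 * (l * S s) * inverse ((C s)^3)) = 2 * l * (S s)\<^sup>2 * inverse ((C s)^3)" by (simp add: power2_eq_square)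
   also have "\<dots> = 2 * l * (inverse (C s) - inverse ((C s)^3))"
    unfolding SC(2) using C0[of s] by (simp add: field_simps power2_eq_square power3_eq_cube)
   finally have e: "S s * (2 * (l * S s) * inverse ((C s)^3)) = 2 * l * (inverse (C s) - inverse ((C s)^3))" .
   show ?thesis unfolding D2_def e using C0[of s]
    by (simp add: field_simps power2_eq_square power3_eq_cube)
  qed
  ultimately show ?thesis by simp
 qed
 have w: "wt l d = (\<lambda>s. inverse (D s))" by (simp add: wt_def[abs_def] D_def C_def)
 have v1: "vd (wt l d) = (\<lambda>s. - D1 s * inverse (D s) * inverse (D s))"
  unfolding w
 proof (rule vdI)
  fix s
  have "((\<lambda>s. inverse (D s)) has_real_derivative - D1 s * inverse (D s) * inverse (D s)) (at s)"
   using D0[of s] by (auto intro!: derivative_eq_intros dD simp: power2_eq_square)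
  then show "((\<lambda>s. inverse (D s)) has_vector_derivative - D1 s * inverse (D s) * inverse (D s)) (at s)"
   by (simp add: has_real_derivative_iff_has_vector_derivative)
 qed
 have v2: "vd (vd (wt l d)) = (\<lambda>s. - D2 s * inverse (D s) * inverse (D s) + 2 * (D1 s)\<^sup>2 * inverse (D s) ^ 3)"
  unfolding v1
 proof (rule vdI)
  fix s
  have i: "((\<lambda>s. inverse (D s)) has_real_derivative - D1 s * inverse (D s) * inverse (D s)) (at s)"
   using D0[of s] by (auto intro!: derivative_eq_intros dD simp: power2_eq_square)
  have "((\<lambda>s. - D1 s * inverse (D s) * inverse (D s)) has_real_derivative - D2 s * inverse (D s) * inverse (D s) + 2 * (D1 s)\<^sup>2 * inverse (D s) ^ 3) (at s)"
   by (rule DERIV_cong[OF DERIV_mult[OF DERIV_mult[OF DERIV_minus[OF dD1] i] i]])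
    (simp add: power2_eq_square power3_eq_cube algebra_simps)
  then show "((\<lambda>s. - D1 s * inverse (D s) * inverse (D s)) has_vector_derivative - D2 s * inverse (D s) * inverse (D s) + 2 * (D1 s)\<^sup>2 * inverse (D s) ^ 3) (at s)"
   by (simp add: has_real_derivative_iff_has_vector_derivative)
 qed
 have b1: "\<bar>D1 s\<bar> \<le> l * D s" for s
 proof -
  have "\<bar>S s * (d - inverse ((C s)\<^sup>2))\<bar> \<le> C s * (d + inverse ((C s)\<^sup>2))"
   unfolding abs_mult using SC(1)[of s] less_imp_le[OF C0[of s]] d by (intro mult_mono) (auto simp: abs_le_iff add_increasing)
  also have "\<dots> = D s" using C0[of s] by (simp add: D_def power2_eq_square field_simps)
  finally show ?thesis using l by (simp add: D1_def abs_mult mult_left_mono)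
 qed
 have b2: "\<bar>D2 s\<bar> \<le> l\<^sup>2 * D s" for s
 proof -
  have C1: "C s \<ge> 1" by (simp add: C_def cosh_real_ge_1)
  have "inverse ((C s)^3) \<le> inverse (C s)"
   using C1 power_increasing[of 1 3 "C s"] by (intro le_imp_inverse_le) auto
  moreover have "inverse ((C s)^3) \<ge> 0" "d * C s \<ge> 0" using C1 d by auto
  ultimately have "\<bar>d * C s + inverse (C s) - 2 * inverse ((C s)^3)\<bar> \<le> D s" unfolding D_def by linarith
  then show ?thesis by (simp add: D2_def abs_mult mult_left_mono)
 qed
 define i where "i = inverse (D s)"
 have i: "i > 0" "D s * i = 1" using D0[of s] by (auto simp: i_def)
 show "\<bar>vd (wt l d) s\<bar> \<le> l * wt l d s"
 proof -
  have "\<bar>vd (wt l d) s\<bar> = \<bar>D1 s\<bar> * i * i" using i(1) by (simp add: v1 abs_mult i_def[symmetric])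
  also have "\<dots> \<le> l * D s * i * i" using i b1 by (intro mult_right_mono) auto
  also have "\<dots> = l * (D s * i) * i" by (simp only: mult_ac)
  also have "\<dots> = l * wt l d s" by (simp add: i w i_def[symmetric])
  finally show ?thesis .
 qed
 show "\<bar>vd (vd (wt l d)) s\<bar> \<le> 3 * l\<^sup>2 * wt l d s"
 proof -
  have "\<bar>vd (vd (wt l d)) s\<bar> \<le> \<bar>D2 s\<bar> * i * i + 2 * (D1 s)\<^sup>2 * i ^ 3"
   unfolding v2 i_def[symmetric] by (rule order_trans[OF abs_triangle_ineq]) (use i in \<open>simp add: abs_mult\<close>)
  also have "\<dots> \<le> l\<^sup>2 * D s * i * i + 2 * (l * D s)\<^sup>2 * i ^ 3"
  proof (intro add_mono mult_right_mono mult_left_mono)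
   show "(D1 s)\<^sup>2 \<le> (l * D s)\<^sup>2" using b1[of s] l D0[of s] by (simp add: abs_le_square_iff[symmetric] abs_mult)
  qed (use i b2 in auto)
  also have "\<dots> = l\<^sup>2 * (D s * i) * i + 2 * l\<^sup>2 * (D s * i) * (D s * i) * i"
   by (simp add: power2_eq_square power3_eq_cube algebra_simps)
  also have "\<dots> = 3 * l\<^sup>2 * wt l d s" by (simp add: i w i_def[symmetric])
  finally show ?thesis .
 qed
qed

text \<open>Iteration instead of differentiation, so \<open>y\<close> may be merely measurable:
  inserting (2P + b/2^i) e^(2Qt) into the integral, with twice the natural rate in the exponent,
  halves the second coefficient. The bound \<open>B0\<close> starts the iteration and
  disappears.\<close>

lemma gronwall:
 fixes y :: "real \<Rightarrow> ennreal"
 assumes [measurable]: "y \<in> borel_measurable borel"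
  and bd: "\<And>t. t \<in> {0..1} \<Longrightarrow> y t \<le> ennreal B0" and PQ: "P \<ge> 0" "Q \<ge> 0"
  and y: "\<And>t. t \<in> {0..1} \<Longrightarrow> y t \<le> ennreal P + ennreal Q * (\<integral>\<^sup>+s. indicator {0..t} s * y s \<partial>lborel)"
  and t: "t \<in> {0..1}"
 shows "y t \<le> ennreal (2 * P * exp (2 * Q))"
proof -
 define b where "b = max 0 B0"
 have step: "y t \<le> ennreal ((2 * P + b / 2 ^ i) * exp (2 * Q * t))" if "t \<in> {0..1}" for t i
  using that
 proof (induction i arbitrary: t)
  case 0
  have "b * 1 \<le> (2 * P + b) * exp (2 * Q * t)" using 0 PQ by (intro mult_mono) (auto simp: b_def)
  then show ?case using bd[OF 0] by (auto simp: b_def intro: order_trans ennreal_leI)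
 next
  case (Suc i)
  define a where "a = 2 * P + b / 2 ^ i"
  have a: "a \<ge> 0" using PQ by (simp add: a_def b_def)
  have i1: "ennreal Q * (\<integral>\<^sup>+s. indicator {0..t} s * ennreal (exp (2 * Q * s)) \<partial>lborel) = ennreal ((exp (2 * Q * t) - 1) / 2)"
  proof -
   have "ennreal Q * (\<integral>\<^sup>+s. indicator {0..t} s * ennreal (exp (2 * Q * s)) \<partial>lborel) =
     (\<integral>\<^sup>+s. ennreal (Q * exp (2 * Q * s)) * indicator {0..t} s \<partial>lborel)"
    using PQ by (subst nn_integral_cmult[symmetric]) (auto simp: ennreal_mult mult_ac)
   also have "\<dots> = ennreal (exp (2 * Q * t) / 2 - exp (2 * Q * 0) / 2)"
    by (rule nn_integral_FTC_Icc) (use PQ Suc in \<open>auto intro!: derivative_eq_intros\<close>)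
   finally show ?thesis by (simp add: diff_divide_distrib)
  qed
  have "y t \<le> ennreal P + ennreal Q * (\<integral>\<^sup>+s. indicator {0..t} s * y s \<partial>lborel)" by (rule y[OF Suc.prems])
  also have "\<dots> \<le> ennreal P + ennreal Q * (\<integral>\<^sup>+s. ennreal a * (indicator {0..t} s * ennreal (exp (2 * Q * s))) \<partial>lborel)"
  proof (intro add_left_mono mult_left_mono nn_integral_mono)
   fix s :: real
   show "indicator {0..t} s * y s \<le> ennreal a * (indicator {0..t} s * ennreal (exp (2 * Q * s)))"
   proof (cases "s \<in> {0..t}")
    case True
    then have "y s \<le> ennreal (a * exp (2 * Q * s))" using Suc.IH[of s] Suc.prems by (auto simp: a_def)
    with True a show ?thesis by (simp add: ennreal_mult)
   qed simp
  qed auto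
  also have "\<dots> = ennreal P + ennreal a * (ennreal Q * (\<integral>\<^sup>+s. indicator {0..t} s * ennreal (exp (2 * Q * s)) \<partial>lborel))"
   by (subst nn_integral_cmult) (auto simp: mult_ac)
  also have "\<dots> = ennreal (P + a * ((exp (2 * Q * t) - 1) / 2))"
   unfolding i1 using PQ a Suc.prems by (simp add: ennreal_mult[symmetric] ennreal_plus[symmetric] del: ennreal_plus)
  also have "\<dots> \<le> ennreal ((2 * P + b / 2 ^ Suc i) * exp (2 * Q * t))"
  proof (intro ennreal_leI)
   have e: "exp (2 * Q * t) \<ge> 1" using PQ Suc.prems by simp
   have "P + a * ((exp (2 * Q * t) - 1) / 2) \<le> P * exp (2 * Q * t) + a * (exp (2 * Q * t) / 2)"
    using e a PQ by (intro add_mono mult_left_mono) (auto simp: mult_le_cancel_left1)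
   also have "\<dots> = (2 * P + b / 2 ^ Suc i) * exp (2 * Q * t)" by (simp add: a_def field_simps)
   finally show "P + a * ((exp (2 * Q * t) - 1) / 2) \<le> (2 * P + b / 2 ^ Suc i) * exp (2 * Q * t)" .
  qed
  finally show ?case .
 qed
 have "(\<lambda>i. b / 2 ^ i) \<longlonglongrightarrow> 0" by real_asymp
 then have "(\<lambda>i. ennreal ((2 * P + b / 2 ^ i) * exp (2 * Q * t))) \<longlonglongrightarrow> ennreal ((2 * P + 0) * exp (2 * Q * t))"
  by (intro tendsto_intros)
 then have "y t \<le> ennreal ((2 * P + 0) * exp (2 * Q * t))"
  by (rule LIMSEQ_le_const) (use step[OF t] in blast)
 also have "\<dots> \<le> ennreal (2 * P * exp (2 * Q))"
  using PQ t by (intro ennreal_leI) (auto intro!: mult_left_mono simp: mult_left_le)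
 finally show ?thesis .
qed

subsection \<open>Decay faster than any exponential\<close>

definition pw :: "nat \<Rightarrow> (nat \<Rightarrow> real \<Rightarrow> real) \<Rightarrow> (nat \<Rightarrow> real) \<Rightarrow> real" where
 "pw n W x = (\<Prod>i<n. W i (x i))"

lemma pw_measurable [measurable (raw)]:
 "(\<And>i. i < n \<Longrightarrow> W i \<in> borel_measurable borel) \<Longrightarrow> pw n W \<in> Bor n"
proof -
 assume W: "\<And>i. i < n \<Longrightarrow> W i \<in> borel_measurable borel"
 have "(\<lambda>x. W i (x i)) \<in> Bor n" if "i < n" for i
  using that by (intro measurable_compose[OF _ W[OF that]]) simp
 then show ?thesis unfolding pw_def[abs_def] by measurable
qed

text \<open>With z = -i\<eta> this is one factor of a weighted Fourier kernel. The formula for its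
  second derivative shows which terms fall on the weight.\<close>

definition wexp :: "(real \<Rightarrow> real) \<Rightarrow> complex \<Rightarrow> real \<Rightarrow> complex" where
 "wexp w z s = of_real (w s) * exp (z * of_real s)"

lemma smooth_wexp: "smooth w \<Longrightarrow> smooth (wexp w z)"
 unfolding wexp_def[abs_def] by (intro smooth_mult smooth_of_real smooth_exp)

lemma vd_wexp:
 assumes w: "smooth w"
 shows "vd (wexp w z) = (\<lambda>s. wexp (vd w) z s + z * wexp w z s)"
  and "vd (vd (wexp w z)) = (\<lambda>s. wexp (vd (vd w)) z s + (2 * z) * wexp (vd w) z s + z\<^sup>2 * wexp w z s)"
proof -
 have 1: "vd (wexp w z) = (\<lambda>s. wexp (vd w) z s + z * wexp w z s)" if w: "smooth w" for w
 proof -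
  have "vd (wexp w z) = (\<lambda>s. of_real (w s) * vd (\<lambda>s. exp (z * of_real s)) s + vd (\<lambda>s. of_real (w s)) s * exp (z * of_real s))"
   unfolding wexp_def[abs_def] by (rule vd_mult[OF smooth_of_real[OF w] smooth_exp])
  also have "\<dots> = (\<lambda>s. wexp (vd w) z s + z * wexp w z s)"
   unfolding vd_exp vd_of_real[OF w] wexp_def by (simp add: algebra_simps)
  finally show ?thesis .
 qed
 show "vd (wexp w z) = (\<lambda>s. wexp (vd w) z s + z * wexp w z s)" by (rule 1[OF w])
 have "vd (vd (wexp w z)) = (\<lambda>s. vd (wexp (vd w) z) s + vd (\<lambda>s. z * wexp w z s) s)"
  unfolding 1[OF w] by (rule vd_add) (intro smooth_wexp smooth_vd w smooth_cmult)+
 also have "\<dots> = (\<lambda>s. wexp (vd (vd w)) z s + z * wexp (vd w) z s + z * (wexp (vd w) z s + z * wexp w z s))"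
  unfolding vd_cmult[OF smooth_wexp[OF w]] 1[OF w] 1[OF smooth_vd(2)[OF w]] ..
 finally show "vd (vd (wexp w z)) = (\<lambda>s. wexp (vd (vd w)) z s + (2 * z) * wexp (vd w) z s + z\<^sup>2 * wexp w z s)"
  by (simp add: fun_eq_iff algebra_simps power2_eq_square)
qed

lemma tens_wexp: "tens n (\<lambda>i. wexp (W i) (- (\<i> * of_real (\<eta> i)))) x = of_real (pw n W x) * ek n \<eta> x"
 unfolding tens_def wexp_def pw_def ek_def by (simp add: prod.distrib)

lemma tens_slot_add: "i < n \<Longrightarrow> tens n (f(i := (\<lambda>s. a s + b s))) x = tens n (f(i := a)) x + tens n (f(i := b)) x"
 and tens_slot_cmult: "i < n \<Longrightarrow> tens n (f(i := (\<lambda>s. z * a s))) x = z * tens n (f(i := a)) x"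
proof -
 have *: "tens n (f(i := g)) x = g (x i) * (\<Prod>j\<in>{..<n}-{i}. f j (x j))" if "i < n" for g
 proof -
  have "tens n (f(i := g)) x = (f(i := g)) i (x i) * (\<Prod>j\<in>{..<n}-{i}. (f(i := g)) j (x j))"
   unfolding tens_def using that by (intro prod.remove) auto
  also have "(\<Prod>j\<in>{..<n}-{i}. (f(i := g)) j (x j)) = (\<Prod>j\<in>{..<n}-{i}. f j (x j))" by (intro prod.cong) auto
  finally show ?thesis by (simp only: fun_upd_same)
 qed
 show "i < n \<Longrightarrow> tens n (f(i := (\<lambda>s. a s + b s))) x = tens n (f(i := a)) x + tens n (f(i := b)) x"
  by (simp add: * algebra_simps)
 show "i < n \<Longrightarrow> tens n (f(i := (\<lambda>s. z * a s))) x = z * tens n (f(i := a)) x"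
  by (simp add: *)
qed

lemma fourier_joint [measurable]:
 assumes [measurable]: "case_prod W \<in> Bor2 n" "w \<in> Bor n"
 shows "(\<lambda>(s, \<eta>). fourier n (\<lambda>x. of_real (w x) * W s x) \<eta>) \<in> Bor2 n"
proof -
 have [measurable]: "(\<lambda>p. W (fst (fst p)) (snd p)) \<in> borel_measurable ((borel \<Otimes>\<^sub>M lbn n) \<Otimes>\<^sub>M lbn n)"
  using measurable_compose[OF _ assms(1), of "\<lambda>p. (fst (fst p), snd p)" "(borel \<Otimes>\<^sub>M lbn n) \<Otimes>\<^sub>M lbn n"] by simp
 show ?thesis unfolding fourier_def split_beta by measurable
qed

lemma fourier_sec [measurable]:
 assumes [measurable]: "case_prod W \<in> Bor2 n" "w \<in> Bor n"
  and \<eta>: "\<eta> \<in> space (lbn n)"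
 shows "(\<lambda>s. fourier n (\<lambda>x. of_real (w x) * W s x) \<eta>) \<in> borel_measurable borel"
 using measurable_compose[OF measurable_Pair2'[OF \<eta>, of borel] fourier_joint[OF assms(1,2)]] by simp

lemma ennreal_sum_sq:
 fixes a :: "'i \<Rightarrow> ennreal"
 assumes "finite I"
 shows "(\<Sum>i\<in>I. a i)\<^sup>2 \<le> of_nat (card I) * (\<Sum>i\<in>I. (a i)\<^sup>2)"
proof (cases "\<exists>i\<in>I. a i = top")
 case True
 then obtain i where i: "i \<in> I" "a i = top" by blast
 have "(a i)\<^sup>2 \<le> (\<Sum>i\<in>I. (a i)\<^sup>2)" using assms i(1) by (intro member_le_sum) auto
 with i have "(\<Sum>i\<in>I. (a i)\<^sup>2) = top" by (simp add: top_unique)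
 moreover have "card I > 0" using i assms by (auto simp: card_gt_0_iff)
 ultimately show ?thesis by (simp add: ennreal_mult_top)
next
 case False
 then have "\<forall>i\<in>I. \<exists>r\<ge>0. a i = ennreal r" by (metis ennreal_cases)
 then obtain r where r: "\<And>i. i \<in> I \<Longrightarrow> r i \<ge> 0 \<and> a i = ennreal (r i)" by metis
 have "(\<Sum>i\<in>I. r i)\<^sup>2 \<le> (\<Sum>i\<in>I. (r i)\<^sup>2) * real (card I)"
  using Cauchy_Schwarz_ineq_sum[of r "\<lambda>_. 1" I] by simp
 then have "ennreal ((\<Sum>i\<in>I. r i)\<^sup>2) \<le> ennreal (real (card I) * (\<Sum>i\<in>I. (r i)\<^sup>2))"
  by (intro ennreal_leI) (simp add: mult.commute)
 also have "\<dots> = of_nat (card I) * ennreal (\<Sum>i\<in>I. (r i)\<^sup>2)"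
  by (simp add: ennreal_mult sum_nonneg ennreal_of_nat_eq_real_of_nat)
 also have "ennreal (\<Sum>i\<in>I. (r i)\<^sup>2) = (\<Sum>i\<in>I. (a i)\<^sup>2)"
  using r by (subst sum_ennreal[symmetric]) (auto simp: ennreal_power intro!: sum.cong)
 also have "ennreal ((\<Sum>i\<in>I. r i)\<^sup>2) = (\<Sum>i\<in>I. a i)\<^sup>2"
 proof -
  have "(\<Sum>i\<in>I. a i) = ennreal (\<Sum>i\<in>I. r i)" using r by (subst sum_ennreal[symmetric]) auto
  then show ?thesis using r by (simp add: ennreal_power sum_nonneg)
 qed
 finally show ?thesis .
qed

section \<open>Comparison with the Gaussian weight\<close>

definition gw :: "nat \<Rightarrow> real \<Rightarrow> (nat \<Rightarrow> real) \<Rightarrow> real" where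
 "gw n \<gamma> x = exp (\<gamma> * (\<Sum>i<n. (x i)\<^sup>2))"

lemma gw_measurable [measurable]: "gw n \<gamma> \<in> Bor n"
 unfolding gw_def by measurable

lemma gw_prod: "gw n \<gamma> x = (\<Prod>i<n. exp (\<gamma> * (x i)\<^sup>2))"
 by (simp add: gw_def sum_distrib_left exp_sum)

text \<open>Completing the square gives |l s| <= l^2/(4\<gamma>) + \<gamma> s^2. Hence the Gaussian
  decay of the initial value and of F supplies the data for every exponential rate
  \<open>l\<close>.\<close>

lemma cosh_le_gauss:
 fixes l s \<gamma> :: real
 assumes "\<gamma> > 0"
 shows "cosh (l * s) \<le> exp (l\<^sup>2 / (4 * \<gamma>)) * exp (\<gamma> * s\<^sup>2)"
proof -
 have "\<bar>l * s\<bar> \<le> l\<^sup>2 / (4 * \<gamma>) + \<gamma> * s\<^sup>2"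
 proof -
  have "0 \<le> (\<bar>l\<bar> / (2 * sqrt \<gamma>) - sqrt \<gamma> * \<bar>s\<bar>)\<^sup>2" by simp
  also have "\<dots> = l\<^sup>2 / (4 * \<gamma>) + \<gamma> * s\<^sup>2 - \<bar>l * s\<bar>"
   using assms by (simp add: power2_diff power_mult_distrib power_divide abs_mult)
  finally show ?thesis by simp
 qed
 then have e: "exp \<bar>l * s\<bar> \<le> exp (l\<^sup>2 / (4 * \<gamma>) + \<gamma> * s\<^sup>2)" by simp
 have "cosh (l * s) \<le> exp \<bar>l * s\<bar>"
 proof -
  have "cosh (l * s) = cosh \<bar>l * s\<bar>" by (simp add: abs_if)
  also have "\<dots> \<le> exp \<bar>l * s\<bar>" by (simp add: cosh_field_def)
  finally show ?thesis .
 qed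
 with e show ?thesis unfolding exp_add by (rule order_trans[rotated])
qed

lemma pw_cosh_le_gw:
 assumes "\<gamma> > 0"
 shows "pw n (\<lambda>_ s. cosh (l * s)) x \<le> exp (l\<^sup>2 / (4 * \<gamma>)) ^ n * gw n \<gamma> x"
proof -
 have "pw n (\<lambda>_ s. cosh (l * s)) x \<le> (\<Prod>i<n. exp (l\<^sup>2 / (4 * \<gamma>)) * exp (\<gamma> * (x i)\<^sup>2))"
  unfolding pw_def using cosh_le_gauss[OF assms] by (intro prod_mono) auto
 then show ?thesis by (simp add: prod.distrib gw_prod)
qed

lemma pw_L2:
 assumes "\<And>i. i < n \<Longrightarrow> W i \<in> borel_measurable borel"
  and "\<And>i. i < n \<Longrightarrow> (sq_int lborel (\<lambda>s. W i s)) < \<infinity>"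
 shows "\<exists>a\<ge>0. (sq_int (lbn n) (\<lambda>x. cmod (complex_of_real (pw n W x)))) \<le> ennreal (a\<^sup>2)"
proof -
 have "sq_int (lbn n) (\<lambda>x. cmod (complex_of_real (pw n W x))) = (\<integral>\<^sup>+x. (\<Prod>i<n. ennreal ((W i (x i))\<^sup>2)) \<partial>lbn n)"
 proof (intro nn_integral_cong)
  fix x
  have "(cmod (complex_of_real (pw n W x)))\<^sup>2 = (\<Prod>i<n. (W i (x i))\<^sup>2)"
   by (simp only: norm_of_real power2_abs pw_def prod_power_distrib)
  then show "ennreal ((cmod (complex_of_real (pw n W x)))\<^sup>2) = (\<Prod>i<n. ennreal ((W i (x i))\<^sup>2))"
   by (simp add: prod_ennreal)
 qed
 also have "\<dots> = (\<Prod>i<n. \<integral>\<^sup>+s. ennreal ((W i s)\<^sup>2) \<partial>lborel)"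
 proof (rule lbp.product_nn_integral_prod)
  fix i assume "i \<in> {..<n}"
  then have [measurable]: "W i \<in> borel_measurable borel" using assms by auto
  show "(\<lambda>s. ennreal ((W i s)\<^sup>2)) \<in> borel_measurable lborel" by measurable
 qed simp
 also have "\<dots> < \<infinity>" using assms(2) by (simp add: less_top[symmetric] ennreal_prod_eq_top)
 finally obtain r where "sq_int (lbn n) (\<lambda>x. cmod (complex_of_real (pw n W x))) = ennreal r" "r \<ge> 0"
  by (cases "\<integral>\<^sup>+x. ennreal ((cmod (complex_of_real (pw n W x)))\<^sup>2) \<partial>lbn n") auto
 then show ?thesis by (intro exI[of _ "sqrt r"]) auto
qed

lemma borel_measurable_cosh [measurable]: "(cosh :: real \<Rightarrow> real) \<in> borel_measurable borel"
 by (intro borel_measurable_continuous_onI continuous_intros)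

lemma sech_scaled_L2:
 assumes l: "l > 0"
 shows "sq_int lborel (\<lambda>s. a * (1 / cosh (l * s))) < \<infinity>"
proof -
 have "sq_int lborel (\<lambda>s. 1 / cosh s) = ennreal \<bar>l\<bar> * sq_int lborel (\<lambda>s. 1 / cosh (0 + l * s))"
  by (rule nn_integral_real_affine) (use l in auto)
 with sech_L2 l have "sq_int lborel (\<lambda>s. 1 / cosh (l * s)) < \<infinity>"
  by (auto simp: ennreal_mult_less_top)
 moreover have "sq_int lborel (\<lambda>s. a * (1 / cosh (l * s))) = ennreal (a\<^sup>2) * sq_int lborel (\<lambda>s. 1 / cosh (l * s))"
  by (subst nn_integral_cmult[symmetric]) (auto simp: ennreal_mult[symmetric] power_mult_distrib power_divide)
 ultimately show ?thesis by (simp add: ennreal_mult_less_top)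
qed

lemma wplancherel:
 assumes [measurable]: "f \<in> Bor n" "w \<in> Bor n"
  and "integrable (lbn n) (\<lambda>x. of_real (w x) * f x)"
  and "sq_int (lbn n) (\<lambda>x. w x * cmod (f x)) < \<infinity>"
 shows "sq_int (lbn n) (\<lambda>\<eta>. cmod (fourier n (\<lambda>x. of_real (w x) * f x) \<eta>)) =
  ennreal ((2 * pi) ^ n) * sq_int (lbn n) (\<lambda>x. w x * cmod (f x))"
proof -
 have "(cmod (complex_of_real (w x) * f x))\<^sup>2 = (w x * cmod (f x))\<^sup>2" for x by (simp add: norm_mult power_mult_distrib)
 with plancherel[OF assms(3)] assms(4) show ?thesis by simp
qed

text \<open>Parabolic smoothing: the squared kernel 4 r^2 e^(-2 A r^2 (t - s)) integrates to at most
  2/A, whatever the frequency r. One factor of the frequency, hence one spatial derivative, is thus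
  absorbed.\<close>

lemma heat_multiplier_bound:
 fixes q :: "real \<Rightarrow> real"
 assumes A: "A > 0" and t: "0 \<le> t" and [measurable]: "q \<in> borel_measurable borel"
 shows "(\<integral>\<^sup>+s. ennreal (indicator {0..t} s * \<bar>2 * r * exp (- A * r\<^sup>2 * (t - s)) * q s\<bar>) \<partial>lborel)\<^sup>2 \<le>
  ennreal (2 / A) * (\<integral>\<^sup>+s. ennreal (indicator {0..t} s * (q s)\<^sup>2) \<partial>lborel)"
proof -
 define k where "k s = 2 * r * exp (- A * r\<^sup>2 * (t - s))" for s
 have [measurable]: "k \<in> borel_measurable borel" unfolding k_def by measurable
 define f where "f s = ennreal (indicator {0..t} s * \<bar>k s\<bar>)" for s
 define g where "g s = ennreal (indicator {0..t} s * \<bar>q s\<bar>)" for s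
 have [measurable]: "f \<in> borel_measurable borel" "g \<in> borel_measurable borel" unfolding f_def g_def by measurable
 have 1: "(\<integral>\<^sup>+s. ennreal (indicator {0..t} s * \<bar>k s * q s\<bar>) \<partial>lborel) = (\<integral>\<^sup>+s. f s * g s \<partial>lborel)"
  unfolding f_def g_def
  by (intro nn_integral_cong) (simp add: ennreal_mult[symmetric] abs_mult split: split_indicator)
 have 2: "(\<integral>\<^sup>+s. (g s)\<^sup>2 \<partial>lborel) = (\<integral>\<^sup>+s. ennreal (indicator {0..t} s * (q s)\<^sup>2) \<partial>lborel)"
  unfolding g_def by (intro nn_integral_cong) (simp add: ennreal_power split: split_indicator)
 have 3: "(\<integral>\<^sup>+s. (f s)\<^sup>2 \<partial>lborel) \<le> ennreal (2 / A)"
 proof -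
  have k2: "(k s)\<^sup>2 = 4 * r\<^sup>2 * exp (2 * A * r\<^sup>2 * (s - t))" for s
  proof -
   have "(exp (- A * r\<^sup>2 * (t - s)))\<^sup>2 = exp (2 * A * r\<^sup>2 * (s - t))" by (simp add: exp_double[symmetric] algebra_simps)
   then show ?thesis unfolding k_def by (simp add: power_mult_distrib)
  qed
  have "(\<integral>\<^sup>+s. (f s)\<^sup>2 \<partial>lborel) = (\<integral>\<^sup>+s. ennreal (4 * r\<^sup>2 * exp (2 * A * r\<^sup>2 * (s - t))) * indicator {0..t} s \<partial>lborel)"
   unfolding f_def by (intro nn_integral_cong) (simp add: ennreal_power k2 split: split_indicator)
  also have "\<dots> = ennreal ((2 / A) * exp (2 * A * r\<^sup>2 * (t - t)) - (2 / A) * exp (2 * A * r\<^sup>2 * (0 - t)))"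
  proof (rule nn_integral_FTC_Icc)
   show "((\<lambda>s. (2 / A) * exp (2 * A * r\<^sup>2 * (s - t))) has_real_derivative 4 * r\<^sup>2 * exp (2 * A * r\<^sup>2 * (s - t))) (at s)" for s
   proof -
    have "((\<lambda>s. exp (2 * A * r\<^sup>2 * (s - t))) has_real_derivative exp (2 * A * r\<^sup>2 * (s - t)) * (2 * A * r\<^sup>2 * 1)) (at s)"
     by (auto intro!: derivative_eq_intros)
    from DERIV_cmult[OF this, of "2 / A"] show ?thesis using A by (simp add: mult_ac)
   qed
  qed (use t in auto)
  also have "\<dots> \<le> ennreal (2 / A)" using A by (intro ennreal_leI) simp
  finally show ?thesis .
 qed
 have "(\<integral>\<^sup>+s. f s * g s \<partial>lborel)\<^sup>2 \<le> (\<integral>\<^sup>+s. (f s)\<^sup>2 \<partial>lborel) * (\<integral>\<^sup>+s. (g s)\<^sup>2 \<partial>lborel)"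
  by (rule Cauchy_Schwarz_nn_integral) measurable
 with 3 show ?thesis unfolding 1[symmetric] 2 k_def by (meson mult_right_mono order_trans zero_le)
qed

text \<open>In \<open>F_le\<close> the norm on the right carries no weight, as in the definition of
  M2. \<open>U0\<close> is the only decay of u recorded here; the norm at time 1 enters as a
  hypothesis of the convexity lemmas.\<close>

locale heat_weighted = heat_solution n "Complex A B" U G CU
 for n :: nat and A B :: real and U G :: "real \<Rightarrow> (nat \<Rightarrow> real) \<Rightarrow> complex" and CU :: real +
 fixes F :: "real \<Rightarrow> (nat \<Rightarrow> real) \<Rightarrow> complex" and \<gamma> M1 M2 :: real
 assumes A_pos: "A > 0" and \<gamma>_pos: "\<gamma> > 0" and M_nonneg: "M1 \<ge> 0" "M2 \<ge> 0"
  and F_meas: "case_prod F \<in> Bor2 n"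
  and G_le: "\<And>t x. t \<in> {0..1} \<Longrightarrow> cmod (G t x) \<le> M1 * cmod (U t x) + cmod (F t x)"
  and F_le: "\<And>t. t \<in> {0..1} \<Longrightarrow> (sq_int (lbn n) (\<lambda>x. gw n \<gamma> x * cmod (F t x))) \<le>
   ennreal (M2\<^sup>2) * sq_int (lbn n) (\<lambda>x. cmod (U t x))"
  and U0: "sq_int (lbn n) (\<lambda>x. gw n \<gamma> x * cmod (U 0 x)) < \<infinity>"
begin

lemma F_measurable [measurable]: "t \<in> {0..1} \<Longrightarrow> F t \<in> Bor n"
 using measurable_compose[OF measurable_Pair1'[of t borel "lbn n"] F_meas] by simp

lemma weighted_F:
 assumes t: "t \<in> {0..1}" and w: "\<And>x. 0 \<le> w x \<and> w x \<le> K * gw n \<gamma> x" "K \<ge> 0"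
 shows "sq_int (lbn n) (\<lambda>x. w x * cmod (F t x)) \<le> ennreal (K\<^sup>2 * M2\<^sup>2 * CU\<^sup>2)"
proof -
 have [measurable]: "F t \<in> Bor n" using t by measurable
 have "sq_int (lbn n) (\<lambda>x. w x * cmod (F t x)) \<le> (\<integral>\<^sup>+x. ennreal (K\<^sup>2) * ennreal ((gw n \<gamma> x * cmod (F t x))\<^sup>2) \<partial>lbn n)"
 proof (intro nn_integral_mono)
  fix x
  have "(w x * cmod (F t x))\<^sup>2 \<le> (K * gw n \<gamma> x * cmod (F t x))\<^sup>2"
   using w by (intro power_mono mult_right_mono) auto
  then show "ennreal ((w x * cmod (F t x))\<^sup>2) \<le> ennreal (K\<^sup>2) * ennreal ((gw n \<gamma> x * cmod (F t x))\<^sup>2)"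
   by (simp add: ennreal_mult[symmetric] power_mult_distrib mult_ac ennreal_leI)
 qed
 also have "\<dots> = ennreal (K\<^sup>2) * sq_int (lbn n) (\<lambda>x. gw n \<gamma> x * cmod (F t x))"
  by (rule nn_integral_cmult) measurable
 also have "\<dots> \<le> ennreal (K\<^sup>2) * (ennreal (M2\<^sup>2) * ennreal (CU\<^sup>2))"
  by (intro mult_left_mono order_trans[OF F_le[OF t]] U_L2 t) auto
 also have "\<dots> = ennreal (K\<^sup>2 * M2\<^sup>2 * CU\<^sup>2)" by (simp add: ennreal_mult mult.assoc)
 finally show ?thesis .
qed

lemma weighted_G:
 assumes t: "t \<in> {0..1}" and w: "\<And>x. 0 \<le> w x \<and> w x \<le> K * gw n \<gamma> x" "K \<ge> 0"
  and [measurable]: "w \<in> Bor n"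
 shows "sq_int (lbn n) (\<lambda>x. w x * cmod (G t x)) \<le>
  ennreal (2 * M1\<^sup>2) * sq_int (lbn n) (\<lambda>x. w x * cmod (U t x)) + ennreal (2 * (K\<^sup>2 * M2\<^sup>2 * CU\<^sup>2))"
proof -
 have [measurable]: "F t \<in> Bor n" "U t \<in> Bor n" using t by measurable
 have "sq_int (lbn n) (\<lambda>x. w x * cmod (G t x)) \<le>
  (\<integral>\<^sup>+x. ennreal (2 * M1\<^sup>2) * ennreal ((w x * cmod (U t x))\<^sup>2) + ennreal 2 * ennreal ((w x * cmod (F t x))\<^sup>2) \<partial>lbn n)"
 proof (intro nn_integral_mono)
  fix x
  have "(w x * cmod (G t x))\<^sup>2 \<le> (w x * (M1 * cmod (U t x)) + w x * cmod (F t x))\<^sup>2"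
   unfolding distrib_left[symmetric] using w G_le[OF t] by (intro power_mono mult_left_mono) auto
  also have "\<dots> \<le> 2 * (w x * (M1 * cmod (U t x)))\<^sup>2 + 2 * (w x * cmod (F t x))\<^sup>2"
   using zero_le_power2[of "w x * (M1 * cmod (U t x)) - w x * cmod (F t x)"] by (simp add: power2_sum power2_diff)
  also have "\<dots> = 2 * M1\<^sup>2 * (w x * cmod (U t x))\<^sup>2 + 2 * (w x * cmod (F t x))\<^sup>2"
   by (simp add: power_mult_distrib)
  finally show "ennreal ((w x * cmod (G t x))\<^sup>2) \<le> ennreal (2 * M1\<^sup>2) * ennreal ((w x * cmod (U t x))\<^sup>2) + ennreal 2 * ennreal ((w x * cmod (F t x))\<^sup>2)"
   by (simp add: ennreal_mult[symmetric] ennreal_plus[symmetric] ennreal_leI del: ennreal_plus ennreal_numeral)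
 qed
 also have "\<dots> = ennreal (2 * M1\<^sup>2) * sq_int (lbn n) (\<lambda>x. w x * cmod (U t x)) + ennreal 2 * sq_int (lbn n) (\<lambda>x. w x * cmod (F t x))"
  by (subst nn_integral_add) (auto simp: nn_integral_cmult)
 also have "\<dots> \<le> ennreal (2 * M1\<^sup>2) * sq_int (lbn n) (\<lambda>x. w x * cmod (U t x)) + ennreal 2 * ennreal (K\<^sup>2 * M2\<^sup>2 * CU\<^sup>2)"
  by (intro add_left_mono mult_left_mono weighted_F t w) auto
 also have "ennreal 2 * ennreal (K\<^sup>2 * M2\<^sup>2 * CU\<^sup>2) = ennreal (2 * (K\<^sup>2 * M2\<^sup>2 * CU\<^sup>2))" by (rule ennreal_mult[symmetric]) auto
 finally show ?thesis .
qed

end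

lemma ennreal_add_sq: "((a::ennreal) + b)\<^sup>2 \<le> 2 * a\<^sup>2 + 2 * b\<^sup>2"
 using ennreal_sum_sq[of "{0,1::nat}" "\<lambda>i. if i = 0 then a else b"] by (simp add: distrib_left)

lemma pw_upd: "i < n \<Longrightarrow> pw n (W(i := v)) x = v (x i) * (\<Prod>j\<in>{..<n}-{i}. W j (x j))"
proof -
 assume "i < n"
 then have "pw n (W(i := v)) x = (W(i := v)) i (x i) * (\<Prod>j\<in>{..<n}-{i}. (W(i := v)) j (x j))"
  unfolding pw_def by (intro prod.remove) auto
 also have "(\<Prod>j\<in>{..<n}-{i}. (W(i := v)) j (x j)) = (\<Prod>j\<in>{..<n}-{i}. W j (x j))" by (intro prod.cong) auto
 finally show ?thesis by (simp only: fun_upd_same)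
qed

text \<open>An energy estimate at one frequency. \<open>R\<close> and \<open>Q\<close> stand for the
  transforms with the second and the first derivative of the weight, \<open>Z\<close> for the
  forcing. For \<open>R\<close> and \<open>Z\<close> it suffices that the heat factor is at most 1;
  in the term with \<open>Q\<close> the factor \<eta>_i is paid for by
  \<open>heat_multiplier_bound\<close>, which brings in 1/A. The 8 is 2 from squaring a sum of two
  terms times 4 from squaring a sum of three.\<close>

lemma duhamel_sq_bound:
 fixes h0 :: complex and R Q :: "nat \<Rightarrow> real \<Rightarrow> complex" and Z :: "real \<Rightarrow> complex" and \<eta> :: "nat \<Rightarrow> real"
 assumes A: "A > 0" and t: "0 \<le> t" "t \<le> 1"
  and RQ [measurable]: "\<And>i. i < n \<Longrightarrow> R i \<in> borel_measurable borel" "\<And>i. i < n \<Longrightarrow> Q i \<in> borel_measurable borel" "Z \<in> borel_measurable borel"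
  and h: "exp (c * of_real (\<Sum>i<n. (\<eta> i)\<^sup>2) * of_real t) * h1 - h0 = (int_on 0 t (\<lambda>s. exp (c * of_real (\<Sum>i<n. (\<eta> i)\<^sup>2) * of_real s) *
    (c * ((\<Sum>i<n. R i s - 2 * \<i> * of_real (\<eta> i) * Q i s) + Z s))))"
  and c: "Re c = A"
 shows "ennreal ((cmod h1)\<^sup>2) \<le> 2 * ennreal ((cmod h0)\<^sup>2) + ennreal (8 * (cmod c)\<^sup>2) * (
  ennreal (real n) * (\<Sum>i<n. \<integral>\<^sup>+s. ennreal (indicator {0..t} s * (cmod (R i s))\<^sup>2) \<partial>lborel) +
  ennreal (real n * (2 / A)) * (\<Sum>i<n. \<integral>\<^sup>+s. ennreal (indicator {0..t} s * (cmod (Q i s))\<^sup>2) \<partial>lborel) +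
  (\<integral>\<^sup>+s. ennreal (indicator {0..t} s * (cmod (Z s))\<^sup>2) \<partial>lborel))"
proof -
 define e2 where "e2 = (\<Sum>i<n. (\<eta> i)\<^sup>2)"
 have e2: "e2 \<ge> 0" "\<And>i. i < n \<Longrightarrow> (\<eta> i)\<^sup>2 \<le> e2" unfolding e2_def by (auto intro: sum_nonneg member_le_sum)
 define X where "X i = (\<integral>\<^sup>+s. ennreal (indicator {0..t} s * \<bar>cmod (R i s)\<bar>) \<partial>lborel)" for i
 define Y where "Y i = (\<integral>\<^sup>+s. ennreal (indicator {0..t} s * \<bar>2 * \<eta> i * exp (- A * (\<eta> i)\<^sup>2 * (t - s)) * cmod (Q i s)\<bar>) \<partial>lborel)" for i
 define W where "W = (\<integral>\<^sup>+s. ennreal (indicator {0..t} s * \<bar>cmod (Z s)\<bar>) \<partial>lborel)"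
 let ?T = "\<lambda>s. (\<Sum>i<n. R i s - 2 * \<i> * of_real (\<eta> i) * Q i s) + Z s"
 let ?g = "\<lambda>s. indicator {0..t} s *\<^sub>R (exp (c * of_real e2 * of_real s) * (c * ?T s))"
 let ?I = "\<integral>s. ?g s \<partial>lborel"
 have "exp (c * of_real e2 * of_real t) * h1 = h0 + ?I" using h unfolding e2_def by (simp add: algebra_simps)
 then have "cmod (exp (c * of_real e2 * of_real t)) * cmod h1 = cmod (h0 + ?I)" by (metis norm_mult)
 then have "exp (A * e2 * t) * cmod h1 \<le> cmod h0 + cmod ?I"
  using c norm_triangle_ineq[of h0 ?I] by simp
 then have "cmod h1 \<le> exp (- (A * e2 * t)) * (cmod h0 + cmod ?I)"
  by (simp add: exp_minus field_simps)
 also have "\<dots> \<le> cmod h0 + exp (- (A * e2 * t)) * cmod ?I"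
 proof -
  have "exp (- (A * e2 * t)) \<le> 1" using A e2 t by simp
  then have "exp (- (A * e2 * t)) * cmod h0 \<le> 1 * cmod h0" by (intro mult_right_mono) auto
  then show ?thesis by (simp add: distrib_left)
 qed
 finally have 1: "ennreal (cmod h1) \<le> ennreal (cmod h0) + ennreal (exp (- (A * e2 * t)) * cmod ?I)"
  by (simp add: ennreal_plus[symmetric] ennreal_leI del: ennreal_plus)
 have 2: "ennreal (exp (- (A * e2 * t)) * cmod ?I) \<le> ennreal (cmod c) * ((\<Sum>i<n. X i) + (\<Sum>i<n. Y i) + W)"
 proof -
  have "ennreal (cmod ?I) \<le> (\<integral>\<^sup>+s. ennreal (cmod (?g s)) \<partial>lborel)"
  proof (cases "integrable lborel ?g")
   case True
   then show ?thesis by (rule integral_norm_bound_ennreal)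
  qed (simp add: not_integrable_integral_eq)
  then have "ennreal (exp (- (A * e2 * t)) * cmod ?I) \<le> ennreal (exp (- (A * e2 * t))) * (\<integral>\<^sup>+s. ennreal (cmod (?g s)) \<partial>lborel)"
   by (simp add: ennreal_mult mult_left_mono)
  also have "\<dots> = (\<integral>\<^sup>+s. ennreal (exp (- (A * e2 * t))) * ennreal (cmod (?g s)) \<partial>lborel)"
   by (rule nn_integral_cmult[symmetric]) measurable
  also have "\<dots> \<le> (\<integral>\<^sup>+s. ennreal (cmod c) * ((\<Sum>i<n. ennreal (indicator {0..t} s * \<bar>cmod (R i s)\<bar>)) +
   (\<Sum>i<n. ennreal (indicator {0..t} s * \<bar>2 * \<eta> i * exp (- A * (\<eta> i)\<^sup>2 * (t - s)) * cmod (Q i s)\<bar>)) +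
   ennreal (indicator {0..t} s * \<bar>cmod (Z s)\<bar>)) \<partial>lborel)"
  proof (intro nn_integral_mono)
   fix s :: real
   show "ennreal (exp (- (A * e2 * t))) * ennreal (cmod (?g s)) \<le> ennreal (cmod c) * ((\<Sum>i<n. ennreal (indicator {0..t} s * \<bar>cmod (R i s)\<bar>)) +
   (\<Sum>i<n. ennreal (indicator {0..t} s * \<bar>2 * \<eta> i * exp (- A * (\<eta> i)\<^sup>2 * (t - s)) * cmod (Q i s)\<bar>)) +
   ennreal (indicator {0..t} s * \<bar>cmod (Z s)\<bar>))"
   proof (cases "s \<in> {0..t}")
    case True
    define k where "k = exp (- (A * e2 * (t - s)))"
    have k: "0 \<le> k" "k \<le> 1" using A e2 True by (auto simp: k_def)
    \<comment> \<open>The decay in all coordinates together is at least the decay in coordinate i,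
      so the one-dimensional multiplier bound can be used for each i.\<close>
    have ki: "k \<le> exp (- A * (\<eta> i)\<^sup>2 * (t - s))" if "i < n" for i
    proof -
     have "A * (\<eta> i)\<^sup>2 * (t - s) \<le> A * e2 * (t - s)"
      using A e2(2)[OF that] True by (intro mult_right_mono mult_left_mono) auto
     then show ?thesis by (simp add: k_def)
    qed
    have "exp (- (A * e2 * t)) * cmod (?g s) = cmod c * (k * cmod (?T s))"
    proof -
     have "cmod (exp (c * of_real e2 * of_real s) * (c * z)) = exp (A * e2 * s) * (cmod c * cmod z)" for z
      using c by (simp add: norm_mult)
     then have "exp (- (A * e2 * t)) * cmod (?g s) = exp (- (A * e2 * t)) * (exp (A * e2 * s) * (cmod c * cmod (?T s)))"
      using True by simp
     also have "\<dots> = (exp (- (A * e2 * t)) * exp (A * e2 * s)) * (cmod c * cmod (?T s))" by (rule mult.assoc[symmetric])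
     also have "exp (- (A * e2 * t)) * exp (A * e2 * s) = k"
      unfolding k_def exp_add[symmetric] by (simp only: right_diff_distrib) simp
     finally show ?thesis by (simp only: mult.left_commute)
    qed
    also have "\<dots> \<le> cmod c * ((\<Sum>i<n. cmod (R i s)) + (\<Sum>i<n. \<bar>2 * \<eta> i * exp (- A * (\<eta> i)\<^sup>2 * (t - s)) * cmod (Q i s)\<bar>) + cmod (Z s))"
    proof (intro mult_left_mono)
     have "k * cmod (?T s) \<le> k * ((\<Sum>i<n. cmod (R i s) + 2 * \<bar>\<eta> i\<bar> * cmod (Q i s)) + cmod (Z s))"
     proof (intro mult_left_mono order_trans[OF norm_triangle_ineq] add_mono order_trans[OF norm_sum] sum_mono k)
      fix i show "cmod (R i s - 2 * \<i> * of_real (\<eta> i) * Q i s) \<le> cmod (R i s) + 2 * \<bar>\<eta> i\<bar> * cmod (Q i s)"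
       by (rule order_trans[OF norm_triangle_ineq4]) (simp add: norm_mult)
     qed simp
     also have "\<dots> = (\<Sum>i<n. k * cmod (R i s)) + (\<Sum>i<n. 2 * \<bar>\<eta> i\<bar> * k * cmod (Q i s)) + k * cmod (Z s)"
      by (simp add: distrib_left sum.distrib sum_distrib_left mult_ac)
     also have "\<dots> \<le> (\<Sum>i<n. 1 * cmod (R i s)) + (\<Sum>i<n. \<bar>2 * \<eta> i * exp (- A * (\<eta> i)\<^sup>2 * (t - s)) * cmod (Q i s)\<bar>) + 1 * cmod (Z s)"
      using k ki by (intro add_mono sum_mono mult_right_mono) (auto simp: abs_mult intro!: mult_right_mono mult_left_mono)
     finally show "k * cmod (?T s) \<le> (\<Sum>i<n. cmod (R i s)) + (\<Sum>i<n. \<bar>2 * \<eta> i * exp (- A * (\<eta> i)\<^sup>2 * (t - s)) * cmod (Q i s)\<bar>) + cmod (Z s)"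
      by simp
    qed simp
    finally have "ennreal (exp (- (A * e2 * t)) * cmod (?g s)) \<le> ennreal (cmod c * ((\<Sum>i<n. cmod (R i s)) + (\<Sum>i<n. \<bar>2 * \<eta> i * exp (- A * (\<eta> i)\<^sup>2 * (t - s)) * cmod (Q i s)\<bar>) + cmod (Z s)))"
     by (rule ennreal_leI)
    then show ?thesis using True
     by (simp add: ennreal_mult sum_ennreal sum_nonneg)
   qed simp
  qed
  also have "\<dots> = ennreal (cmod c) * ((\<Sum>i<n. X i) + (\<Sum>i<n. Y i) + W)"
  proof -
   define fX where "fX i s = ennreal (indicator {0..t} s * \<bar>cmod (R i s)\<bar>)" for i s
   define fY where "fY i s = ennreal (indicator {0..t} s * \<bar>2 * \<eta> i * exp (- A * (\<eta> i)\<^sup>2 * (t - s)) * cmod (Q i s)\<bar>)" for i s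
   define fW where "fW s = ennreal (indicator {0..t} s * \<bar>cmod (Z s)\<bar>)" for s
   have mX: "fX i \<in> borel_measurable lborel" and mY: "fY i \<in> borel_measurable lborel" if "i < n" for i
   proof -
    have [measurable]: "R i \<in> borel_measurable borel" "Q i \<in> borel_measurable borel" using that RQ by auto
    show "fX i \<in> borel_measurable lborel" unfolding fX_def by measurable
    show "fY i \<in> borel_measurable lborel" unfolding fY_def by measurable
   qed
   have [measurable]: "fW \<in> borel_measurable lborel" unfolding fW_def by measurable
   have [measurable]: "(\<lambda>s. \<Sum>i<n. fX i s) \<in> borel_measurable lborel" "(\<lambda>s. \<Sum>i<n. fY i s) \<in> borel_measurable lborel"
    using mX mY by (auto intro!: borel_measurable_sum)
   have "(\<integral>\<^sup>+s. ennreal (cmod c) * ((\<Sum>i<n. fX i s) + (\<Sum>i<n. fY i s) + fW s) \<partial>lborel) =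
    ennreal (cmod c) * ((\<integral>\<^sup>+s. (\<Sum>i<n. fX i s) \<partial>lborel) + (\<integral>\<^sup>+s. (\<Sum>i<n. fY i s) \<partial>lborel) + (\<integral>\<^sup>+s. fW s \<partial>lborel))"
    by (simp add: nn_integral_cmult nn_integral_add)
   also have "(\<integral>\<^sup>+s. (\<Sum>i<n. fX i s) \<partial>lborel) = (\<Sum>i<n. X i)"
    using mX by (subst nn_integral_sum) (auto simp: X_def fX_def[abs_def])
   also have "(\<integral>\<^sup>+s. (\<Sum>i<n. fY i s) \<partial>lborel) = (\<Sum>i<n. Y i)"
    using mY by (subst nn_integral_sum) (auto simp: Y_def fY_def[abs_def])
   also have "(\<integral>\<^sup>+s. fW s \<partial>lborel) = W" by (simp add: W_def fW_def)
   finally show ?thesis unfolding fX_def fY_def fW_def .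
  qed
  finally show ?thesis .
 qed
 have X2: "(X i)\<^sup>2 \<le> (\<integral>\<^sup>+s. ennreal (indicator {0..t} s * (cmod (R i s))\<^sup>2) \<partial>lborel)" if "i < n" for i
 proof -
  have [measurable]: "R i \<in> borel_measurable borel" using that RQ by auto
  have "(X i)\<^sup>2 \<le> ennreal (t - 0) * (\<integral>\<^sup>+s. ennreal (indicator {0..t} s * (cmod (R i s))\<^sup>2) \<partial>lborel)"
   unfolding X_def by (rule cauchy_schwarz_interval) (use t in measurable)
  also have "\<dots> \<le> 1 * (\<integral>\<^sup>+s. ennreal (indicator {0..t} s * (cmod (R i s))\<^sup>2) \<partial>lborel)"
   using t by (intro mult_right_mono) (auto simp: ennreal_le_1)
  finally show ?thesis by simp
 qed
 have W2: "W\<^sup>2 \<le> (\<integral>\<^sup>+s. ennreal (indicator {0..t} s * (cmod (Z s))\<^sup>2) \<partial>lborel)"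
 proof -
  have "W\<^sup>2 \<le> ennreal (t - 0) * (\<integral>\<^sup>+s. ennreal (indicator {0..t} s * (cmod (Z s))\<^sup>2) \<partial>lborel)"
   unfolding W_def by (rule cauchy_schwarz_interval) (use t in measurable)
  also have "\<dots> \<le> 1 * (\<integral>\<^sup>+s. ennreal (indicator {0..t} s * (cmod (Z s))\<^sup>2) \<partial>lborel)"
   using t by (intro mult_right_mono) (auto simp: ennreal_le_1)
  finally show ?thesis by simp
 qed
 have Y2: "(Y i)\<^sup>2 \<le> ennreal (2 / A) * (\<integral>\<^sup>+s. ennreal (indicator {0..t} s * (cmod (Q i s))\<^sup>2) \<partial>lborel)" if "i < n" for i
 proof -
  have [measurable]: "Q i \<in> borel_measurable borel" using that RQ by auto
  show ?thesis unfolding Y_def by (rule heat_multiplier_bound[OF A t(1)]) measurable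
 qed
 have sX: "(\<Sum>i<n. X i)\<^sup>2 \<le> ennreal (real n) * (\<Sum>i<n. \<integral>\<^sup>+s. ennreal (indicator {0..t} s * (cmod (R i s))\<^sup>2) \<partial>lborel)"
  using ennreal_sum_sq[of "{..<n}" X] X2
  by (auto simp: ennreal_of_nat_eq_real_of_nat intro!: order_trans[OF ennreal_sum_sq] mult_left_mono sum_mono)
 have sY: "(\<Sum>i<n. Y i)\<^sup>2 \<le> ennreal (real n * (2 / A)) * (\<Sum>i<n. \<integral>\<^sup>+s. ennreal (indicator {0..t} s * (cmod (Q i s))\<^sup>2) \<partial>lborel)"
 proof -
  have "(\<Sum>i<n. Y i)\<^sup>2 \<le> of_nat (card {..<n}) * (\<Sum>i<n. (Y i)\<^sup>2)" by (rule ennreal_sum_sq) simp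
  also have "\<dots> \<le> of_nat (card {..<n}) * (\<Sum>i<n. ennreal (2 / A) * (\<integral>\<^sup>+s. ennreal (indicator {0..t} s * (cmod (Q i s))\<^sup>2) \<partial>lborel))"
   using Y2 by (intro mult_left_mono sum_mono) auto
  also have "\<dots> = (ennreal (real n) * ennreal (2 / A)) * (\<Sum>i<n. \<integral>\<^sup>+s. ennreal (indicator {0..t} s * (cmod (Q i s))\<^sup>2) \<partial>lborel)"
   by (simp add: sum_distrib_left[symmetric] mult.assoc ennreal_of_nat_eq_real_of_nat)
  also have "ennreal (real n) * ennreal (2 / A) = ennreal (real n * (2 / A))" using A by (intro ennreal_mult[symmetric]) auto
  finally show ?thesis .
 qed
 let ?S = "(\<Sum>i<n. X i) + (\<Sum>i<n. Y i) + W"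
 have "ennreal ((cmod h1)\<^sup>2) = (ennreal (cmod h1))\<^sup>2" by (simp add: ennreal_power)
 also have "\<dots> \<le> (ennreal (cmod h0) + ennreal (cmod c) * ?S)\<^sup>2"
  using 1 2 by (intro power_mono) (auto intro: order_trans add_left_mono)
 also have "\<dots> \<le> 2 * (ennreal (cmod h0))\<^sup>2 + 2 * (ennreal (cmod c) * ?S)\<^sup>2" by (rule ennreal_add_sq)
 also have "\<dots> = 2 * ennreal ((cmod h0)\<^sup>2) + 2 * (ennreal ((cmod c)\<^sup>2) * ?S\<^sup>2)"
  by (simp add: ennreal_power power_mult_distrib)
 also have "\<dots> \<le> 2 * ennreal ((cmod h0)\<^sup>2) + 2 * (ennreal ((cmod c)\<^sup>2) * (4 * ((\<Sum>i<n. X i)\<^sup>2 + (\<Sum>i<n. Y i)\<^sup>2 + W\<^sup>2)))"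
 proof (intro add_left_mono mult_left_mono)
  have "?S\<^sup>2 \<le> 2 * ((\<Sum>i<n. X i) + (\<Sum>i<n. Y i))\<^sup>2 + 2 * W\<^sup>2" by (rule ennreal_add_sq)
  also have "\<dots> \<le> 2 * (2 * (\<Sum>i<n. X i)\<^sup>2 + 2 * (\<Sum>i<n. Y i)\<^sup>2) + 4 * W\<^sup>2"
   by (intro add_mono mult_left_mono mult_right_mono ennreal_add_sq) auto
  also have "\<dots> = 4 * ((\<Sum>i<n. X i)\<^sup>2 + (\<Sum>i<n. Y i)\<^sup>2 + W\<^sup>2)"
   by (simp add: distrib_left mult.assoc[symmetric])
  finally show "?S\<^sup>2 \<le> 4 * ((\<Sum>i<n. X i)\<^sup>2 + (\<Sum>i<n. Y i)\<^sup>2 + W\<^sup>2)" .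
 qed auto
 also have "\<dots> = 2 * ennreal ((cmod h0)\<^sup>2) + ennreal (8 * (cmod c)\<^sup>2) * ((\<Sum>i<n. X i)\<^sup>2 + (\<Sum>i<n. Y i)\<^sup>2 + W\<^sup>2)"
 proof -
  have "2 * (ennreal ((cmod c)\<^sup>2) * (4 * z)) = ennreal (8 * (cmod c)\<^sup>2) * z" for z
  proof -
   have "ennreal (8 * (cmod c)\<^sup>2) = ennreal 8 * ennreal ((cmod c)\<^sup>2)" by (rule ennreal_mult) auto
   moreover have "2 * (ennreal ((cmod c)\<^sup>2) * (4 * z)) = (2 * 4) * ennreal ((cmod c)\<^sup>2) * z" by (simp only: mult_ac)
   moreover have "2 * 4 = (8 :: ennreal)" by simp
   ultimately show ?thesis by (metis ennreal_numeral)
  qed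
  then show ?thesis by (simp only:)
 qed
 also have "\<dots> \<le> 2 * ennreal ((cmod h0)\<^sup>2) + ennreal (8 * (cmod c)\<^sup>2) * (
  ennreal (real n) * (\<Sum>i<n. \<integral>\<^sup>+s. ennreal (indicator {0..t} s * (cmod (R i s))\<^sup>2) \<partial>lborel) +
  ennreal (real n * (2 / A)) * (\<Sum>i<n. \<integral>\<^sup>+s. ennreal (indicator {0..t} s * (cmod (Q i s))\<^sup>2) \<partial>lborel) +
  (\<integral>\<^sup>+s. ennreal (indicator {0..t} s * (cmod (Z s))\<^sup>2) \<partial>lborel))"
  by (intro add_left_mono mult_left_mono add_mono sX sY W2) auto
 finally show ?thesis .
qed

context heat_weighted
begin

text \<open>Time and frequency are exchanged so that Plancherel's theorem can be applied at each
  fixed time.\<close>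

lemma fourier_tonelli:
 fixes V :: "real \<Rightarrow> (nat \<Rightarrow> real) \<Rightarrow> complex" and w :: "(nat \<Rightarrow> real) \<Rightarrow> real" and t :: real
 assumes W: "case_prod V \<in> Bor2 n" and [measurable]: "w \<in> Bor n"
  and int: "\<And>s. s \<in> {0..1} \<Longrightarrow> integrable (lbn n) (\<lambda>x. of_real (w x) * V s x)"
  and fin: "\<And>s. s \<in> {0..1} \<Longrightarrow> (sq_int (lbn n) (\<lambda>x. w x * cmod (V s x))) < \<infinity>"
  and t: "t \<le> 1"
 shows "(\<integral>\<^sup>+\<eta>. (\<integral>\<^sup>+s. ennreal (indicator {0..t} s * (cmod (fourier n (\<lambda>x. of_real (w x) * V s x) \<eta>))\<^sup>2) \<partial>lborel) \<partial>lbn n) =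
  ennreal ((2 * pi) ^ n) * (\<integral>\<^sup>+s. indicator {0..t} s * sq_int (lbn n) (\<lambda>x. w x * cmod (V s x)) \<partial>lborel)"
proof -
 interpret P: pair_sigma_finite "lbn n" "lborel :: real measure" ..
 have [measurable]: "case_prod V \<in> Bor2 n" by (rule W)
 have V [measurable]: "V s \<in> Bor n" for s
  using measurable_compose[OF measurable_Pair1'[of s borel "lbn n"] W] by simp
 have m: "(\<lambda>(s, \<eta>). fourier n (\<lambda>x. of_real (w x) * V s x) \<eta>) \<in> Bor2 n"
  by (rule fourier_joint[OF W]) measurable
 have m' [measurable]: "(\<lambda>p. fourier n (\<lambda>x. of_real (w x) * V (snd p) x) (fst p)) \<in> borel_measurable (lbn n \<Otimes>\<^sub>M lborel)"
  using measurable_compose[OF measurable_pair_swap'[of "lbn n" "borel"] m] by (simp add: split_beta cong: measurable_cong_sets)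
 have "(\<integral>\<^sup>+\<eta>. (\<integral>\<^sup>+s. ennreal (indicator {0..t} s * (cmod (fourier n (\<lambda>x. of_real (w x) * V s x) \<eta>))\<^sup>2) \<partial>lborel) \<partial>lbn n) =
  (\<integral>\<^sup>+s. (\<integral>\<^sup>+\<eta>. ennreal (indicator {0..t} s * (cmod (fourier n (\<lambda>x. of_real (w x) * V s x) \<eta>))\<^sup>2) \<partial>lbn n) \<partial>lborel)"
  by (rule P.Fubini'[where f = "\<lambda>\<eta> s. ennreal (indicator {0..t} s * (cmod (fourier n (\<lambda>x. of_real (w x) * V s x) \<eta>))\<^sup>2)", symmetric])
   (simp add: split_beta)
 also have "\<dots> = (\<integral>\<^sup>+s. ennreal ((2 * pi) ^ n) * (indicator {0..t} s * sq_int (lbn n) (\<lambda>x. w x * cmod (V s x))) \<partial>lborel)"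
 proof (intro nn_integral_cong)
  fix s :: real
  show "(\<integral>\<^sup>+\<eta>. ennreal (indicator {0..t} s * (cmod (fourier n (\<lambda>x. of_real (w x) * V s x) \<eta>))\<^sup>2) \<partial>lbn n) =
   ennreal ((2 * pi) ^ n) * (indicator {0..t} s * sq_int (lbn n) (\<lambda>x. w x * cmod (V s x)))"
  proof (cases "s \<in> {0..t}")
   case True
   then have s: "s \<in> {0..1}" using t by auto
   from True wplancherel[OF V _ int[OF s] fin[OF s]] show ?thesis by simp
  qed simp
 qed
 also have "\<dots> = ennreal ((2 * pi) ^ n) * (\<integral>\<^sup>+s. indicator {0..t} s * sq_int (lbn n) (\<lambda>x. w x * cmod (V s x)) \<partial>lborel)"
 proof (rule nn_integral_cmult)
  have [measurable]: "(\<lambda>p. V (fst p) (snd p)) \<in> borel_measurable (lborel \<Otimes>\<^sub>M lbn n)"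
   using W by (simp add: split_beta')
  show "(\<lambda>s. indicator {0..t} s * sq_int (lbn n) (\<lambda>x. w x * cmod (V s x))) \<in> borel_measurable lborel"
   by measurable
 qed
 finally show ?thesis .
qed

end

text \<open>The reference weight \<Omega> is square integrable, which makes w V integrable, and
  bounded, which makes it square integrable. \<open>wplancherel\<close> needs both. The weights
  \<open>w\<close> will be \<Omega> and the products in which one factor of \<Omega> is
  differentiated.\<close>

lemma weighted_pair:
 fixes V :: "(nat \<Rightarrow> real) \<Rightarrow> complex"
 assumes [measurable]: "V \<in> Bor n" "w \<in> Bor n" "\<Omega> \<in> Bor n"
  and w: "\<And>x. \<bar>w x\<bar> \<le> k * \<Omega> x" and \<Omega>: "\<And>x. 0 \<le> \<Omega> x" "\<And>x. \<Omega> x \<le> b"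
  and a: "sq_int (lbn n) (\<lambda>x. cmod (complex_of_real (\<Omega> x))) \<le> ennreal (a\<^sup>2)" "a \<ge> 0"
  and V: "sq_int (lbn n) (\<lambda>x. cmod (V x)) \<le> ennreal (CU\<^sup>2)" "CU \<ge> 0"
 shows "integrable (lbn n) (\<lambda>x. of_real (w x) * V x)"
  and "sq_int (lbn n) (\<lambda>x. w x * cmod (V x)) \<le> ennreal (k\<^sup>2) * sq_int (lbn n) (\<lambda>x. \<Omega> x * cmod (V x))"
  and "sq_int (lbn n) (\<lambda>x. \<Omega> x * cmod (V x)) \<le> ennreal (b\<^sup>2 * CU\<^sup>2)"
  and "sq_int (lbn n) (\<lambda>x. w x * cmod (V x)) < \<infinity>"
proof -
 have "integrable (lbn n) (\<lambda>x. of_real (\<Omega> x) * V x)"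
  by (rule L2_product(2)[OF _ _ a(1) V(1) a(2) V(2)]) measurable
 then have "integrable (lbn n) (\<lambda>x. of_real k * (of_real (\<Omega> x) * V x))" by simp
 then show "integrable (lbn n) (\<lambda>x. of_real (w x) * V x)"
 proof (rule Bochner_Integration.integrable_bound)
  show "AE x in lbn n. cmod (of_real (w x) * V x) \<le> cmod (of_real k * (of_real (\<Omega> x) * V x))"
  proof (intro AE_I2)
   fix x
   have "\<bar>w x\<bar> \<le> \<bar>k\<bar> * \<bar>\<Omega> x\<bar>" using w[of x] by (metis abs_ge_self abs_mult order_trans)
   then have "\<bar>w x\<bar> * cmod (V x) \<le> (\<bar>k\<bar> * \<bar>\<Omega> x\<bar>) * cmod (V x)" by (rule mult_right_mono) simp
   then show "cmod (of_real (w x) * V x) \<le> cmod (of_real k * (of_real (\<Omega> x) * V x))" by (simp add: norm_mult mult.assoc)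
  qed
 qed measurable
 have "sq_int (lbn n) (\<lambda>x. w x * cmod (V x)) \<le> (\<integral>\<^sup>+x. ennreal (k\<^sup>2) * ennreal ((\<Omega> x * cmod (V x))\<^sup>2) \<partial>lbn n)"
 proof (intro nn_integral_mono)
  fix x
  have "(\<bar>w x\<bar> * cmod (V x))\<^sup>2 \<le> (k * \<Omega> x * cmod (V x))\<^sup>2" by (intro power_mono mult_right_mono w) auto
  then show "ennreal ((w x * cmod (V x))\<^sup>2) \<le> ennreal (k\<^sup>2) * ennreal ((\<Omega> x * cmod (V x))\<^sup>2)"
   by (simp add: ennreal_mult[symmetric] power_mult_distrib mult_ac ennreal_leI)
 qed
 then show 2: "sq_int (lbn n) (\<lambda>x. w x * cmod (V x)) \<le> ennreal (k\<^sup>2) * sq_int (lbn n) (\<lambda>x. \<Omega> x * cmod (V x))"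
  by (simp add: nn_integral_cmult)
 have "sq_int (lbn n) (\<lambda>x. \<Omega> x * cmod (V x)) \<le> (\<integral>\<^sup>+x. ennreal (b\<^sup>2) * ennreal ((cmod (V x))\<^sup>2) \<partial>lbn n)"
 proof (intro nn_integral_mono)
  fix x
  have "(\<Omega> x * cmod (V x))\<^sup>2 \<le> (b * cmod (V x))\<^sup>2" using \<Omega> by (intro power_mono mult_right_mono) auto
  then show "ennreal ((\<Omega> x * cmod (V x))\<^sup>2) \<le> ennreal (b\<^sup>2) * ennreal ((cmod (V x))\<^sup>2)"
   by (simp add: ennreal_mult[symmetric] power_mult_distrib mult_ac ennreal_leI)
 qed
 also have "\<dots> = ennreal (b\<^sup>2) * sq_int (lbn n) (\<lambda>x. cmod (V x))" by (simp add: nn_integral_cmult)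
 also have "\<dots> \<le> ennreal (b\<^sup>2) * ennreal (CU\<^sup>2)" using V(1) by (intro mult_left_mono) auto
 finally show 3: "sq_int (lbn n) (\<lambda>x. \<Omega> x * cmod (V x)) \<le> ennreal (b\<^sup>2 * CU\<^sup>2)" by (simp add: ennreal_mult)
 have "ennreal (k\<^sup>2) * sq_int (lbn n) (\<lambda>x. \<Omega> x * cmod (V x)) \<le> ennreal (k\<^sup>2) * ennreal (b\<^sup>2 * CU\<^sup>2)"
  using 3 by (intro mult_left_mono) auto
 also have "\<dots> < \<infinity>" by (simp add: ennreal_mult[symmetric])
 finally show "sq_int (lbn n) (\<lambda>x. w x * cmod (V x)) < \<infinity>" using 2 by (rule order.strict_trans1[rotated])
qed

lemma fourier_time_measurable:
 fixes V :: "real \<Rightarrow> (nat \<Rightarrow> real) \<Rightarrow> complex"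
 assumes W: "case_prod V \<in> Bor2 n" and [measurable]: "w \<in> Bor n"
 shows "(\<lambda>\<eta>. \<integral>\<^sup>+s. ennreal (indicator {0..t} s * (cmod (fourier n (\<lambda>x. of_real (w x) * V s x) \<eta>))\<^sup>2) \<partial>lborel) \<in> Bor n"
proof -
 have m: "(\<lambda>(s, \<eta>). fourier n (\<lambda>x. of_real (w x) * V s x) \<eta>) \<in> Bor2 n"
  by (rule fourier_joint[OF W]) measurable
 have m' [measurable]: "(\<lambda>p. fourier n (\<lambda>x. of_real (w x) * V (snd p) x) (fst p)) \<in> borel_measurable (lbn n \<Otimes>\<^sub>M lborel)"
  using measurable_compose[OF measurable_pair_swap'[of "lbn n" "borel"] m] by (simp add: split_beta cong: measurable_cong_sets)
 show ?thesis by (rule lborel.borel_measurable_nn_integral) (simp add: split_beta)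
qed

lemma pw_const_bound:
 assumes i: "i < n" and v: "\<And>s. \<bar>v s\<bar> \<le> k * w s" and w: "\<And>s. w s \<ge> (0::real)"
 shows "\<bar>pw n ((\<lambda>_. w)(i := v)) x\<bar> \<le> k * pw n (\<lambda>_. w) x"
proof -
 have p: "(\<Prod>j\<in>{..<n}-{i}. w (x j)) \<ge> 0" using w by (intro prod_nonneg) auto
 have "\<bar>pw n ((\<lambda>_. w)(i := v)) x\<bar> = \<bar>v (x i)\<bar> * (\<Prod>j\<in>{..<n}-{i}. w (x j))"
  unfolding pw_upd[OF i] using p by (simp add: abs_mult)
 also have "\<dots> \<le> (k * w (x i)) * (\<Prod>j\<in>{..<n}-{i}. w (x j))" by (rule mult_right_mono[OF v p])
 also have "\<dots> = k * pw n (\<lambda>_. w) x" unfolding pw_def using i by (subst prod.remove[of "{..<n}" i]) auto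
 finally show ?thesis .
qed

text \<open>The upper bound 1/d and square integrability make transforms and Gronwall's inequality
  available for a fixed \<open>d\<close>; the comparison with the Gaussian is uniform in
  \<open>d\<close> and controls the data.\<close>

lemma pw_wt:
 assumes l: "l > 0" and d: "d > 0"
 shows "0 \<le> pw n (\<lambda>_. wt l d) x" and "pw n (\<lambda>_. wt l d) x \<le> (1 / d) ^ n"
  and "\<gamma> > 0 \<Longrightarrow> pw n (\<lambda>_. wt l d) x \<le> exp (l\<^sup>2 / (4 * \<gamma>)) ^ n * gw n \<gamma> x"
  and "\<exists>a\<ge>0. (sq_int (lbn n) (\<lambda>x. cmod (complex_of_real (pw n (\<lambda>_. wt l d) x)))) \<le> ennreal (a\<^sup>2)"
  and "pw n (\<lambda>_. wt l d) \<in> Bor n"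
proof -
 have p: "0 \<le> wt l d s" for s using wt_pos[of d l s] d by simp
 show "0 \<le> pw n (\<lambda>_. wt l d) x" unfolding pw_def by (intro prod_nonneg) (simp add: p)
 have "wt l d s \<le> 1 / d" for s
 proof -
  have "(1 / d) * (1 / cosh (l * s)) \<le> (1 / d) * 1"
   using d cosh_real_ge_1[of "l * s"] by (intro mult_left_mono) auto
  with wt_le_sech[OF d, of l s] show ?thesis by simp
 qed
 then have "pw n (\<lambda>_. wt l d) x \<le> (\<Prod>i<n. 1 / d)" unfolding pw_def by (intro prod_mono) (simp add: p)
 then show "pw n (\<lambda>_. wt l d) x \<le> (1 / d) ^ n" by simp
 have "pw n (\<lambda>_. wt l d) x \<le> pw n (\<lambda>_ s. cosh (l * s)) x"
  unfolding pw_def using d by (intro prod_mono) (simp add: p wt_le_cosh)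
 then show "\<gamma> > 0 \<Longrightarrow> pw n (\<lambda>_. wt l d) x \<le> exp (l\<^sup>2 / (4 * \<gamma>)) ^ n * gw n \<gamma> x"
  using pw_cosh_le_gw[of \<gamma> n l x] by linarith
 have [measurable]: "wt l d \<in> borel_measurable borel" using d by (intro smooth_borel smooth_wt) simp
 show "pw n (\<lambda>_. wt l d) \<in> Bor n" by measurable
 show "\<exists>a\<ge>0. (sq_int (lbn n) (\<lambda>x. cmod (complex_of_real (pw n (\<lambda>_. wt l d) x)))) \<le> ennreal (a\<^sup>2)"
 proof (rule pw_L2)
  have "sq_int lborel (\<lambda>s. wt l d s) \<le> sq_int lborel (\<lambda>s. (1 / d) * (1 / cosh (l * s)))"
   by (intro nn_integral_mono ennreal_leI power_mono wt_le_sech d p)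
  also have "\<dots> < \<infinity>" by (rule sech_scaled_L2[OF l])
  finally show "sq_int lborel (\<lambda>s. wt l d s) < \<infinity>" .
 qed measurable
qed

context heat_weighted
begin

text \<open>The second derivative of \<omega>(s) e^(-i\<eta>s) is (\<omega>'' - 2i\<eta> \<omega>' -
  \<eta>^2 \<omega>) e^(-i\<eta>s). Summed over the coordinates, the last terms are removed by the
  integrating factor e^(c |\<eta>|^2 t); the other two join G as forcing.\<close>

lemma fourier_duhamel:
 assumes l: "l > 0" and d: "d > 0" and \<eta>: "\<eta> \<in> space (lbn n)" and t: "t \<in> {0..1}"
 defines "\<omega> \<equiv> wt l d"
 shows "exp (Complex A B * of_real (\<Sum>i<n. (\<eta> i)\<^sup>2) * of_real t) * fourier n (\<lambda>x. of_real (pw n (\<lambda>_. \<omega>) x) * U t x) \<eta>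
  - fourier n (\<lambda>x. of_real (pw n (\<lambda>_. \<omega>) x) * U 0 x) \<eta> =
  (int_on 0 t (\<lambda>s. exp (Complex A B * of_real (\<Sum>i<n. (\<eta> i)\<^sup>2) * of_real s) * (Complex A B *
   ((\<Sum>i<n. fourier n (\<lambda>x. of_real (pw n ((\<lambda>_. \<omega>)(i := vd (vd \<omega>))) x) * U s x) \<eta>
     - 2 * \<i> * of_real (\<eta> i) * fourier n (\<lambda>x. of_real (pw n ((\<lambda>_. \<omega>)(i := vd \<omega>)) x) * U s x) \<eta>)
    + fourier n (\<lambda>x. of_real (pw n (\<lambda>_. \<omega>) x) * G s x) \<eta>))))"
proof -
 define c where "c = Complex A B"
 define z where "z i = - (\<i> * complex_of_real (\<eta> i))" for i
 define f where "f i = wexp \<omega> (z i)" for i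
 define \<Omega> where "\<Omega> = pw n (\<lambda>_. \<omega>)"
 define e2 where "e2 = (\<Sum>i<n. (\<eta> i)\<^sup>2)"
 note P = pw_wt[OF l d, of n, folded \<omega>_def, folded \<Omega>_def]
 have p: "0 \<le> \<omega> s" for s using wt_pos[of d l s] d by (simp add: \<omega>_def)
 have sm: "smooth \<omega>" using d by (simp add: \<omega>_def smooth_wt)
 have sm': "smooth (vd \<omega>)" "smooth (vd (vd \<omega>))" using smooth_vd(2)[OF sm] smooth_vd(2)[OF smooth_vd(2)[OF sm]] by auto
 have [measurable]: "\<omega> \<in> borel_measurable borel" "vd \<omega> \<in> borel_measurable borel" "vd (vd \<omega>) \<in> borel_measurable borel"
  using sm sm' by (auto intro: smooth_borel)
 have \<Omega>m [measurable]: "\<Omega> \<in> Bor n" using P(5) .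
 have W1m [measurable]: "pw n ((\<lambda>_. \<omega>)(i := vd \<omega>)) \<in> Bor n" for i by (rule pw_measurable) (simp add: fun_upd_def)
 have W2m [measurable]: "pw n ((\<lambda>_. \<omega>)(i := vd (vd \<omega>))) \<in> Bor n" for i by (rule pw_measurable) (simp add: fun_upd_def)
 obtain a where a: "a \<ge> 0" "sq_int (lbn n) (\<lambda>x. cmod (complex_of_real (\<Omega> x))) \<le> ennreal (a\<^sup>2)" using P(4) by blast
 have der: "\<bar>vd \<omega> s\<bar> \<le> l * \<omega> s" "\<bar>vd (vd \<omega>) s\<bar> \<le> 3 * l\<^sup>2 * \<omega> s" for s
  using wt_derivatives[of l d s] l d by (auto simp: \<omega>_def)
 have ek1: "integrable (lbn n) (\<lambda>x. g x * ek n \<eta> x)" if g: "integrable (lbn n) g" for g :: "(nat \<Rightarrow> real) \<Rightarrow> complex"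
  by (rule Bochner_Integration.integrable_bound[OF g]) (use \<eta> g in \<open>auto simp: norm_mult\<close>)
 have int: "integrable (lbn n) (\<lambda>x. of_real (\<Omega> x) * U s x * ek n \<eta> x)"
  "i < n \<Longrightarrow> integrable (lbn n) (\<lambda>x. of_real (pw n ((\<lambda>_. \<omega>)(i := vd \<omega>)) x) * U s x * ek n \<eta> x)"
  "i < n \<Longrightarrow> integrable (lbn n) (\<lambda>x. of_real (pw n ((\<lambda>_. \<omega>)(i := vd (vd \<omega>))) x) * U s x * ek n \<eta> x)" if s: "s \<in> {0..1}" for s i
 proof -
  have [measurable]: "U s \<in> Bor n" using s by measurable
  note wp = weighted_pair(1)[OF _ _ \<Omega>m _ P(1) P(2) a(2,1) U_L2[OF s] CU]
  show "integrable (lbn n) (\<lambda>x. of_real (\<Omega> x) * U s x * ek n \<eta> x)"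
   by (rule ek1, rule wp[where k = 1]) (use P(1) in auto)
  show "i < n \<Longrightarrow> integrable (lbn n) (\<lambda>x. of_real (pw n ((\<lambda>_. \<omega>)(i := vd \<omega>)) x) * U s x * ek n \<eta> x)"
   by (rule ek1, rule wp[where k = l]) (use pw_const_bound[OF _ der(1) p] in \<open>auto simp: \<Omega>_def\<close>)
  show "i < n \<Longrightarrow> integrable (lbn n) (\<lambda>x. of_real (pw n ((\<lambda>_. \<omega>)(i := vd (vd \<omega>))) x) * U s x * ek n \<eta> x)"
   by (rule ek1, rule wp[where k = "3 * l\<^sup>2"]) (use pw_const_bound[OF _ der(2) p] in \<open>auto simp: \<Omega>_def\<close>)
 qed
 have tf: "tens n f x = of_real (\<Omega> x) * ek n \<eta> x" for x
  unfolding f_def[abs_def] z_def \<Omega>_def by (rule tens_wexp)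
 have tf': "tens n (f(i := wexp v (z i))) x = of_real (pw n ((\<lambda>_. \<omega>)(i := v)) x) * ek n \<eta> x" for i v x
 proof -
  have "f(i := wexp v (z i)) = (\<lambda>j. wexp (((\<lambda>_. \<omega>)(i := v)) j) (- (\<i> * of_real (\<eta> j))))"
   by (auto simp: f_def z_def fun_eq_iff)
  then show ?thesis using tens_wexp[of n "(\<lambda>_. \<omega>)(i := v)" \<eta> x] by (simp only:)
 qed
 have pU: "pair U f s = fourier n (\<lambda>x. of_real (\<Omega> x) * U s x) \<eta>" "pair G f s = fourier n (\<lambda>x. of_real (\<Omega> x) * G s x) \<eta>" for s
  unfolding pair_def fourier_def tf by (simp_all add: mult_ac)
 have pUi: "pair U (f(i := vd (vd (f i)))) s =
   fourier n (\<lambda>x. of_real (pw n ((\<lambda>_. \<omega>)(i := vd (vd \<omega>))) x) * U s x) \<eta>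
   - 2 * \<i> * of_real (\<eta> i) * fourier n (\<lambda>x. of_real (pw n ((\<lambda>_. \<omega>)(i := vd \<omega>)) x) * U s x) \<eta>
   - of_real ((\<eta> i)\<^sup>2) * fourier n (\<lambda>x. of_real (\<Omega> x) * U s x) \<eta>" if i: "i < n" and s: "s \<in> {0..1}" for i s
 proof -
  have "vd (vd (f i)) = (\<lambda>r. (wexp (vd (vd \<omega>)) (z i) r + (2 * z i) * wexp (vd \<omega>) (z i) r) + (z i)\<^sup>2 * wexp \<omega> (z i) r)"
   unfolding f_def vd_wexp(2)[OF sm] ..
  then have "tens n (f(i := vd (vd (f i)))) x = tens n (f(i := wexp (vd (vd \<omega>)) (z i))) x + (2 * z i) * tens n (f(i := wexp (vd \<omega>) (z i))) x + (z i)\<^sup>2 * tens n (f(i := wexp \<omega> (z i))) x" for x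
   by (simp only: tens_slot_add[OF i] tens_slot_cmult[OF i])
  moreover have "f(i := wexp \<omega> (z i)) = f" by (auto simp: f_def)
  ultimately have "U s x * tens n (f(i := vd (vd (f i)))) x =
   of_real (pw n ((\<lambda>_. \<omega>)(i := vd (vd \<omega>))) x) * U s x * ek n \<eta> x + (2 * z i) * (of_real (pw n ((\<lambda>_. \<omega>)(i := vd \<omega>)) x) * U s x * ek n \<eta> x)
   + (z i)\<^sup>2 * (of_real (\<Omega> x) * U s x * ek n \<eta> x)" for x
   by (simp add: tf tf' algebra_simps del: fun_upd_apply)
  then have "pair U (f(i := vd (vd (f i)))) s = fourier n (\<lambda>x. of_real (pw n ((\<lambda>_. \<omega>)(i := vd (vd \<omega>))) x) * U s x) \<eta>
   + (2 * z i) * fourier n (\<lambda>x. of_real (pw n ((\<lambda>_. \<omega>)(i := vd \<omega>)) x) * U s x) \<eta>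
   + (z i)\<^sup>2 * fourier n (\<lambda>x. of_real (\<Omega> x) * U s x) \<eta>"
   unfolding pair_def fourier_def using int[OF s] i by simp
  then show ?thesis by (simp add: z_def power_mult_distrib)
 qed
 \<comment> \<open>The sum of the constants for the factor and its first two derivatives, so that a
   single multiple of \<omega> is an envelope for all three.\<close>
 define k where "k i = 1 + (l + \<bar>\<eta> i\<bar>) + (3 * l\<^sup>2 + 2 * \<bar>\<eta> i\<bar> * l + (\<eta> i)\<^sup>2)" for i
 have k: "k i \<ge> 0" for i using l unfolding k_def by (auto intro!: add_nonneg_nonneg)
 have main: "exp (- (- (c * of_real e2)) * of_real t) * pair U f t - exp (- (- (c * of_real e2)) * of_real 0) * pair U f 0 =
  (int_on 0 t (\<lambda>s. exp (- (- (c * of_real e2)) * of_real s) * (c * rhs f s - (- (c * of_real e2)) * pair U f s)))"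
  unfolding c_def
 proof (rule duhamel_dominated[where b = "\<lambda>i s. k i * \<omega> s"])
  show "smooth (f i)" for i unfolding f_def by (rule smooth_wexp[OF sm])
  show "cmod (f i s) \<le> k i * \<omega> s \<and> cmod (vd (f i) s) \<le> k i * \<omega> s \<and> cmod (vd (vd (f i)) s) \<le> k i * \<omega> s" for i s
  proof -
   have w: "cmod (wexp v (z i) s) = \<bar>v s\<bar>" for v by (simp add: wexp_def z_def norm_mult)
   have z: "cmod (z i) = \<bar>\<eta> i\<bar>" by (simp add: z_def norm_mult)
   have nn: "0 \<le> l * \<omega> s" "0 \<le> \<bar>\<eta> i\<bar> * \<omega> s" "0 \<le> l\<^sup>2 * \<omega> s" "0 \<le> \<bar>\<eta> i\<bar> * (l * \<omega> s)" "0 \<le> (\<eta> i)\<^sup>2 * \<omega> s" "0 \<le> \<omega> s"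
    using l p[of s] by (auto intro!: mult_nonneg_nonneg)
   have ks: "k i * \<omega> s = \<omega> s + l * \<omega> s + \<bar>\<eta> i\<bar> * \<omega> s + 3 * (l\<^sup>2 * \<omega> s) + 2 * (\<bar>\<eta> i\<bar> * (l * \<omega> s)) + (\<eta> i)\<^sup>2 * \<omega> s"
    unfolding k_def by (simp add: algebra_simps)
   have 1: "cmod (vd (f i) s) \<le> l * \<omega> s + \<bar>\<eta> i\<bar> * \<omega> s"
    unfolding f_def vd_wexp(1)[OF sm]
    by (rule order_trans[OF norm_triangle_ineq]) (use der(1)[of s] p[of s] in \<open>simp add: w norm_mult z\<close>)
   have 2: "cmod (vd (vd (f i)) s) \<le> 3 * (l\<^sup>2 * \<omega> s) + 2 * (\<bar>\<eta> i\<bar> * (l * \<omega> s)) + (\<eta> i)\<^sup>2 * \<omega> s"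
   proof -
    have "cmod (vd (vd (f i)) s) \<le> cmod (wexp (vd (vd \<omega>)) (z i) s) + cmod ((2 * z i) * wexp (vd \<omega>) (z i) s) + cmod ((z i)\<^sup>2 * wexp \<omega> (z i) s)"
     unfolding f_def vd_wexp(2)[OF sm] by (intro order_trans[OF norm_triangle_ineq] add_mono norm_triangle_ineq order_refl)
    also have "\<dots> = \<bar>vd (vd \<omega>) s\<bar> + 2 * (\<bar>\<eta> i\<bar> * \<bar>vd \<omega> s\<bar>) + (\<eta> i)\<^sup>2 * \<omega> s"
     using p[of s] by (simp add: norm_mult norm_power w z)
    also have "\<dots> \<le> 3 * (l\<^sup>2 * \<omega> s) + 2 * (\<bar>\<eta> i\<bar> * (l * \<omega> s)) + (\<eta> i)\<^sup>2 * \<omega> s"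
     using der[of s] by (intro add_mono mult_left_mono) auto
    finally show ?thesis .
   qed
   have 0: "cmod (f i s) = \<omega> s" using p[of s] by (simp add: f_def w)
   show ?thesis using 0 1 2 nn unfolding ks by (intro conjI; linarith)
  qed
  show "(\<lambda>s. k i * \<omega> s) \<in> borel_measurable borel" for i by measurable
  fix r :: real assume r: "r \<in> {0..1}"
  have [measurable]: "U r \<in> Bor n" "G r \<in> Bor n" using r by measurable
  have pk: "(\<Prod>i<n. k i * \<omega> (x i)) = (\<Prod>i<n. k i) * \<Omega> x" for x by (simp add: \<Omega>_def pw_def prod.distrib)
  have kk: "(\<Prod>i<n. k i) \<ge> 0" by (intro prod_nonneg) (simp add: k)
  have "(\<integral>\<^sup>+x. ennreal ((\<Prod>i<n. k i * \<omega> (x i)) * (cmod (U r x) + cmod (G r x))) \<partial>lbn n) =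
   (\<integral>\<^sup>+x. ennreal (\<Prod>i<n. k i) * (ennreal (cmod (of_real (\<Omega> x) * U r x)) + ennreal (cmod (of_real (\<Omega> x) * G r x))) \<partial>lbn n)"
  proof (intro nn_integral_cong)
   fix x
   have "(\<Prod>i<n. k i * \<omega> (x i)) * (cmod (U r x) + cmod (G r x)) = (\<Prod>i<n. k i) * (cmod (of_real (\<Omega> x) * U r x) + cmod (of_real (\<Omega> x) * G r x))"
    unfolding pk using P(1)[of x] by (simp add: norm_mult algebra_simps)
   then show "ennreal ((\<Prod>i<n. k i * \<omega> (x i)) * (cmod (U r x) + cmod (G r x))) =
    ennreal (\<Prod>i<n. k i) * (ennreal (cmod (of_real (\<Omega> x) * U r x)) + ennreal (cmod (of_real (\<Omega> x) * G r x)))"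
    using kk by (simp only: ennreal_mult norm_ge_zero add_nonneg_nonneg ennreal_plus)
  qed
  also have "\<dots> = ennreal (\<Prod>i<n. k i) * ((\<integral>\<^sup>+x. ennreal (cmod (of_real (\<Omega> x) * U r x)) \<partial>lbn n) + (\<integral>\<^sup>+x. ennreal (cmod (of_real (\<Omega> x) * G r x)) \<partial>lbn n))"
   by (subst nn_integral_cmult) (auto simp: nn_integral_add)
  also have "\<dots> \<le> ennreal (\<Prod>i<n. k i) * (ennreal (a * CU) + ennreal (a * CU))"
   by (intro mult_left_mono add_mono L2_product(1)[OF _ _ a(2) _ a(1) CU] U_L2 G_L2 r) measurable
  also have "\<dots> = ennreal ((\<Prod>i<n. k i) * (a * CU + a * CU))"
   using mult_nonneg_nonneg[OF a(1) CU] kk by (simp only: ennreal_mult[OF kk] ennreal_plus add_nonneg_nonneg)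
  finally show "(\<integral>\<^sup>+x. ennreal ((\<Prod>i<n. k i * \<omega> (x i)) * (cmod (U r x) + cmod (G r x))) \<partial>lbn n) \<le> ennreal ((\<Prod>i<n. k i) * (a * CU + a * CU))" .
 qed (use t in auto)
 have eq: "c * rhs f s - (- (c * of_real e2)) * pair U f s = c *
   ((\<Sum>i<n. fourier n (\<lambda>x. of_real (pw n ((\<lambda>_. \<omega>)(i := vd (vd \<omega>))) x) * U s x) \<eta>
     - 2 * \<i> * of_real (\<eta> i) * fourier n (\<lambda>x. of_real (pw n ((\<lambda>_. \<omega>)(i := vd \<omega>)) x) * U s x) \<eta>)
    + fourier n (\<lambda>x. of_real (\<Omega> x) * G s x) \<eta>)" if s: "s \<in> {0..1}" for s
 proof -
  define h where "h = fourier n (\<lambda>x. of_real (\<Omega> x) * U s x) \<eta>"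
  define T where "T i = fourier n (\<lambda>x. of_real (pw n ((\<lambda>_. \<omega>)(i := vd (vd \<omega>))) x) * U s x) \<eta>
     - 2 * \<i> * of_real (\<eta> i) * fourier n (\<lambda>x. of_real (pw n ((\<lambda>_. \<omega>)(i := vd \<omega>)) x) * U s x) \<eta>" for i
  have "(\<Sum>i<n. pair U (f(i := vd (vd (f i)))) s) = (\<Sum>i<n. T i - of_real ((\<eta> i)\<^sup>2) * h)"
   by (intro sum.cong) (use pUi[OF _ s] in \<open>auto simp: T_def h_def\<close>)
  also have "\<dots> = (\<Sum>i<n. T i) - of_real e2 * h" by (simp add: sum_subtractf sum_distrib_right e2_def)
  finally have R: "rhs f s = (\<Sum>i<n. T i) - of_real e2 * h + pair G f s" by (simp add: rhs_def)
  have alg: "c * (S - e * h + p) - (- (c * e)) * h = c * (S + p)" for S e p :: complex by (simp add: algebra_simps)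
  show ?thesis unfolding T_def[symmetric] R pU h_def[symmetric] by (rule alg)
 qed
 have "(int_on 0 t (\<lambda>s. exp (- (- (c * of_real e2)) * of_real s) * (c * rhs f s - (- (c * of_real e2)) * pair U f s))) =
  (int_on 0 t (\<lambda>s. exp (c * of_real e2 * of_real s) * (c *
   ((\<Sum>i<n. fourier n (\<lambda>x. of_real (pw n ((\<lambda>_. \<omega>)(i := vd (vd \<omega>))) x) * U s x) \<eta>
     - 2 * \<i> * of_real (\<eta> i) * fourier n (\<lambda>x. of_real (pw n ((\<lambda>_. \<omega>)(i := vd \<omega>)) x) * U s x) \<eta>)
    + fourier n (\<lambda>x. of_real (\<Omega> x) * G s x) \<eta>))))"
 proof (intro Bochner_Integration.integral_cong refl)
  fix s :: real
  show "indicator {0..t} s *\<^sub>R (exp (- (- (c * of_real e2)) * of_real s) * (c * rhs f s - (- (c * of_real e2)) * pair U f s)) =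
   indicator {0..t} s *\<^sub>R (exp (c * of_real e2 * of_real s) * (c *
   ((\<Sum>i<n. fourier n (\<lambda>x. of_real (pw n ((\<lambda>_. \<omega>)(i := vd (vd \<omega>))) x) * U s x) \<eta>
     - 2 * \<i> * of_real (\<eta> i) * fourier n (\<lambda>x. of_real (pw n ((\<lambda>_. \<omega>)(i := vd \<omega>)) x) * U s x) \<eta>)
    + fourier n (\<lambda>x. of_real (\<Omega> x) * G s x) \<eta>)))"
  proof (cases "s \<in> {0..t}")
   case True
   then have "s \<in> {0..1}" using t by auto
   from eq[OF this] show ?thesis by (simp only: minus_minus)
  qed simp
 qed
 with main show ?thesis unfolding \<Omega>_def[symmetric] e2_def[symmetric] c_def[symmetric] pU by simp
qed

end

section \<open>The a priori estimate\<close>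

lemma ennreal_mult_bound: "z \<le> ennreal r \<Longrightarrow> 0 \<le> x \<Longrightarrow> ennreal x * z \<le> ennreal (x * r)"
 by (simp add: ennreal_mult' mult_left_mono)

lemma ennreal_add_bound: "z \<le> ennreal r \<Longrightarrow> z' \<le> ennreal r' \<Longrightarrow> 0 \<le> r \<Longrightarrow> 0 \<le> r' \<Longrightarrow> z + z' \<le> ennreal (r + r')"
 by (simp add: add_mono)

lemma ennreal_sum_bound: "(\<And>i. i < n \<Longrightarrow> f i \<le> ennreal r) \<Longrightarrow> (\<Sum>i<n. f i) \<le> ennreal (real n * r)"
proof -
 assume "\<And>i. i < n \<Longrightarrow> f i \<le> ennreal r"
 then have "(\<Sum>i<n. f i) \<le> (\<Sum>i<n. ennreal r)" by (intro sum_mono) auto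
 also have "\<dots> = ennreal (real n * r)" by (simp add: ennreal_mult' ennreal_of_nat_eq_real_of_nat)
 finally show ?thesis .
qed

lemma nn_integral_limit_bound:
 fixes f :: "nat \<Rightarrow> 'a \<Rightarrow> ennreal"
 assumes "\<And>k. f k \<in> borel_measurable M" "\<And>x. x \<in> space M \<Longrightarrow> (\<lambda>k. f k x) \<longlonglongrightarrow> g x"
  and "\<And>k. (\<integral>\<^sup>+x. f k x \<partial>M) \<le> B"
 shows "(\<integral>\<^sup>+x. g x \<partial>M) \<le> B"
proof -
 have "(\<integral>\<^sup>+x. g x \<partial>M) = (\<integral>\<^sup>+x. liminf (\<lambda>k. f k x) \<partial>M)"
  using assms(2) by (intro nn_integral_cong lim_imp_Liminf[symmetric]) auto
 also have "\<dots> \<le> liminf (\<lambda>k. \<integral>\<^sup>+x. f k x \<partial>M)" by (rule nn_integral_liminf[OF assms(1)])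
 also have "\<dots> \<le> limsup (\<lambda>k. \<integral>\<^sup>+x. f k x \<partial>M)" by (rule Liminf_le_Limsup) simp
 also have "\<dots> \<le> B" by (rule Limsup_bounded) (simp add: assms(3))
 finally show ?thesis .
qed

context heat_weighted
begin

text \<open>The truncated weight is bounded, so its weighted norm is finite at all times and
  Gronwall's inequality applies. The constants \<open>P\<close> and \<open>Q\<close> are built from
  \<open>wt_derivatives\<close> and the comparison with the Gaussian and do not contain
  \<open>d\<close>; the bound 1/d serves only as the starting bound of the iteration in
  \<open>gronwall\<close>.\<close>

lemma apriori_delta:
 assumes l: "l > 0"
 shows "\<exists>P. \<forall>d>0. \<forall>t\<in>{0..1}. (sq_int (lbn n) (\<lambda>x. pw n (\<lambda>_. wt l d) x * cmod (U t x))) \<le> ennreal P"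
proof -
 define K where "K = exp (l\<^sup>2 / (4 * \<gamma>)) ^ n"
 have K: "K \<ge> 0" by (simp add: K_def)
 obtain Y0 where Y0: "sq_int (lbn n) (\<lambda>x. gw n \<gamma> x * cmod (U 0 x)) = ennreal Y0" "Y0 \<ge> 0"
  using U0 by (cases "\<integral>\<^sup>+x. ennreal ((gw n \<gamma> x * cmod (U 0 x))\<^sup>2) \<partial>lbn n") auto
 define c2 where "c2 = (cmod (Complex A B))\<^sup>2"
 have c2: "c2 \<ge> 0" by (simp add: c2_def)
 define Q where "Q = 8 * c2 * (real n * (real n * (3 * l\<^sup>2)\<^sup>2) + (real n * (2 / A)) * (real n * l\<^sup>2) + 2 * M1\<^sup>2)"
 define E where "E = 2 * (K\<^sup>2 * M2\<^sup>2 * CU\<^sup>2)"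
 define P where "P = 2 * (K\<^sup>2 * Y0) + 8 * c2 * E"
 have E: "E \<ge> 0" by (simp add: E_def)
 have Q: "Q \<ge> 0" and P: "P \<ge> 0" unfolding Q_def P_def using c2 A_pos E Y0 by (auto intro!: add_nonneg_nonneg mult_nonneg_nonneg)
 have "sq_int (lbn n) (\<lambda>x. pw n (\<lambda>_. wt l d) x * cmod (U t x)) \<le> ennreal (2 * P * exp (2 * Q))"
  if d: "d > 0" and t: "t \<in> {0..1}" for d t
 proof -
  define \<omega> where "\<omega> = wt l d"
  define \<Omega> where "\<Omega> = pw n (\<lambda>_. \<omega>)"
  note PW = pw_wt[OF l d, where n = n, folded \<omega>_def, folded \<Omega>_def]
  define y where "y s = sq_int (lbn n) (\<lambda>x. \<Omega> x * cmod (U s x))" for s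
  have sm: "smooth \<omega>" using d by (simp add: \<omega>_def smooth_wt)
  have [measurable]: "\<omega> \<in> borel_measurable borel" "vd \<omega> \<in> borel_measurable borel" "vd (vd \<omega>) \<in> borel_measurable borel"
   using sm smooth_vd(2)[OF sm] smooth_vd(2)[OF smooth_vd(2)[OF sm]] by (auto intro: smooth_borel)
  have \<Omega>m [measurable]: "\<Omega> \<in> Bor n" using PW(5) .
  define W1 where "W1 i = pw n ((\<lambda>_. \<omega>)(i := vd \<omega>))" for i
  define W2 where "W2 i = pw n ((\<lambda>_. \<omega>)(i := vd (vd \<omega>)))" for i
  have [measurable]: "W1 i \<in> Bor n" "W2 i \<in> Bor n" for i
   unfolding W1_def W2_def by (rule pw_measurable, simp add: fun_upd_def)+
  have p: "0 \<le> \<omega> s" for s using wt_pos[of d l s] d by (simp add: \<omega>_def)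
  have der: "\<bar>vd \<omega> s\<bar> \<le> l * \<omega> s" "\<bar>vd (vd \<omega>) s\<bar> \<le> 3 * l\<^sup>2 * \<omega> s" for s
   using wt_derivatives[of l d s] l d by (auto simp: \<omega>_def)
  have W: "\<bar>W1 i x\<bar> \<le> l * \<Omega> x" "\<bar>W2 i x\<bar> \<le> 3 * l\<^sup>2 * \<Omega> x" if "i < n" for i x
   unfolding W1_def W2_def \<Omega>_def by (rule pw_const_bound[OF that der(1) p], rule pw_const_bound[OF that der(2) p])
  obtain a where a: "a \<ge> 0" "sq_int (lbn n) (\<lambda>x. cmod (complex_of_real (\<Omega> x))) \<le> ennreal (a\<^sup>2)" using PW(4) by blast
  have \<Omega>K: "0 \<le> \<Omega> x \<and> \<Omega> x \<le> K * gw n \<gamma> x" for x using PW(1) PW(3)[OF \<gamma>_pos] by (simp add: K_def)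
  have wpU: "w \<in> Bor n \<Longrightarrow> (\<And>x. \<bar>w x\<bar> \<le> k * \<Omega> x) \<Longrightarrow> integrable (lbn n) (\<lambda>x. of_real (w x) * U s x)"
    "w \<in> Bor n \<Longrightarrow> (\<And>x. \<bar>w x\<bar> \<le> k * \<Omega> x) \<Longrightarrow> (sq_int (lbn n) (\<lambda>x. w x * cmod (U s x))) \<le> ennreal (k\<^sup>2) * y s"
    "w \<in> Bor n \<Longrightarrow> (\<And>x. \<bar>w x\<bar> \<le> k * \<Omega> x) \<Longrightarrow> (sq_int (lbn n) (\<lambda>x. w x * cmod (U s x))) < \<infinity>"
   if s: "s \<in> {0..1}" for s w k
   unfolding y_def by (rule weighted_pair[OF U_measurable(1)[OF s] _ \<Omega>m _ PW(1,2) a(2,1) U_L2[OF s] CU]; assumption)+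
  have yb: "y s \<le> ennreal (((1 / d) ^ n)\<^sup>2 * CU\<^sup>2)" if s: "s \<in> {0..1}" for s
   unfolding y_def by (rule weighted_pair(3)[OF U_measurable(1)[OF s] \<Omega>m \<Omega>m _ PW(1,2) a(2,1) U_L2[OF s] CU, where k = 1]) (use PW(1) in auto)
  have wpG: "integrable (lbn n) (\<lambda>x. of_real (\<Omega> x) * G s x)" "sq_int (lbn n) (\<lambda>x. \<Omega> x * cmod (G s x)) < \<infinity>" if s: "s \<in> {0..1}" for s
   using weighted_pair(1,4)[OF G_measurable(1)[OF s] \<Omega>m \<Omega>m _ PW(1,2) a(2,1) G_L2[OF s] CU, where k = 1] PW(1) by auto
  have ym [measurable]: "y \<in> borel_measurable borel"
  proof -
   have [measurable]: "(\<lambda>p. U (fst p) (snd p)) \<in> borel_measurable (lborel \<Otimes>\<^sub>M lbn n)"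
    using U_measurable(3) by (simp add: split_beta')
   have "y \<in> borel_measurable lborel" unfolding y_def by measurable
   then show ?thesis by simp
  qed
  have "y t \<le> ennreal (2 * P * exp (2 * Q))"
  proof (rule gronwall[OF ym yb P Q _ t])
   fix t :: real assume t: "t \<in> {0..1}"
   define I where "I = (\<integral>\<^sup>+s. indicator {0..t} s * y s \<partial>lborel)"
   have "I \<le> (\<integral>\<^sup>+s. ennreal (((1 / d) ^ n)\<^sup>2 * CU\<^sup>2) * indicator {0..t} s \<partial>lborel)"
    unfolding I_def using yb t by (intro nn_integral_mono) (auto split: split_indicator)
   also have "\<dots> = ennreal (((1 / d) ^ n)\<^sup>2 * CU\<^sup>2) * ennreal t" using t by (simp add: nn_integral_cmult_indicator)
   also have "\<dots> < top" by (simp add: ennreal_mult_less_top)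
   \<comment> \<open>With a finite value for the time integral all contributions become real numbers
     with the common factor \<open>D\<close>, which is cancelled at the end together with the one on
     the left.\<close>
   finally obtain \<iota> where \<iota>: "I = ennreal \<iota>" "\<iota> \<ge> 0" by (cases I) auto
   define D where "D = (2 * pi) ^ n"
   have D: "D > 0" by (simp add: D_def)
   define fU where "fU w s \<eta> = fourier n (\<lambda>x. of_real (w x) * U s x) \<eta>" for w s \<eta>
   define fG where "fG s \<eta> = fourier n (\<lambda>x. of_real (\<Omega> x) * G s x) \<eta>" for s \<eta>
   define J where "J w \<eta> = (\<integral>\<^sup>+s. ennreal (indicator {0..t} s * (cmod (fU w s \<eta>))\<^sup>2) \<partial>lborel)" for w \<eta>
   define JG where "JG \<eta> = (\<integral>\<^sup>+s. ennreal (indicator {0..t} s * (cmod (fG s \<eta>))\<^sup>2) \<partial>lborel)" for \<eta>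
   have Jm [measurable]: "w \<in> Bor n \<Longrightarrow> J w \<in> Bor n" for w
    unfolding J_def fU_def by (rule fourier_time_measurable[OF U_meas])
   have [measurable]: "JG \<in> Bor n"
    unfolding JG_def fG_def by (rule fourier_time_measurable[OF G_meas \<Omega>m])
   have fUm [measurable]: "fU \<Omega> s \<in> Bor n" if "s \<in> {0..1}" for s
    unfolding fU_def[abs_def] by (rule fourier_measurable) (use that in measurable)
   have pt: "ennreal ((cmod (fU \<Omega> t \<eta>))\<^sup>2) \<le> 2 * ennreal ((cmod (fU \<Omega> 0 \<eta>))\<^sup>2) + ennreal (8 * c2) *
     (ennreal (real n) * (\<Sum>i<n. J (W2 i) \<eta>) + ennreal (real n * (2 / A)) * (\<Sum>i<n. J (W1 i) \<eta>) + JG \<eta>)"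
    if \<eta>: "\<eta> \<in> space (lbn n)" for \<eta>
    unfolding J_def JG_def fU_def fG_def c2_def W1_def W2_def \<Omega>_def
   proof (rule duhamel_sq_bound[OF A_pos _ _ _ _ _ fourier_duhamel[OF l d \<eta> t, folded \<omega>_def]])
    show "0 \<le> t" "t \<le> 1" using t by auto
    show "(\<lambda>s. fourier n (\<lambda>x. of_real (pw n ((\<lambda>_. \<omega>)(i := vd (vd \<omega>))) x) * U s x) \<eta>) \<in> borel_measurable borel" for i
     unfolding W2_def[symmetric] by (rule fourier_sec[OF U_meas _ \<eta>]) measurable
    show "(\<lambda>s. fourier n (\<lambda>x. of_real (pw n ((\<lambda>_. \<omega>)(i := vd \<omega>)) x) * U s x) \<eta>) \<in> borel_measurable borel" for i
     unfolding W1_def[symmetric] by (rule fourier_sec[OF U_meas _ \<eta>]) measurable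
    show "(\<lambda>s. fourier n (\<lambda>x. of_real (pw n (\<lambda>_. \<omega>) x) * G s x) \<eta>) \<in> borel_measurable borel"
     unfolding \<Omega>_def[symmetric] by (rule fourier_sec[OF G_meas \<Omega>m \<eta>])
   qed simp
   have pl: "sq_int (lbn n) (\<lambda>\<eta>. cmod (fU \<Omega> s \<eta>)) = ennreal D * y s" if s: "s \<in> {0..1}" for s
    unfolding fU_def y_def D_def
    by (rule wplancherel[OF U_measurable(1)[OF s] \<Omega>m wpU(1)[OF s \<Omega>m, where k = 1] wpU(3)[OF s \<Omega>m, where k = 1]]) (use PW(1) in auto)
   have JI: "(\<integral>\<^sup>+\<eta>. J w \<eta> \<partial>lbn n) \<le> ennreal (D * (k\<^sup>2 * \<iota>))" if w: "w \<in> Bor n" "\<forall>x. \<bar>w x\<bar> \<le> k * \<Omega> x" for w k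
   proof -
    have wb: "\<bar>w x\<bar> \<le> k * \<Omega> x" for x using w by auto
    have "(\<integral>\<^sup>+\<eta>. J w \<eta> \<partial>lbn n) = ennreal D * (\<integral>\<^sup>+s. indicator {0..t} s * sq_int (lbn n) (\<lambda>x. w x * cmod (U s x)) \<partial>lborel)"
     unfolding J_def fU_def D_def
     by (rule fourier_tonelli[OF U_meas w(1)]) (use t wpU(1,3)[OF _ w(1) wb] in auto)
    also have "\<dots> \<le> ennreal D * (\<integral>\<^sup>+s. ennreal (k\<^sup>2) * (indicator {0..t} s * y s) \<partial>lborel)"
     using t by (intro mult_left_mono nn_integral_mono) (auto split: split_indicator intro!: wpU(2) w(1) wb)
    also have "(\<integral>\<^sup>+s. ennreal (k\<^sup>2) * (indicator {0..t} s * y s) \<partial>lborel) = ennreal (k\<^sup>2) * I"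
     unfolding I_def by (rule nn_integral_cmult) measurable
    also have "ennreal D * (ennreal (k\<^sup>2) * I) = ennreal (D * (k\<^sup>2 * \<iota>))" using D \<iota> by (simp add: ennreal_mult)
    finally show ?thesis .
   qed
   have JGI: "(\<integral>\<^sup>+\<eta>. JG \<eta> \<partial>lbn n) \<le> ennreal (D * (2 * M1\<^sup>2 * \<iota> + E))"
   proof -
    have "(\<integral>\<^sup>+\<eta>. JG \<eta> \<partial>lbn n) = ennreal D * (\<integral>\<^sup>+s. indicator {0..t} s * sq_int (lbn n) (\<lambda>x. \<Omega> x * cmod (G s x)) \<partial>lborel)"
     unfolding JG_def fG_def D_def by (rule fourier_tonelli[OF G_meas \<Omega>m wpG]) (use t in auto)
    also have "\<dots> \<le> ennreal D * (\<integral>\<^sup>+s. ennreal (2 * M1\<^sup>2) * (indicator {0..t} s * y s) + ennreal E * indicator {0..1} s \<partial>lborel)"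
    proof (intro mult_left_mono nn_integral_mono)
     fix s :: real
     show "indicator {0..t} s * sq_int (lbn n) (\<lambda>x. \<Omega> x * cmod (G s x)) \<le> ennreal (2 * M1\<^sup>2) * (indicator {0..t} s * y s) + ennreal E * indicator {0..1} s"
     proof (cases "s \<in> {0..t}")
      case True
      then have s: "s \<in> {0..1}" using t by auto
      from True s weighted_G[OF s \<Omega>K K \<Omega>m] show ?thesis by (simp add: y_def E_def)
     qed simp
    qed simp
    also have "(\<integral>\<^sup>+s. ennreal (2 * M1\<^sup>2) * (indicator {0..t} s * y s) + ennreal E * indicator {0..1} s \<partial>lborel) = ennreal (2 * M1\<^sup>2) * I + ennreal E"
     unfolding I_def by (subst nn_integral_add) (auto simp: nn_integral_cmult nn_integral_cmult_indicator)
    also have "ennreal D * (ennreal (2 * M1\<^sup>2) * I + ennreal E) = ennreal (D * (2 * M1\<^sup>2 * \<iota> + E))"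
     using D \<iota> E by (simp add: ennreal_mult ennreal_plus)
    finally show ?thesis .
   qed
   have y0: "y 0 \<le> ennreal (K\<^sup>2 * Y0)"
   proof -
    have "y 0 \<le> (\<integral>\<^sup>+x. ennreal (K\<^sup>2) * ennreal ((gw n \<gamma> x * cmod (U 0 x))\<^sup>2) \<partial>lbn n)"
     unfolding y_def
    proof (intro nn_integral_mono)
     fix x
     have "(\<Omega> x * cmod (U 0 x))\<^sup>2 \<le> (K * gw n \<gamma> x * cmod (U 0 x))\<^sup>2" using \<Omega>K by (intro power_mono mult_right_mono) auto
     then show "ennreal ((\<Omega> x * cmod (U 0 x))\<^sup>2) \<le> ennreal (K\<^sup>2) * ennreal ((gw n \<gamma> x * cmod (U 0 x))\<^sup>2)"
      by (simp add: ennreal_mult[symmetric] power_mult_distrib mult_ac ennreal_leI)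
    qed
    also have "\<dots> = ennreal (K\<^sup>2) * ennreal Y0" unfolding Y0(1)[symmetric] by (rule nn_integral_cmult) measurable
    finally show ?thesis using Y0(2) by (simp add: ennreal_mult)
   qed
   have "ennreal D * y t \<le> (\<integral>\<^sup>+\<eta>. 2 * ennreal ((cmod (fU \<Omega> 0 \<eta>))\<^sup>2) + ennreal (8 * c2) *
     (ennreal (real n) * (\<Sum>i<n. J (W2 i) \<eta>) + ennreal (real n * (2 / A)) * (\<Sum>i<n. J (W1 i) \<eta>) + JG \<eta>) \<partial>lbn n)"
    unfolding pl[OF t, symmetric] by (rule nn_integral_mono) (rule pt)
   also have "\<dots> = 2 * sq_int (lbn n) (\<lambda>\<eta>. cmod (fU \<Omega> 0 \<eta>)) + ennreal (8 * c2) *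
     (ennreal (real n) * (\<Sum>i<n. \<integral>\<^sup>+\<eta>. J (W2 i) \<eta> \<partial>lbn n) + ennreal (real n * (2 / A)) * (\<Sum>i<n. \<integral>\<^sup>+\<eta>. J (W1 i) \<eta> \<partial>lbn n) + (\<integral>\<^sup>+\<eta>. JG \<eta> \<partial>lbn n))"
    by (simp add: nn_integral_add nn_integral_cmult nn_integral_sum)
   also have "\<dots> = ennreal 2 * (ennreal D * y 0) + ennreal (8 * c2) *
     (ennreal (real n) * (\<Sum>i<n. \<integral>\<^sup>+\<eta>. J (W2 i) \<eta> \<partial>lbn n) + ennreal (real n * (2 / A)) * (\<Sum>i<n. \<integral>\<^sup>+\<eta>. J (W1 i) \<eta> \<partial>lbn n) + (\<integral>\<^sup>+\<eta>. JG \<eta> \<partial>lbn n))"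
    by (simp add: pl)
   also have "\<dots> \<le> ennreal (2 * (D * (K\<^sup>2 * Y0)) + 8 * c2 * (real n * (real n * (D * ((3 * l\<^sup>2)\<^sup>2 * \<iota>))) + (real n * (2 / A)) * (real n * (D * (l\<^sup>2 * \<iota>))) + D * (2 * M1\<^sup>2 * \<iota> + E)))"
    by (intro ennreal_add_bound ennreal_mult_bound ennreal_sum_bound JI JGI y0)
     (use W D \<iota> A_pos E Y0 c2 in \<open>auto intro!: add_nonneg_nonneg mult_nonneg_nonneg divide_nonneg_nonneg\<close>)
   also have "2 * (D * (K\<^sup>2 * Y0)) + 8 * c2 * (real n * (real n * (D * ((3 * l\<^sup>2)\<^sup>2 * \<iota>))) + (real n * (2 / A)) * (real n * (D * (l\<^sup>2 * \<iota>))) + D * (2 * M1\<^sup>2 * \<iota> + E)) = D * (P + Q * \<iota>)"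
   proof -
    have "2 * (D * u) + 8 * c2 * (m * (m * (D * (v * \<iota>))) + q * (m * (D * (w * \<iota>))) + D * (2 * m1 * \<iota> + E)) =
     D * (2 * u + 8 * c2 * E + 8 * c2 * (m * (m * v) + q * (m * w) + 2 * m1) * \<iota>)" for u m v q w m1 :: real
     by (simp add: algebra_simps)
    then show ?thesis unfolding P_def Q_def .
   qed
   also have "ennreal (D * (P + Q * \<iota>)) = ennreal D * (ennreal P + ennreal Q * I)"
    using D P Q \<iota> by (simp add: ennreal_mult ennreal_plus)
   finally show "y t \<le> ennreal P + ennreal Q * (\<integral>\<^sup>+s. indicator {0..t} s * y s \<partial>lborel)"
    unfolding I_def[symmetric] using D by (subst (asm) ennreal_mult_le_mult_iff) auto
  qed
  then show ?thesis by (simp add: y_def \<Omega>_def \<omega>_def)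
 qed
 then show ?thesis by blast
qed

text \<open>Fatou's lemma for d = 1/(k + 1), along which the truncated weights converge to
  cosh.\<close>

lemma apriori:
 assumes l: "l > 0"
 shows "\<exists>P. \<forall>t\<in>{0..1}. (sq_int (lbn n) (\<lambda>x. pw n (\<lambda>_ s. cosh (l * s)) x * cmod (U t x))) \<le> ennreal P"
proof -
 obtain P where P: "\<And>d t. d > 0 \<Longrightarrow> t \<in> {0..1} \<Longrightarrow> (sq_int (lbn n) (\<lambda>x. pw n (\<lambda>_. wt l d) x * cmod (U t x))) \<le> ennreal P"
  using apriori_delta[OF l] by blast
 have "sq_int (lbn n) (\<lambda>x. pw n (\<lambda>_ s. cosh (l * s)) x * cmod (U t x)) \<le> ennreal P" if t: "t \<in> {0..1}" for t
 proof (rule nn_integral_limit_bound)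
  fix k :: nat
  have [measurable]: "pw n (\<lambda>_. wt l (1 / real (Suc k))) \<in> Bor n" by (rule pw_wt(5)[OF l]) simp
  have [measurable]: "U t \<in> Bor n" using t by measurable
  show "(\<lambda>x. ennreal ((pw n (\<lambda>_. wt l (1 / real (Suc k))) x * cmod (U t x))\<^sup>2)) \<in> Bor n" by measurable
  show "sq_int (lbn n) (\<lambda>x. pw n (\<lambda>_. wt l (1 / real (Suc k))) x * cmod (U t x)) \<le> ennreal P"
   by (rule P[OF _ t]) simp
 next
  fix x
  show "(\<lambda>k. ennreal ((pw n (\<lambda>_. wt l (1 / real (Suc k))) x * cmod (U t x))\<^sup>2)) \<longlonglongrightarrow> ennreal ((pw n (\<lambda>_ s. cosh (l * s)) x * cmod (U t x))\<^sup>2)"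
   unfolding pw_def by (intro tendsto_intros tendsto_ennrealI wt_tendsto)
 qed
 then show ?thesis by blast
qed

end

subsection \<open>Exponential weights\<close>

definition ew :: "nat \<Rightarrow> (nat \<Rightarrow> real) \<Rightarrow> (nat \<Rightarrow> real) \<Rightarrow> real" where
 "ew n \<xi> = pw n (\<lambda>i s. exp (\<xi> i * s))"

lemma ew_pos: "ew n \<xi> x > 0" unfolding ew_def pw_def by (intro prod_pos) simp

lemma ew_measurable [measurable]: "ew n \<xi> \<in> Bor n"
 unfolding ew_def by measurable

text \<open>The rate \<open>l\<close> exceeds every |\<xi>_i| by at least 1, and the surplus is
  spent on a factor sech. That factor is square integrable and will make e^(\<xi>.x) u
  integrable.\<close>

lemma ew_le_cosh:
 fixes \<xi> :: "nat \<Rightarrow> real"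
 assumes l: "\<And>i. i < n \<Longrightarrow> \<bar>\<xi> i\<bar> + 1 \<le> l"
 shows "ew n \<xi> x \<le> 2 ^ n * (pw n (\<lambda>_ s. 1 / cosh s) x * pw n (\<lambda>_ s. cosh (l * s)) x)"
proof -
 have e: "exp \<bar>s\<bar> / 2 \<le> cosh s" "cosh s \<le> exp \<bar>s\<bar>" for s :: real
  by (auto simp: cosh_field_def abs_if intro!: divide_right_mono)
 have "exp (\<xi> i * s) \<le> 2 * (1 / cosh s * cosh (l * s))" if i: "i < n" for i s
 proof -
  have "exp (\<xi> i * s) * cosh s \<le> exp (\<bar>\<xi> i\<bar> * \<bar>s\<bar>) * exp \<bar>s\<bar>"
   using e(2)[of s] by (intro mult_mono) (auto simp: abs_mult[symmetric])
  also have "\<dots> = exp ((\<bar>\<xi> i\<bar> + 1) * \<bar>s\<bar>)" by (simp add: exp_add[symmetric] algebra_simps)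
  also have "\<dots> \<le> exp (l * \<bar>s\<bar>)" using l[OF i] by (simp add: mult_right_mono)
  also have "\<dots> = exp \<bar>l * s\<bar>" using l[OF i] by (simp add: abs_mult)
  also have "\<dots> \<le> 2 * cosh (l * s)" using e(1)[of "l * s"] by simp
  finally show ?thesis by (simp add: field_simps)
 qed
 then have "ew n \<xi> x \<le> (\<Prod>i<n. 2 * (1 / cosh (x i) * cosh (l * x i)))"
  unfolding ew_def pw_def by (intro prod_mono) auto
 also have "\<dots> = 2 ^ n * (pw n (\<lambda>_ s. 1 / cosh s) x * pw n (\<lambda>_ s. cosh (l * s)) x)"
  unfolding pw_def by (simp only: prod.distrib prod_constant card_lessThan)
 finally show ?thesis .
qed

context heat_weighted
begin

lemma weighted_G_apriori:
 assumes "l > 0"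
 shows "\<exists>P\<ge>0. \<forall>t\<in>{0..1}. (sq_int (lbn n) (\<lambda>x. pw n (\<lambda>_ s. cosh (l * s)) x * cmod (U t x))) \<le> ennreal P
  \<and> (sq_int (lbn n) (\<lambda>x. pw n (\<lambda>_ s. cosh (l * s)) x * cmod (G t x))) \<le> ennreal P"
proof -
 define K where "K = exp (l\<^sup>2 / (4 * \<gamma>)) ^ n"
 define w where "w = pw n (\<lambda>_ s. cosh (l * s))"
 have [measurable]: "w \<in> Bor n" unfolding w_def by measurable
 have w: "0 \<le> w x \<and> w x \<le> K * gw n \<gamma> x" for x
  unfolding w_def K_def using pw_cosh_le_gw[OF \<gamma>_pos] by (auto simp: pw_def intro!: prod_nonneg)
 obtain P where P: "\<And>t. t \<in> {0..1} \<Longrightarrow> (sq_int (lbn n) (\<lambda>x. w x * cmod (U t x))) \<le> ennreal P"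
  using apriori[OF assms] unfolding w_def by blast
 have P': "sq_int (lbn n) (\<lambda>x. w x * cmod (U t x)) \<le> ennreal \<bar>P\<bar>" if "t \<in> {0..1}" for t
  using P[OF that] by (rule order_trans) (simp add: ennreal_leI)
 define R where "R = 2 * M1\<^sup>2 * \<bar>P\<bar> + 2 * (K\<^sup>2 * M2\<^sup>2 * CU\<^sup>2)"
 have R: "R \<ge> 0" by (simp add: R_def)
 have G: "sq_int (lbn n) (\<lambda>x. w x * cmod (G t x)) \<le> ennreal R" if t: "t \<in> {0..1}" for t
 proof -
  have "sq_int (lbn n) (\<lambda>x. w x * cmod (G t x)) \<le>
   ennreal (2 * M1\<^sup>2) * sq_int (lbn n) (\<lambda>x. w x * cmod (U t x)) + ennreal (2 * (K\<^sup>2 * M2\<^sup>2 * CU\<^sup>2))"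
   by (rule weighted_G[OF t w]) (simp_all add: K_def)
  also have "\<dots> \<le> ennreal R" unfolding R_def
   by (intro ennreal_add_bound ennreal_mult_bound P' t order_refl) simp_all
  finally show ?thesis .
 qed
 have "ennreal \<bar>P\<bar> \<le> ennreal (\<bar>P\<bar> + R)" "ennreal R \<le> ennreal (\<bar>P\<bar> + R)" using R by (intro ennreal_leI; simp)+
 then have "\<forall>t\<in>{0..1}. (sq_int (lbn n) (\<lambda>x. w x * cmod (U t x))) \<le> ennreal (\<bar>P\<bar> + R)
  \<and> (sq_int (lbn n) (\<lambda>x. w x * cmod (G t x))) \<le> ennreal (\<bar>P\<bar> + R)"
  using P' G by (meson order_trans)
 moreover have "0 \<le> \<bar>P\<bar> + R" using R by simp
 ultimately show ?thesis unfolding w_def by blast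
qed

text \<open>Integrability comes from the Cauchy-Schwarz inequality with the factor \<open>S\<close>
  split off by \<open>ew_le_cosh\<close>, square integrability from S <= 1. The first makes the
  transform an honest integral, the second puts it within reach of Plancherel's theorem.\<close>

lemma ew_bounds:
 "\<exists>C\<ge>0. \<forall>t\<in>{0..1}. \<forall>V\<in>{U t, G t}. V \<in> Bor n \<and>
  (\<integral>\<^sup>+x. ennreal (ew n \<xi> x * cmod (V x)) \<partial>lbn n) \<le> ennreal C \<and> (sq_int (lbn n) (\<lambda>x. ew n \<xi> x * cmod (V x))) \<le> ennreal C"
proof -
 define l where "l = (\<Sum>i<n. \<bar>\<xi> i\<bar>) + 1"
 have l: "l > 0" unfolding l_def by (intro add_nonneg_pos sum_nonneg) auto
 define S where "S = pw n (\<lambda>_ s. 1 / cosh s)"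
 define C where "C = pw n (\<lambda>_ s. cosh (l * s))"
 have [measurable]: "S \<in> Bor n" "C \<in> Bor n" unfolding S_def C_def by measurable
 have ewl: "ew n \<xi> x \<le> 2 ^ n * (S x * C x)" for x
  unfolding S_def C_def by (rule ew_le_cosh) (auto simp: l_def intro: member_le_sum)
 have S: "0 \<le> S x" "S x \<le> 1" for x
  unfolding S_def pw_def by (auto intro!: prod_nonneg prod_le_1 simp: cosh_real_ge_1)
 have C: "0 \<le> C x" for x unfolding C_def pw_def by (auto intro!: prod_nonneg)
 obtain a where a: "a \<ge> 0" "sq_int (lbn n) (\<lambda>x. cmod (complex_of_real (S x))) \<le> ennreal (a\<^sup>2)"
  unfolding S_def using pw_L2[of n "\<lambda>_ s. 1 / cosh s"] sech_L2 by auto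
 obtain P where P: "P \<ge> 0" "\<And>t V. t \<in> {0..1} \<Longrightarrow> V \<in> {U t, G t} \<Longrightarrow> (sq_int (lbn n) (\<lambda>x. C x * cmod (V x))) \<le> ennreal P"
  using weighted_G_apriori[OF l] unfolding C_def by blast
 show ?thesis
 proof (intro exI[of _ "2 ^ n * (a * sqrt P) + (2 ^ n)\<^sup>2 * P"] conjI ballI)
  show "0 \<le> 2 ^ n * (a * sqrt P) + (2 ^ n)\<^sup>2 * P" using a P by auto
  fix t V assume t: "t \<in> {0..1::real}" and V: "V \<in> {U t, G t}"
  show Vm [measurable]: "V \<in> Bor n" using V U_measurable(1)[OF t] G_measurable(1)[OF t] by auto
  have PV: "sq_int (lbn n) (\<lambda>x. cmod (of_real (C x) * V x)) \<le> ennreal ((sqrt P)\<^sup>2)"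
   using P(2)[OF t V] P(1) C by (simp add: norm_mult)
  have "(\<integral>\<^sup>+x. ennreal (ew n \<xi> x * cmod (V x)) \<partial>lbn n) \<le> (\<integral>\<^sup>+x. ennreal (2 ^ n) * ennreal (cmod (of_real (S x) * (of_real (C x) * V x))) \<partial>lbn n)"
  proof (intro nn_integral_mono)
   fix x
   have "ew n \<xi> x * cmod (V x) \<le> (2 ^ n * (S x * C x)) * cmod (V x)" by (rule mult_right_mono[OF ewl]) simp
   also have "\<dots> = 2 ^ n * cmod (of_real (S x) * (of_real (C x) * V x))" using S C by (simp add: norm_mult)
   finally show "ennreal (ew n \<xi> x * cmod (V x)) \<le> ennreal (2 ^ n) * ennreal (cmod (of_real (S x) * (of_real (C x) * V x)))"
    by (simp only: ennreal_mult[symmetric] ennreal_leI norm_ge_zero zero_le_power zero_le_numeral)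
  qed
  also have "\<dots> = ennreal (2 ^ n) * (\<integral>\<^sup>+x. ennreal (cmod (of_real (S x) * (of_real (C x) * V x))) \<partial>lbn n)"
   by (rule nn_integral_cmult) measurable
  also have "\<dots> \<le> ennreal (2 ^ n * (a * sqrt P))"
   by (intro ennreal_mult_bound L2_product(1)[OF _ _ a(2) PV a(1)]) (use P in auto)
  also have "\<dots> \<le> ennreal (2 ^ n * (a * sqrt P) + (2 ^ n)\<^sup>2 * P)" using P by (intro ennreal_leI) simp
  finally show "(\<integral>\<^sup>+x. ennreal (ew n \<xi> x * cmod (V x)) \<partial>lbn n) \<le> ennreal (2 ^ n * (a * sqrt P) + (2 ^ n)\<^sup>2 * P)" .
  have "sq_int (lbn n) (\<lambda>x. ew n \<xi> x * cmod (V x)) \<le> (\<integral>\<^sup>+x. ennreal ((2 ^ n)\<^sup>2) * ennreal ((C x * cmod (V x))\<^sup>2) \<partial>lbn n)"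
  proof (intro nn_integral_mono)
   fix x
   have h: "2 ^ n * (S x * C x) \<le> 2 ^ n * (1 * C x)" using S C by (intro mult_left_mono mult_right_mono) auto
   from order_trans[OF ewl h] have "ew n \<xi> x \<le> 2 ^ n * C x" by (simp only: mult_1)
   then have "(ew n \<xi> x * cmod (V x))\<^sup>2 \<le> (2 ^ n * C x * cmod (V x))\<^sup>2"
    using ew_pos[of n \<xi> x] by (intro power_mono mult_right_mono) auto
   also have "\<dots> = (2 ^ n)\<^sup>2 * (C x * cmod (V x))\<^sup>2" by (simp add: power_mult_distrib mult.assoc)
   finally show "ennreal ((ew n \<xi> x * cmod (V x))\<^sup>2) \<le> ennreal ((2 ^ n)\<^sup>2) * ennreal ((C x * cmod (V x))\<^sup>2)"
    by (simp only: ennreal_mult[symmetric] ennreal_leI zero_le_power2)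
  qed
  also have "\<dots> = ennreal ((2 ^ n)\<^sup>2) * sq_int (lbn n) (\<lambda>x. C x * cmod (V x))"
   by (rule nn_integral_cmult) measurable
  also have "\<dots> \<le> ennreal ((2 ^ n)\<^sup>2 * P)" by (intro ennreal_mult_bound P(2)[OF t V]) simp
  also have "\<dots> \<le> ennreal (2 ^ n * (a * sqrt P) + (2 ^ n)\<^sup>2 * P)" using P a by (intro ennreal_leI) simp
  finally show "sq_int (lbn n) (\<lambda>x. ew n \<xi> x * cmod (V x)) \<le> ennreal (2 ^ n * (a * sqrt P) + (2 ^ n)\<^sup>2 * P)" .
 qed
qed

text \<open>The test function e^((\<xi> - i\<eta>).x) is an eigenfunction of the Laplacian, and
  \<open>m\<close> is \<open>Complex A B\<close> times its eigenvalue. The Laplacian cancels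
  completely against the integrating factor and the forcing is G alone, without terms from the
  weight.\<close>

lemma twisted_duhamel:
 fixes \<xi> :: "nat \<Rightarrow> real"
 assumes \<eta>: "\<eta> \<in> space (lbn n)" and t: "0 \<le> s0" "s0 \<le> s1" "s1 \<le> 1"
 defines "m \<equiv> Complex A B * (\<Sum>i<n. (of_real (\<xi> i) - \<i> * of_real (\<eta> i))\<^sup>2)"
 shows "exp (- m * of_real s1) * fourier n (\<lambda>x. of_real (ew n \<xi> x) * U s1 x) \<eta>
  - exp (- m * of_real s0) * fourier n (\<lambda>x. of_real (ew n \<xi> x) * U s0 x) \<eta> =
  (int_on s0 s1 (\<lambda>s. exp (- m * of_real s) * (Complex A B * fourier n (\<lambda>x. of_real (ew n \<xi> x) * G s x) \<eta>)))"
proof -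
 define z where "z i = complex_of_real (\<xi> i) - \<i> * of_real (\<eta> i)" for i
 define f where "f i = (\<lambda>s. exp (z i * complex_of_real s))" for i
 have f': "f = (\<lambda>i. wexp (\<lambda>s. exp (\<xi> i * s)) (- (\<i> * of_real (\<eta> i))))"
  by (simp add: f_def wexp_def fun_eq_iff z_def exp_of_real[symmetric] exp_add[symmetric] algebra_simps)
 have tf: "tens n f x = of_real (ew n \<xi> x) * ek n \<eta> x" for x
  unfolding f' ew_def by (rule tens_wexp)
 have pU: "pair U f s = fourier n (\<lambda>x. of_real (ew n \<xi> x) * U s x) \<eta>" "pair G f s = fourier n (\<lambda>x. of_real (ew n \<xi> x) * G s x) \<eta>" for s
  unfolding pair_def fourier_def tf by (simp_all add: mult_ac)
 have vf: "vd (f i) = (\<lambda>s. z i * f i s)" "vd (vd (f i)) = (\<lambda>s. (z i)\<^sup>2 * f i s)" for i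
 proof -
  have sf: "smooth (f i)" unfolding f_def by (rule smooth_exp)
  show 1: "vd (f i) = (\<lambda>s. z i * f i s)" unfolding f_def by (rule vd_exp)
  have "vd (vd (f i)) = (\<lambda>s. z i * vd (f i) s)" by (subst 1) (rule vd_cmult[OF sf])
  then show "vd (vd (f i)) = (\<lambda>s. (z i)\<^sup>2 * f i s)" by (simp add: 1 power2_eq_square mult.assoc)
 qed
 have rhs: "rhs f s = (\<Sum>i<n. (z i)\<^sup>2) * pair U f s + pair G f s" for s
 proof -
  have "pair U (f(i := vd (vd (f i)))) s = (z i)\<^sup>2 * pair U f s" if i: "i < n" for i
  proof -
   have "tens n (f(i := vd (vd (f i)))) x = (z i)\<^sup>2 * tens n f x" for x
    unfolding vf(2) tens_slot_cmult[OF i] by simp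
   then have e: "U s x * tens n (f(i := vd (vd (f i)))) x = (z i)\<^sup>2 * (U s x * tens n f x)" for x by simp
   show ?thesis unfolding pair_def e by (rule integral_mult_right_zero)
  qed
  then show ?thesis unfolding rhs_def sum_distrib_right by (intro arg_cong2[where f = "(+)"] sum.cong) auto
 qed
 obtain C where C: "C \<ge> 0" "\<And>t V. t \<in> {0..1} \<Longrightarrow> V \<in> {U t, G t} \<Longrightarrow> (\<integral>\<^sup>+x. ennreal (ew n \<xi> x * cmod (V x)) \<partial>lbn n) \<le> ennreal C"
  using ew_bounds[of \<xi>] by meson
 define k where "k i = 1 + cmod (z i) + (cmod (z i))\<^sup>2" for i
 have k: "k i \<ge> 0" for i unfolding k_def by auto
 have main: "exp (- m * of_real s1) * pair U f s1 - exp (- m * of_real s0) * pair U f s0 =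
  (int_on s0 s1 (\<lambda>s. exp (- m * of_real s) * (Complex A B * rhs f s - m * pair U f s)))"
 proof (rule duhamel_dominated[where b = "\<lambda>i s. k i * exp (\<xi> i * s)"])
  show "smooth (f i)" for i unfolding f_def by (rule smooth_exp)
  show "cmod (f i s) \<le> k i * exp (\<xi> i * s) \<and> cmod (vd (f i) s) \<le> k i * exp (\<xi> i * s) \<and> cmod (vd (vd (f i)) s) \<le> k i * exp (\<xi> i * s)" for i s
  proof -
   have "cmod (f i s) = exp (\<xi> i * s)" by (simp add: f_def z_def)
   then show ?thesis unfolding vf(2) unfolding vf(1) by (auto simp: norm_mult norm_power k_def mult_right_mono)
  qed
  show "(\<lambda>s. k i * exp (\<xi> i * s)) \<in> borel_measurable borel" for i by measurable
  fix r :: real assume r: "r \<in> {0..1}"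
  have [measurable]: "U r \<in> Bor n" "G r \<in> Bor n" using r by measurable
  have kk: "(\<Prod>i<n. k i) \<ge> 0" by (intro prod_nonneg) (simp add: k)
  have "(\<integral>\<^sup>+x. ennreal ((\<Prod>i<n. k i * exp (\<xi> i * x i)) * (cmod (U r x) + cmod (G r x))) \<partial>lbn n) =
   (\<integral>\<^sup>+x. ennreal (\<Prod>i<n. k i) * (ennreal (ew n \<xi> x * cmod (U r x)) + ennreal (ew n \<xi> x * cmod (G r x))) \<partial>lbn n)"
  proof (intro nn_integral_cong)
   fix x
   have e: "(\<Prod>i<n. k i * exp (\<xi> i * x i)) * (cmod (U r x) + cmod (G r x)) = (\<Prod>i<n. k i) * (ew n \<xi> x * cmod (U r x) + ew n \<xi> x * cmod (G r x))"
    by (simp add: ew_def pw_def prod.distrib algebra_simps)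
   show "ennreal ((\<Prod>i<n. k i * exp (\<xi> i * x i)) * (cmod (U r x) + cmod (G r x))) =
    ennreal (\<Prod>i<n. k i) * (ennreal (ew n \<xi> x * cmod (U r x)) + ennreal (ew n \<xi> x * cmod (G r x)))"
    unfolding e using ew_pos[of n \<xi> x] by (simp only: ennreal_mult[OF kk] ennreal_plus mult_nonneg_nonneg less_imp_le norm_ge_zero add_nonneg_nonneg)
  qed
  also have "\<dots> = ennreal (\<Prod>i<n. k i) * ((\<integral>\<^sup>+x. ennreal (ew n \<xi> x * cmod (U r x)) \<partial>lbn n) + (\<integral>\<^sup>+x. ennreal (ew n \<xi> x * cmod (G r x)) \<partial>lbn n))"
   by (subst nn_integral_cmult) (auto simp: nn_integral_add)
  also have "\<dots> \<le> ennreal ((\<Prod>i<n. k i) * (C + C))"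
   by (intro ennreal_mult_bound ennreal_add_bound C(2)[OF r] C(1) kk) auto
  finally show "(\<integral>\<^sup>+x. ennreal ((\<Prod>i<n. k i * exp (\<xi> i * x i)) * (cmod (U r x) + cmod (G r x))) \<partial>lbn n) \<le> ennreal ((\<Prod>i<n. k i) * (C + C))" .
 qed (use t in auto)
 have "Complex A B * rhs f s - m * pair U f s = Complex A B * pair G f s" for s
  unfolding rhs m_def z_def[symmetric] by (simp add: algebra_simps)
 with main show ?thesis unfolding pU by (simp only:)
qed

end

section \<open>The Gaussian as a limit of positive combinations of exponentials\<close>

lemma ew_sq: "(ew n \<xi> x)\<^sup>2 = (\<Prod>i<n. exp (2 * \<xi> i * x i))"
 unfolding ew_def pw_def prod_power_distrib exp_double[symmetric] by (simp only: mult.assoc)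

text \<open>The binomial theorem for a power of a sum of two exponentials. The exponent is arranged
  to match the square of an exponential weight as in \<open>ew_sq\<close>.\<close>

lemma cosh_power_expand:
 "cosh (2 * a * s) ^ k = (\<Sum>m\<le>k. real (k choose m) / 2 ^ k * exp (2 * ((2 * real m - real k) * a) * (s::real)))"
proof -
 have "cosh (2 * a * s) = (exp (2 * a * s) + exp (- (2 * a * s))) / 2" by (simp add: cosh_field_def)
 then have "cosh (2 * a * s) ^ k = (\<Sum>m\<le>k. real (k choose m) * exp (2 * a * s) ^ m * exp (- (2 * a * s)) ^ (k - m)) / 2 ^ k"
  by (simp only: power_divide binomial_ring)
 also have "\<dots> = (\<Sum>m\<le>k. real (k choose m) / 2 ^ k * exp (2 * ((2 * real m - real k) * a) * s))"
  unfolding sum_divide_distrib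
 proof (intro sum.cong refl)
  fix m assume "m \<in> {..k}"
  then have "exp (2 * a * s) ^ m * exp (- (2 * a * s)) ^ (k - m) = exp (2 * ((2 * real m - real k) * a) * s)"
   by (simp add: exp_of_nat_mult[symmetric] exp_add[symmetric] of_nat_diff algebra_simps)
  then show "real (k choose m) * exp (2 * a * s) ^ m * exp (- (2 * a * s)) ^ (k - m) / 2 ^ k =
   real (k choose m) / 2 ^ k * exp (2 * ((2 * real m - real k) * a) * s)" by (simp add: mult.assoc)
 qed
 finally show ?thesis .
qed

text \<open>The weights \<open>cosh (2 a x)\<^sup>k\<close> with \<open>a\<^sup>2 k = \<gamma>\<close> converge to the Gaussian weight and are positive
 combinations of exponentials.\<close>

lemma gauss_approx:
 fixes n k :: nat and \<gamma> :: real and x :: "nat \<Rightarrow> real"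
 assumes \<gamma>: "\<gamma> > 0"
 defines "a \<equiv> \<lambda>k. sqrt (\<gamma> / real k)"
 defines "W \<equiv> \<lambda>k x. \<Prod>i<n. cosh (2 * a k * x i) ^ k"
 shows "k > 0 \<Longrightarrow> \<exists>(J :: (nat \<Rightarrow> nat) set) p \<xi>. finite J \<and> (\<forall>j\<in>J. p j \<ge> 0) \<and> (\<forall>x. W k x = (\<Sum>j\<in>J. p j * (ew n (\<xi> j) x)\<^sup>2))"
  and "1 \<le> W k x" and "k > 0 \<Longrightarrow> W k x \<le> (gw n \<gamma> x)\<^sup>2" and "(\<lambda>k. W (Suc k) x) \<longlonglongrightarrow> (gw n \<gamma> x)\<^sup>2"
proof -
 have gw2: "(gw n \<gamma> x)\<^sup>2 = (\<Prod>i<n. exp (2 * \<gamma> * (x i)\<^sup>2))" for x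
  unfolding gw_prod prod_power_distrib exp_double[symmetric] by (simp only: mult.assoc)
 \<comment> \<open>The scale is chosen so that k times the second-order term of cosh is 2 \<gamma>
   s^2, the exponent of the squared Gaussian.\<close>
 have ak: "k > 0 \<Longrightarrow> (2 * a k * s)\<^sup>2 / 2 = 2 * \<gamma> * s\<^sup>2 / real k" for k s
  using \<gamma> by (simp add: a_def power_mult_distrib)
 have up: "cosh (2 * a k * s) ^ k \<le> exp (2 * \<gamma> * s\<^sup>2)" if "k > 0" for k s
 proof -
  have "cosh (2 * a k * s) ^ k \<le> exp ((2 * a k * s)\<^sup>2 / 2) ^ k"
   by (intro power_mono cosh_le_exp_sq) simp
  also have "\<dots> = exp (2 * \<gamma> * s\<^sup>2)" unfolding ak[OF that] using that by (simp add: exp_of_nat_mult[symmetric])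
  finally show ?thesis .
 qed
 have low: "(1 + 2 * \<gamma> * s\<^sup>2 / real k) ^ k \<le> cosh (2 * a k * s) ^ k" if "k > 0" for k s
  using cosh_lower[of "2 * a k * s"] \<gamma> unfolding ak[OF that] by (intro power_mono) auto
 show "1 \<le> W k x" unfolding W_def by (intro prod_ge_1 one_le_power cosh_real_ge_1)
 show "k > 0 \<Longrightarrow> W k x \<le> (gw n \<gamma> x)\<^sup>2" unfolding W_def gw2 using up by (intro prod_mono) auto
 show "(\<lambda>k. W (Suc k) x) \<longlonglongrightarrow> (gw n \<gamma> x)\<^sup>2"
  unfolding W_def gw2
 proof (intro tendsto_prod)
  fix i
  show "(\<lambda>k. cosh (2 * a (Suc k) * x i) ^ Suc k) \<longlonglongrightarrow> exp (2 * \<gamma> * (x i)\<^sup>2)"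
  proof (rule tendsto_sandwich[OF always_eventually always_eventually _ tendsto_const])
   show "\<forall>k. (1 + 2 * \<gamma> * (x i)\<^sup>2 / real (Suc k)) ^ Suc k \<le> cosh (2 * a (Suc k) * x i) ^ Suc k" using low by blast
   show "\<forall>k. cosh (2 * a (Suc k) * x i) ^ Suc k \<le> exp (2 * \<gamma> * (x i)\<^sup>2)" using up by blast
   show "(\<lambda>k. (1 + 2 * \<gamma> * (x i)\<^sup>2 / real (Suc k)) ^ Suc k) \<longlonglongrightarrow> exp (2 * \<gamma> * (x i)\<^sup>2)"
    using LIMSEQ_Suc[OF tendsto_exp_limit_sequentially[of "2 * \<gamma> * (x i)\<^sup>2"]] .
  qed
 qed
 assume k: "k > 0"
 \<comment> \<open>Multiplying out the n coordinates gives one exponential for every multi-index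
   from {..k}^n; the coefficients are products of binomial probabilities and hence
   nonnegative.\<close>
 define p where "p j = (\<Prod>i<n. real (k choose j i) / 2 ^ k)" for j :: "nat \<Rightarrow> nat"
 define \<xi> where "\<xi> j i = (2 * real (j i) - real k) * a k" for j :: "nat \<Rightarrow> nat" and i
 have "W k x = (\<Sum>j\<in>PiE {..<n} (\<lambda>_. {..k}). p j * (ew n (\<xi> j) x)\<^sup>2)" for x
  unfolding W_def cosh_power_expand ew_sq p_def \<xi>_def prod.distrib[symmetric]
  by (rule prod_sum_PiE) auto
 then show "\<exists>(J :: (nat \<Rightarrow> nat) set) p \<xi>. finite J \<and> (\<forall>j\<in>J. p j \<ge> 0) \<and> (\<forall>x. W k x = (\<Sum>j\<in>J. p j * (ew n (\<xi> j) x)\<^sup>2))"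
  by (intro exI[of _ "PiE {..<n} (\<lambda>_. {..k})"] exI[of _ p] exI[of _ \<xi>])
    (auto simp: p_def intro!: finite_PiE prod_nonneg)
qed

context heat_weighted
begin

text \<open>The transforms for all \<xi>_j form one scalar family: Plancherel's theorem and the sum
  over j reassemble the weight W, so the total norm of the family is Y. The abstract convexity
  result then needs the forcing to be bounded by K times this total norm.\<close>

lemma weighted_convexity:
 fixes J :: "'j set" and p :: "'j \<Rightarrow> real" and \<xi> :: "'j \<Rightarrow> nat \<Rightarrow> real"
 assumes J: "finite J" and p: "\<And>j. j \<in> J \<Longrightarrow> p j \<ge> 0" and W: "\<And>x. W x = (\<Sum>j\<in>J. p j * (ew n (\<xi> j) x)\<^sup>2)"
  and W1: "\<And>x. 1 \<le> W x" and Wg: "\<And>x. W x \<le> (gw n \<gamma> x)\<^sup>2"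
 defines "Y \<equiv> \<lambda>t. \<integral>\<^sup>+x. ennreal (W x * (cmod (U t x))\<^sup>2) \<partial>lbn n"
 defines "K \<equiv> cmod (Complex A B) * (M1 + M2)"
 assumes e: "Y 0 \<le> ennreal (exp (2 * l0))" "Y 1 \<le> ennreal (exp (2 * l1))" and t: "t \<in> {0..1}"
 shows "Y t \<le> ennreal (exp (2 * ((1 - t) * l0 + t * l1 + 12 * K + 32 * K\<^sup>2)))"
proof -
 define c where "c = Complex A B"
 define D where "D = (2 * pi) ^ n"
 have D: "D > 0" by (simp add: D_def)
 have Wm [measurable]: "W \<in> Bor n" unfolding W[abs_def] by measurable
 define Pr where "Pr j C \<longleftrightarrow> (\<forall>t\<in>{0..1}. \<forall>V\<in>{U t, G t}. V \<in> Bor n \<and>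
  (\<integral>\<^sup>+x. ennreal (ew n (\<xi> j) x * cmod (V x)) \<partial>lbn n) \<le> ennreal C \<and> (sq_int (lbn n) (\<lambda>x. ew n (\<xi> j) x * cmod (V x))) \<le> ennreal C)" for j C
 have "\<forall>j. \<exists>C. 0 \<le> C \<and> Pr j C" unfolding Pr_def using ew_bounds by blast
 from choice[OF this] obtain C where C0: "\<forall>j. 0 \<le> C j \<and> Pr j (C j)" ..
 have C: "\<And>j. C j \<ge> 0" "\<And>j t V. t \<in> {0..1} \<Longrightarrow> V \<in> {U t, G t} \<Longrightarrow> V \<in> Bor n"
   "\<And>j t V. t \<in> {0..1} \<Longrightarrow> V \<in> {U t, G t} \<Longrightarrow> (\<integral>\<^sup>+x. ennreal (ew n (\<xi> j) x * cmod (V x)) \<partial>lbn n) \<le> ennreal (C j)"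
   "\<And>j t V. t \<in> {0..1} \<Longrightarrow> V \<in> {U t, G t} \<Longrightarrow> (sq_int (lbn n) (\<lambda>x. ew n (\<xi> j) x * cmod (V x))) \<le> ennreal (C j)"
  using C0 unfolding Pr_def by blast+
 \<comment> \<open>Distributes the coefficient \<open>p j\<close> and the Plancherel constant over
   the transforms, so that the total norm of \<open>h\<close> is exactly \<open>Y\<close>.\<close>
 define r where "r j = sqrt (p j / D)" for j
 define fo where "fo j V = fourier n (\<lambda>x. of_real (ew n (\<xi> j) x) * V x)" for j V
 define h where "h j t \<eta> = of_real (r j) * fo j (U t) \<eta>" for j t \<eta>
 define g where "g j t \<eta> = c * (of_real (r j) * fo j (G t) \<eta>)" for j t \<eta>
 define m where "m j \<eta> = c * (\<Sum>i<n. (of_real (\<xi> j i) - \<i> * of_real (\<eta> i))\<^sup>2)" for j and \<eta> :: "nat \<Rightarrow> real"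
 have plan: "sq_int (lbn n) (\<lambda>\<eta>. r j * cmod (fo j V \<eta>)) = ennreal (p j) * sq_int (lbn n) (\<lambda>x. ew n (\<xi> j) x * cmod (V x))"
  if j: "j \<in> J" and s: "s \<in> {0..1}" and V: "V \<in> {U s, G s}" for j s V
 proof -
  have [measurable]: "V \<in> Bor n" by (rule C(2)[OF s V])
  have [measurable]: "fo j V \<in> Bor n" unfolding fo_def by measurable
  have int: "integrable (lbn n) (\<lambda>x. of_real (ew n (\<xi> j) x) * V x)"
  proof (rule integrableI_bounded)
   have "(\<integral>\<^sup>+x. ennreal (cmod (of_real (ew n (\<xi> j) x) * V x)) \<partial>lbn n) = (\<integral>\<^sup>+x. ennreal (ew n (\<xi> j) x * cmod (V x)) \<partial>lbn n)"
    using ew_pos[of n "\<xi> j"] by (simp add: norm_mult less_imp_le)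
   also have "\<dots> < \<infinity>" using C(3)[OF s V, of j] by (rule order.strict_trans1) simp
   finally show "(\<integral>\<^sup>+x. ennreal (cmod (of_real (ew n (\<xi> j) x) * V x)) \<partial>lbn n) < \<infinity>" .
  qed measurable
  have fin: "sq_int (lbn n) (\<lambda>x. ew n (\<xi> j) x * cmod (V x)) < \<infinity>"
   using C(4)[OF s V, of j] by (rule order.strict_trans1) simp
  have "ennreal ((r j * cmod (fo j V \<eta>))\<^sup>2) = ennreal (p j / D) * ennreal ((cmod (fo j V \<eta>))\<^sup>2)" for \<eta>
   using p[OF j] D by (simp add: r_def power_mult_distrib ennreal_mult[symmetric])
  then have "sq_int (lbn n) (\<lambda>\<eta>. r j * cmod (fo j V \<eta>)) = ennreal (p j / D) * sq_int (lbn n) (\<lambda>\<eta>. cmod (fo j V \<eta>))"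
   by (simp add: nn_integral_cmult)
  also have "sq_int (lbn n) (\<lambda>\<eta>. cmod (fo j V \<eta>)) = ennreal D * sq_int (lbn n) (\<lambda>x. ew n (\<xi> j) x * cmod (V x))"
   unfolding fo_def D_def by (rule wplancherel[OF _ _ int fin]) measurable
  finally show ?thesis using p[OF j] D by (simp add: mult.assoc[symmetric] ennreal_mult[symmetric])
 qed
 have sumW: "(\<Sum>j\<in>J. \<integral>\<^sup>+\<eta>. ennreal ((r j * cmod (fo j V \<eta>))\<^sup>2) \<partial>lbn n) = (\<integral>\<^sup>+x. ennreal (W x * (cmod (V x))\<^sup>2) \<partial>lbn n)"
  if s: "s \<in> {0..1}" and V: "V \<in> {U s, G s}" for s V
 proof -
  have [measurable]: "V \<in> Bor n" by (rule C(2)[OF s V])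
  have "(\<Sum>j\<in>J. \<integral>\<^sup>+\<eta>. ennreal ((r j * cmod (fo j V \<eta>))\<^sup>2) \<partial>lbn n) = (\<Sum>j\<in>J. \<integral>\<^sup>+x. ennreal (p j) * ennreal ((ew n (\<xi> j) x * cmod (V x))\<^sup>2) \<partial>lbn n)"
   using plan[OF _ s V] by (intro sum.cong refl) (simp add: nn_integral_cmult)
  also have "\<dots> = (\<integral>\<^sup>+x. (\<Sum>j\<in>J. ennreal (p j) * ennreal ((ew n (\<xi> j) x * cmod (V x))\<^sup>2)) \<partial>lbn n)"
   by (rule nn_integral_sum[symmetric]) measurable
  also have "\<dots> = (\<integral>\<^sup>+x. ennreal (W x * (cmod (V x))\<^sup>2) \<partial>lbn n)"
  proof (intro nn_integral_cong)
   fix x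
   have "(\<Sum>j\<in>J. ennreal (p j) * ennreal ((ew n (\<xi> j) x * cmod (V x))\<^sup>2)) = (\<Sum>j\<in>J. ennreal (p j * (ew n (\<xi> j) x)\<^sup>2 * (cmod (V x))\<^sup>2))"
    using p by (intro sum.cong refl) (simp add: ennreal_mult[symmetric] power_mult_distrib mult.assoc)
   also have "\<dots> = ennreal (\<Sum>j\<in>J. p j * (ew n (\<xi> j) x)\<^sup>2 * (cmod (V x))\<^sup>2)"
    using p by (intro sum_ennreal) auto
   finally show "(\<Sum>j\<in>J. ennreal (p j) * ennreal ((ew n (\<xi> j) x * cmod (V x))\<^sup>2)) = ennreal (W x * (cmod (V x))\<^sup>2)"
    by (simp add: W sum_distrib_right)
  qed
  finally show ?thesis .
 qed
 have hY: "(\<Sum>j\<in>J. \<integral>\<^sup>+\<eta>. ennreal ((cmod (h j s \<eta>))\<^sup>2) \<partial>lbn n) = Y s" if s: "s \<in> {0..1}" for s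
  unfolding Y_def sumW[OF s, of "U s", simplified, symmetric] h_def norm_mult norm_of_real
  using p D by (intro sum.cong refl) (simp add: r_def)
 have gY: "(\<Sum>j\<in>J. \<integral>\<^sup>+\<eta>. ennreal ((cmod (g j s \<eta>))\<^sup>2) \<partial>lbn n) = ennreal ((cmod c)\<^sup>2) * (\<integral>\<^sup>+x. ennreal (W x * (cmod (G s x))\<^sup>2) \<partial>lbn n)" if s: "s \<in> {0..1}" for s
 proof -
  have [measurable]: "G s \<in> Bor n" using s by measurable
  have [measurable]: "fo j (G s) \<in> Bor n" for j unfolding fo_def by measurable
  have "(cmod (g j s \<eta>))\<^sup>2 = (cmod c)\<^sup>2 * (r j * cmod (fo j (G s) \<eta>))\<^sup>2" if "j \<in> J" for j \<eta>
   using p[OF that] D by (simp add: g_def norm_mult power_mult_distrib r_def)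
  then have "(\<Sum>j\<in>J. \<integral>\<^sup>+\<eta>. ennreal ((cmod (g j s \<eta>))\<^sup>2) \<partial>lbn n) = (\<Sum>j\<in>J. \<integral>\<^sup>+\<eta>. ennreal ((cmod c)\<^sup>2) * ennreal ((r j * cmod (fo j (G s) \<eta>))\<^sup>2) \<partial>lbn n)"
   by (intro sum.cong refl nn_integral_cong) (simp add: ennreal_mult)
  also have "\<dots> = (\<Sum>j\<in>J. ennreal ((cmod c)\<^sup>2) * sq_int (lbn n) (\<lambda>\<eta>. r j * cmod (fo j (G s) \<eta>)))"
   by (intro sum.cong refl nn_integral_cmult) measurable
  also have "\<dots> = ennreal ((cmod c)\<^sup>2) * (\<Sum>j\<in>J. \<integral>\<^sup>+\<eta>. ennreal ((r j * cmod (fo j (G s) \<eta>))\<^sup>2) \<partial>lbn n)"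
   by (rule sum_distrib_left[symmetric])
  finally show ?thesis using sumW[OF s, of "G s"] by simp
 qed
 \<comment> \<open>Finiteness at intermediate times, obtained from the a priori estimate through
   \<open>ew_bounds\<close>; the value is irrelevant for the conclusion.\<close>
 define Bd where "Bd = (\<Sum>j\<in>J. p j * C j)"
 have Yb: "Y s \<le> ennreal Bd" if s: "s \<in> {0..1}" for s
 proof -
  have "Y s = (\<Sum>j\<in>J. \<integral>\<^sup>+\<eta>. ennreal ((r j * cmod (fo j (U s) \<eta>))\<^sup>2) \<partial>lbn n)" using sumW[OF s, of "U s"] by (simp add: Y_def)
  also have "\<dots> \<le> (\<Sum>j\<in>J. ennreal (p j * C j))"
  proof (intro sum_mono)
   fix j assume j: "j \<in> J"
   show "sq_int (lbn n) (\<lambda>\<eta>. r j * cmod (fo j (U s) \<eta>)) \<le> ennreal (p j * C j)"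
    by (subst plan[OF j s]) (use p[OF j] C(4)[OF s] in \<open>auto intro!: ennreal_mult_bound\<close>)
  qed
  also have "\<dots> = ennreal Bd" unfolding Bd_def using p C(1) by (intro sum_ennreal) auto
  finally show ?thesis .
 qed
 \<comment> \<open>The part of G bounded by M1 |U| keeps its weight. For F the weight is first
   enlarged to the Gaussian, then M2 compares with the unweighted norm of U, which is at most the
   weighted one as W >= 1. Minkowski's inequality adds the two constants.\<close>
 have GW: "(\<integral>\<^sup>+x. ennreal (W x * (cmod (G s x))\<^sup>2) \<partial>lbn n) \<le> ennreal ((M1 + M2)\<^sup>2) * Y s" if s: "s \<in> {0..1}" for s
 proof -
  have [measurable]: "U s \<in> Bor n" "G s \<in> Bor n" "F s \<in> Bor n" using s by measurable
  obtain y where y: "Y s = ennreal y" "y \<ge> 0" using Yb[OF s] by (cases "Y s") (auto simp: top_unique)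
  have W0: "W x \<ge> 0" for x using W1[of x] by simp
  \<comment> \<open>A one-point index set turns \<open>nn_L2_triangle\<close> into the ordinary
    triangle inequality.\<close>
  have a: "(\<Sum>j\<in>{()}. \<integral>\<^sup>+x. ennreal ((M1 * (sqrt (W x) * cmod (U s x)))\<^sup>2) \<partial>lbn n) \<le> ennreal ((M1 * sqrt y)\<^sup>2)"
  proof -
   have "(\<Sum>j\<in>{()}. \<integral>\<^sup>+x. ennreal ((M1 * (sqrt (W x) * cmod (U s x)))\<^sup>2) \<partial>lbn n) = (\<integral>\<^sup>+x. ennreal (M1\<^sup>2) * ennreal (W x * (cmod (U s x))\<^sup>2) \<partial>lbn n)"
    using W0 by (simp add: power_mult_distrib ennreal_mult[symmetric])
   also have "\<dots> = ennreal (M1\<^sup>2) * Y s" unfolding Y_def by (rule nn_integral_cmult) measurable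
   also have "\<dots> = ennreal ((M1 * sqrt y)\<^sup>2)" using y by (simp add: ennreal_mult[symmetric] power_mult_distrib)
   finally show ?thesis by simp
  qed
  have b: "(\<Sum>j\<in>{()}. \<integral>\<^sup>+x. ennreal ((sqrt (W x) * cmod (F s x))\<^sup>2) \<partial>lbn n) \<le> ennreal ((M2 * sqrt y)\<^sup>2)"
  proof -
   have "(\<Sum>j\<in>{()}. \<integral>\<^sup>+x. ennreal ((sqrt (W x) * cmod (F s x))\<^sup>2) \<partial>lbn n) = (\<integral>\<^sup>+x. ennreal (W x * (cmod (F s x))\<^sup>2) \<partial>lbn n)"
    using W0 by (simp add: power_mult_distrib)
   also have "\<dots> \<le> sq_int (lbn n) (\<lambda>x. gw n \<gamma> x * cmod (F s x))"
    unfolding power_mult_distrib by (intro nn_integral_mono ennreal_leI mult_right_mono Wg) simp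
   also have "\<dots> \<le> ennreal (M2\<^sup>2) * sq_int (lbn n) (\<lambda>x. cmod (U s x))" by (rule F_le[OF s])
   also have "\<dots> \<le> ennreal (M2\<^sup>2) * Y s" unfolding Y_def
   proof (intro mult_left_mono nn_integral_mono ennreal_leI)
    show "(cmod (U s x))\<^sup>2 \<le> W x * (cmod (U s x))\<^sup>2" for x using mult_right_mono[OF W1[of x], of "(cmod (U s x))\<^sup>2"] by simp
   qed simp
   also have "\<dots> = ennreal ((M2 * sqrt y)\<^sup>2)" using y by (simp add: ennreal_mult[symmetric] power_mult_distrib)
   finally show ?thesis by simp
  qed
  have "(\<integral>\<^sup>+x. ennreal (W x * (cmod (G s x))\<^sup>2) \<partial>lbn n) \<le> sq_int (lbn n) (\<lambda>x. M1 * (sqrt (W x) * cmod (U s x)) + sqrt (W x) * cmod (F s x))"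
  proof (intro nn_integral_mono ennreal_leI)
   fix x
   have "W x * (cmod (G s x))\<^sup>2 = (sqrt (W x) * cmod (G s x))\<^sup>2" using W0[of x] by (simp add: power_mult_distrib)
   also have "\<dots> \<le> (sqrt (W x) * (M1 * cmod (U s x) + cmod (F s x)))\<^sup>2"
    using W0[of x] by (intro power_mono mult_left_mono G_le[OF s]) auto
   also have "sqrt (W x) * (M1 * cmod (U s x) + cmod (F s x)) = M1 * (sqrt (W x) * cmod (U s x)) + sqrt (W x) * cmod (F s x)"
    by (simp add: algebra_simps)
   finally show "W x * (cmod (G s x))\<^sup>2 \<le> (M1 * (sqrt (W x) * cmod (U s x)) + sqrt (W x) * cmod (F s x))\<^sup>2" .
  qed
  also have "\<dots> = (\<Sum>j\<in>{()}. \<integral>\<^sup>+x. ennreal ((M1 * (sqrt (W x) * cmod (U s x)) + sqrt (W x) * cmod (F s x))\<^sup>2) \<partial>lbn n)" by simp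
  also have "\<dots> \<le> ennreal ((M1 * sqrt y + M2 * sqrt y)\<^sup>2)"
   by (rule nn_L2_triangle[OF _ _ a b]) (use M_nonneg y in auto)
  also have "(M1 * sqrt y + M2 * sqrt y)\<^sup>2 = (M1 + M2)\<^sup>2 * y"
   unfolding distrib_right[symmetric] using y by (simp add: power_mult_distrib)
  also have "ennreal ((M1 + M2)\<^sup>2 * y) = ennreal ((M1 + M2)\<^sup>2) * Y s" using y by (simp add: ennreal_mult)
  finally show ?thesis .
 qed
 interpret S: scalar_family "lbn n" J h g m K Bd
 proof
  show "h j s \<in> Bor n" if "j \<in> J" "s \<in> {0..1}" for j s
  proof -
   have [measurable]: "U s \<in> Bor n" using that by measurable
   show ?thesis unfolding h_def[abs_def] fo_def by measurable
  qed
  show "case_prod (g j) \<in> Bor2 n" for j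
  proof -
   have [measurable]: "(\<lambda>(s, \<eta>). fourier n (\<lambda>x. of_real (ew n (\<xi> j) x) * G s x) \<eta>) \<in> Bor2 n"
    by (rule fourier_joint[OF G_meas]) measurable
   have "(\<lambda>p. c * (of_real (r j) * (\<lambda>(s, \<eta>). fourier n (\<lambda>x. of_real (ew n (\<xi> j) x) * G s x) \<eta>) p)) \<in> Bor2 n"
    by measurable
   then show ?thesis unfolding g_def fo_def by (simp add: split_beta')
  qed
  show "exp (- m j \<eta> * of_real s1) * h j s1 \<eta> - exp (- m j \<eta> * of_real s0) * h j s0 \<eta> =
   (int_on s0 s1 (\<lambda>s. exp (- m j \<eta> * of_real s) * g j s \<eta>))"
   if "\<eta> \<in> space (lbn n)" "0 \<le> s0" "s0 \<le> s1" "s1 \<le> 1" for j \<eta> s0 s1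
  proof -
   have "exp (- m j \<eta> * of_real s1) * h j s1 \<eta> - exp (- m j \<eta> * of_real s0) * h j s0 \<eta> =
    of_real (r j) * (exp (- m j \<eta> * of_real s1) * fo j (U s1) \<eta> - exp (- m j \<eta> * of_real s0) * fo j (U s0) \<eta>)"
    by (simp add: h_def algebra_simps)
   also have "\<dots> = of_real (r j) * (int_on s0 s1 (\<lambda>s. exp (- m j \<eta> * of_real s) * (c * fo j (G s) \<eta>)))"
    unfolding fo_def m_def c_def using twisted_duhamel[OF that, of "\<xi> j"] by simp
   also have "\<dots> = (\<integral>s. of_real (r j) * (indicator {s0..s1} s *\<^sub>R (exp (- m j \<eta> * of_real s) * (c * fo j (G s) \<eta>))) \<partial>lborel)"
    by (rule integral_mult_right_zero[symmetric])
   also have "(\<lambda>s. of_real (r j) * (indicator {s0..s1} s *\<^sub>R (exp (- m j \<eta> * of_real s) * (c * fo j (G s) \<eta>)))) =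
    (\<lambda>s. indicator {s0..s1} s *\<^sub>R (exp (- m j \<eta> * of_real s) * g j s \<eta>))"
    by (simp add: g_def fun_eq_iff scaleR_conv_of_real mult_ac)
   finally show ?thesis .
  qed
  show "(\<Sum>j\<in>J. \<integral>\<^sup>+z. ennreal ((cmod (h j s z))\<^sup>2) \<partial>lbn n) \<le> ennreal Bd" if "s \<in> {0..1}" for s
   using Yb[OF that] hY[OF that] by simp
  show "(\<Sum>j\<in>J. \<integral>\<^sup>+z. ennreal ((cmod (g j s z))\<^sup>2) \<partial>lbn n) \<le> ennreal (K\<^sup>2) * (\<Sum>j\<in>J. \<integral>\<^sup>+z. ennreal ((cmod (h j s z))\<^sup>2) \<partial>lbn n)"
   if s: "s \<in> {0..1}" for s
  proof -
   have "ennreal ((cmod c)\<^sup>2) * (\<integral>\<^sup>+x. ennreal (W x * (cmod (G s x))\<^sup>2) \<partial>lbn n) \<le> ennreal ((cmod c)\<^sup>2) * (ennreal ((M1 + M2)\<^sup>2) * Y s)"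
    by (intro mult_left_mono GW s) simp
   also have "\<dots> = ennreal (K\<^sup>2) * Y s"
    by (simp add: K_def c_def power_mult_distrib ennreal_mult mult.assoc)
   finally show ?thesis unfolding gY[OF s] hY[OF s] .
  qed
  show "K \<ge> 0" unfolding K_def using M_nonneg by simp
 qed
 have N: "S.N2 s = Y s" if "s \<in> {0..1}" for s unfolding S.N2_def by (rule hY[OF that])
 show ?thesis using S.log_convex[of l0 l1 t] e t N[of 0] N[of 1] N[OF t] by simp
qed

text \<open>The approximating weights lie below the Gaussian, so the two end norms bound theirs, and
  the resulting estimate does not depend on the approximation; Fatou's lemma carries it to the
  limit. Positive bounds are needed to take logarithms.\<close>

lemma gauss_convexity:
 assumes \<alpha>: "\<alpha>0 > 0" "\<alpha>1 > 0" and t: "t \<in> {0..1}"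
  and e: "sq_int (lbn n) (\<lambda>x. gw n \<gamma> x * cmod (U 0 x)) \<le> ennreal (\<alpha>0\<^sup>2)"
   "sq_int (lbn n) (\<lambda>x. gw n \<gamma> x * cmod (U 1 x)) \<le> ennreal (\<alpha>1\<^sup>2)"
 defines "K \<equiv> cmod (Complex A B) * (M1 + M2)"
 shows "sq_int (lbn n) (\<lambda>x. gw n \<gamma> x * cmod (U t x)) \<le>
  ennreal ((exp (12 * K + 32 * K\<^sup>2) * \<alpha>0 powr (1 - t) * \<alpha>1 powr t)\<^sup>2)"
proof -
 define W where "W k x = (\<Prod>i<n. cosh (2 * sqrt (\<gamma> / real k) * x i) ^ k)" for k x
 note GA = gauss_approx[OF \<gamma>_pos, where n = n, folded W_def]
 have l: "ennreal (\<alpha>0\<^sup>2) = ennreal (exp (2 * ln \<alpha>0))" "ennreal (\<alpha>1\<^sup>2) = ennreal (exp (2 * ln \<alpha>1))"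
  using \<alpha> by (simp_all add: exp_double)
 have b: "(\<integral>\<^sup>+x. ennreal (W (Suc k) x * (cmod (U s x))\<^sup>2) \<partial>lbn n) \<le> sq_int (lbn n) (\<lambda>x. gw n \<gamma> x * cmod (U s x))" for k s
  unfolding power_mult_distrib by (intro nn_integral_mono ennreal_leI mult_right_mono GA(3)) auto
 have r: "(\<integral>\<^sup>+x. ennreal (W (Suc k) x * (cmod (U t x))\<^sup>2) \<partial>lbn n) \<le>
  ennreal (exp (2 * ((1 - t) * ln \<alpha>0 + t * ln \<alpha>1 + 12 * K + 32 * K\<^sup>2)))" for k
 proof -
  obtain J :: "(nat \<Rightarrow> nat) set" and p \<xi> where J: "finite J" "\<forall>j\<in>J. p j \<ge> 0" "\<forall>x. W (Suc k) x = (\<Sum>j\<in>J. p j * (ew n (\<xi> j) x)\<^sup>2)"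
   using GA(1)[where k = "Suc k", OF zero_less_Suc] by blast
  have gA: "W (Suc k) x \<le> (gw n \<gamma> x)\<^sup>2" for x by (rule GA(3)) simp
  show ?thesis unfolding K_def
   by (rule weighted_convexity[OF J(1) J(2)[rule_format] J(3)[rule_format] GA(2) gA
      order_trans[OF b e(1)[unfolded l]] order_trans[OF b e(2)[unfolded l]] t])
 qed
 have eq: "exp (2 * ((1 - t) * ln \<alpha>0 + t * ln \<alpha>1 + 12 * K + 32 * K\<^sup>2)) = (exp (12 * K + 32 * K\<^sup>2) * \<alpha>0 powr (1 - t) * \<alpha>1 powr t)\<^sup>2"
  unfolding exp_double using \<alpha> by (simp add: powr_def exp_add[symmetric] algebra_simps)
 have [measurable]: "U t \<in> Bor n" using t by measurable
 have [measurable]: "W k \<in> Bor n" for k unfolding W_def by measurable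
 show ?thesis unfolding eq[symmetric]
 proof (rule nn_integral_limit_bound[OF _ _ r])
  show "(\<lambda>x. ennreal (W (Suc k) x * (cmod (U t x))\<^sup>2)) \<in> Bor n" for k by measurable
  show "(\<lambda>k. ennreal (W (Suc k) x * (cmod (U t x))\<^sup>2)) \<longlonglongrightarrow> ennreal ((gw n \<gamma> x * cmod (U t x))\<^sup>2)" for x
   unfolding power_mult_distrib by (intro tendsto_ennrealI tendsto_intros GA(4))
 qed
qed

end

subsection \<open>Borel representatives\<close>

lemma completion_AE_measurable:
 assumes [measurable]: "g \<in> M \<rightarrow>\<^sub>M N" and ae: "AE x in M. f x = g x" and f: "\<And>x. x \<in> space M \<Longrightarrow> f x \<in> space N"
 shows "f \<in> completion M \<rightarrow>\<^sub>M N"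
proof (rule measurableI)
 show "x \<in> space (completion M) \<Longrightarrow> f x \<in> space N" for x using f by simp
 fix A assume [measurable]: "A \<in> sets N"
 show "f -` A \<inter> space (completion M) \<in> sets (completion M)"
 proof (rule completion.in_sets_AE[where A = "g -` A \<inter> space M"])
  show "AE x in completion M. (x \<in> g -` A \<inter> space M) = (x \<in> f -` A \<inter> space (completion M))"
   by (rule AE_completion) (use ae in eventually_elim, auto)
 qed (auto intro: measurable_sets)
qed

lemma integral_completion_AE:
 fixes f g :: "'a \<Rightarrow> complex"
 assumes g: "g \<in> borel_measurable M" and ae: "AE x in M. f x = g x"
 shows "(\<integral>x. f x \<partial>completion M) = (\<integral>x. g x \<partial>M)"
proof -
 have "(\<integral>x. f x \<partial>completion M) = (\<integral>x. g x \<partial>completion M)"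
  by (rule Bochner_Integration.integral_cong_AE)
    (use g in \<open>auto intro: completion_AE_measurable[OF g ae] AE_completion[OF ae] measurable_completion\<close>)
 then show ?thesis using integral_completion[OF g] by simp
qed

lemma complex_borel_representative:
 fixes f :: "'a \<Rightarrow> complex"
 assumes [measurable]: "f \<in> borel_measurable (completion M)"
 shows "\<exists>g\<in>borel_measurable M. AE x in M. f x = g x"
proof -
 obtain a where a: "a \<in> borel_measurable M" "AE x in M. Re (f x) = a x"
  using completion_ex_borel_measurable_real[of "\<lambda>x. Re (f x)" M] by auto
 obtain b where b: "b \<in> borel_measurable M" "AE x in M. Im (f x) = b x"
  using completion_ex_borel_measurable_real[of "\<lambda>x. Im (f x)" M] by auto
 note [measurable] = a(1) b(1)
 have [measurable]: "(\<lambda>x. Complex (a x) (b x)) \<in> borel_measurable M"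
  unfolding Complex_eq by measurable
 show ?thesis
 proof (intro bexI[of _ "\<lambda>x. Complex (a x) (b x)"])
  show "AE x in M. f x = Complex (a x) (b x)" using a(2) b(2) by eventually_elim (simp add: complex_eq_iff)
 qed measurable
qed

lemma L2norm_measurable: "L2norm n f < \<infinity> \<Longrightarrow> f \<in> borel_measurable (leb n)"
 by (auto simp: L2norm_def split: if_splits)

text \<open>Both sides are infinite together, so estimates can be made with \<open>sq_int\<close>
  without a case distinction. It also replaces the completed measure by the product measure.\<close>

lemma L2norm_sq:
 assumes [measurable]: "f \<in> borel_measurable (leb n)"
 shows "(L2norm n f)\<^sup>2 = sq_int (lbn n) (\<lambda>x. cmod (f x))"
proof -
 have 1: "sq_int (lbn n) (\<lambda>x. cmod (f x)) = sq_int (leb n) (\<lambda>x. cmod (f x))"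
  unfolding leb_def by (rule nn_integral_completion[symmetric])
 show ?thesis
 proof (cases "integrable (leb n) (\<lambda>x. (cmod (f x))\<^sup>2)")
  case True
  then have "L2norm n f = ennreal (sqrt (\<integral>x. (cmod (f x))\<^sup>2 \<partial>leb n))" using assms by (simp add: L2norm_def)
  then have "(L2norm n f)\<^sup>2 = ennreal (\<integral>x. (cmod (f x))\<^sup>2 \<partial>leb n)" by (simp add: ennreal_power)
  with True show ?thesis unfolding 1 by (subst nn_integral_eq_integral) auto
 next
  case False
  then have "L2norm n f = top" by (simp add: L2norm_def)
  moreover have "sq_int (leb n) (\<lambda>x. cmod (f x)) = top"
  proof (rule ccontr)
   assume "sq_int (leb n) (\<lambda>x. cmod (f x)) \<noteq> top"
   then have "integrable (leb n) (\<lambda>x. (cmod (f x))\<^sup>2)" by (intro integrableI_bounded) (auto simp: less_top)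
   with False show False ..
  qed
  ultimately show ?thesis unfolding 1 by (simp add: power2_eq_square ennreal_mult_top)
 qed
qed

lemma L2norm_AE:
 assumes [measurable]: "g \<in> Bor n" and ae: "AE x in lbn n. f x = g x"
 shows "(L2norm n f)\<^sup>2 = sq_int (lbn n) (\<lambda>x. cmod (g x))" and "f \<in> borel_measurable (leb n)"
proof -
 show f: "f \<in> borel_measurable (leb n)" unfolding leb_def by (rule completion_AE_measurable[OF _ ae]) auto
 show "(L2norm n f)\<^sup>2 = sq_int (lbn n) (\<lambda>x. cmod (g x))"
  unfolding L2norm_sq[OF f] by (rule nn_integral_cong_AE) (use ae in eventually_elim, simp)
qed

text \<open>Continuity refers to the topology of all functions from \<open>nat\<close>, while the
  product sigma-algebra lives on extensional functions. The continuous retraction \<open>r\<close>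
  onto the latter connects the two.\<close>

lemma euclid_continuous_measurable:
 fixes \<phi> :: "(nat \<Rightarrow> real) \<Rightarrow> real"
 assumes \<phi>: "continuous_on (euclid d) \<phi>"
 shows "\<phi> \<in> borel_measurable (lbn d)"
proof -
 define r where "r x = restrict x {..<d}" for x :: "nat \<Rightarrow> real"
 have "continuous_on UNIV r"
 proof (rule continuous_on_coordinatewise_then_product)
  show "continuous_on UNIV (\<lambda>x. r x i)" for i
   by (cases "i < d") (auto simp: r_def intro: continuous_on_product_coordinates)
 qed
 then have "continuous_on UNIV (\<lambda>x. \<phi> (r x))" by (rule continuous_on_compose2[OF \<phi>]) (auto simp: r_def)
 then have m: "(\<lambda>x. \<phi> (r x)) \<in> borel_measurable borel" by (rule borel_measurable_continuous_onI)
 have i: "(\<lambda>x. x) \<in> lbn d \<rightarrow>\<^sub>M (borel :: (nat \<Rightarrow> real) measure)"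
 proof (rule measurable_coordinatewise_then_product)
  fix i
  show "(\<lambda>x. x i) \<in> borel_measurable (lbn d)"
  proof (cases "i < d")
   case False
   then have "(\<lambda>x. x i) \<in> borel_measurable (lbn d) \<longleftrightarrow> (\<lambda>x. undefined :: real) \<in> borel_measurable (lbn d)"
    by (intro measurable_cong) (auto simp: space_PiM PiE_def extensional_def)
   then show ?thesis by simp
  qed simp
 qed
 have "\<phi> \<in> borel_measurable (lbn d) \<longleftrightarrow> (\<lambda>x. \<phi> (r x)) \<in> borel_measurable (lbn d)"
  by (intro measurable_cong) (auto simp: r_def space_PiM PiE_def extensional_restrict)
 with measurable_compose[OF i m] show ?thesis by simp
qed

lemma slice_measurable:
 assumes "\<phi> \<in> borel_measurable (lbn (Suc n))"
 shows "(\<lambda>(t, x). \<phi> (x(n := t)) :: real) \<in> Bor2 n"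
proof -
 have 1: "(\<lambda>(x, t). x(n := t)) \<in> lbn n \<Otimes>\<^sub>M lborel \<rightarrow>\<^sub>M lbn (Suc n)"
  using measurable_add_dim[of n "{..<n}" "\<lambda>_. lborel"] by (simp add: lessThan_Suc)
 have 2: "(\<lambda>(t, x). (x, t)) \<in> borel \<Otimes>\<^sub>M lbn n \<rightarrow>\<^sub>M lbn n \<Otimes>\<^sub>M lborel"
  using measurable_pair_swap'[of "borel :: real measure" "lbn n"] by (simp cong: measurable_cong_sets)
 show ?thesis using measurable_compose[OF measurable_compose[OF 2 1] assms] by (simp add: split_beta')
qed

text \<open>Uniform continuity from compactness, for a squared distance that satisfies the triangle
  inequality only up to a factor 2; the tolerance e/4 is chosen since 2 e/4 + 2 e/4 = e.\<close>

lemma heine_cantor_ennreal: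
 fixes d :: "real \<Rightarrow> real \<Rightarrow> ennreal"
 assumes cont: "\<And>s. s \<in> {0..1} \<Longrightarrow> ((\<lambda>t. d t s) \<longlongrightarrow> 0) (at s within {0..1})"
  and tri: "\<And>s t r. d s t \<le> 2 * d s r + 2 * d t r" and refl: "\<And>s. d s s = 0" and e: "e > 0"
 shows "\<exists>\<delta>>0. \<forall>s\<in>{0..1}. \<forall>t\<in>{0..1}. \<bar>s - t\<bar> < \<delta> \<longrightarrow> d s t \<le> ennreal e"
proof -
 have "\<exists>\<delta>>0. \<forall>t\<in>{0..1}. dist t s < \<delta> \<longrightarrow> d t s \<le> ennreal (e / 4)" if s: "s \<in> {0..1}" for s
 proof -
  have "\<forall>\<^sub>F t in at s within {0..1}. d t s < ennreal (e / 4)"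
   by (rule order_tendstoD(2)[OF cont[OF s]]) (use e in simp)
  then obtain \<delta> where "\<delta> > 0" "\<forall>t\<in>{0..1}. t \<noteq> s \<and> dist t s < \<delta> \<longrightarrow> d t s < ennreal (e / 4)"
   unfolding eventually_at by auto
  then show ?thesis using refl[of s] by (intro exI[of _ \<delta>]) (metis less_imp_le zero_le)
 qed
 then obtain \<rho> where \<rho>: "\<And>s. s \<in> {0..1} \<Longrightarrow> \<rho> s > 0" "\<And>s t. s \<in> {0..1} \<Longrightarrow> t \<in> {0..1} \<Longrightarrow> dist t s < \<rho> s \<Longrightarrow> d t s \<le> ennreal (e / 4)"
  by metis
 obtain \<epsilon> where \<epsilon>: "\<epsilon> > 0" "\<And>x. x \<in> {0..1} \<Longrightarrow> \<exists>G\<in>(\<lambda>s. ball s (\<rho> s)) ` {0..1::real}. ball x \<epsilon> \<subseteq> G"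
 proof (rule Heine_Borel_lemma[of "{0..1::real}" "(\<lambda>s. ball s (\<rho> s)) ` {0..1}"])
  show "{0..1} \<subseteq> \<Union> ((\<lambda>s. ball s (\<rho> s)) ` {0..1})" using \<rho>(1) by force
 qed auto
 show ?thesis
 proof (intro exI[of _ \<epsilon>] conjI ballI impI \<epsilon>(1))
  fix s t assume st: "s \<in> {0..1::real}" "t \<in> {0..1::real}" "\<bar>s - t\<bar> < \<epsilon>"
  obtain r where r: "r \<in> {0..1}" "ball s \<epsilon> \<subseteq> ball r (\<rho> r)" using \<epsilon>(2)[OF st(1)] by blast
  have "s \<in> ball r (\<rho> r)" "t \<in> ball r (\<rho> r)" using r(2) \<epsilon>(1) st(3) by (auto simp: subset_eq dist_real_def)
  then have "d s r \<le> ennreal (e / 4)" "d t r \<le> ennreal (e / 4)" using \<rho>(2) r(1) st by (auto simp: dist_commute)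
  then have "2 * d s r + 2 * d t r \<le> ennreal 2 * ennreal (e / 4) + ennreal 2 * ennreal (e / 4)"
   by (intro add_mono mult_mono) auto
  also have "\<dots> = ennreal e" using e by (simp only: ennreal_mult[symmetric] ennreal_plus[symmetric]) simp
  finally show "d s t \<le> ennreal e" using tri[of s t r] by (rule order_trans[rotated])
 qed
qed

text \<open>The squared errors have a summable sequence of integrals, so their pointwise sum is
  finite almost everywhere and its terms tend to 0. No subsequence has to be extracted.\<close>

lemma AE_converges_L2:
 fixes f :: "nat \<Rightarrow> 'a \<Rightarrow> complex"
 assumes [measurable]: "\<And>k. f k \<in> borel_measurable M" "g \<in> borel_measurable M"
  and b: "\<And>k. (sq_int M (\<lambda>x. cmod (f k x - g x))) \<le> ennreal ((1 / 4) ^ k)"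
 shows "AE x in M. (\<lambda>k. f k x) \<longlonglongrightarrow> g x"
proof -
 have "(\<integral>\<^sup>+x. (\<Sum>k. ennreal ((cmod (f k x - g x))\<^sup>2)) \<partial>M) = (\<Sum>k. \<integral>\<^sup>+x. ennreal ((cmod (f k x - g x))\<^sup>2) \<partial>M)"
  by (rule nn_integral_suminf) measurable
 also have "\<dots> \<le> (\<Sum>k. ennreal ((1 / 4) ^ k))" by (intro suminf_le b) auto
 also have "\<dots> = ennreal (\<Sum>k. (1 / 4) ^ k)" by (intro suminf_ennreal2) auto
 finally have "(\<integral>\<^sup>+x. (\<Sum>k. ennreal ((cmod (f k x - g x))\<^sup>2)) \<partial>M) \<noteq> \<infinity>" by (auto simp: top_unique)
 then have "AE x in M. (\<Sum>k. ennreal ((cmod (f k x - g x))\<^sup>2)) \<noteq> \<infinity>" by (intro nn_integral_PInf_AE) measurable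
 then show ?thesis
 proof eventually_elim
  case (elim x)
  then have "summable (\<lambda>k. (cmod (f k x - g x))\<^sup>2)" by (intro summable_suminf_not_top) auto
  from tendsto_real_sqrt[OF summable_LIMSEQ_zero[OF this]] have "(\<lambda>k. cmod (f k x - g x)) \<longlonglongrightarrow> 0" by simp
  then show ?case by (rule LIM_zero_cancel[OF tendsto_norm_zero_cancel])
 qed
qed

text \<open>Representatives chosen separately for each time need not be jointly measurable. Sampled
  on a time grid they take only countably many values in time and are jointly measurable; by uniform
  continuity the grids can be chosen with squared error at most 4^(-k), so the samples converge for
  almost every x at each fixed t.\<close>

lemma L2_curve_representative:
 assumes u: "in_C_L2 n u"
 obtains U C where "case_prod U \<in> Bor2 n"
  "\<And>t. t \<in> {0..1} \<Longrightarrow> AE x in lbn n. u t x = U t x" "C \<ge> 0"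
  "\<And>t. t \<in> {0..1} \<Longrightarrow> (sq_int (lbn n) (\<lambda>x. cmod (U t x))) \<le> ennreal (C\<^sup>2)"
  "\<And>s. s \<in> {0..1} \<Longrightarrow> ((\<lambda>t. \<integral>\<^sup>+x. ennreal ((cmod (U t x - U s x))\<^sup>2) \<partial>lbn n) \<longlongrightarrow> 0) (at s within {0..1})"
proof -
 have uL: "L2norm n (u t) < \<infinity>" if "t \<in> {0..1}" for t using u that by (auto simp: in_C_L2_def)
 have um: "u t \<in> borel_measurable (completion (lbn n))" if "t \<in> {0..1}" for t
  using L2norm_measurable[OF uL[OF that]] by (simp add: leb_def)
 \<comment> \<open>A choice for every t on its own, with no relation between different
   times.\<close>
 define v where "v t = (if t \<in> {0..1} then SOME g. g \<in> Bor n \<and> (AE x in lbn n. u t x = g x) else (\<lambda>_. 0))" for t :: real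
 have v: "v t \<in> Bor n \<and> (AE x in lbn n. u t x = v t x)" if t: "t \<in> {0..1}" for t
 proof -
  have ex: "\<exists>g. g \<in> Bor n \<and> (AE x in lbn n. u t x = g x)"
   using complex_borel_representative[OF um[OF t]] by blast
  have "v t = (SOME g. g \<in> Bor n \<and> (AE x in lbn n. u t x = g x))" using t by (simp add: v_def)
  then show ?thesis using someI_ex[OF ex] by (simp only:)
 qed
 have [measurable]: "v t \<in> Bor n" for t
  using v[of t] by (cases "t \<in> {0..1}") (auto simp: v_def)
 define d where "d s t = sq_int (lbn n) (\<lambda>x. cmod (v s x - v t x))" for s t
 have d_u: "(L2norm n (\<lambda>x. u t x - u s x))\<^sup>2 = d t s" if "t \<in> {0..1}" "s \<in> {0..1}" for s t
  unfolding d_def using v[OF that(1)] v[OF that(2)] by (intro L2norm_AE(1)) auto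
 have cont: "((\<lambda>t. d t s) \<longlongrightarrow> 0) (at s within {0..1})" if s: "s \<in> {0..1}" for s
 proof -
  have L: "((\<lambda>t. L2norm n (\<lambda>x. u t x - u s x)) \<longlongrightarrow> 0) (at s within {0..1})" using u s by (auto simp: in_C_L2_def)
  have L2: "((\<lambda>t. L2norm n (\<lambda>x. u t x - u s x) * L2norm n (\<lambda>x. u t x - u s x)) \<longlongrightarrow> 0) (at s within {0..1})"
   using tendsto_mult_ennreal[OF L L] by simp
  show ?thesis
  proof (rule Lim_transform_eventually[OF L2])
   show "\<forall>\<^sub>F t in at s within {0..1}. L2norm n (\<lambda>x. u t x - u s x) * L2norm n (\<lambda>x. u t x - u s x) = d t s"
    unfolding eventually_at_filter power2_eq_square[symmetric] using s by (intro always_eventually) (auto simp: d_u)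
  qed
 qed
 have sq2: "(a + b)\<^sup>2 \<le> 2 * a\<^sup>2 + 2 * b\<^sup>2" for a b :: real
  using zero_le_power2[of "a - b"] by (simp add: power2_sum power2_diff)
 have L2tri: "sq_int (lbn n) (\<lambda>x. cmod (f x - g x)) \<le> 2 * sq_int (lbn n) (\<lambda>x. cmod (f x - h x)) + 2 * sq_int (lbn n) (\<lambda>x. cmod (g x - h x))"
  if [measurable]: "f \<in> Bor n" "g \<in> Bor n" "h \<in> Bor n" for f g h :: "(nat \<Rightarrow> real) \<Rightarrow> complex"
 proof -
  have "sq_int (lbn n) (\<lambda>x. cmod (f x - g x)) \<le> (\<integral>\<^sup>+x. ennreal 2 * ennreal ((cmod (f x - h x))\<^sup>2) + ennreal 2 * ennreal ((cmod (g x - h x))\<^sup>2) \<partial>lbn n)"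
  proof (intro nn_integral_mono)
   fix x
   have "(cmod (f x - g x))\<^sup>2 \<le> (cmod (f x - h x) + cmod (g x - h x))\<^sup>2"
    using norm_triangle_ineq4[of "f x - h x" "g x - h x"] by (intro power_mono) simp_all
   also note sq2
   finally show "ennreal ((cmod (f x - g x))\<^sup>2) \<le> ennreal 2 * ennreal ((cmod (f x - h x))\<^sup>2) + ennreal 2 * ennreal ((cmod (g x - h x))\<^sup>2)"
    by (simp add: ennreal_mult[symmetric] ennreal_plus[symmetric] ennreal_leI del: ennreal_plus ennreal_numeral)
  qed
  then show ?thesis by (simp add: nn_integral_add nn_integral_cmult)
 qed
 have "\<forall>k::nat. \<exists>N::nat. N > 0 \<and> (\<forall>s\<in>{0..1}. \<forall>t\<in>{0..1}. \<bar>s - t\<bar> < 1 / real N \<longrightarrow> d s t \<le> ennreal ((1 / 4) ^ k))"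
 proof
  fix k :: nat
  have "\<exists>\<delta>>0. \<forall>s\<in>{0..1}. \<forall>t\<in>{0..1}. \<bar>s - t\<bar> < \<delta> \<longrightarrow> d s t \<le> ennreal ((1 / 4) ^ k)"
   by (rule heine_cantor_ennreal[OF cont]) (auto simp: d_def intro!: L2tri)
  then obtain \<delta> where \<delta>: "\<delta> > 0" "\<forall>s\<in>{0..1}. \<forall>t\<in>{0..1}. \<bar>s - t\<bar> < \<delta> \<longrightarrow> d s t \<le> ennreal ((1 / 4) ^ k)" by blast
  obtain N where N: "inverse (real (Suc N)) < \<delta>" using reals_Archimedean[OF \<delta>(1)] by blast
  show "\<exists>N::nat. N > 0 \<and> (\<forall>s\<in>{0..1}. \<forall>t\<in>{0..1}. \<bar>s - t\<bar> < 1 / real N \<longrightarrow> d s t \<le> ennreal ((1 / 4) ^ k))"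
  proof (intro exI[of _ "Suc N"] conjI ballI impI)
   fix s t assume "s \<in> {0..1::real}" "t \<in> {0..1::real}" "\<bar>s - t\<bar> < 1 / real (Suc N)"
   then show "d s t \<le> ennreal ((1 / 4) ^ k)" using \<delta>(2) N by (auto simp: inverse_eq_divide)
  qed simp
 qed
 from choice[OF this] obtain N :: "nat \<Rightarrow> nat" where N: "\<And>k. N k > 0"
  "\<And>k s t. s \<in> {0..1} \<Longrightarrow> t \<in> {0..1} \<Longrightarrow> \<bar>s - t\<bar> < 1 / real (N k) \<Longrightarrow> d s t \<le> ennreal ((1 / 4) ^ k)" by blast
 \<comment> \<open>The last grid point not after t. For t in [0,1] the index is at most
   \<open>N k\<close>, so the grid points used lie in [0,1] and are finite in number.\<close>
 define q where "q k t = real_of_int \<lfloor>t * real (N k)\<rfloor> / real (N k)" for k t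
 have q: "q k t \<in> {0..1}" "\<bar>q k t - t\<bar> < 1 / real (N k)" "q k t = real (nat \<lfloor>t * real (N k)\<rfloor>) / real (N k)" "nat \<lfloor>t * real (N k)\<rfloor> \<le> N k"
  if t: "t \<in> {0..1}" for k t
 proof -
  have Np: "real (N k) > 0" using N(1)[of k] by simp
  have f0: "0 \<le> \<lfloor>t * real (N k)\<rfloor>" using t by simp
  have "t * real (N k) \<le> 1 * real (N k)" using t by (intro mult_right_mono) auto
  then have f1: "\<lfloor>t * real (N k)\<rfloor> \<le> int (N k)" by (simp add: floor_le_iff)
  show "q k t \<in> {0..1}" unfolding q_def using f0 f1 Np by simp
  have "\<bar>real_of_int \<lfloor>t * real (N k)\<rfloor> - t * real (N k)\<bar> < 1" by linarith
  moreover have "q k t - t = (real_of_int \<lfloor>t * real (N k)\<rfloor> - t * real (N k)) / real (N k)" using Np by (simp add: q_def field_simps)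
  ultimately show "\<bar>q k t - t\<bar> < 1 / real (N k)" using Np by (simp add: abs_divide divide_strict_right_mono)
  show "q k t = real (nat \<lfloor>t * real (N k)\<rfloor>) / real (N k)" unfolding q_def using f0 by simp
  show "nat \<lfloor>t * real (N k)\<rfloor> \<le> N k" using f1 by simp
 qed
 define U where "U t x = lim (\<lambda>k. v (q k t) x)" for t x
 have Um: "case_prod U \<in> Bor2 n"
 proof -
  have m: "(\<lambda>p. v (q k (fst p)) (snd p)) \<in> Bor2 n" for k
   unfolding q_def
   by (rule measurable_compose_countable[where f = "\<lambda>i p. v (real_of_int i / real (N k)) (snd p)" and g = "\<lambda>p. \<lfloor>fst p * real (N k)\<rfloor>"]) measurable
  have "(\<lambda>p. lim (\<lambda>k. v (q k (fst p)) (snd p))) \<in> Bor2 n" by (rule borel_measurable_lim_metric[OF m])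
  then show ?thesis by (simp add: U_def split_beta')
 qed
 have Uv: "AE x in lbn n. U t x = v t x" if t: "t \<in> {0..1}" for t
 proof -
  have "AE x in lbn n. (\<lambda>k. v (q k t) x) \<longlonglongrightarrow> v t x"
   by (rule AE_converges_L2) (use N(2)[OF q(1)[OF t] t q(2)[OF t]] in \<open>auto simp: d_def\<close>)
  then show ?thesis by eventually_elim (simp add: U_def limI)
 qed
 have Ut [measurable]: "U t \<in> Bor n" for t
  using measurable_compose[OF measurable_Pair1'[of t borel "lbn n"] Um] by simp
 have vfin: "sq_int (lbn n) (\<lambda>x. cmod (v t x)) < top" if t: "t \<in> {0..1}" for t
 proof -
  have "(L2norm n (u t))\<^sup>2 < top" using uL[OF t] by (simp add: power2_eq_square ennreal_mult_less_top)
  then show ?thesis using L2norm_AE(1)[of "v t" n "u t"] v[OF t] by simp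
 qed
 define a where "a i = enn2real (sq_int (lbn n) (\<lambda>x. cmod (v (real i / real (N 0)) x)))" for i :: nat
 \<comment> \<open>On the coarsest grid only finitely many functions occur, and every
   \<open>v t\<close> has squared distance at most 1 from one of them; the factors 2 come from the
   triangle inequality for squares.\<close>
 define C where "C = sqrt (2 + 2 * (\<Sum>i\<le>N 0. a i))"
 have aC: "0 \<le> 2 + 2 * (\<Sum>i\<le>N 0. a i)" by (intro add_nonneg_nonneg mult_nonneg_nonneg sum_nonneg) (auto simp: a_def)
 have Ub: "sq_int (lbn n) (\<lambda>x. cmod (U t x)) \<le> ennreal (C\<^sup>2)" if t: "t \<in> {0..1}" for t
 proof -
  have "sq_int (lbn n) (\<lambda>x. cmod (U t x)) = sq_int (lbn n) (\<lambda>x. cmod (v t x - 0))"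
   by (rule nn_integral_cong_AE) (use Uv[OF t] in eventually_elim, simp)
  also have "\<dots> = sq_int (lbn n) (\<lambda>x. cmod (0 - v t x))" by simp
  also have "\<dots> \<le> 2 * sq_int (lbn n) (\<lambda>x. cmod (0 - v (q 0 t) x)) + 2 * d t (q 0 t)"
   unfolding d_def by (rule L2tri) measurable
  also have "\<dots> \<le> ennreal 2 * ennreal (\<Sum>i\<le>N 0. a i) + ennreal 2 * ennreal 1"
  proof (intro add_mono mult_mono)
   have "d t (q 0 t) \<le> ennreal ((1 / 4) ^ 0)"
    by (rule N(2)[OF t q(1)[OF t]]) (use q(2)[OF t, of 0] in \<open>simp add: abs_minus_commute\<close>)
   then show "d t (q 0 t) \<le> ennreal 1" by simp
   define i where "i = nat \<lfloor>t * real (N 0)\<rfloor>"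
   have i: "q 0 t = real i / real (N 0)" "i \<le> N 0" using q(3,4)[OF t, of 0] by (auto simp: i_def)
   have "sq_int (lbn n) (\<lambda>x. cmod (0 - v (q 0 t) x)) = ennreal (a i)"
    unfolding a_def i(1)[symmetric] using vfin[OF q(1)[OF t, of 0]] by simp
   also have "a i \<le> (\<Sum>i\<le>N 0. a i)" using i(2) by (intro member_le_sum) (auto simp: a_def)
   finally show "sq_int (lbn n) (\<lambda>x. cmod (0 - v (q 0 t) x)) \<le> ennreal (\<Sum>i\<le>N 0. a i)" by (simp add: ennreal_leI)
  qed auto
  also have "\<dots> = ennreal (2 + 2 * (\<Sum>i\<le>N 0. a i))"
   by (simp add: ennreal_mult' sum_nonneg a_def add.commute)
  also have "2 + 2 * (\<Sum>i\<le>N 0. a i) = C\<^sup>2" using aC by (simp add: C_def)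
  finally show ?thesis .
 qed
 show thesis
 proof (rule that[of U C])
  show "AE x in lbn n. u t x = U t x" if t: "t \<in> {0..1}" for t
   using v[OF t, THEN conjunct2] Uv[OF t] by eventually_elim simp
  show "((\<lambda>t. \<integral>\<^sup>+x. ennreal ((cmod (U t x - U s x))\<^sup>2) \<partial>lbn n) \<longlongrightarrow> 0) (at s within {0..1})" if s: "s \<in> {0..1}" for s
  proof (rule Lim_transform_eventually[OF cont[OF s]])
   have "d t s = sq_int (lbn n) (\<lambda>x. cmod (U t x - U s x))" if t: "t \<in> {0..1}" for t
    unfolding d_def by (rule nn_integral_cong_AE) (use Uv[OF t] Uv[OF s] in eventually_elim, simp)
   then show "\<forall>\<^sub>F t in at s within {0..1}. d t s = sq_int (lbn n) (\<lambda>x. cmod (U t x - U s x))"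
    unfolding eventually_at_filter by (intro always_eventually) auto
  qed
  show "C \<ge> 0" unfolding C_def using aC by simp
 qed (use Um Ub in auto)
qed

text \<open>Lets a numerical conclusion be drawn from an inequality that holds almost everywhere, as
  in the proof that \<open>M1\<close> is nonnegative.\<close>

lemma lbn_not_null: "\<not> (AE x in lbn n. False)"
proof
 assume "AE x in lbn n. False"
 then have 0: "emeasure (lbn n) (space (lbn n)) = 0"
  by (simp add: eventually_False ae_filter_eq_bot_iff)
 have "emeasure (lbn n) (PiE {..<n} (\<lambda>_. {0..1})) = 1"
  by (subst lbp.emeasure_PiM) auto
 moreover have "emeasure (lbn n) (PiE {..<n} (\<lambda>_. {0..1})) \<le> emeasure (lbn n) (space (lbn n))"
  by (rule emeasure_space)
 ultimately show False using 0 by simp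
qed

text \<open>A representative on the strip determines almost every time slice by Fubini's theorem for
  null sets. It cannot say anything about a particular time.\<close>

lemma strip_representative:
 fixes W :: "real \<Rightarrow> (nat \<Rightarrow> real) \<Rightarrow> complex"
 assumes W: "case_prod W \<in> borel_measurable (leb_strip n)"
 obtains W' where "case_prod W' \<in> Bor2 n"
  "AE t in lborel. t \<in> {0..1} \<longrightarrow> (AE x in lbn n. W t x = W' t x)"
proof -
 let ?R = "restrict_space lborel {0..1::real}"
 have sR: "sigma_finite_measure ?R"
  by (rule sigma_finite_measure_restrict_space[OF lborel.sigma_finite_measure_axioms]) simp
 interpret P: pair_sigma_finite ?R "lbn n"
  by (rule pair_sigma_finite.intro[OF sR lbn.sigma_finite_measure_axioms])
 obtain g where g: "g \<in> borel_measurable (?R \<Otimes>\<^sub>M lbn n)" "AE p in ?R \<Otimes>\<^sub>M lbn n. case_prod W p = g p"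
  using complex_borel_representative[OF W[unfolded leb_strip_def]] by blast
 have "AE t in ?R. AE x in lbn n. case_prod W (t, x) = g (t, x)" by (rule P.AE_pair[OF g(2)])
 then have ae: "AE t in lborel. t \<in> {0..1} \<longrightarrow> (AE x in lbn n. W t x = g (t, x))"
  by (simp add: AE_restrict_space_iff)
 \<comment> \<open>Clamping extends the representative from [0,1] to all times without changing it
   on the interval.\<close>
 define cl where "cl t = max 0 (min 1 t)" for t :: real
 have cl: "cl \<in> borel \<rightarrow>\<^sub>M ?R" by (rule measurable_restrict_space2) (auto simp: cl_def[abs_def])
 have [measurable]: "(\<lambda>p. cl (fst p)) \<in> borel \<Otimes>\<^sub>M lbn n \<rightarrow>\<^sub>M ?R" by (rule measurable_compose[OF measurable_fst cl])
 have "(\<lambda>p. (cl (fst p), snd p)) \<in> borel \<Otimes>\<^sub>M lbn n \<rightarrow>\<^sub>M ?R \<Otimes>\<^sub>M lbn n" by measurable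
 from measurable_compose[OF this g(1)] have m: "(\<lambda>p. g (cl (fst p), snd p)) \<in> Bor2 n" .
 show thesis
 proof (rule that[of "\<lambda>t x. g (cl t, x)"])
  show "case_prod (\<lambda>t x. g (cl t, x)) \<in> Bor2 n" using m by (simp add: split_beta')
  show "AE t in lborel. t \<in> {0..1} \<longrightarrow> (AE x in lbn n. W t x = g (cl t, x))"
   using ae by eventually_elim (auto simp: cl_def)
 qed
qed

text \<open>The inner integrals change on a null set of times only, and the representative makes the
  outer integrand Borel.\<close>

lemma strip_integral:
 fixes f g :: "real \<Rightarrow> (nat \<Rightarrow> real) \<Rightarrow> complex"
 assumes g: "case_prod g \<in> Bor2 n"
  and ae: "AE t in lborel. t \<in> {0..1} \<longrightarrow> (AE x in lbn n. f t x = g t x)"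
 shows "(\<integral>t. (\<integral>x. f t x \<partial>leb n) \<partial>lebesgue_on {0..1}) = (int_on 0 1 (\<lambda>t. \<integral>x. g t x \<partial>lbn n))"
proof -
 have [measurable]: "(\<lambda>p. g (fst p) (snd p)) \<in> borel_measurable (lborel \<Otimes>\<^sub>M lbn n)" using g by (simp add: split_beta')
 have gt: "g t \<in> Bor n" for t
  using measurable_compose[OF measurable_Pair1'[of t borel "lbn n"] g] by simp
 have "(\<integral>t. (\<integral>x. f t x \<partial>leb n) \<partial>lebesgue_on {0..1}) = (\<integral>t. indicator {0..1} t *\<^sub>R (\<integral>x. f t x \<partial>leb n) \<partial>lebesgue)"
  by (rule integral_restrict_space) simp
 also have "\<dots> = (int_on 0 1 (\<lambda>t. \<integral>x. g t x \<partial>lbn n))"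
 proof (rule integral_completion_AE)
  show "(\<lambda>t. indicator {0..1} t *\<^sub>R (\<integral>x. g t x \<partial>lbn n)) \<in> borel_measurable lborel" by measurable
  show "AE t in lborel. indicator {0..1} t *\<^sub>R (\<integral>x. f t x \<partial>leb n) = indicator {0..1} t *\<^sub>R (\<integral>x. g t x \<partial>lbn n)"
   using ae
  proof eventually_elim
   case (elim t)
   show ?case
   proof (cases "t \<in> {0..1}")
    case True
    with elim have "AE x in lbn n. f t x = g t x" by simp
    from integral_completion_AE[OF gt this] show ?thesis by (simp add: leb_def)
   qed simp
  qed
 qed
 finally show ?thesis .
qed

text \<open>If the norm of \<open>u t\<close> is positive and finite, one divides by it. If it
  vanishes, any admissible constant forces the left side to be 0, because M * 0 = 0 also for
  infinite M.\<close>

lemma M2_const_bound: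
 assumes fin: "M2_const n \<gamma> F u < \<infinity>" and t: "t \<in> {0..1}" and L: "L2norm n (u t) < \<infinity>"
 shows "L2norm n (gauss n \<gamma> (F t)) \<le> M2_const n \<gamma> F u * L2norm n (u t)"
proof -
 define S where "S = {M. \<forall>t\<in>{0..1}. L2norm n (gauss n \<gamma> (F t)) \<le> M * L2norm n (u t)}"
 have M2: "M2_const n \<gamma> F u = Inf S" by (simp add: M2_const_def S_def)
 have S: "L2norm n (gauss n \<gamma> (F t)) \<le> M * L2norm n (u t)" if "M \<in> S" for M using that t by (simp add: S_def)
 obtain M0 where M0: "M0 \<in> S" using fin unfolding M2 by (cases "S = {}") auto
 show ?thesis
 proof (cases "L2norm n (u t) = 0")
  case True
  then show ?thesis using S[OF M0] by simp
 next
  case False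
  then have pos: "0 < L2norm n (u t)" by (simp add: zero_less_iff_neq_zero)
  have "L2norm n (gauss n \<gamma> (F t)) / L2norm n (u t) \<le> Inf S"
   by (rule Inf_greatest) (use S pos in \<open>auto intro: divide_le_posI_ennreal simp: mult.commute\<close>)
  then have "L2norm n (gauss n \<gamma> (F t)) / L2norm n (u t) * L2norm n (u t) \<le> Inf S * L2norm n (u t)"
   by (rule mult_right_mono) simp
  then show ?thesis using False L by (simp add: M2 ennreal_divide_times)
 qed
qed

section \<open>Transfer of the hypotheses and conclusion\<close>

lemma C_k_continuous: "C_k d k \<phi> \<Longrightarrow> continuous_on (euclid d) \<phi>"
 by (cases k) auto

lemma C_k_pd: "\<forall>k. C_k d k \<phi> \<Longrightarrow> i < d \<Longrightarrow> \<forall>k. C_k d k (pd i \<phi>)"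
 by (metis C_k.simps(2))

text \<open>The bounds are required at every time, while the representatives of V and F are tied to
  the originals only at almost every time. Setting both to 0 at the exceptional times keeps all
  bounds and does not affect the weak equation, which is integrated in time. U agrees with u at
  every time, so the norms at 0, 1 and t are preserved.\<close>

lemma heat_weighted_representative:
 assumes A: "A > 0" and \<gamma>: "\<gamma> > 0" and u: "in_C_L2 n u"
  and Vm: "case_prod V \<in> borel_measurable (leb_strip n)" and Fm: "case_prod F \<in> borel_measurable (leb_strip n)"
  and ws: "weak_solution n (Complex A B) V F u"
  and VM: "(SUP t\<in>{0..1}. Linf_norm n (V t)) \<le> ereal M1"
  and u0: "L2norm n (gauss n \<gamma> (u 0)) < \<infinity>" and M2: "M2_const n \<gamma> F u < \<infinity>"
 obtains U G F' CU where "heat_weighted n A B U G CU F' \<gamma> M1 (enn2real (M2_const n \<gamma> F u))"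
  "\<And>t. t \<in> {0..1} \<Longrightarrow> U t \<in> Bor n \<and> (AE x in lbn n. u t x = U t x)"
proof -
 define m2 where "m2 = enn2real (M2_const n \<gamma> F u)"
 have m2: "M2_const n \<gamma> F u = ennreal m2" "m2 \<ge> 0" using M2 by (auto simp: m2_def)
 obtain U C where U: "case_prod U \<in> Bor2 n"
  "\<And>t. t \<in> {0..1} \<Longrightarrow> AE x in lbn n. u t x = U t x" "C \<ge> 0"
  "\<And>t. t \<in> {0..1} \<Longrightarrow> (sq_int (lbn n) (\<lambda>x. cmod (U t x))) \<le> ennreal (C\<^sup>2)"
  "\<And>s. s \<in> {0..1} \<Longrightarrow> ((\<lambda>t. \<integral>\<^sup>+x. ennreal ((cmod (U t x - U s x))\<^sup>2) \<partial>lbn n) \<longlongrightarrow> 0) (at s within {0..1})"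
  using L2_curve_representative[OF u] by blast
 obtain V' where V': "case_prod V' \<in> Bor2 n"
  "AE t in lborel. t \<in> {0..1} \<longrightarrow> (AE x in lbn n. V t x = V' t x)" by (rule strip_representative[OF Vm])
 obtain F' where F': "case_prod F' \<in> Bor2 n"
  "AE t in lborel. t \<in> {0..1} \<longrightarrow> (AE x in lbn n. F t x = F' t x)" by (rule strip_representative[OF Fm])
 have "AE t in lborel. t \<in> {0..1} \<longrightarrow> (AE x in lbn n. V t x = V' t x) \<and> (AE x in lbn n. F t x = F' t x)"
  using V'(2) F'(2) by eventually_elim blast
 \<comment> \<open>A Borel null set of times, so that cutting off along it preserves joint
   measurability.\<close>
 then obtain N where N: "{t \<in> space lborel. \<not> (t \<in> {0..1} \<longrightarrow> (AE x in lbn n. V t x = V' t x) \<and> (AE x in lbn n. F t x = F' t x))} \<subseteq> N"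
  "emeasure lborel N = 0" "N \<in> sets lborel" by (rule AE_E)
 have [measurable]: "N \<in> sets borel" using N(3) by simp
 have nN: "AE t in lborel. t \<notin> N" using N by (intro AE_not_in) (auto simp: null_sets_def)
 have VB: "AE x in lbn n. cmod (V t x) \<le> M1" if t: "t \<in> {0..1}" for t
 proof -
  have "Linf_norm n (V t) \<le> ereal M1" using VM t by (meson SUP_upper order_trans)
  moreover have "AE x in leb n. ereal (cmod (V t x)) \<le> Linf_norm n (V t)" unfolding Linf_norm_def by (rule esssup_AE)
  ultimately have "AE x in leb n. cmod (V t x) \<le> M1" by (auto elim!: eventually_mono dest: order_trans)
  then show ?thesis unfolding leb_def AE_completion_iff .
 qed
 have M1: "M1 \<ge> 0"
 proof (rule ccontr)
  assume n: "\<not> M1 \<ge> 0"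
  have "AE x in lbn n. cmod (V 0 x) \<le> M1" by (rule VB) simp
  then have "AE x in lbn n. False"
  proof eventually_elim
   case (elim x)
   then show ?case using n norm_ge_zero[of "V 0 x"] by linarith
  qed
  then show False using lbn_not_null by blast
 qed
 \<comment> \<open>Truncation at \<open>M1\<close> turns the bound for almost every x into one for
   all x; at a time outside \<open>N\<close> it changes the representative on a null set
   only.\<close>
 define V3 where "V3 t x = (if t \<notin> N \<and> cmod (V' t x) \<le> M1 then V' t x else 0)" for t x
 define F3 where "F3 t x = (if t \<notin> N then F' t x else 0)" for t x
 define G where "G t x = V3 t x * U t x + F3 t x" for t x
 have [measurable]: "(\<lambda>p. U (fst p) (snd p)) \<in> Bor2 n"
  "(\<lambda>p. V' (fst p) (snd p)) \<in> Bor2 n" "(\<lambda>p. F' (fst p) (snd p)) \<in> Bor2 n"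
  using U(1) V'(1) F'(1) by (simp_all add: split_beta')
 have V3m: "case_prod V3 \<in> Bor2 n" unfolding V3_def split_beta' by measurable
 have F3m: "case_prod F3 \<in> Bor2 n" unfolding F3_def split_beta' by measurable
 have Gm: "case_prod G \<in> Bor2 n" unfolding G_def V3_def F3_def split_beta' by measurable
 have sec: "case_prod W \<in> Bor2 n \<Longrightarrow> W t \<in> Bor n" for W :: "real \<Rightarrow> (nat \<Rightarrow> real) \<Rightarrow> complex" and t
  using measurable_compose[OF measurable_Pair1'[of t borel "lbn n"], of "case_prod W" borel] by simp
 have [measurable]: "U t \<in> Bor n" "F3 t \<in> Bor n" "G t \<in> Bor n" for t
  by (rule sec[OF U(1)], rule sec[OF F3m], rule sec[OF Gm])
 have eqV: "AE x in lbn n. V t x = V3 t x" and eqF: "AE x in lbn n. F t x = F3 t x" if t: "t \<in> {0..1}" "t \<notin> N" for t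
 proof -
  have 1: "AE x in lbn n. V t x = V' t x" "AE x in lbn n. F t x = F' t x" using N(1) t by auto
  show "AE x in lbn n. V t x = V3 t x" using 1(1) VB[OF t(1)] by eventually_elim (use t in \<open>auto simp: V3_def\<close>)
  show "AE x in lbn n. F t x = F3 t x" using 1(2) by eventually_elim (use t in \<open>auto simp: F3_def\<close>)
 qed
 have gauss_sq: "(L2norm n (gauss n \<gamma> f))\<^sup>2 = sq_int (lbn n) (\<lambda>x. gw n \<gamma> x * cmod (g x))"
  if [measurable]: "g \<in> Bor n" and ae: "AE x in lbn n. f x = g x" for f g
 proof -
  have "(L2norm n (gauss n \<gamma> f))\<^sup>2 = sq_int (lbn n) (\<lambda>x. cmod (of_real (gw n \<gamma> x) * g x))"
   by (rule L2norm_AE(1), measurable) (use ae in eventually_elim, simp add: gauss_def gw_def)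
  then show ?thesis by (simp add: norm_mult gw_def)
 qed
 have FL: "sq_int (lbn n) (\<lambda>x. gw n \<gamma> x * cmod (F3 t x)) \<le> ennreal (m2\<^sup>2) * sq_int (lbn n) (\<lambda>x. cmod (U t x))" if t: "t \<in> {0..1}" for t
 proof (cases "t \<in> N")
  case True
  then show ?thesis by (simp add: F3_def)
 next
  case False
  have uL: "L2norm n (u t) < \<infinity>" using u t by (auto simp: in_C_L2_def)
  have "sq_int (lbn n) (\<lambda>x. gw n \<gamma> x * cmod (F3 t x)) = (L2norm n (gauss n \<gamma> (F t)))\<^sup>2"
   by (rule gauss_sq[symmetric]) (use eqF[OF t False] in auto)
  also have "\<dots> \<le> (ennreal m2 * L2norm n (u t))\<^sup>2"
   using M2_const_bound[OF M2 t uL] by (intro power_mono) (auto simp: m2)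
  also have "\<dots> = ennreal (m2\<^sup>2) * (L2norm n (u t))\<^sup>2" using m2 by (simp add: power_mult_distrib ennreal_power)
  also have "(L2norm n (u t))\<^sup>2 = sq_int (lbn n) (\<lambda>x. cmod (U t x))" by (rule L2norm_AE(1)[OF _ U(2)[OF t]]) measurable
  finally show ?thesis .
 qed
 have GL: "cmod (G t x) \<le> M1 * cmod (U t x) + cmod (F3 t x)" for t x
 proof -
  have "cmod (V3 t x) \<le> M1" using M1 by (simp add: V3_def)
  then have "cmod (V3 t x * U t x) \<le> M1 * cmod (U t x)" by (simp add: norm_mult mult_right_mono)
  then show ?thesis unfolding G_def using norm_triangle_ineq[of "V3 t x * U t x" "F3 t x"] by linarith
 qed
 \<comment> \<open>The first summand bounds U. The others bound G: |G|^2 <= 2 M1^2 |U|^2 + 2 |F|^2,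
   where F is estimated with its Gaussian weight, which is at least 1.\<close>
 define CU where "CU = sqrt (C\<^sup>2 + (2 * M1\<^sup>2 * C\<^sup>2 + 2 * (m2\<^sup>2 * C\<^sup>2)))"
 have CU2: "CU\<^sup>2 = C\<^sup>2 + (2 * M1\<^sup>2 * C\<^sup>2 + 2 * (m2\<^sup>2 * C\<^sup>2))" unfolding CU_def by simp
 have GL2: "sq_int (lbn n) (\<lambda>x. cmod (G t x)) \<le> ennreal (CU\<^sup>2)" if t: "t \<in> {0..1}" for t
 proof -
  have "sq_int (lbn n) (\<lambda>x. cmod (G t x)) \<le> (\<integral>\<^sup>+x. ennreal (2 * M1\<^sup>2) * ennreal ((cmod (U t x))\<^sup>2) + ennreal 2 * ennreal ((gw n \<gamma> x * cmod (F3 t x))\<^sup>2) \<partial>lbn n)"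
  proof (intro nn_integral_mono)
   fix x
   have g1: "1 \<le> gw n \<gamma> x" using \<gamma> by (simp add: gw_def sum_nonneg)
   have "cmod (F3 t x) \<le> gw n \<gamma> x * cmod (F3 t x)" using mult_right_mono[OF g1, of "cmod (F3 t x)"] by simp
   then have "(cmod (G t x))\<^sup>2 \<le> (M1 * cmod (U t x) + gw n \<gamma> x * cmod (F3 t x))\<^sup>2"
    using GL[of t x] by (intro power_mono) auto
   also have "\<dots> \<le> 2 * (M1 * cmod (U t x))\<^sup>2 + 2 * (gw n \<gamma> x * cmod (F3 t x))\<^sup>2"
    using zero_le_power2[of "M1 * cmod (U t x) - gw n \<gamma> x * cmod (F3 t x)"] by (simp add: power2_sum power2_diff)
   also have "\<dots> = 2 * M1\<^sup>2 * (cmod (U t x))\<^sup>2 + 2 * (gw n \<gamma> x * cmod (F3 t x))\<^sup>2" by (simp add: power_mult_distrib)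
   finally show "ennreal ((cmod (G t x))\<^sup>2) \<le> ennreal (2 * M1\<^sup>2) * ennreal ((cmod (U t x))\<^sup>2) + ennreal 2 * ennreal ((gw n \<gamma> x * cmod (F3 t x))\<^sup>2)"
    by (simp add: ennreal_mult[symmetric] ennreal_plus[symmetric] ennreal_leI del: ennreal_plus ennreal_numeral)
  qed
  also have "\<dots> = ennreal (2 * M1\<^sup>2) * sq_int (lbn n) (\<lambda>x. cmod (U t x)) + ennreal 2 * sq_int (lbn n) (\<lambda>x. gw n \<gamma> x * cmod (F3 t x))"
   by (subst nn_integral_add) (auto simp: nn_integral_cmult)
  also have "\<dots> \<le> ennreal (2 * M1\<^sup>2 * C\<^sup>2 + 2 * (m2\<^sup>2 * C\<^sup>2))"
   by (intro ennreal_add_bound ennreal_mult_bound U(4) t order_trans[OF FL]) auto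
  also have "\<dots> \<le> ennreal (CU\<^sup>2)" unfolding CU2 by (intro ennreal_leI) simp
  finally show ?thesis .
 qed
 have weak: "- (int_on 0 1 (\<lambda>t. \<integral>x. U t x * of_real (pd n \<phi> (x(n := t))) \<partial>lbn n)) =
   Complex A B * (int_on 0 1 (\<lambda>t. \<integral>x. U t x * of_real (\<Sum>i<n. pd i (pd i \<phi>) (x(n := t))) +
      G t x * of_real (\<phi> (x(n := t))) \<partial>lbn n))" if \<phi>: "spacetime_test_function n \<phi>" for \<phi>
 proof -
  have Ck: "\<forall>k. C_k (Suc n) k \<phi>" using \<phi> by (simp add: spacetime_test_function_def test_function_def)
  have sl: "(\<lambda>p. \<psi> ((snd p)(n := fst p))) \<in> Bor2 n" if "\<forall>k. C_k (Suc n) k \<psi>" for \<psi>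
   using slice_measurable[OF euclid_continuous_measurable[OF C_k_continuous[OF that[rule_format]]]] by (simp add: split_beta')
  have [measurable]: "(\<lambda>p. \<phi> ((snd p)(n := fst p))) \<in> Bor2 n" by (rule sl[OF Ck])
  have [measurable]: "(\<lambda>p. pd n \<phi> ((snd p)(n := fst p))) \<in> Bor2 n" by (rule sl[OF C_k_pd[OF Ck]]) simp
  have "(\<lambda>p. pd i (pd i \<phi>) ((snd p)(n := fst p))) \<in> Bor2 n" if "i < n" for i
   by (rule sl[OF C_k_pd[OF C_k_pd[OF Ck]]]) (use that in auto)
  then have [measurable]: "(\<lambda>p. \<Sum>i<n. pd i (pd i \<phi>) ((snd p)(n := fst p))) \<in> Bor2 n"
   by (intro borel_measurable_sum) auto
  have [measurable]: "(\<lambda>p. G (fst p) (snd p)) \<in> Bor2 n" using Gm by (simp add: split_beta')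
  have L: "(\<integral>t. (\<integral>x. u t x * of_real (pd n \<phi> (x(n := t))) \<partial>leb n) \<partial>lebesgue_on {0..1}) =
   (int_on 0 1 (\<lambda>t. \<integral>x. U t x * of_real (pd n \<phi> (x(n := t))) \<partial>lbn n))"
  proof (rule strip_integral)
   show "(\<lambda>(t, x). U t x * of_real (pd n \<phi> (x(n := t)))) \<in> Bor2 n" unfolding split_beta' by measurable
   show "AE t in lborel. t \<in> {0..1} \<longrightarrow> (AE x in lbn n. u t x * of_real (pd n \<phi> (x(n := t))) = U t x * of_real (pd n \<phi> (x(n := t))))"
   proof (rule AE_I2, rule impI)
    fix t :: real assume "t \<in> {0..1}"
    from U(2)[OF this] show "AE x in lbn n. u t x * of_real (pd n \<phi> (x(n := t))) = U t x * of_real (pd n \<phi> (x(n := t)))"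
     by eventually_elim simp
   qed
  qed
  have R: "(\<integral>t. (\<integral>x. u t x * complex_of_real (\<Sum>i<n. pd i (pd i \<phi>) (x(n := t))) + (V t x * u t x + F t x) * complex_of_real (\<phi> (x(n := t))) \<partial>leb n) \<partial>lebesgue_on {0..1}) =
   (int_on 0 1 (\<lambda>t. \<integral>x. U t x * of_real (\<Sum>i<n. pd i (pd i \<phi>) (x(n := t))) + G t x * of_real (\<phi> (x(n := t))) \<partial>lbn n))"
  proof (rule strip_integral)
   show "(\<lambda>(t, x). U t x * of_real (\<Sum>i<n. pd i (pd i \<phi>) (x(n := t))) + G t x * of_real (\<phi> (x(n := t)))) \<in> Bor2 n"
    unfolding split_beta' by measurable
   show "AE t in lborel. t \<in> {0..1} \<longrightarrow> (AE x in lbn n. u t x * complex_of_real (\<Sum>i<n. pd i (pd i \<phi>) (x(n := t))) + (V t x * u t x + F t x) * complex_of_real (\<phi> (x(n := t))) =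
    U t x * of_real (\<Sum>i<n. pd i (pd i \<phi>) (x(n := t))) + G t x * of_real (\<phi> (x(n := t))))"
    using nN
   proof (eventually_elim, intro impI)
    fix t :: real assume t: "t \<notin> N" "t \<in> {0..1}"
    from U(2)[OF t(2)] eqV[OF t(2,1)] eqF[OF t(2,1)]
    show "AE x in lbn n. u t x * complex_of_real (\<Sum>i<n. pd i (pd i \<phi>) (x(n := t))) + (V t x * u t x + F t x) * complex_of_real (\<phi> (x(n := t))) =
     U t x * of_real (\<Sum>i<n. pd i (pd i \<phi>) (x(n := t))) + G t x * of_real (\<phi> (x(n := t)))"
     by eventually_elim (simp add: G_def)
   qed
  qed
  show ?thesis using ws[unfolded weak_solution_def, rule_format, OF \<phi>] unfolding L R .
 qed
 have "heat_weighted n A B U G CU F3 \<gamma> M1 m2"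
 proof
  show "case_prod U \<in> Bor2 n" by (rule U(1))
  show "case_prod G \<in> Bor2 n" by (rule Gm)
  show "case_prod F3 \<in> Bor2 n" by (rule F3m)
  show "CU \<ge> 0" by (simp add: CU_def)
  show "sq_int (lbn n) (\<lambda>x. cmod (U t x)) \<le> ennreal (CU\<^sup>2)" if "t \<in> {0..1}" for t
   using U(4)[OF that] by (rule order_trans) (simp add: CU2 ennreal_leI)
  show "sq_int (lbn n) (\<lambda>x. gw n \<gamma> x * cmod (U 0 x)) < \<infinity>"
  proof -
   have "sq_int (lbn n) (\<lambda>x. gw n \<gamma> x * cmod (U 0 x)) = (L2norm n (gauss n \<gamma> (u 0)))\<^sup>2"
    by (rule gauss_sq[symmetric]) (use U(2)[of 0] in auto)
   then show ?thesis using u0 by (simp add: power2_eq_square ennreal_mult_less_top)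
  qed
  show "cmod (G t x) \<le> M1 * cmod (U t x) + cmod (F3 t x)" for t x by (rule GL)
 qed (fact GL2 U(5) weak A \<gamma> M1 m2(2) FL)+
 then show thesis using U(2) unfolding m2_def by (intro that[of U G CU F3]) auto
qed

text \<open>The shift makes the base positive. For s = 0 all powers are then 1, so the convention
  0^0 = 1 is the limit that actually occurs.\<close>

lemma rpow_limit:
 assumes "a \<ge> 0" "s \<ge> 0"
 shows "(\<lambda>k. (a + 1 / real (Suc k)) powr s) \<longlonglongrightarrow> rpow a s"
proof (cases "s = 0")
 case True
 have "a + 1 / real (Suc k) \<noteq> 0" for k using assms by (metis add_nonneg_pos less_irrefl of_nat_0_less_iff zero_less_Suc zero_less_divide_1_iff)
 then show ?thesis using True by (simp add: rpow_def)
next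
 case False
 have "(\<lambda>k. a + 1 / real (Suc k)) \<longlonglongrightarrow> a + 0" by (intro tendsto_intros) real_asymp
 then have "(\<lambda>k. (a + 1 / real (Suc k)) powr s) \<longlonglongrightarrow> a powr s"
  by (intro tendsto_powr') (use assms False in auto)
 then show ?thesis using False by (simp add: rpow_def)
qed

text \<open>The norms at the ends may vanish, so the convexity estimate is applied with both
  enlarged by 1/(k + 1), after which k tends to infinity.\<close>

lemma gauss_log_convex:
 assumes A: "A > 0" and \<gamma>: "\<gamma> > 0" and u: "in_C_L2 n u"
  and VF: "case_prod V \<in> borel_measurable (leb_strip n)" "case_prod F \<in> borel_measurable (leb_strip n)"
  and ws: "weak_solution n (Complex A B) V F u"
  and VM: "(SUP t\<in>{0..1}. Linf_norm n (V t)) \<le> ereal M1"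
  and u01: "L2norm n (gauss n \<gamma> (u 0)) < \<infinity>" "L2norm n (gauss n \<gamma> (u 1)) < \<infinity>" and M2: "M2_const n \<gamma> F u < \<infinity>"
  and t: "t \<in> {0..1}"
 defines "m2 \<equiv> enn2real (M2_const n \<gamma> F u)"
 shows "L2norm n (gauss n \<gamma> (u t)) \<le> ennreal
    (exp (64 * ((A\<^sup>2 + B\<^sup>2) * (M1\<^sup>2 + m2\<^sup>2) + sqrt (A\<^sup>2 + B\<^sup>2) * (M1 + m2)))
    * rpow (enn2real (L2norm n (gauss n \<gamma> (u 0)))) (1 - t)
    * rpow (enn2real (L2norm n (gauss n \<gamma> (u 1)))) t)"
proof -
 obtain U G F' CU where H: "heat_weighted n A B U G CU F' \<gamma> M1 m2"
  and U: "\<And>t. t \<in> {0..1} \<Longrightarrow> U t \<in> Bor n \<and> (AE x in lbn n. u t x = U t x)"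
  unfolding m2_def by (rule heat_weighted_representative[OF A \<gamma> u VF ws VM u01(1) M2]) blast
 interpret heat_weighted n A B U G CU F' \<gamma> M1 m2 by (rule H)
 have gs: "(L2norm n (gauss n \<gamma> (u s)))\<^sup>2 = sq_int (lbn n) (\<lambda>x. gw n \<gamma> x * cmod (U s x))" if s: "s \<in> {0..1}" for s
 proof -
  have [measurable]: "U s \<in> Bor n" and ae: "AE x in lbn n. u s x = U s x" using U[OF s] by auto
  have "(L2norm n (gauss n \<gamma> (u s)))\<^sup>2 = sq_int (lbn n) (\<lambda>x. cmod (of_real (gw n \<gamma> x) * U s x))"
  proof (rule L2norm_AE(1))
   show "(\<lambda>x. of_real (gw n \<gamma> x) * U s x) \<in> Bor n" using s by measurable
   show "AE x in lbn n. gauss n \<gamma> (u s) x = of_real (gw n \<gamma> x) * U s x"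
    using ae by eventually_elim (simp add: gauss_def gw_def)
  qed
  then show ?thesis by (simp add: norm_mult gw_def)
 qed
 define a0 where "a0 = enn2real (L2norm n (gauss n \<gamma> (u 0)))"
 define a1 where "a1 = enn2real (L2norm n (gauss n \<gamma> (u 1)))"
 have a: "a0 \<ge> 0" "a1 \<ge> 0" "L2norm n (gauss n \<gamma> (u 0)) = ennreal a0" "L2norm n (gauss n \<gamma> (u 1)) = ennreal a1"
  using u01 by (auto simp: a0_def a1_def)
 define K where "K = cmod (Complex A B) * (M1 + m2)"
 define E where "E = exp (64 * ((A\<^sup>2 + B\<^sup>2) * (M1\<^sup>2 + m2\<^sup>2) + sqrt (A\<^sup>2 + B\<^sup>2) * (M1 + m2)))"
 have K: "exp (12 * K + 32 * K\<^sup>2) \<le> E"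
 proof -
  have c: "cmod (Complex A B) = sqrt (A\<^sup>2 + B\<^sup>2)" by (simp add: complex_norm)
  have Keq: "sqrt (A\<^sup>2 + B\<^sup>2) * (M1 + m2) = K" by (simp add: K_def c)
  have "K \<ge> 0" unfolding K_def using M_nonneg by simp
  \<comment> \<open>(M1 + M2)^2 <= 2 (M1^2 + M2^2) doubles the 32; the resulting 64 also covers the
    12 in front of the linear term.\<close>
  moreover have "32 * K\<^sup>2 \<le> 64 * ((A\<^sup>2 + B\<^sup>2) * (M1\<^sup>2 + m2\<^sup>2))"
  proof -
   have "(M1 + m2)\<^sup>2 \<le> 2 * (M1\<^sup>2 + m2\<^sup>2)" using zero_le_power2[of "M1 - m2"] by (simp add: power2_sum power2_diff)
   then have "(A\<^sup>2 + B\<^sup>2) * (M1 + m2)\<^sup>2 \<le> (A\<^sup>2 + B\<^sup>2) * (2 * (M1\<^sup>2 + m2\<^sup>2))" by (rule mult_left_mono) simp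
   also have "\<dots> = 2 * ((A\<^sup>2 + B\<^sup>2) * (M1\<^sup>2 + m2\<^sup>2))" by (rule mult.left_commute)
   also have "(A\<^sup>2 + B\<^sup>2) * (M1 + m2)\<^sup>2 = K\<^sup>2" unfolding K_def c power_mult_distrib by simp
   finally show ?thesis by linarith
  qed
  moreover have "12 * K + 32 * q \<le> 64 * (X + K)" if "0 \<le> K" "32 * q \<le> 64 * X" for q X :: real
   using that by (simp add: distrib_left)
  ultimately have "12 * K + 32 * K\<^sup>2 \<le> 64 * ((A\<^sup>2 + B\<^sup>2) * (M1\<^sup>2 + m2\<^sup>2) + sqrt (A\<^sup>2 + B\<^sup>2) * (M1 + m2))"
   unfolding Keq by blast
  then show ?thesis by (simp add: E_def)
 qed
 have step: "L2norm n (gauss n \<gamma> (u t)) \<le> ennreal (E * (a0 + 1 / real (Suc k)) powr (1 - t) * (a1 + 1 / real (Suc k)) powr t)" for k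
 proof (rule ennreal_le_of_sq_le)
  have d: "1 / real (Suc k) > 0" by simp
  have "(L2norm n (gauss n \<gamma> (u t)))\<^sup>2 \<le> ennreal ((exp (12 * K + 32 * K\<^sup>2) * (a0 + 1 / real (Suc k)) powr (1 - t) * (a1 + 1 / real (Suc k)) powr t)\<^sup>2)"
   unfolding gs[OF t] K_def
  proof (rule gauss_convexity[OF _ _ t])
   show "a0 + 1 / real (Suc k) > 0" "a1 + 1 / real (Suc k) > 0" using a d by linarith+
   have "sq_int (lbn n) (\<lambda>x. gw n \<gamma> x * cmod (U 0 x)) = ennreal (a0\<^sup>2)" using gs[of 0] a by (simp add: ennreal_power)
   also have "\<dots> \<le> ennreal ((a0 + 1 / real (Suc k))\<^sup>2)" using a d by (intro ennreal_leI power_mono) linarith+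
   finally show "sq_int (lbn n) (\<lambda>x. gw n \<gamma> x * cmod (U 0 x)) \<le> ennreal ((a0 + 1 / real (Suc k))\<^sup>2)" .
   have "sq_int (lbn n) (\<lambda>x. gw n \<gamma> x * cmod (U 1 x)) = ennreal (a1\<^sup>2)" using gs[of 1] a by (simp add: ennreal_power)
   also have "\<dots> \<le> ennreal ((a1 + 1 / real (Suc k))\<^sup>2)" using a d by (intro ennreal_leI power_mono) linarith+
   finally show "sq_int (lbn n) (\<lambda>x. gw n \<gamma> x * cmod (U 1 x)) \<le> ennreal ((a1 + 1 / real (Suc k))\<^sup>2)" .
  qed
  also have "\<dots> \<le> ennreal ((E * (a0 + 1 / real (Suc k)) powr (1 - t) * (a1 + 1 / real (Suc k)) powr t)\<^sup>2)"
   by (intro ennreal_leI power_mono mult_right_mono K mult_nonneg_nonneg) auto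
  finally show "(L2norm n (gauss n \<gamma> (u t)))\<^sup>2 \<le> ennreal ((E * (a0 + 1 / real (Suc k)) powr (1 - t) * (a1 + 1 / real (Suc k)) powr t)\<^sup>2)" .
 qed (auto simp: E_def)
 have lim: "(\<lambda>k. ennreal (E * (a0 + 1 / real (Suc k)) powr (1 - t) * (a1 + 1 / real (Suc k)) powr t)) \<longlonglongrightarrow> ennreal (E * rpow a0 (1 - t) * rpow a1 t)"
  by (intro tendsto_ennrealI tendsto_mult tendsto_const rpow_limit) (use a t in auto)
 show ?thesis unfolding E_def[symmetric] a0_def[symmetric] a1_def[symmetric]
  by (rule LIMSEQ_le_const[OF lim]) (use step in blast)
qed

theorem lemma3:
 shows "\<exists>N::real. \<forall>(n::nat) (A::real) (B::real) (\<gamma>::real) (M1::real)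
   (u :: real \<Rightarrow> (nat \<Rightarrow> real) \<Rightarrow> complex)
   (V :: real \<Rightarrow> (nat \<Rightarrow> real) \<Rightarrow> complex)
   (F :: real \<Rightarrow> (nat \<Rightarrow> real) \<Rightarrow> complex).
  n \<ge> 1 \<longrightarrow> A > 0 \<longrightarrow> \<gamma> > 0 \<longrightarrow>
  in_Linf_L2 n u \<longrightarrow> in_L2_H1 n u \<longrightarrow> in_C_L2 n u \<longrightarrow>
  case_prod V \<in> borel_measurable (leb_strip n) \<longrightarrow>
  case_prod F \<in> borel_measurable (leb_strip n) \<longrightarrow>
  weak_solution n (Complex A B) V F u \<longrightarrow>
  (SUP t\<in>{0..1}. Linf_norm n (V t)) \<le> ereal M1 \<longrightarrow>
  L2norm n (gauss n \<gamma> (u 0)) < \<infinity> \<longrightarrow>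
  L2norm n (gauss n \<gamma> (u 1)) < \<infinity> \<longrightarrow>
  M2_const n \<gamma> F u < \<infinity> \<longrightarrow>
  (let M2 = enn2real (M2_const n \<gamma> F u) in
   \<forall>t\<in>{0..1}. L2norm n (gauss n \<gamma> (u t)) \<le> ennreal
    (exp (N * ((A\<^sup>2 + B\<^sup>2) * (M1\<^sup>2 + M2\<^sup>2) + sqrt (A\<^sup>2 + B\<^sup>2) * (M1 + M2)))
    * rpow (enn2real (L2norm n (gauss n \<gamma> (u 0)))) (1 - t)
    * rpow (enn2real (L2norm n (gauss n \<gamma> (u 1)))) t))"
 unfolding Let_def
 by (intro exI[of _ 64] allI impI ballI) (rule gauss_log_convex)

end
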